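(* Let $\phi_\theta:T^2\to\mathbb R$ ($\theta\in\Theta$) be a target test function. Let $(X_\beta)_{\beta\in\mathcal B}$ and $(Y_\beta)_{\beta\in\mathcal B}$ be perturbations of $X$ and $Y$. Suppose that (a) $X_\beta=\sum_{m=1}^M X_{\beta,m}$, where the pairs $\{(X_{\beta,m},\dot X_{\beta,m})\}_{m=1}^M$ are independent under $P_\theta$, and $(Y_\beta,\dot Y_\beta)$ is jointly Gaussian under $Q_\theta$; (b) $\mathbb E_{P_\theta}[\sup_{\beta\in\mathcal B}\|\dot X_\beta\|_\infty]<\infty$ and $\mathbb E_{Q_\theta}[\sup_{\beta\in\mathcal B}\|\dot Y_\beta\|_\infty]<\infty$; (c) $\beta\mapsto F(\theta,\beta)$ and $\beta\mapsto F^{\mathrm G}(\theta,\beta)$ are convex on $\mathcal B$. Then for all $\theta\in\Theta$ and any $\epsilon>0$ such that $\pm\epsilon\in\mathcal B$, $$\Phi^{\mathrm G}(\theta,-\epsilon)-\Delta_1(\theta,-\epsilon)-\frac{\Delta_2(\theta,-\epsilon)}{\epsilon}\le\Phi(\theta)\le\Phi^{\mathrm G}(\theta,\epsilon)+\Delta_1(\theta,\epsilon)+\frac{\Delta_2(\theta,\epsilon)}{\epsilon},$$ where, writing $X_m=X_{0,m}$, $$\Delta_1(\theta,\beta)=\|\phi_\theta-\psi_{\theta,0}\|_\infty+\|\phi_\theta-\psi^{\mathrm G}_{\theta,\beta}\|_\infty+3\sum_{m=1}^M\Bigl(\mathbb E_\theta\|X_m-\mathbb E_\theta[X_m]\|_\infty^3\Bigr)^{2/3}\Bigl(\mathbb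 E_\theta\|\dot X_{0,m}-\mathbb E_\theta[\dot X_{0,m}]\|_\infty^3\Bigr)^{1/3},$$ $$\begin{aligned}\Delta_2(\theta,\beta)={}&\|\mathbb E_\theta[X]-\mathbb E_\theta[Y]\|_\infty+\|\mathbb E_\theta[X_\beta]-\mathbb E_\theta[Y_\beta]\|_\infty+\|\mathrm{Cov}_\theta(X)-\mathrm{Cov}_\theta(Y)\|_\infty+\|\mathrm{Cov}_\theta(X_\beta)-\mathrm{Cov}_\theta(Y_\beta)\|_\infty\\&+\sum_{m=1}^M\mathbb E_\theta\|X_m-\mathbb E_\theta[X_m]\|_\infty^3+\sum_{m=1}^M\mathbb E_\theta\|X_{\beta,m}-\mathbb E_\theta[X_{\beta,m}]\|_\infty^3.\end{aligned}$$
   Context: $\Theta$ is a compact parameter space and $T\subseteq\Theta$ is a compact metric space with a Borel probability measure $\pi$. $C(T)$ carries the sup norm $\|\cdot\|_\infty$. $(P_\theta)$, $(Q_\theta)$, $\theta\in\Theta$, are families of probability measures on a common sample space $\Omega$; $X$ is a $C(T)$-valued random variable (considered under $P_\theta$) and $Y$ a $C(T)$-valued random variable that is Gaussian under $Q_\theta$. For a process $Z$ let $\pi_Z(\mathrm dt)=e^{Z(t)}\pi(\mathrm dt)/\int_T e^{Z(s)}\pi(\mathrm ds)$, and let $\mathbb E[\pi_Z^{\otimes2}]$ be the expected product measure on $T^2$. Perturbations: $\mathcal B\subset\mathbb R$ is an open interval containing $0$. A perturbation of $X$ is a family $(X_\beta)_{\beta\in\mathcal B}$ of $C(T)$-valued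 random variables on $\Omega$ with $X_0=X$ such that for every $\omega$ the map $\beta\mapsto X_\beta(\omega)\in C(T)$ is differentiable, with derivative at $\beta$ denoted $\dot X_\beta$ (likewise $\dot X_{\beta,m}$ is the $\beta$-derivative of the component $X_{\beta,m}$). A perturbation of $Y$ is such a family $(Y_\beta)_{\beta\in\mathcal B}$ with $Y_0=Y$ and, for every $\beta$, $Y_\beta$ Gaussian and $(Y_\beta,\dot Y_\beta)$ jointly Gaussian under $Q_\theta$. Define $$F(\theta,\beta)=\mathbb E_{P_\theta}\Bigl[\log\int_Te^{X_\beta(t)}\pi(\mathrm dt)\Bigr],\qquad F^{\mathrm G}(\theta,\beta)=\mathbb E_{Q_\theta}\Bigl[\log\int_Te^{Y_\beta(t)}\pi(\mathrm dt)\Bigr],$$ $$\psi_{\theta,\beta}(s,t)=\mathbb E_{P_\theta}[\dot X_\beta(t)]+\mathrm{Cov}_{P_\theta}(X_\beta(t),\dot X_\beta(t))-\mathrm{Cov}_{P_\theta}(X_\beta(s),\dot X_\beta(t)),$$ $$\psi^{\mathrm G}_{\theta,\beta}(s,t)=\mathbb E_{Q_\theta}[\dot Y_\beta(t)]+\mathrm{Cov}_{Q_\theta}(Y_\beta(t),\dot Y_\beta(t))-\mathrm{Cov}_{Q_\theta}(Y_\beta(s),\dot Y_\beta(t)),$$ $$\Phi(\theta)=\iint_{T^2}\phi_\theta(s,t)\,\mathbb E_{P_\theta}[\pi_X^{\otimes2}](\mathrm ds,\mathrm dt),\qquad \Phi^{\mathrm G}(\theta,\beta)=\iint_{T^2}\phi_\theta(s,t)\,\mathbb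 E_{Q_\theta}[\pi_{Y_\beta}^{\otimes2}](\mathrm ds,\mathrm dt).$$ The function $\phi_\theta$ is Borel measurable and such that these integrals are well defined. For $\phi:T^2\to\mathbb R$, $\|\phi\|_\infty=\sup_{(s,t)\in T^2}|\phi(s,t)|$; the same sup norm over $T^2$ is used for differences of covariance kernels $\mathrm{Cov}_\theta(X)(s,t)=\mathrm{Cov}_\theta(X(s),X(t))$. $\mathbb E_\theta,\mathrm{Cov}_\theta$ are under $P_\theta$ for expressions in $X$ and under $Q_\theta$ for expressions in $Y$; $\mathbb E_\theta[X]$ is the mean function. When $\Delta_1$ or $\Delta_2$ is infinite the corresponding inequality is vacuous. *)

theory Defs
  imports "HOL-Probability.Probability"
begin

class compact_metric_space = metric_space +
  assumes compact_UNIV: "compact (UNIV :: 'a set)"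

text \<open>Compact metric spaces are second countable. The instance makes the Borel sets of
  a product such as \<^typ>\<open>'t \<times> 't\<close> coincide with the product sigma-algebra.\<close>

instance compact_metric_space \<subseteq> second_countable_topology
proof
  have "\<exists>K. \<forall>n. finite (K n) \<and> (UNIV :: 'a set) = (\<Union>x\<in>K n. ball x (1 / Suc n))"
  proof (rule choice, rule allI)
    fix n
    have "\<forall>e>0. \<exists>k. finite k \<and> (UNIV :: 'a set) \<subseteq> (\<Union>x\<in>k. ball x e)"
      using compact_UNIV unfolding compact_eq_totally_bounded by (rule conjunct2)
    moreover have "1 / real (Suc n) > 0" by simp
    ultimately have "\<exists>k. finite k \<and> (UNIV :: 'a set) \<subseteq> (\<Union>x\<in>k. ball x (1 / Suc n))"
      by blast
    then show "\<exists>k. finite k \<and> (UNIV :: 'a set) = (\<Union>x\<in>k. ball x (1 / Suc n))"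
      by blast
  qed
  then obtain K where fin: "\<And>n. finite (K n)"
    and cov: "\<And>n. (UNIV :: 'a set) = (\<Union>x\<in>K n. ball x (1 / Suc n))"
    by auto
  define B where "B = (\<Union>n. (\<lambda>x. ball x (1 / Suc n)) ` K n)"
  have "countable B"
    unfolding B_def using fin by (intro countable_UN) (auto intro: countable_finite)
  moreover have "topological_basis B"
  proof (rule topological_basisI)
    fix b assume "b \<in> B"
    then show "open b" by (auto simp: B_def)
  next
    fix U and x :: 'a assume "open U" "x \<in> U"
    then obtain e where e: "e > 0" "ball x e \<subseteq> U"
      by (auto simp: open_contains_ball)
    obtain n where n: "1 / Suc n < e / 2"
      using nat_approx_posE[of "e / 2"] e(1) by auto
    obtain y where y: "y \<in> K n" "x \<in> ball y (1 / Suc n)"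
      using cov[of n] by blast
    have "ball y (1 / Suc n) \<subseteq> ball x e"
    proof
      fix z assume "z \<in> ball y (1 / Suc n)"
      then have "dist y z < e / 2" and "dist y x < e / 2" using y n by auto
      then have "dist x z < e" using dist_triangle_half_r[of y x e z] by simp
      then show "z \<in> ball x e" by simp
    qed
    then show "\<exists>b\<in>B. x \<in> b \<and> b \<subseteq> U"
      using y e(2) by (intro bexI[of _ "ball y (1 / Suc n)"]) (auto simp: B_def)
  qed
  ultimately show "\<exists>B :: 'a set set. countable B \<and> open = generate_topology B"
    by (intro exI[of _ B] conjI topological_basis_imp_subbasis)
qed

text \<open>\<^typ>\<open>'t \<Rightarrow>\<^sub>C real\<close> with its norm is \<open>C(T)\<close> with the sup norm: every continuous
  function on a compact space is bounded.\<close>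

definition ddot :: "(real \<Rightarrow> 'w \<Rightarrow> 'v::real_normed_vector) \<Rightarrow> real \<Rightarrow> 'w \<Rightarrow> 'v" where
  "ddot Z \<beta> \<omega> = vector_derivative (\<lambda>b. Z b \<omega>) (at \<beta>)"

definition perturbation ::
  "'w measure \<Rightarrow> real set \<Rightarrow> ('w \<Rightarrow> 'v::real_normed_vector) \<Rightarrow> (real \<Rightarrow> 'w \<Rightarrow> 'v) \<Rightarrow> bool" where
  "perturbation \<Omega> B X Xb \<longleftrightarrow>
     (\<forall>\<beta>\<in>B. Xb \<beta> \<in> borel_measurable \<Omega>) \<and>
     (\<forall>\<omega>\<in>space \<Omega>. Xb 0 \<omega> = X \<omega>) \<and>
     (\<forall>\<omega>\<in>space \<Omega>. \<forall>\<beta>\<in>B. (\<lambda>b. Xb b \<omega>) differentiable (at \<beta>))"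

text \<open>Real normal laws, including the degenerate ones (point masses).\<close>

definition normal_law :: "real measure \<Rightarrow> bool" where
  "normal_law N \<longleftrightarrow>
     (\<exists>\<mu>. N = return borel \<mu>) \<or> (\<exists>\<mu> \<sigma>. \<sigma> > 0 \<and> N = density lborel (normal_density \<mu> \<sigma>))"

text \<open>A random element of a normed space is Gaussian if all continuous linear functionals
  of it are normal. Joint Gaussianity of a pair is Gaussianity in the product space.\<close>

definition gaussian :: "'w measure \<Rightarrow> ('w \<Rightarrow> 'v::real_normed_vector) \<Rightarrow> bool" where
  "gaussian M Z \<longleftrightarrow>
     (\<forall>L :: 'v \<Rightarrow> real. bounded_linear L \<longrightarrow>
        (\<lambda>\<omega>. L (Z \<omega>)) \<in> borel_measurable M \<and> normal_law (distr M borel (\<lambda>\<omega>. L (Z \<omega>))))"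

definition gaussian_perturbation ::
  "'w measure \<Rightarrow> 'w measure \<Rightarrow> real set \<Rightarrow> ('w \<Rightarrow> 'v::real_normed_vector) \<Rightarrow>
     (real \<Rightarrow> 'w \<Rightarrow> 'v) \<Rightarrow> bool" where
  "gaussian_perturbation \<Omega> M B Y Yb \<longleftrightarrow>
     perturbation \<Omega> B Y Yb \<and>
     (\<forall>\<beta>\<in>B. gaussian M (Yb \<beta>) \<and> gaussian M (\<lambda>\<omega>. (Yb \<beta> \<omega>, ddot Yb \<beta> \<omega>)))"

definition covariance :: "'w measure \<Rightarrow> ('w \<Rightarrow> real) \<Rightarrow> ('w \<Rightarrow> real) \<Rightarrow> real" where
  "covariance M U V = (\<integral>\<omega>. (U \<omega> - (\<integral>\<omega>'. U \<omega>' \<partial>M)) * (V \<omega> - (\<integral>\<omega>'. V \<omega>' \<partial>M)) \<partial>M)"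

definition mean_fun ::
  "'w measure \<Rightarrow> ('w \<Rightarrow> 't::topological_space \<Rightarrow>\<^sub>C real) \<Rightarrow> 't \<Rightarrow> real" where
  "mean_fun M Z t = (\<integral>\<omega>. Z \<omega> t \<partial>M)"

definition cov_kernel ::
  "'w measure \<Rightarrow> ('w \<Rightarrow> 't::topological_space \<Rightarrow>\<^sub>C real) \<Rightarrow> 't \<Rightarrow> 't \<Rightarrow> real" where
  "cov_kernel M Z s t = covariance M (\<lambda>\<omega>. Z \<omega> s) (\<lambda>\<omega>. Z \<omega> t)"

text \<open>Sup norms of arbitrary real functions, possibly infinite.\<close>

definition sup_norm :: "('t \<Rightarrow> real) \<Rightarrow> ennreal" where
  "sup_norm f = (SUP t. ennreal \<bar>f t\<bar>)"

definition sup_norm2 :: "('t \<Rightarrow> 't \<Rightarrow> real) \<Rightarrow> ennreal" where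
  "sup_norm2 f = (SUP (s, t). ennreal \<bar>f s t\<bar>)"

text \<open>Only used for exponents \<open>a > 0\<close>.\<close>

definition ennreal_powr :: "ennreal \<Rightarrow> real \<Rightarrow> ennreal" where
  "ennreal_powr x a = (if x = \<infinity> then \<infinity> else ennreal (enn2real x powr a))"

definition centered_moment3 ::
  "'w measure \<Rightarrow> ('w \<Rightarrow> 't::topological_space \<Rightarrow>\<^sub>C real) \<Rightarrow> ennreal" where
  "centered_moment3 M Z = (\<integral>\<^sup>+\<omega>. (sup_norm (\<lambda>t. Z \<omega> t - mean_fun M Z t)) ^ 3 \<partial>M)"

definition free_energy ::
  "'t measure \<Rightarrow> 'w measure \<Rightarrow> ('w \<Rightarrow> 't::topological_space \<Rightarrow>\<^sub>C real) \<Rightarrow> real" where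
  "free_energy \<pi> M Z = (\<integral>\<omega>. ln (\<integral>t. exp (Z \<omega> t) \<partial>\<pi>) \<partial>M)"

definition psi_kernel ::
  "'w measure \<Rightarrow> ('w \<Rightarrow> 't::topological_space \<Rightarrow>\<^sub>C real) \<Rightarrow> ('w \<Rightarrow> 't \<Rightarrow>\<^sub>C real) \<Rightarrow>
     't \<Rightarrow> 't \<Rightarrow> real" where
  "psi_kernel M Z Zd s t =
     mean_fun M Zd t
     + covariance M (\<lambda>\<omega>. Z \<omega> t) (\<lambda>\<omega>. Zd \<omega> t)
     - covariance M (\<lambda>\<omega>. Z \<omega> s) (\<lambda>\<omega>. Zd \<omega> t)"

definition gibbs :: "'t measure \<Rightarrow> ('t::topological_space \<Rightarrow>\<^sub>C real) \<Rightarrow> 't measure" where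
  "gibbs \<pi> z = density \<pi> (\<lambda>t. ennreal (exp (z t) / (\<integral>s. exp (z s) \<partial>\<pi>)))"

text \<open>The expected product measure: averaging the random measure over \<open>M\<close> is the
  Giry-monad bind.\<close>

definition expected_gibbs2 ::
  "'t measure \<Rightarrow> 'w measure \<Rightarrow> ('w \<Rightarrow> 't::topological_space \<Rightarrow>\<^sub>C real) \<Rightarrow> ('t \<times> 't) measure" where
  "expected_gibbs2 \<pi> M Z = bind M (\<lambda>\<omega>. gibbs \<pi> (Z \<omega>) \<Otimes>\<^sub>M gibbs \<pi> (Z \<omega>))"

definition Phi ::
  "'t measure \<Rightarrow> 'w measure \<Rightarrow> ('w \<Rightarrow> 't::topological_space \<Rightarrow>\<^sub>C real) \<Rightarrow>
     ('t \<Rightarrow> 't \<Rightarrow> real) \<Rightarrow> real" where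
  "Phi \<pi> M Z f = (\<integral>(s, t). f s t \<partial>expected_gibbs2 \<pi> M Z)"

definition Delta1 ::
  "'w measure \<Rightarrow> 'w measure \<Rightarrow> nat \<Rightarrow>
   (real \<Rightarrow> 'w \<Rightarrow> 't::topological_space \<Rightarrow>\<^sub>C real) \<Rightarrow> (nat \<Rightarrow> real \<Rightarrow> 'w \<Rightarrow> 't \<Rightarrow>\<^sub>C real) \<Rightarrow>
   (real \<Rightarrow> 'w \<Rightarrow> 't \<Rightarrow>\<^sub>C real) \<Rightarrow> ('t \<Rightarrow> 't \<Rightarrow> real) \<Rightarrow> real \<Rightarrow> ennreal" where
  "Delta1 P Q M Xb Xc Yb f \<beta> =
     sup_norm2 (\<lambda>s t. f s t - psi_kernel P (Xb 0) (ddot Xb 0) s t)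
     + sup_norm2 (\<lambda>s t. f s t - psi_kernel Q (Yb \<beta>) (ddot Yb \<beta>) s t)
     + 3 * (\<Sum>m=1..M. ennreal_powr (centered_moment3 P (Xc m 0)) (2 / 3)
                     * ennreal_powr (centered_moment3 P (ddot (Xc m) 0)) (1 / 3))"

definition Delta2 ::
  "'w measure \<Rightarrow> 'w measure \<Rightarrow> nat \<Rightarrow>
   ('w \<Rightarrow> 't::topological_space \<Rightarrow>\<^sub>C real) \<Rightarrow>
   (real \<Rightarrow> 'w \<Rightarrow> 't \<Rightarrow>\<^sub>C real) \<Rightarrow> (nat \<Rightarrow> real \<Rightarrow> 'w \<Rightarrow> 't \<Rightarrow>\<^sub>C real) \<Rightarrow>
   ('w \<Rightarrow> 't \<Rightarrow>\<^sub>C real) \<Rightarrow> (real \<Rightarrow> 'w \<Rightarrow> 't \<Rightarrow>\<^sub>C real) \<Rightarrow> real \<Rightarrow> ennreal" where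
  "Delta2 P Q M X Xb Xc Y Yb \<beta> =
     sup_norm (\<lambda>t. mean_fun P X t - mean_fun Q Y t)
     + sup_norm (\<lambda>t. mean_fun P (Xb \<beta>) t - mean_fun Q (Yb \<beta>) t)
     + sup_norm2 (\<lambda>s t. cov_kernel P X s t - cov_kernel Q Y s t)
     + sup_norm2 (\<lambda>s t. cov_kernel P (Xb \<beta>) s t - cov_kernel Q (Yb \<beta>) s t)
     + (\<Sum>m=1..M. centered_moment3 P (Xc m 0))
     + (\<Sum>m=1..M. centered_moment3 P (Xc m \<beta>))"

end

theory Submission
  imports Defs
begin

text \<open>
  Write \<open>F \<beta> = E log \<integral> exp X\<^sub>\<beta> d\<pi>\<close> for the free energy. Its derivative is the expected Gibbs
  average of the derivative of \<open>X\<^sub>\<beta>\<close>. Integration by parts turns this into an average of the kernel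
  \<open>psi\<close> over the expected pair of Gibbs measures: exactly for a Gaussian process, and approximately for
  a sum of independent summands. So \<open>Phi\<close> is the derivative of the free energy of \<open>X\<close> at \<open>0\<close>, and
  the Gaussian \<open>Phi\<close> is the derivative of the Gaussian free energy at \<open>\<beta> = \<plusminus>\<epsilon>\<close>, both up to the
  error \<open>Delta1\<close>. By convexity each free energy lies above its tangents. The tangent of the one at \<open>0\<close>,
  evaluated at \<open>\<beta>\<close>, and the tangent of the other at \<open>\<beta>\<close>, evaluated at \<open>0\<close>, compare the two derivatives
  through the increments of the two free energies over the interval between \<open>0\<close> and \<open>\<beta>\<close>. These
  increments differ by at most \<open>Delta2\<close>.

  Both analytic ingredients rest on one estimate, \<open>approx_integration_by_parts\<close>: if \<open>X\<close> and \<open>V\<close> are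
  sums of independent pairs, a second order expansion around the sum without its \<open>i\<close>-th summand gives
  integration by parts up to third moments, because the third cumulants of a Gibbs measure are
  bounded. Applied to the velocity of a rotation of one independent sum into another one it yields a
  Lindeberg comparison of the expected log partition functions (\<open>lindeberg_comparison\<close>), and hence
  \<open>Delta2\<close>; applied to the derivative of the perturbation it yields \<open>Delta1\<close>.

  Gaussian processes enter only through stability: a centered Gaussian law is the law of \<open>n\<close>
  independent copies of itself, scaled by the inverse square root of \<open>n\<close>. Letting \<open>n\<close> tend to
  infinity makes integration by parts exact (\<open>gaussian_integration_by_parts\<close>) and the
  Gaussian contribution to the Lindeberg error zero (\<open>gaussian_comparison\<close>). This needs two facts on
  Gaussian laws on \<open>C(T)\<close>: they are determined by their characteristic functionals (\<open>law_eqI_char\<close>), and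
  they have third moments (\<open>gaussian_third_moment\<close>, a weak form of Fernique's theorem).
\<close>

section \<open>Separability of C(T) and measurability\<close>

instance bcontfun :: (metric_space, banach) banach ..

lemma compact_UNIV_finite_ball_cover:
  assumes "e > 0"
  obtains K :: "'t::compact_metric_space set" where "finite K" "UNIV = (\<Union>x\<in>K. ball x e)"
proof -
  have "\<forall>e>0. \<exists>k. finite k \<and> (UNIV :: 't set) \<subseteq> (\<Union>x\<in>k. ball x e)"
    using compact_UNIV unfolding compact_eq_totally_bounded by (rule conjunct2)
  then show thesis using assms that by (metis subset_antisym subset_UNIV)
qed

text \<open>Separability of \<open>C(T)\<close> makes the Bochner integral of random functions available, and
  sums and pairs of random functions become measurable. The proof discretises: a continuous
  function is known up to a small error from its values at the centers of a finite net, rounded to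
  a countable dense set, provided the net is fine enough for its modulus of continuity. There are
  countably many tables of rounded values, and one function is chosen for each table that occurs.\<close>

instance bcontfun :: (compact_metric_space, "{metric_space, second_countable_topology}")
  second_countable_topology
proof
  have "\<exists>K. \<forall>n. finite (K n) \<and> (UNIV :: 'a set) = (\<Union>x\<in>K n. ball x (1 / Suc n))"
    by (rule choice) (metis compact_UNIV_finite_ball_cover of_nat_0_less_iff zero_less_Suc zero_less_divide_1_iff)
  then obtain K :: "nat \<Rightarrow> 'a set" where fin: "\<And>n. finite (K n)"
    and cov: "\<And>n. (UNIV :: 'a set) = (\<Union>x\<in>K n. ball x (1 / Suc n))"
    by auto
  obtain D :: "'b set" where D: "countable D" "\<And>U. open U \<Longrightarrow> U \<noteq> {} \<Longrightarrow> \<exists>d\<in>D. d \<in> U"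
    using countable_dense_setE by blast
  define fits where "fits n k p f \<longleftrightarrow>
    (\<forall>x\<in>K n. \<forall>y\<in>ball x (1 / Suc n). dist (apply_bcontfun f y) (p x) < 1 / Suc k)"
    for n k :: nat and p :: "'a \<Rightarrow> 'b" and f :: "'a \<Rightarrow>\<^sub>C 'b"
  define S where "S = (\<lambda>(n, k, p). SOME f. fits n k p f) `
    (SIGMA n:UNIV. SIGMA k:UNIV. PiE (K n) (\<lambda>_. D))"
  have "countable S"
    unfolding S_def using fin D(1) by (intro countable_image countable_SIGMA countable_PiE) auto
  define A where "A = (\<lambda>(g, j). ball g (1 / Suc j)) ` (S \<times> (UNIV :: nat set))"
  have "countable A"
    unfolding A_def using \<open>countable S\<close> by auto
  moreover have "topological_basis A"
  proof (rule topological_basisI)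
    fix b assume "b \<in> A"
    then show "open b" by (auto simp: A_def)
  next
    fix U and f :: "'a \<Rightarrow>\<^sub>C 'b" assume "open U" "f \<in> U"
    then obtain e where e: "e > 0" "ball f e \<subseteq> U"
      by (auto simp: open_contains_ball)
    obtain j where j: "1 / Suc j < e / 2"
      using nat_approx_posE[of "e / 2"] e(1) by auto
    \<comment> \<open>two functions with the same table differ by at most \<open>2 / Suc k\<close>, less than the radius \<open>1 / Suc j\<close>\<close>
    define k where "k = 2 * j + 2"
    have k: "2 / Suc k < 1 / Suc j" by (simp add: k_def field_simps)
    have "uniformly_continuous_on UNIV (apply_bcontfun f)"
      by (rule compact_uniformly_continuous[OF continuous_on_apply_bcontfun compact_UNIV])
    then obtain d where d: "d > 0"
      "\<And>x y. dist x y < d \<Longrightarrow> dist (apply_bcontfun f x) (apply_bcontfun f y) < 1 / (2 * Suc k)"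
      unfolding uniformly_continuous_on_def
      by (elim allE[of _ "1 / real (2 * Suc k)"]) (auto simp: dist_commute)
    obtain n where n: "1 / Suc n < d" using nat_approx_posE[of d] d(1) by auto
    have "\<exists>q\<in>D. q \<in> ball (apply_bcontfun f x) (1 / (2 * Suc k))" for x
      by (rule D(2)) auto
    then obtain q where q: "\<And>x. q x \<in> D" "\<And>x. dist (apply_bcontfun f x) (q x) < 1 / (2 * Suc k)"
      by (metis mem_ball)
    define p where "p = restrict q (K n)"
    have p: "p \<in> PiE (K n) (\<lambda>_. D)" using q by (auto simp: p_def)
    have f: "fits n k p f"
      unfolding fits_def
    proof safe
      fix x y assume x: "x \<in> K n" and y: "y \<in> ball x (1 / real (Suc n))"
      have "dist (apply_bcontfun f y) (apply_bcontfun f x) < 1 / (2 * Suc k)"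
        using y n by (intro d(2)) (auto simp: dist_commute)
      moreover have "dist (apply_bcontfun f x) (p x) < 1 / (2 * Suc k)"
        using q(2)[of x] x by (simp add: p_def)
      moreover have "1 / (2 * Suc k) + 1 / (2 * Suc k) = 1 / real (Suc k)"
        by (simp add: field_simps)
      ultimately show "dist (apply_bcontfun f y) (p x) < 1 / Suc k"
        using dist_triangle[of "apply_bcontfun f y" "p x" "apply_bcontfun f x"]
        by (metis add_strict_mono le_less_trans)
    qed
    define g where "g = (SOME f. fits n k p f)"
    have gS: "g \<in> S" unfolding S_def g_def using p
      by (intro image_eqI[of _ _ "(n, k, p)"]) auto
    have g: "fits n k p g" unfolding g_def by (rule someI[of "fits n k p", OF f])
    have "dist f g \<le> 2 / Suc k"
    proof (rule dist_bound)
      fix y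
      obtain x where x: "x \<in> K n" "y \<in> ball x (1 / Suc n)" using cov[of n] by blast
      have "dist (apply_bcontfun f y) (p x) < 1 / Suc k" "dist (apply_bcontfun g y) (p x) < 1 / Suc k"
        using f g x unfolding fits_def by blast+
      then show "dist (apply_bcontfun f y) (apply_bcontfun g y) \<le> 2 / Suc k"
        using dist_triangle2[of "apply_bcontfun f y" "apply_bcontfun g y" "p x"] by (simp add: add_divide_distrib)
    qed
    then have fg: "dist f g < 1 / Suc j" using k by linarith
    have "ball g (1 / Suc j) \<subseteq> ball f e"
    proof
      fix h assume "h \<in> ball g (1 / Suc j)"
      then show "h \<in> ball f e" using fg j dist_triangle[of f h g] by simp
    qed
    then show "\<exists>b\<in>A. f \<in> b \<and> b \<subseteq> U"
      using fg gS e(2) by (intro bexI[of _ "ball g (1 / Suc j)"]) (auto simp: A_def dist_commute)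
  qed
  ultimately show "\<exists>A :: ('a \<Rightarrow>\<^sub>C 'b) set set. countable A \<and> open = generate_topology A"
    by (intro exI[of _ A] conjI topological_basis_imp_subbasis)
qed

lemma bounded_linear_eval: "bounded_linear (\<lambda>z :: 't::topological_space \<Rightarrow>\<^sub>C real. apply_bcontfun z t)"
proof (rule bounded_linear_intro)
  show "norm (apply_bcontfun x t) \<le> norm x * 1" for x :: "'t \<Rightarrow>\<^sub>C real"
    using norm_bounded[of x t] by simp
qed simp_all

lemma abs_eval_le: "\<bar>apply_bcontfun (z :: 't::topological_space \<Rightarrow>\<^sub>C real) t\<bar> \<le> norm z"
  using norm_bounded[of z t] by simp

text \<open>Near \<open>(z, t)\<close> the value \<open>z' t'\<close> splits into \<open>(z' - z) t'\<close>, which is small uniformly in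
  \<open>t'\<close>, and \<open>z t'\<close>.\<close>

lemma continuous_eval:
  "continuous_on UNIV (\<lambda>p :: ('t::metric_space \<Rightarrow>\<^sub>C real) \<times> 't. apply_bcontfun (fst p) (snd p))"
proof (intro continuous_at_imp_continuous_on ballI)
  fix q :: "('t \<Rightarrow>\<^sub>C real) \<times> 't"
  obtain z t where q: "q = (z, t)" by (cases q)
  show "isCont (\<lambda>p. apply_bcontfun (fst p) (snd p)) q"
    unfolding q isCont_def fst_conv snd_conv
  proof -
    have 1: "((\<lambda>p. norm (fst p - z)) \<longlongrightarrow> norm (fst (z, t) - z)) (at (z, t))"
      by (intro tendsto_intros)
    have 2: "((\<lambda>p :: ('t \<Rightarrow>\<^sub>C real) \<times> 't. apply_bcontfun z (snd p)) \<longlongrightarrow> apply_bcontfun z t) (at (z, t))"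
    proof (rule tendsto_compose[of "apply_bcontfun z"])
      show "(apply_bcontfun z \<longlongrightarrow> apply_bcontfun z t) (at t)"
        using continuous_on_apply_bcontfun[of UNIV z] by (simp add: continuous_on_def)
      show "(snd \<longlongrightarrow> t) (at (z, t))"
        using tendsto_snd[OF tendsto_ident_at[of "(z, t)" UNIV]] by simp
    qed
    have "((\<lambda>p. apply_bcontfun (fst p - z) (snd p)) \<longlongrightarrow> 0) (at (z, t))"
      using abs_eval_le[of "fst p - z" "snd p" for p]
      by (intro tendsto_0_le[where K=1, OF 1[simplified]]) (simp add: always_eventually)
    from tendsto_add[OF this 2]
    show "((\<lambda>p. apply_bcontfun (fst p) (snd p)) \<longlongrightarrow> apply_bcontfun z t) (at (z, t))" by simp
  qed
qed

lemma measurable_eval [measurable (raw)]: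
  fixes f :: "'a \<Rightarrow> 't::compact_metric_space \<Rightarrow>\<^sub>C real"
  assumes [measurable]: "f \<in> borel_measurable M" "g \<in> borel_measurable M"
  shows "(\<lambda>x. apply_bcontfun (f x) (g x)) \<in> borel_measurable M"
proof -
  have "(\<lambda>x. (f x, g x)) \<in> borel_measurable M" by measurable
  from measurable_compose[OF this borel_measurable_continuous_onI[OF continuous_eval]]
  show ?thesis by simp
qed

text \<open>With a countable \<open>D\<close> the sup norm becomes a countable supremum, hence measurable as soon as
  the evaluations are.\<close>

lemma norm_le_iff_dense:
  fixes z :: "'t::metric_space \<Rightarrow>\<^sub>C real"
  assumes D: "\<And>U. open U \<Longrightarrow> U \<noteq> {} \<Longrightarrow> \<exists>d\<in>D. d \<in> U"
  shows "norm z \<le> r \<longleftrightarrow> (\<forall>t\<in>D. \<bar>apply_bcontfun z t\<bar> \<le> r)"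
proof
  assume "norm z \<le> r"
  then show "\<forall>t\<in>D. \<bar>apply_bcontfun z t\<bar> \<le> r" using abs_eval_le order_trans by blast
next
  assume *: "\<forall>t\<in>D. \<bar>apply_bcontfun z t\<bar> \<le> r"
  have "closed {t. \<bar>apply_bcontfun z t\<bar> \<le> r}"
    by (intro closed_Collect_le continuous_on_rabs continuous_on_apply_bcontfun continuous_on_const)
  then have "open (- {t. \<bar>apply_bcontfun z t\<bar> \<le> r})" by blast
  then have "- {t. \<bar>apply_bcontfun z t\<bar> \<le> r} = {}" using D * by blast
  then show "norm z \<le> r" by (intro norm_bound) auto
qed

text \<open>Distances to a fixed function are measurable because they are countable suprema of
  evaluations, and in a separable space every open set is a countable union of balls.\<close>

lemma borel_measurable_bcontfunI:
  fixes f :: "'a \<Rightarrow> 't::compact_metric_space \<Rightarrow>\<^sub>C real"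
  assumes ev: "\<And>t. (\<lambda>x. apply_bcontfun (f x) t) \<in> borel_measurable M"
  shows "f \<in> borel_measurable M"
proof -
  obtain D :: "'t set" where D: "countable D" "\<And>U. open U \<Longrightarrow> U \<noteq> {} \<Longrightarrow> \<exists>d\<in>D. d \<in> U"
    using countable_dense_setE by blast
  have dist: "(\<lambda>x. dist (f x) c) \<in> borel_measurable M" for c
  proof (rule borel_measurableI_le)
    fix r
    have "{x \<in> space M. dist (f x) c \<le> r} = {x \<in> space M. \<forall>t\<in>D. \<bar>apply_bcontfun (f x) t - apply_bcontfun c t\<bar> \<le> r}"
      using norm_le_iff_dense[OF D(2)] by (simp add: dist_norm)
    also have "\<dots> \<in> sets M"
      using D(1) ev by measurable
    finally show "{x \<in> space M. dist (f x) c \<le> r} \<in> sets M" .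
  qed
  show ?thesis
  proof (rule borel_measurableI)
    fix U :: "('t \<Rightarrow>\<^sub>C real) set" assume "open U"
    obtain E :: "('t \<Rightarrow>\<^sub>C real) set" where E: "countable E" "\<And>U. open U \<Longrightarrow> U \<noteq> {} \<Longrightarrow> \<exists>d\<in>E. d \<in> U"
      using countable_dense_setE by blast
    have U: "U = (\<Union>(c, k)\<in>{(c, k). c \<in> E \<and> ball c (1 / Suc k) \<subseteq> U}. ball c (1 / Suc k))"
    proof (intro subset_antisym subsetI)
      fix z assume "z \<in> U"
      then obtain e where e: "e > 0" "ball z e \<subseteq> U" using \<open>open U\<close> by (auto simp: open_contains_ball)
      obtain k where k: "1 / Suc k < e / 2" using nat_approx_posE[of "e / 2"] e(1) by auto
      obtain c where c: "c \<in> E" "c \<in> ball z (1 / Suc k)" using E(2)[of "ball z (1 / Suc k)"] by auto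
      have "ball c (1 / Suc k) \<subseteq> ball z e"
      proof
        fix h assume "h \<in> ball c (1 / Suc k)"
        then show "h \<in> ball z e" using c k dist_triangle[of z h c] by simp
      qed
      with c e show "z \<in> (\<Union>(c, k)\<in>{(c, k). c \<in> E \<and> ball c (1 / Suc k) \<subseteq> U}. ball c (1 / Suc k))"
        by (intro UN_I[of "(c, k)"]) (auto simp: dist_commute)
    qed auto
    have ct: "countable {(c, k). c \<in> E \<and> ball c (1 / Suc k) \<subseteq> U}"
      by (rule countable_subset[of _ "E \<times> UNIV"]) (use E in auto)
    have "f -` U \<inter> space M = (\<Union>(c, k)\<in>{(c, k). c \<in> E \<and> ball c (1 / Suc k) \<subseteq> U}. {x \<in> space M. dist (f x) c < 1 / Suc k})"
    proof (intro subset_antisym subsetI)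
      fix x assume x: "x \<in> f -` U \<inter> space M"
      then obtain c k where "c \<in> E" "ball c (1 / Suc k) \<subseteq> U" "f x \<in> ball c (1 / Suc k)"
        using U by blast
      with x show "x \<in> (\<Union>(c, k)\<in>{(c, k). c \<in> E \<and> ball c (1 / Suc k) \<subseteq> U}. {x \<in> space M. dist (f x) c < 1 / Suc k})"
        by (intro UN_I[of "(c, k)"]) (auto simp: dist_commute)
    qed (auto simp: dist_commute)
    also have "\<dots> \<in> sets M"
      using dist by (intro sets.countable_UN'' ct) auto
    finally show "f -` U \<inter> space M \<in> sets M" .
  qed
qed

section \<open>Calculus of Gibbs measures\<close>

definition gibbs_mean ::
  "'t measure \<Rightarrow> ('t::topological_space \<Rightarrow>\<^sub>C real) \<Rightarrow> ('t \<Rightarrow> real) \<Rightarrow> real" where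
  "gibbs_mean \<pi> z f = (\<integral>t. f t \<partial>gibbs \<pi> z)"

definition gibbs_cov ::
  "'t measure \<Rightarrow> ('t::topological_space \<Rightarrow>\<^sub>C real) \<Rightarrow> ('t \<Rightarrow> real) \<Rightarrow> ('t \<Rightarrow> real) \<Rightarrow> real" where
  "gibbs_cov \<pi> z f h = gibbs_mean \<pi> z (\<lambda>t. f t * h t) - gibbs_mean \<pi> z f * gibbs_mean \<pi> z h"

definition log_partition :: "'t measure \<Rightarrow> ('t::topological_space \<Rightarrow>\<^sub>C real) \<Rightarrow> real" where
  "log_partition \<pi> z = ln (\<integral>t. exp (z t) \<partial>\<pi>)"

lemma abs_exp_remainder_le:
  fixes x :: real
  assumes "\<bar>x\<bar> \<le> 1"
  shows "\<bar>exp x - 1 - x\<bar> \<le> x\<^sup>2"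
proof -
  have "exp x \<le> 1 + x + x\<^sup>2"
  proof (cases "x \<ge> 0")
    case True
    then show ?thesis using exp_bound[of x] assms by simp
  next
    case False
    define y where "y = - x"
    have y: "y \<ge> 0" using False by (simp add: y_def)
    have "exp (- y) * (1 + y + y\<^sup>2 / 2) \<le> exp (- y) * exp y"
      using exp_lower_Taylor_quadratic[OF y] by (intro mult_left_mono) auto
    also have "\<dots> = 1" by (simp add: exp_minus)
    also have "\<dots> \<le> 1 + y\<^sup>2 / 2 + y ^ 3 / 2 + y ^ 4 / 2" using y by simp
    also have "\<dots> = (1 - y + y\<^sup>2) * (1 + y + y\<^sup>2 / 2)"
      by (simp add: field_simps power2_eq_square power3_eq_cube power4_eq_xxxx)
    finally have "exp (- y) \<le> 1 - y + y\<^sup>2"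
      using y by (simp add: mult_le_cancel_right add_nonneg_pos not_less add_pos_nonneg)
    then show ?thesis by (simp add: y_def)
  qed
  moreover have "1 + x \<le> exp x" by (rule exp_ge_add_one_self)
  moreover have "0 \<le> x\<^sup>2" by simp
  ultimately show ?thesis unfolding abs_le_iff by linarith
qed

locale base_measure = prob_space \<pi> for \<pi> :: "'t::compact_metric_space measure" +
  assumes sets_base: "sets \<pi> = sets borel"
begin

lemma measurable_base_cong [measurable_cong]: "sets \<pi> = sets borel"
  by (rule sets_base)

lemma space_base [simp]: "space \<pi> = UNIV"
  using sets_eq_imp_space_eq[OF sets_base] by simp

lemma measure_base_UNIV [simp]: "measure \<pi> UNIV = 1"
  using prob_space by simp

lemma borel_measurable_apply_bcontfun [measurable]:
  "apply_bcontfun (z :: 't \<Rightarrow>\<^sub>C real) \<in> borel_measurable borel"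
  by (intro borel_measurable_continuous_onI) simp

lemma exp_bcontfun_bounds:
  "exp (- norm z) \<le> exp (apply_bcontfun (z :: 't \<Rightarrow>\<^sub>C real) t)"
  "exp (apply_bcontfun (z :: 't \<Rightarrow>\<^sub>C real) t) \<le> exp (norm z)"
  using abs_eval_le[of z t] by auto

lemma integrable_exp_weight:
  assumes [measurable]: "f \<in> borel_measurable borel" and f: "\<And>t. \<bar>f t\<bar> \<le> K"
  shows "integrable \<pi> (\<lambda>t. f t * exp (apply_bcontfun (z :: 't \<Rightarrow>\<^sub>C real) t))"
proof (rule integrable_const_bound[where B="K * exp (norm z)"])
  show "AE t in \<pi>. norm (f t * exp (apply_bcontfun z t)) \<le> K * exp (norm z)"
  proof (rule AE_I2)
    fix t
    have "\<bar>f t\<bar> * exp (z t) \<le> K * exp (norm z)"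
      using f[of t] exp_bcontfun_bounds[of z t] by (intro mult_mono) auto
    then show "norm (f t * exp (apply_bcontfun z t)) \<le> K * exp (norm z)" by (simp add: abs_mult)
  qed
qed measurable

lemma integrable_exp: "integrable \<pi> (\<lambda>t. exp (apply_bcontfun (z :: 't \<Rightarrow>\<^sub>C real) t))"
  using integrable_exp_weight[of "\<lambda>_. 1" 1 z] by simp

lemma partition_pos: "(\<integral>t. exp (apply_bcontfun (z :: 't \<Rightarrow>\<^sub>C real) t) \<partial>\<pi>) > 0"
proof -
  have "(\<integral>t. exp (- norm z) \<partial>\<pi>) \<le> (\<integral>t. exp (z t) \<partial>\<pi>)"
    by (intro integral_mono integrable_exp exp_bcontfun_bounds) auto
  then have "exp (- norm z) \<le> (\<integral>t. exp (z t) \<partial>\<pi>)" by (simp add: prob_space)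
  then show ?thesis using exp_gt_zero[of "- norm z"] by linarith
qed

lemma sets_gibbs [measurable_cong]: "sets (gibbs \<pi> z) = sets borel"
  by (simp add: gibbs_def sets_base)

lemma space_gibbs [simp]: "space (gibbs \<pi> z) = UNIV"
  using sets_eq_imp_space_eq[OF sets_gibbs] by simp

lemma gibbs_mean_eq:
  assumes [measurable]: "f \<in> borel_measurable borel"
  shows "gibbs_mean \<pi> z f = (\<integral>t. f t * exp (z t) \<partial>\<pi>) / (\<integral>t. exp (z t) \<partial>\<pi>)"
proof -
  have "gibbs_mean \<pi> z f = (\<integral>t. (exp (z t) / (\<integral>s. exp (z s) \<partial>\<pi>)) *\<^sub>R f t \<partial>\<pi>)"
    unfolding gibbs_mean_def gibbs_def using partition_pos[of z]
    by (intro integral_density) (auto simp: less_imp_le)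
  also have "\<dots> = (\<integral>t. f t * exp (z t) / (\<integral>s. exp (z s) \<partial>\<pi>) \<partial>\<pi>)"
    by (simp add: mult.commute)
  finally show ?thesis by simp
qed

lemma prob_space_gibbs: "prob_space (gibbs \<pi> z)"
proof
  have "emeasure (gibbs \<pi> z) (space (gibbs \<pi> z)) = (\<integral>\<^sup>+t. ennreal (exp (z t) / (\<integral>s. exp (z s) \<partial>\<pi>)) \<partial>\<pi>)"
    by (simp add: gibbs_def emeasure_density)
  also have "\<dots> = ennreal (\<integral>t. exp (z t) / (\<integral>s. exp (z s) \<partial>\<pi>) \<partial>\<pi>)"
    using partition_pos[of z] integrable_exp[of z]
    by (intro nn_integral_eq_integral) (auto simp: less_imp_le)
  also have "\<dots> = 1" using partition_pos[of z] by simp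
  finally show "emeasure (gibbs \<pi> z) (space (gibbs \<pi> z)) = 1" .
qed

lemma measure_gibbs_UNIV [simp]: "measure (gibbs \<pi> z) UNIV = 1"
  using prob_space.prob_space[OF prob_space_gibbs[of z]] by simp

lemma integrable_gibbs:
  fixes f :: "'t \<Rightarrow> real"
  assumes [measurable]: "f \<in> borel_measurable borel" and f: "\<And>t. \<bar>f t\<bar> \<le> K"
  shows "integrable (gibbs \<pi> z) f"
proof -
  interpret G: prob_space "gibbs \<pi> z" by (rule prob_space_gibbs)
  show ?thesis by (rule G.integrable_const_bound[where B=K]) (use f in auto)
qed

lemma abs_gibbs_mean_le:
  assumes [measurable]: "f \<in> borel_measurable borel" and f: "\<And>t. \<bar>f t\<bar> \<le> K"
  shows "\<bar>gibbs_mean \<pi> z f\<bar> \<le> K"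
proof -
  interpret G: prob_space "gibbs \<pi> z" by (rule prob_space_gibbs)
  have "\<bar>gibbs_mean \<pi> z f\<bar> \<le> (\<integral>t. \<bar>f t\<bar> \<partial>gibbs \<pi> z)"
    unfolding gibbs_mean_def by (rule integral_abs_bound)
  also have "\<dots> \<le> (\<integral>t. K \<partial>gibbs \<pi> z)"
    using f order_trans[OF abs_ge_zero f]
    by (intro integral_mono integrable_abs integrable_gibbs[where K=K]) auto
  finally show ?thesis by (simp add: G.prob_space)
qed

text \<open>Everything smooth about Gibbs measures comes from the Frechet differentiability of
  exponential integrals with a bounded weight \<open>f\<close>: Gibbs means are quotients of two of them.\<close>

lemma exp_integral_has_derivative:
  fixes z :: "'t \<Rightarrow>\<^sub>C real"
  assumes [measurable]: "f \<in> borel_measurable borel" and f: "\<And>t. \<bar>f t\<bar> \<le> K"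
  shows "((\<lambda>z :: 't \<Rightarrow>\<^sub>C real. \<integral>t. f t * exp (z t) \<partial>\<pi>) has_derivative
          (\<lambda>h. \<integral>t. f t * apply_bcontfun h t * exp (z t) \<partial>\<pi>)) (at z)"
proof -
  have K: "K \<ge> 0" using order_trans[OF abs_ge_zero f] .
  have fh: "\<bar>f t * apply_bcontfun h t\<bar> \<le> K * norm h" for h :: "'t \<Rightarrow>\<^sub>C real" and t
    using f[of t] abs_eval_le[of h t] K by (simp add: abs_mult mult_mono)
  have int: "integrable \<pi> (\<lambda>t. f t * apply_bcontfun h t * exp (apply_bcontfun z t))" for h z :: "'t \<Rightarrow>\<^sub>C real"
    by (rule integrable_exp_weight[where K="K * norm h"]) (auto intro: fh)
  have int0: "integrable \<pi> (\<lambda>t. f t * exp (apply_bcontfun z t))" for z :: "'t \<Rightarrow>\<^sub>C real"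
    by (rule integrable_exp_weight[where K=K]) (auto intro: f)
  have lin: "bounded_linear (\<lambda>h :: 't \<Rightarrow>\<^sub>C real. \<integral>t. f t * h t * exp (z t) \<partial>\<pi>)"
  proof (rule bounded_linear_intro[where K="K * exp (norm z)"])
    show "norm (\<integral>t. f t * h t * exp (z t) \<partial>\<pi>) \<le> norm h * (K * exp (norm z))" for h :: "'t \<Rightarrow>\<^sub>C real"
    proof -
      have "norm (\<integral>t. f t * h t * exp (z t) \<partial>\<pi>) \<le> (\<integral>t. norm (f t * h t * exp (z t)) \<partial>\<pi>)"
        by (rule integral_norm_bound)
      also have "\<dots> \<le> (\<integral>t. K * norm h * exp (norm z) \<partial>\<pi>)"
      proof (intro integral_mono integrable_norm int)
        fix t
        show "norm (f t * h t * exp (z t)) \<le> K * norm h * exp (norm z)"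
          using fh[of t h] exp_bcontfun_bounds[of z t] K unfolding real_norm_def abs_mult[of "f t * h t"]
          by (intro mult_mono) auto
      qed auto
      finally show ?thesis by (simp add: prob_space mult_ac)
    qed
  next
    show "(\<integral>t. f t * (x + y) t * exp (z t) \<partial>\<pi>) = (\<integral>t. f t * x t * exp (z t) \<partial>\<pi>) + (\<integral>t. f t * y t * exp (z t) \<partial>\<pi>)"
      for x y :: "'t \<Rightarrow>\<^sub>C real"
      unfolding Bochner_Integration.integral_add[OF int int, symmetric]
      by (intro Bochner_Integration.integral_cong) (auto simp: algebra_simps)
  qed (simp add: algebra_simps flip: integral_mult_right_zero)
  show ?thesis
  proof (rule has_derivativeI_sandwich[where e=1 and H="\<lambda>y. K * exp (norm z) * norm (y - z)", OF _ lin])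
    fix y assume "y \<noteq> z" "dist y z < 1"
    define h where "h = y - z"
    have h: "norm h > 0" "norm h < 1" using \<open>y \<noteq> z\<close> \<open>dist y z < 1\<close> by (auto simp: h_def dist_norm)
    have y: "y = z + h" by (simp add: h_def)
    have "norm ((\<integral>t. f t * exp (y t) \<partial>\<pi>) - (\<integral>t. f t * exp (z t) \<partial>\<pi>) - (\<integral>t. f t * h t * exp (z t) \<partial>\<pi>))
        = norm (\<integral>t. f t * exp (y t) - f t * exp (z t) - f t * h t * exp (z t) \<partial>\<pi>)"
      using int int0 by simp
    also have "\<dots> \<le> (\<integral>t. norm (f t * exp (y t) - f t * exp (z t) - f t * h t * exp (z t)) \<partial>\<pi>)"
      by (rule integral_norm_bound)
    also have "\<dots> \<le> (\<integral>t. K * exp (norm z) * (norm h)\<^sup>2 \<partial>\<pi>)"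
    proof (intro integral_mono integrable_norm Bochner_Integration.integrable_diff int int0)
      fix t
      have "f t * exp (y t) - f t * exp (z t) - f t * h t * exp (z t) = f t * exp (z t) * (exp (h t) - 1 - h t)"
        by (simp add: y exp_add algebra_simps)
      also have "norm \<dots> = \<bar>f t\<bar> * exp (z t) * \<bar>exp (h t) - 1 - h t\<bar>" by (simp add: abs_mult)
      also have "\<dots> \<le> K * exp (norm z) * (norm h)\<^sup>2"
      proof (intro mult_mono)
        have "\<bar>exp (h t) - 1 - h t\<bar> \<le> (h t)\<^sup>2"
          using abs_eval_le[of h t] h by (intro abs_exp_remainder_le) auto
        also have "\<dots> \<le> (norm h)\<^sup>2" using abs_eval_le[of h t] by (simp add: abs_le_square_iff[symmetric])
        finally show "\<bar>exp (h t) - 1 - h t\<bar> \<le> (norm h)\<^sup>2" .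
      qed (use f K exp_bcontfun_bounds in auto)
      finally show "norm (f t * exp (y t) - f t * exp (z t) - f t * h t * exp (z t)) \<le> K * exp (norm z) * (norm h)\<^sup>2" .
    qed auto
    finally have "norm ((\<integral>t. f t * exp (y t) \<partial>\<pi>) - (\<integral>t. f t * exp (z t) \<partial>\<pi>) - (\<integral>t. f t * h t * exp (z t) \<partial>\<pi>))
        \<le> K * exp (norm z) * (norm h)\<^sup>2" by (simp add: prob_space)
    then show "norm ((\<integral>t. f t * exp (y t) \<partial>\<pi>) - (\<integral>t. f t * exp (z t) \<partial>\<pi>) - (\<integral>t. f t * (y - z) t * exp (z t) \<partial>\<pi>)) / norm (y - z)
        \<le> K * exp (norm z) * norm (y - z)"
      unfolding h_def[symmetric] using h by (simp add: divide_le_eq power2_eq_square mult_ac)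
  next
    show "((\<lambda>y. K * exp (norm z) * norm (y - z)) \<longlongrightarrow> 0) (at z)"
      by (rule tendsto_eq_intros refl | simp)+
  qed auto
qed

lemma gibbs_mean_has_real_derivative:
  fixes z :: "real \<Rightarrow> 't \<Rightarrow>\<^sub>C real"
  assumes z: "(z has_vector_derivative v) (at r)"
    and [measurable]: "f \<in> borel_measurable borel" and f: "\<And>t. \<bar>f t\<bar> \<le> K"
  shows "((\<lambda>r. gibbs_mean \<pi> (z r) f) has_real_derivative gibbs_cov \<pi> (z r) f v) (at r)"
proof -
  have d: "((\<lambda>r. \<integral>t. g t * exp (z r t) \<partial>\<pi>) has_real_derivative (\<integral>t. g t * v t * exp (z r t) \<partial>\<pi>)) (at r)"
    if "g \<in> borel_measurable borel" "\<And>t. \<bar>g t\<bar> \<le> C" for g C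
  proof -
    have "((\<lambda>r. \<integral>t. g t * exp (z r t) \<partial>\<pi>) has_derivative (\<lambda>x. \<integral>t. g t * (x *\<^sub>R v) t * exp (z r t) \<partial>\<pi>)) (at r)"
      using has_derivative_compose[OF z[unfolded has_vector_derivative_def] exp_integral_has_derivative[OF that]]
      by simp
    also have "(\<lambda>x. \<integral>t. g t * (x *\<^sub>R v) t * exp (z r t) \<partial>\<pi>) = (\<lambda>x. (\<integral>t. g t * v t * exp (z r t) \<partial>\<pi>) * x)"
      by (auto simp: mult_ac simp flip: integral_mult_right_zero)
    finally show ?thesis by (simp add: has_field_derivative_def)
  qed
  have "((\<lambda>r. (\<integral>t. f t * exp (z r t) \<partial>\<pi>) / (\<integral>t. 1 * exp (z r t) \<partial>\<pi>)) has_real_derivative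
     ((\<integral>t. f t * v t * exp (z r t) \<partial>\<pi>) * (\<integral>t. 1 * exp (z r t) \<partial>\<pi>) -
      (\<integral>t. f t * exp (z r t) \<partial>\<pi>) * (\<integral>t. 1 * v t * exp (z r t) \<partial>\<pi>)) /
       ((\<integral>t. 1 * exp (z r t) \<partial>\<pi>) * (\<integral>t. 1 * exp (z r t) \<partial>\<pi>))) (at r)"
    using partition_pos[of "z r"] by (intro DERIV_divide d[of f K] d[of "\<lambda>_. 1" 1] f) auto
  also have "((\<integral>t. f t * v t * exp (z r t) \<partial>\<pi>) * (\<integral>t. 1 * exp (z r t) \<partial>\<pi>) -
      (\<integral>t. f t * exp (z r t) \<partial>\<pi>) * (\<integral>t. 1 * v t * exp (z r t) \<partial>\<pi>)) /
       ((\<integral>t. 1 * exp (z r t) \<partial>\<pi>) * (\<integral>t. 1 * exp (z r t) \<partial>\<pi>)) = gibbs_cov \<pi> (z r) f v"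
    using partition_pos[of "z r"] by (simp add: gibbs_cov_def gibbs_mean_eq field_simps)
  finally show ?thesis by (simp add: gibbs_mean_eq)
qed

lemma log_partition_has_real_derivative:
  fixes z :: "real \<Rightarrow> 't \<Rightarrow>\<^sub>C real"
  assumes z: "(z has_vector_derivative v) (at r)"
  shows "((\<lambda>r. log_partition \<pi> (z r)) has_real_derivative gibbs_mean \<pi> (z r) v) (at r)"
proof -
  have "((\<lambda>r. \<integral>t. 1 * exp (z r t) \<partial>\<pi>) has_derivative (\<lambda>x. \<integral>t. 1 * (x *\<^sub>R v) t * exp (z r t) \<partial>\<pi>)) (at r)"
    by (rule has_derivative_compose[OF z[unfolded has_vector_derivative_def] exp_integral_has_derivative[where K=1]]) auto
  also have "(\<lambda>x. \<integral>t. 1 * (x *\<^sub>R v) t * exp (z r t) \<partial>\<pi>) = (\<lambda>x. (\<integral>t. v t * exp (z r t) \<partial>\<pi>) * x)"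
    by (auto simp: mult_ac simp flip: integral_mult_right_zero)
  finally have "((\<lambda>r. \<integral>t. exp (z r t) \<partial>\<pi>) has_real_derivative (\<integral>t. v t * exp (z r t) \<partial>\<pi>)) (at r)"
    by (simp add: has_field_derivative_def)
  from DERIV_chain2[OF DERIV_ln_divide[OF partition_pos[of "z r"]] this]
  show ?thesis by (simp add: log_partition_def gibbs_mean_eq)
qed

text \<open>The third joint cumulant under the Gibbs measure. It is the derivative of a Gibbs covariance,
  hence a second derivative of a Gibbs mean, and so the remainder in all expansions below.\<close>

definition gibbs_cumulant3 ::
  "('t \<Rightarrow>\<^sub>C real) \<Rightarrow> ('t \<Rightarrow> real) \<Rightarrow> ('t \<Rightarrow> real) \<Rightarrow> ('t \<Rightarrow> real) \<Rightarrow> real" where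
  "gibbs_cumulant3 z f h k = gibbs_mean \<pi> z (\<lambda>t.
     (f t - gibbs_mean \<pi> z f) * (h t - gibbs_mean \<pi> z h) * (k t - gibbs_mean \<pi> z k))"

lemma gibbs_mean_const: "gibbs_mean \<pi> z (\<lambda>t. c) = c"
proof -
  interpret G: prob_space "gibbs \<pi> z" by (rule prob_space_gibbs)
  show ?thesis by (simp add: gibbs_mean_def G.prob_space)
qed

lemma gibbs_cov_has_real_derivative:
  fixes z :: "real \<Rightarrow> 't \<Rightarrow>\<^sub>C real" and f h v :: "'t \<Rightarrow>\<^sub>C real"
  assumes z: "(z has_vector_derivative v) (at r)"
  shows "((\<lambda>r. gibbs_cov \<pi> (z r) f h) has_real_derivative gibbs_cumulant3 (z r) f h v) (at r)"
proof -
  have m [measurable]: "apply_bcontfun f \<in> borel_measurable borel"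
    "apply_bcontfun h \<in> borel_measurable borel" "apply_bcontfun v \<in> borel_measurable borel" by simp_all
  have fh: "\<bar>f t * h t\<bar> \<le> norm f * norm h" for t
    using abs_eval_le[of f t] abs_eval_le[of h t] by (simp add: abs_mult mult_mono)
  let ?G = "gibbs \<pi> (z r)"
  have bnd: "\<bar>f t * h t * v t\<bar> \<le> norm f * norm h * norm v"
    "\<bar>f t * v t\<bar> \<le> norm f * norm v" "\<bar>h t * v t\<bar> \<le> norm h * norm v" for t
    using abs_eval_le[of f t] abs_eval_le[of h t] abs_eval_le[of v t]
    by (simp_all add: abs_mult mult_mono)
  have int: "integrable ?G (\<lambda>t. f t)" "integrable ?G (\<lambda>t. h t)" "integrable ?G (\<lambda>t. v t)"
    "integrable ?G (\<lambda>t. f t * h t)" "integrable ?G (\<lambda>t. f t * v t)" "integrable ?G (\<lambda>t. h t * v t)"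
    "integrable ?G (\<lambda>t. f t * h t * v t)"
    by (rule integrable_gibbs, measurable, rule abs_eval_le fh bnd)+
  interpret G: prob_space ?G by (rule prob_space_gibbs)
  have "((\<lambda>r. gibbs_mean \<pi> (z r) (\<lambda>t. f t * h t) - gibbs_mean \<pi> (z r) f * gibbs_mean \<pi> (z r) h)
     has_real_derivative
     (gibbs_cov \<pi> (z r) (\<lambda>t. f t * h t) v -
      (gibbs_cov \<pi> (z r) f v * gibbs_mean \<pi> (z r) h + gibbs_cov \<pi> (z r) h v * gibbs_mean \<pi> (z r) f))) (at r)"
    by (intro DERIV_diff DERIV_mult gibbs_mean_has_real_derivative[OF z, of _ "norm f"]
        gibbs_mean_has_real_derivative[OF z, of _ "norm h"]
        gibbs_mean_has_real_derivative[OF z, of _ "norm f * norm h"] fh abs_eval_le) measurable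
  also have "gibbs_cov \<pi> (z r) (\<lambda>t. f t * h t) v -
      (gibbs_cov \<pi> (z r) f v * gibbs_mean \<pi> (z r) h + gibbs_cov \<pi> (z r) h v * gibbs_mean \<pi> (z r) f)
    = gibbs_cumulant3 (z r) f h v"
  proof -
    define a b c where "a = gibbs_mean \<pi> (z r) f" and "b = gibbs_mean \<pi> (z r) h" and "c = gibbs_mean \<pi> (z r) v"
    have "gibbs_cumulant3 (z r) f h v = (\<integral>t. f t * h t * v t - c * (f t * h t) - b * (f t * v t) - a * (h t * v t)
       + b * c * f t + a * c * h t + a * b * v t - a * b * c \<partial>?G)"
      unfolding gibbs_cumulant3_def a_def[symmetric] b_def[symmetric] c_def[symmetric]
      unfolding gibbs_mean_def
      by (intro Bochner_Integration.integral_cong) (auto simp: algebra_simps)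
    also have "\<dots> = (\<integral>t. f t * h t * v t \<partial>?G) - c * (\<integral>t. f t * h t \<partial>?G) - b * (\<integral>t. f t * v t \<partial>?G)
       - a * (\<integral>t. h t * v t \<partial>?G) + b * c * (\<integral>t. f t \<partial>?G) + a * c * (\<integral>t. h t \<partial>?G) + a * b * (\<integral>t. v t \<partial>?G) - a * b * c"
      using int by (simp add: G.prob_space)
    finally show ?thesis
      by (simp add: gibbs_cov_def algebra_simps a_def b_def c_def gibbs_mean_def)
  qed
  finally show ?thesis by (simp add: gibbs_cov_def)
qed


lemma gibbs_var_le:
  fixes h :: "'t \<Rightarrow>\<^sub>C real"
  shows "gibbs_mean \<pi> z (\<lambda>t. (h t - gibbs_mean \<pi> z h)\<^sup>2) \<le> (norm h)\<^sup>2"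
proof -
  interpret G: prob_space "gibbs \<pi> z" by (rule prob_space_gibbs)
  have h2: "\<bar>(h t)\<^sup>2\<bar> \<le> (norm h)\<^sup>2" for t
    using abs_eval_le[of h t] by (simp add: abs_le_square_iff[symmetric])
  have int: "integrable (gibbs \<pi> z) h" "integrable (gibbs \<pi> z) (\<lambda>t. (h t)\<^sup>2)"
    by (rule integrable_gibbs, measurable, rule abs_eval_le h2)+
  have "G.variance h = G.expectation (\<lambda>t. (h t)\<^sup>2) - (G.expectation h)\<^sup>2"
    by (rule G.variance_eq[OF int])
  also have "\<dots> \<le> gibbs_mean \<pi> z (\<lambda>t. (h t)\<^sup>2)" by (simp add: gibbs_mean_def)
  also have "\<dots> \<le> (norm h)\<^sup>2"
    using abs_gibbs_mean_le[of "\<lambda>t. (h t)\<^sup>2" "(norm h)\<^sup>2" z, OF _ h2] by simp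
  finally show ?thesis by (simp add: gibbs_mean_def)
qed

text \<open>One factor is bounded by twice its sup norm, the other two by their Gibbs standard
  deviations and thus by their sup norms. The constant \<open>2\<close>, instead of the \<open>8\<close> that results from
  bounding all three factors by twice their sup norms, leads to the constant \<open>3\<close> in the error terms
  of the theorem.\<close>

lemma abs_gibbs_cumulant3_le:
  fixes f h k :: "'t \<Rightarrow>\<^sub>C real"
  shows "\<bar>gibbs_cumulant3 z f h k\<bar> \<le> 2 * norm f * norm h * norm k"
proof (cases "h = 0 \<or> k = 0")
  case True
  then have "gibbs_cumulant3 z f h k = gibbs_mean \<pi> z (\<lambda>t. 0)"
    unfolding gibbs_cumulant3_def by (auto simp: gibbs_mean_const)
  then show ?thesis by (simp add: gibbs_mean_const)
next
  case False
  then have h: "norm h > 0" and k: "norm k > 0" by auto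
  interpret G: prob_space "gibbs \<pi> z" by (rule prob_space_gibbs)
  define c where "c = (\<lambda>(g :: 't \<Rightarrow>\<^sub>C real) t. g t - gibbs_mean \<pi> z g)"
  have mean: "\<bar>gibbs_mean \<pi> z g\<bar> \<le> norm g" for g :: "'t \<Rightarrow>\<^sub>C real"
    by (rule abs_gibbs_mean_le) (auto intro: abs_eval_le)
  have c: "\<bar>c g t\<bar> \<le> 2 * norm g" for g t
    using abs_eval_le[of g t] mean[of g] by (simp add: c_def)
  have cm [measurable]: "c g \<in> borel_measurable borel" for g
    by (simp add: c_def)
  have c2: "\<bar>(c g t)\<^sup>2\<bar> \<le> (2 * norm g)\<^sup>2" for g t
    using power_mono[OF c[of g t], of 2] by simp
  have int2: "integrable (gibbs \<pi> z) (\<lambda>t. (c g t)\<^sup>2)" for g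
    by (rule integrable_gibbs, measurable, rule c2)
  \<comment> \<open>a Young inequality whose weights balance the two variance bounds\<close>
  define q where "q t = norm f * (norm k / norm h * (c h t)\<^sup>2 + norm h / norm k * (c k t)\<^sup>2)" for t
  have pt: "\<bar>c f t * c h t * c k t\<bar> \<le> q t" for t
  proof -
    define x y where "x = sqrt (norm k / norm h) * \<bar>c h t\<bar>" and "y = sqrt (norm h / norm k) * \<bar>c k t\<bar>"
    have xy: "x * y = \<bar>c h t * c k t\<bar>"
    proof -
      have "sqrt (norm k / norm h) * sqrt (norm h / norm k) = 1"
        using h k by (simp flip: real_sqrt_mult)
      then show ?thesis by (simp add: x_def y_def abs_mult mult_ac)
    qed
    have "2 * (x * y) \<le> x\<^sup>2 + y\<^sup>2" using sum_squares_bound[of x y] by simp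
    also have "\<dots> = norm k / norm h * (c h t)\<^sup>2 + norm h / norm k * (c k t)\<^sup>2"
      by (simp add: x_def y_def power_mult_distrib)
    finally have 1: "2 * \<bar>c h t * c k t\<bar> \<le> norm k / norm h * (c h t)\<^sup>2 + norm h / norm k * (c k t)\<^sup>2"
      by (simp add: xy)
    have "\<bar>c f t * c h t * c k t\<bar> = \<bar>c f t\<bar> * \<bar>c h t * c k t\<bar>" by (simp add: abs_mult)
    also have "\<dots> \<le> (2 * norm f) * \<bar>c h t * c k t\<bar>" using c[of f t] by (intro mult_right_mono) auto
    also have "\<dots> = norm f * (2 * \<bar>c h t * c k t\<bar>)" by simp
    also have "\<dots> \<le> q t" unfolding q_def using 1 by (intro mult_left_mono) auto
    finally show ?thesis .
  qed
  have intq: "integrable (gibbs \<pi> z) q" unfolding q_def using int2 by simp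
  have "\<bar>gibbs_cumulant3 z f h k\<bar> \<le> (\<integral>t. q t \<partial>gibbs \<pi> z)"
  proof -
    have "\<bar>gibbs_cumulant3 z f h k\<bar> \<le> (\<integral>t. \<bar>c f t * c h t * c k t\<bar> \<partial>gibbs \<pi> z)"
      unfolding gibbs_cumulant3_def gibbs_mean_def[of _ _ "\<lambda>t. (_ t - _) * _ t * _ t"] c_def
      using integral_abs_bound by (simp add: gibbs_mean_def)
    also have "\<dots> \<le> (\<integral>t. q t \<partial>gibbs \<pi> z)"
      by (intro integral_mono intq Bochner_Integration.integrable_bound[OF intq] pt)
        (use pt in \<open>auto intro!: AE_I2 simp: abs_mult intro: order_trans abs_ge_self\<close>)
    finally show ?thesis .
  qed
  also have "\<dots> = norm f * (norm k / norm h * gibbs_mean \<pi> z (\<lambda>t. (c h t)\<^sup>2) + norm h / norm k * gibbs_mean \<pi> z (\<lambda>t. (c k t)\<^sup>2))"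
    using int2 by (simp add: q_def gibbs_mean_def)
  also have "\<dots> \<le> norm f * (norm k / norm h * (norm h)\<^sup>2 + norm h / norm k * (norm k)\<^sup>2)"
    using h k by (intro mult_left_mono add_mono gibbs_var_le[of z, folded c_def]) (auto simp: c_def gibbs_var_le)
  also have "\<dots> = 2 * norm f * norm h * norm k"
    using h k by (simp add: power2_eq_square)
  finally show ?thesis .
qed

lemma abs_gibbs_mean_bcontfun_le:
  fixes v :: "'t \<Rightarrow>\<^sub>C real"
  shows "\<bar>gibbs_mean \<pi> z v\<bar> \<le> norm v"
  by (rule abs_gibbs_mean_le) (auto intro: abs_eval_le)

lemma integrable_gibbs_bcontfun: "integrable (gibbs \<pi> z) (apply_bcontfun (v :: 't \<Rightarrow>\<^sub>C real))"
  by (rule integrable_gibbs, measurable, rule abs_eval_le)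

lemma integrable_gibbs_bcontfun_mult:
  "integrable (gibbs \<pi> z) (\<lambda>t. apply_bcontfun (v :: 't \<Rightarrow>\<^sub>C real) t * apply_bcontfun (w :: 't \<Rightarrow>\<^sub>C real) t)"
  by (rule integrable_gibbs[where K="norm v * norm w"], measurable)
    (auto simp: abs_mult intro!: mult_mono abs_eval_le)

lemma bounded_linear_gibbs_mean: "bounded_linear (\<lambda>v :: 't \<Rightarrow>\<^sub>C real. gibbs_mean \<pi> z v)"
  using abs_gibbs_mean_bcontfun_le
  by (intro bounded_linear_intro[where K=1])
    (auto simp: gibbs_mean_def integrable_gibbs_bcontfun)

lemma abs_gibbs_cov_le:
  fixes h v :: "'t \<Rightarrow>\<^sub>C real"
  shows "\<bar>gibbs_cov \<pi> z h v\<bar> \<le> 2 * norm h * norm v"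
proof -
  have "\<bar>gibbs_mean \<pi> z (\<lambda>t. h t * v t)\<bar> \<le> norm h * norm v"
    by (rule abs_gibbs_mean_le, measurable) (auto simp: abs_mult intro!: mult_mono abs_eval_le)
  moreover have "\<bar>gibbs_mean \<pi> z h * gibbs_mean \<pi> z v\<bar> \<le> norm h * norm v"
    unfolding abs_mult by (intro mult_mono abs_gibbs_mean_bcontfun_le) auto
  ultimately show ?thesis unfolding gibbs_cov_def by linarith
qed

lemma bounded_bilinear_gibbs_cov:
  "bounded_bilinear (\<lambda>(h :: 't \<Rightarrow>\<^sub>C real) (v :: 't \<Rightarrow>\<^sub>C real). gibbs_cov \<pi> z h v)"
proof
  show "\<exists>K. \<forall>(a :: 't \<Rightarrow>\<^sub>C real) (b :: 't \<Rightarrow>\<^sub>C real). norm (gibbs_cov \<pi> z (apply_bcontfun a) (apply_bcontfun b)) \<le> norm a * norm b * K"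
    using abs_gibbs_cov_le by (intro exI[of _ 2]) (simp add: mult_ac)
qed (simp_all add: gibbs_cov_def gibbs_mean_def algebra_simps integrable_gibbs_bcontfun
      integrable_gibbs_bcontfun_mult)

lemma log_partition_lipschitz:
  fixes x y :: "'t \<Rightarrow>\<^sub>C real"
  shows "\<bar>log_partition \<pi> x - log_partition \<pi> y\<bar> \<le> norm (x - y)"
proof -
  have "log_partition \<pi> x \<le> log_partition \<pi> y + norm (x - y)" for x y :: "'t \<Rightarrow>\<^sub>C real"
  proof -
    have "(\<integral>t. exp (x t) \<partial>\<pi>) \<le> (\<integral>t. exp (norm (x - y)) * exp (y t) \<partial>\<pi>)"
    proof (intro integral_mono integrable_exp integrable_mult_right)
      fix t
      have "x t \<le> norm (x - y) + y t" using abs_eval_le[of "x - y" t] by simp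
      then show "exp (x t) \<le> exp (norm (x - y)) * exp (y t)" by (simp flip: exp_add)
    qed
    then have "ln (\<integral>t. exp (x t) \<partial>\<pi>) \<le> ln (exp (norm (x - y)) * (\<integral>t. exp (y t) \<partial>\<pi>))"
      using partition_pos[of x] by simp
    also have "\<dots> = norm (x - y) + ln (\<integral>t. exp (y t) \<partial>\<pi>)"
      using partition_pos[of y] by (simp add: ln_mult)
    finally show ?thesis by (simp add: log_partition_def)
  qed
  from this[of x y] this[of y x] show ?thesis by (simp add: norm_minus_commute abs_le_iff)
qed

lemma abs_log_partition_le: "\<bar>log_partition \<pi> x\<bar> \<le> norm x"
  using log_partition_lipschitz[of x 0] by (simp add: log_partition_def)

lemma segment_has_vector_derivative:
  "((\<lambda>r. w + r *\<^sub>R (h :: 't \<Rightarrow>\<^sub>C real)) has_vector_derivative h) (at r)"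
  by (auto intro!: derivative_eq_intros)

text \<open>The second derivative along the segment is a third cumulant; its bound \<open>2\<close> cancels the
  factor \<open>1 / 2\<close> in the remainder of Taylor's formula.\<close>

lemma gibbs_mean_taylor:
  fixes w h v :: "'t \<Rightarrow>\<^sub>C real"
  shows "\<bar>gibbs_mean \<pi> (w + h) v - gibbs_mean \<pi> w v - gibbs_cov \<pi> w h v\<bar> \<le> (norm h)\<^sup>2 * norm v"
proof -
  define z where "z r = w + r *\<^sub>R h" for r
  have z: "(z has_vector_derivative h) (at r)" for r
    unfolding z_def by (rule segment_has_vector_derivative)
  define d where "d n r = (if n = 0 then gibbs_mean \<pi> (z r) v else if n = 1 then gibbs_cov \<pi> (z r) v h
      else gibbs_cumulant3 (z r) v h h)" for n :: nat and r
  have "\<exists>t>0. t < 1 \<and> d 0 1 = (\<Sum>m<2. d m 0 / fact m * 1 ^ m) + d 2 t / fact 2 * 1\<^sup>2"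
  proof (rule Maclaurin)
    show "\<forall>m t. m < 2 \<and> 0 \<le> t \<and> t \<le> 1 \<longrightarrow> ((d m) has_real_derivative d (Suc m) t) (at t)"
    proof (intro allI impI)
      fix m :: nat and t :: real assume "m < 2 \<and> 0 \<le> t \<and> t \<le> 1"
      then consider "m = 0" | "m = 1" by linarith
      then show "((d m) has_real_derivative d (Suc m) t) (at t)"
      proof cases
        case 1
        then show ?thesis
          using gibbs_mean_has_real_derivative[OF z, of "apply_bcontfun v" "norm v"]
          by (simp add: d_def[abs_def] abs_eval_le)
      next
        case 2
        then show ?thesis
          using gibbs_cov_has_real_derivative[OF z] by (simp add: d_def[abs_def])
      qed
    qed
  qed auto
  then obtain t where "d 0 1 = (\<Sum>m<2. d m 0 / fact m * 1 ^ m) + d 2 t / fact 2 * 1\<^sup>2" by blast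
  then have "gibbs_mean \<pi> (w + h) v - gibbs_mean \<pi> w v - gibbs_cov \<pi> w v h = gibbs_cumulant3 (z t) v h h / 2"
    by (simp add: d_def z_def numeral_2_eq_2)
  moreover have "\<bar>gibbs_cumulant3 (z t) v h h / 2\<bar> \<le> (norm h)\<^sup>2 * norm v"
    using abs_gibbs_cumulant3_le[of "z t" v h h] by (simp add: power2_eq_square mult_ac)
  moreover have "gibbs_cov \<pi> w v h = gibbs_cov \<pi> w h v" by (simp add: gibbs_cov_def mult_ac)
  ultimately show ?thesis by simp
qed

lemma gibbs_cov_lipschitz:
  fixes w h f v :: "'t \<Rightarrow>\<^sub>C real"
  shows "\<bar>gibbs_cov \<pi> (w + h) f v - gibbs_cov \<pi> w f v\<bar> \<le> 2 * norm h * norm f * norm v"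
proof -
  define z where "z r = w + r *\<^sub>R h" for r
  have z: "(z has_vector_derivative h) (at r)" for r
    unfolding z_def by (rule segment_has_vector_derivative)
  obtain t where "gibbs_cov \<pi> (z 1) f v - gibbs_cov \<pi> (z 0) f v = (1 - 0) * gibbs_cumulant3 (z t) f v h"
    using MVT2[of 0 1 "\<lambda>r. gibbs_cov \<pi> (z r) f v" "\<lambda>t. gibbs_cumulant3 (z t) f v h"]
      gibbs_cov_has_real_derivative[OF z, of f v] by auto
  then show ?thesis
    using abs_gibbs_cumulant3_le[of "z t" f v h] by (simp add: z_def mult_ac)
qed

lemma measurable_gibbs_mean [measurable (raw)]:
  assumes [measurable]: "Z \<in> borel_measurable M"
    and F: "(\<lambda>(x, t). F x t) \<in> borel_measurable (M \<Otimes>\<^sub>M borel)"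
  shows "(\<lambda>x. gibbs_mean \<pi> (Z x) (F x)) \<in> borel_measurable M"
proof -
  have Fx: "F x \<in> borel_measurable borel" if "x \<in> space M" for x
    using measurable_Pair2[OF F that] by simp
  have "(\<lambda>x. gibbs_mean \<pi> (Z x) (F x)) \<in> borel_measurable M \<longleftrightarrow>
     (\<lambda>x. (\<integral>t. F x t * exp (Z x t) \<partial>\<pi>) / (\<integral>t. exp (Z x t) \<partial>\<pi>)) \<in> borel_measurable M"
    by (intro measurable_cong gibbs_mean_eq Fx)
  also have "\<dots>"
    using F by measurable
  finally show ?thesis .
qed

lemma measurable_gibbs_cov [measurable (raw)]:
  assumes [measurable]: "Z \<in> borel_measurable M"
    "H \<in> borel_measurable M" "V \<in> borel_measurable M"
  shows "(\<lambda>x. gibbs_cov \<pi> (Z x) (apply_bcontfun (H x)) (apply_bcontfun (V x))) \<in> borel_measurable M"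
  unfolding gibbs_cov_def by measurable

lemma measurable_log_partition [measurable (raw)]:
  assumes [measurable]: "Z \<in> borel_measurable M"
  shows "(\<lambda>x. log_partition \<pi> (Z x)) \<in> borel_measurable M"
  unfolding log_partition_def by measurable

text \<open>A product of two means is one integral over two independent samples. In this form the
  Gibbs covariance can be averaged over random \<open>h\<close> and \<open>v\<close>, which produces their covariance kernel.\<close>

lemma gibbs_cov_eq_pair_integral:
  fixes h v :: "'t \<Rightarrow>\<^sub>C real"
  shows "gibbs_cov \<pi> z h v = (\<integral>(s, t). h t * v t - h s * v t \<partial>(gibbs \<pi> z \<Otimes>\<^sub>M gibbs \<pi> z))"
proof -
  interpret G: prob_space "gibbs \<pi> z" by (rule prob_space_gibbs)
  interpret GG: pair_prob_space "gibbs \<pi> z" "gibbs \<pi> z" ..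
  have bnd: "\<bar>h s * v t\<bar> \<le> norm h * norm v" for s t
    unfolding abs_mult by (intro mult_mono abs_eval_le) auto
  have int1: "integrable (gibbs \<pi> z \<Otimes>\<^sub>M gibbs \<pi> z) (\<lambda>(s, t). h t * v t)"
    by (rule GG.integrable_const_bound[where B="norm h * norm v"]) (auto simp: bnd)
  have int2: "integrable (gibbs \<pi> z \<Otimes>\<^sub>M gibbs \<pi> z) (\<lambda>(s, t). h s * v t)"
    by (rule GG.integrable_const_bound[where B="norm h * norm v"]) (auto simp: bnd)
  have "(\<integral>(s, t). h t * v t - h s * v t \<partial>(gibbs \<pi> z \<Otimes>\<^sub>M gibbs \<pi> z)) =
    (\<integral>(s, t). h t * v t \<partial>(gibbs \<pi> z \<Otimes>\<^sub>M gibbs \<pi> z)) - (\<integral>(s, t). h s * v t \<partial>(gibbs \<pi> z \<Otimes>\<^sub>M gibbs \<pi> z))"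
    using Bochner_Integration.integral_diff[OF int1 int2] by (simp add: case_prod_beta')
  also have "(\<integral>(s, t). h t * v t \<partial>(gibbs \<pi> z \<Otimes>\<^sub>M gibbs \<pi> z)) = gibbs_mean \<pi> z (\<lambda>t. h t * v t)"
    using GG.integral_fst'[OF int1] by (simp add: gibbs_mean_def)
  also have "(\<integral>(s, t). h s * v t \<partial>(gibbs \<pi> z \<Otimes>\<^sub>M gibbs \<pi> z)) = gibbs_mean \<pi> z h * gibbs_mean \<pi> z v"
    using GG.integral_fst'[OF int2] by (simp add: gibbs_mean_def)
  finally show ?thesis by (simp add: gibbs_cov_def)
qed

end

section \<open>Approximate integration by parts\<close>

text \<open>The two random elements may have different types; below, a random function is independent
  of a pair of random functions.\<close>

definition indep_pair ::
  "'w measure \<Rightarrow> 'b measure \<Rightarrow> ('w \<Rightarrow> 'b) \<Rightarrow> 'c measure \<Rightarrow> ('w \<Rightarrow> 'c) \<Rightarrow> bool" where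
  "indep_pair M S X T Y \<longleftrightarrow> X \<in> measurable M S \<and> Y \<in> measurable M T \<and>
     distr M (S \<Otimes>\<^sub>M T) (\<lambda>\<omega>. (X \<omega>, Y \<omega>)) = distr M S X \<Otimes>\<^sub>M distr M T Y"

lemma (in prob_space) indep_pair_compose:
  assumes ind: "indep_pair M S X T Y" and f [measurable]: "f \<in> measurable S S'" and g [measurable]: "g \<in> measurable T T'"
  shows "indep_pair M S' (\<lambda>\<omega>. f (X \<omega>)) T' (\<lambda>\<omega>. g (Y \<omega>))"
proof -
  have X [measurable]: "X \<in> measurable M S" and Y [measurable]: "Y \<in> measurable M T"
    and eq: "distr M (S \<Otimes>\<^sub>M T) (\<lambda>\<omega>. (X \<omega>, Y \<omega>)) = distr M S X \<Otimes>\<^sub>M distr M T Y"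
    using ind by (auto simp: indep_pair_def)
  have "distr M (S' \<Otimes>\<^sub>M T') (\<lambda>\<omega>. (f (X \<omega>), g (Y \<omega>)))
    = distr (distr M (S \<Otimes>\<^sub>M T) (\<lambda>\<omega>. (X \<omega>, Y \<omega>))) (S' \<Otimes>\<^sub>M T') (\<lambda>(x, y). (f x, g y))"
    by (subst distr_distr) (auto simp: comp_def)
  also have "\<dots> = distr (distr M S X) S' f \<Otimes>\<^sub>M distr (distr M T Y) T' g"
    unfolding eq
    by (rule pair_measure_distr[symmetric])
      (auto intro!: prob_space_imp_sigma_finite prob_space.prob_space_distr prob_space_distr)
  also have "\<dots> = distr M S' (\<lambda>\<omega>. f (X \<omega>)) \<Otimes>\<^sub>M distr M T' (\<lambda>\<omega>. g (Y \<omega>))"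
    by (simp add: distr_distr comp_def)
  finally show ?thesis by (simp add: indep_pair_def)
qed

lemma (in prob_space) indep_pair_of_indep_vars:
  assumes ind: "indep_vars M' X I" and AB: "A \<inter> B = {}" "A \<subseteq> I" "B \<subseteq> I"
    and f: "f \<in> measurable (PiM A M') S" and g: "g \<in> measurable (PiM B M') T"
  shows "indep_pair M S (\<lambda>\<omega>. f (\<lambda>i\<in>A. X i \<omega>)) T (\<lambda>\<omega>. g (\<lambda>i\<in>B. X i \<omega>))"
  using indep_var_restrict[OF ind AB]
  by (intro indep_pair_compose[OF _ f g]) (simp add: indep_pair_def indep_var_distribution_eq)

text \<open>The joint law is the product law, so the two elements may be taken from two independent
  copies of the probability space.\<close>

lemma (in prob_space) indep_pair_integral:
  fixes f :: "'b \<times> 'c \<Rightarrow> real"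
  assumes ind: "indep_pair M S X T Y" and [measurable]: "f \<in> borel_measurable (S \<Otimes>\<^sub>M T)"
    and int: "integrable M (\<lambda>\<omega>. f (X \<omega>, Y \<omega>))"
  shows "integrable (M \<Otimes>\<^sub>M M) (\<lambda>(\<omega>, \<omega>'). f (X \<omega>, Y \<omega>'))"
    and "(\<integral>\<omega>. f (X \<omega>, Y \<omega>) \<partial>M) = (\<integral>\<omega>. (\<integral>\<omega>'. f (X \<omega>, Y \<omega>') \<partial>M) \<partial>M)"
proof -
  have X [measurable]: "X \<in> measurable M S" and Y [measurable]: "Y \<in> measurable M T"
    using ind by (auto simp: indep_pair_def)
  interpret MM: pair_prob_space M M ..
  have "distr (M \<Otimes>\<^sub>M M) (S \<Otimes>\<^sub>M T) (\<lambda>(\<omega>, \<omega>'). (X \<omega>, Y \<omega>')) = distr M S X \<Otimes>\<^sub>M distr M T Y"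
    by (rule pair_measure_distr[symmetric]) (auto intro!: prob_space_imp_sigma_finite prob_space_distr)
  also have "\<dots> = distr M (S \<Otimes>\<^sub>M T) (\<lambda>\<omega>. (X \<omega>, Y \<omega>))"
    using ind by (simp add: indep_pair_def)
  finally have eq: "distr (M \<Otimes>\<^sub>M M) (S \<Otimes>\<^sub>M T) (\<lambda>(\<omega>, \<omega>'). (X \<omega>, Y \<omega>')) = distr M (S \<Otimes>\<^sub>M T) (\<lambda>\<omega>. (X \<omega>, Y \<omega>))" .
  have "integrable (distr M (S \<Otimes>\<^sub>M T) (\<lambda>\<omega>. (X \<omega>, Y \<omega>))) f"
    using int by (simp add: integrable_distr_eq)
  then have "integrable (distr (M \<Otimes>\<^sub>M M) (S \<Otimes>\<^sub>M T) (\<lambda>(\<omega>, \<omega>'). (X \<omega>, Y \<omega>'))) f"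
    by (simp add: eq)
  then show int2: "integrable (M \<Otimes>\<^sub>M M) (\<lambda>(\<omega>, \<omega>'). f (X \<omega>, Y \<omega>'))"
    by (subst (asm) integrable_distr_eq) (auto simp: case_prod_beta')
  have "(\<integral>\<omega>. f (X \<omega>, Y \<omega>) \<partial>M) = integral\<^sup>L (distr M (S \<Otimes>\<^sub>M T) (\<lambda>\<omega>. (X \<omega>, Y \<omega>))) f"
    by (simp add: integral_distr)
  also have "\<dots> = integral\<^sup>L (distr (M \<Otimes>\<^sub>M M) (S \<Otimes>\<^sub>M T) (\<lambda>(\<omega>, \<omega>'). (X \<omega>, Y \<omega>'))) f"
    by (simp add: eq)
  also have "\<dots> = (\<integral>(\<omega>, \<omega>'). f (X \<omega>, Y \<omega>') \<partial>(M \<Otimes>\<^sub>M M))"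
    by (subst integral_distr) (auto simp: case_prod_beta')
  also have "\<dots> = (\<integral>\<omega>. (\<integral>\<omega>'. f (X \<omega>, Y \<omega>') \<partial>M) \<partial>M)"
    using MM.integral_fst'[OF int2] by simp
  finally show "(\<integral>\<omega>. f (X \<omega>, Y \<omega>) \<partial>M) = (\<integral>\<omega>. (\<integral>\<omega>'. f (X \<omega>, Y \<omega>') \<partial>M) \<partial>M)" .
qed

context base_measure
begin

text \<open>For centered \<open>h\<close> and \<open>v\<close> with cross covariance \<open>C\<close> this is the mean of \<open>C t t - C s t\<close> over
  two independent points \<open>s\<close>, \<open>t\<close> sampled from the Gibbs measure at \<open>z\<close>, the main term of an
  integration by parts formula.\<close>

definition avg_gibbs_cov ::
  "'w measure \<Rightarrow> ('w \<Rightarrow> 't \<Rightarrow>\<^sub>C real) \<Rightarrow> ('w \<Rightarrow> 't \<Rightarrow>\<^sub>C real) \<Rightarrow> ('t \<Rightarrow>\<^sub>C real) \<Rightarrow> real" where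
  "avg_gibbs_cov N h v z = (\<integral>\<omega>. gibbs_cov \<pi> z (h \<omega>) (v \<omega>) \<partial>N)"

lemma integrable_gibbs_cov:
  fixes h v :: "'w \<Rightarrow> 't \<Rightarrow>\<^sub>C real"
  assumes [measurable]: "z \<in> borel_measurable N" "h \<in> borel_measurable N" "v \<in> borel_measurable N"
    and int: "integrable N (\<lambda>\<omega>. norm (h \<omega>) * norm (v \<omega>))"
  shows "integrable N (\<lambda>\<omega>. gibbs_cov \<pi> (z \<omega>) (h \<omega>) (v \<omega>))"
  by (rule Bochner_Integration.integrable_bound[OF integrable_mult_right[OF int, of 2]])
    (use abs_gibbs_cov_le in \<open>auto simp: mult.assoc\<close>)

lemma abs_avg_gibbs_cov_le:
  assumes [measurable]: "h \<in> borel_measurable N" "v \<in> borel_measurable N"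
    and int: "integrable N (\<lambda>\<omega>. norm (h \<omega>) * norm (v \<omega>))"
  shows "\<bar>avg_gibbs_cov N h v z\<bar> \<le> 2 * (\<integral>\<omega>. norm (h \<omega>) * norm (v \<omega>) \<partial>N)"
proof -
  have "\<bar>avg_gibbs_cov N h v z\<bar> \<le> (\<integral>\<omega>. \<bar>gibbs_cov \<pi> z (h \<omega>) (v \<omega>)\<bar> \<partial>N)"
    unfolding avg_gibbs_cov_def by (rule integral_abs_bound)
  also have "\<dots> \<le> (\<integral>\<omega>. 2 * (norm (h \<omega>) * norm (v \<omega>)) \<partial>N)"
    using abs_gibbs_cov_le
    by (intro integral_mono integrable_abs integrable_gibbs_cov integrable_mult_right int) (auto simp: mult.assoc)
  finally show ?thesis by simp
qed

lemma avg_gibbs_cov_lipschitz: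
  assumes [measurable]: "h \<in> borel_measurable N" "v \<in> borel_measurable N"
    and int: "integrable N (\<lambda>\<omega>. norm (h \<omega>) * norm (v \<omega>))"
  shows "\<bar>avg_gibbs_cov N h v (z + k) - avg_gibbs_cov N h v z\<bar>
    \<le> 2 * norm k * (\<integral>\<omega>. norm (h \<omega>) * norm (v \<omega>) \<partial>N)"
proof -
  have "\<bar>avg_gibbs_cov N h v (z + k) - avg_gibbs_cov N h v z\<bar>
    = \<bar>\<integral>\<omega>. gibbs_cov \<pi> (z + k) (h \<omega>) (v \<omega>) - gibbs_cov \<pi> z (h \<omega>) (v \<omega>) \<partial>N\<bar>"
    unfolding avg_gibbs_cov_def
    by (subst Bochner_Integration.integral_diff) (auto intro!: integrable_gibbs_cov int)
  also have "\<dots> \<le> (\<integral>\<omega>. \<bar>gibbs_cov \<pi> (z + k) (h \<omega>) (v \<omega>) - gibbs_cov \<pi> z (h \<omega>) (v \<omega>)\<bar> \<partial>N)"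
    by (rule integral_abs_bound)
  also have "\<dots> \<le> (\<integral>\<omega>. 2 * norm k * (norm (h \<omega>) * norm (v \<omega>)) \<partial>N)"
    using gibbs_cov_lipschitz
    by (intro integral_mono integrable_abs Bochner_Integration.integrable_diff integrable_gibbs_cov
        integrable_mult_right int) (auto simp: mult.assoc)
  finally show ?thesis by simp
qed

lemma measurable_avg_gibbs_cov [measurable (raw)]:
  assumes "sigma_finite_measure N" and [measurable]: "h \<in> borel_measurable N" "v \<in> borel_measurable N"
    "z \<in> borel_measurable L"
  shows "(\<lambda>x. avg_gibbs_cov N h v (z x)) \<in> borel_measurable L"
proof -
  interpret sigma_finite_measure N by fact
  show ?thesis unfolding avg_gibbs_cov_def by measurable
qed

lemma integral_gibbs_mean_centered:
  fixes v :: "'w \<Rightarrow> 't \<Rightarrow>\<^sub>C real"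
  assumes int: "integrable N v" and v0: "(\<integral>\<omega>. v \<omega> \<partial>N) = 0"
  shows "(\<integral>\<omega>. gibbs_mean \<pi> z (v \<omega>) \<partial>N) = 0"
proof -
  have "(\<integral>\<omega>. gibbs_mean \<pi> z (v \<omega>) \<partial>N) = gibbs_mean \<pi> z (\<integral>\<omega>. v \<omega> \<partial>N)"
    using integral_bounded_linear[OF bounded_linear_gibbs_mean int] by simp
  then show ?thesis by (simp add: v0 gibbs_mean_const)
qed

lemma integrable_gibbs_mean:
  fixes v :: "'w \<Rightarrow> 't \<Rightarrow>\<^sub>C real"
  assumes [measurable]: "z \<in> borel_measurable N" "v \<in> borel_measurable N"
    and int: "integrable N (\<lambda>\<omega>. norm (v \<omega>))"
  shows "integrable N (\<lambda>\<omega>. gibbs_mean \<pi> (z \<omega>) (v \<omega>))"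
  by (rule Bochner_Integration.integrable_bound[OF int])
    (use abs_gibbs_mean_bcontfun_le in auto)

text \<open>The leave-one-out argument. The Gibbs mean of \<open>v\<close> is expanded around \<open>W\<close>, which is
  independent of \<open>(h, v)\<close>. The term of order zero has mean zero because \<open>v\<close> is centered. The linear
  term is a Gibbs covariance whose mean is, by independence, the mean of the averaged covariance at
  \<open>W\<close>. The first error is the Taylor remainder; the second one is the price of moving the averaged
  covariance from \<open>W\<close> back to \<open>W + h\<close>.\<close>

lemma approx_integration_by_parts_single:
  fixes W h v :: "'w \<Rightarrow> 't \<Rightarrow>\<^sub>C real"
  assumes N: "prob_space N"
    and ind: "indep_pair N borel W borel (\<lambda>\<omega>. (h \<omega>, v \<omega>))"
    and int: "integrable N (\<lambda>\<omega>. norm (h \<omega>))" "integrable N (\<lambda>\<omega>. norm (v \<omega>))"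
      "integrable N (\<lambda>\<omega>. norm (h \<omega>) * norm (v \<omega>))" "integrable N (\<lambda>\<omega>. (norm (h \<omega>))\<^sup>2 * norm (v \<omega>))"
    and v0: "(\<integral>\<omega>. v \<omega> \<partial>N) = 0"
  shows "\<bar>(\<integral>\<omega>. gibbs_mean \<pi> (W \<omega> + h \<omega>) (v \<omega>) \<partial>N) - (\<integral>\<omega>. avg_gibbs_cov N h v (W \<omega> + h \<omega>) \<partial>N)\<bar>
    \<le> (\<integral>\<omega>. (norm (h \<omega>))\<^sup>2 * norm (v \<omega>) \<partial>N)
      + 2 * (\<integral>\<omega>. norm (h \<omega>) \<partial>N) * (\<integral>\<omega>. norm (h \<omega>) * norm (v \<omega>) \<partial>N)"
proof -
  interpret N: prob_space N by fact
  have sf: "sigma_finite_measure N" ..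
  have W [measurable]: "W \<in> borel_measurable N" using ind by (simp add: indep_pair_def)
  have hv: "(\<lambda>\<omega>. (h \<omega>, v \<omega>)) \<in> borel_measurable N" using ind by (simp add: indep_pair_def)
  have h [measurable]: "h \<in> borel_measurable N" and v [measurable]: "v \<in> borel_measurable N"
    using measurable_compose[OF hv, of fst borel] measurable_compose[OF hv, of snd borel]
    by (simp_all add: borel_prod[symmetric])
  let ?C = "\<integral>\<omega>. norm (h \<omega>) * norm (v \<omega>) \<partial>N"
  have intv: "integrable N v"
    using integrable_norm_cancel[OF int(2) v] .
  note i1 = integrable_gibbs_mean[OF _ v int(2)]
  note i2 = integrable_gibbs_cov[OF _ h v int(3)]
  have i3: "integrable N (\<lambda>\<omega>. avg_gibbs_cov N h v (z \<omega>))" if [measurable]: "z \<in> borel_measurable N" for z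
    by (rule N.integrable_const_bound[where B="2 * ?C"])
      (use abs_avg_gibbs_cov_le[OF h v int(3)] sf in auto)
  have z0: "(\<integral>\<omega>. gibbs_mean \<pi> (W \<omega>) (v \<omega>) \<partial>N) = 0"
  proof -
    have "(\<integral>\<omega>. gibbs_mean \<pi> (W \<omega>) (v \<omega>) \<partial>N) = (\<integral>\<omega>. (\<integral>\<omega>'. gibbs_mean \<pi> (W \<omega>) (v \<omega>') \<partial>N) \<partial>N)"
      using N.indep_pair_integral(2)[OF ind, of "\<lambda>(w, h, v). gibbs_mean \<pi> w (apply_bcontfun v)"] i1
      by (simp add: borel_prod[symmetric] case_prod_beta')
    also have "\<dots> = 0" by (simp add: integral_gibbs_mean_centered[OF intv v0])
    finally show ?thesis .
  qed
  have z1: "(\<integral>\<omega>. gibbs_cov \<pi> (W \<omega>) (h \<omega>) (v \<omega>) \<partial>N) = (\<integral>\<omega>. avg_gibbs_cov N h v (W \<omega>) \<partial>N)"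
    using N.indep_pair_integral(2)[OF ind, of "\<lambda>(w, h, v). gibbs_cov \<pi> w (apply_bcontfun h) (apply_bcontfun v)"] i2
    by (simp add: borel_prod[symmetric] case_prod_beta' avg_gibbs_cov_def)
  have "\<bar>(\<integral>\<omega>. gibbs_mean \<pi> (W \<omega> + h \<omega>) (v \<omega>) \<partial>N) - (\<integral>\<omega>. gibbs_cov \<pi> (W \<omega>) (h \<omega>) (v \<omega>) \<partial>N)\<bar>
     = \<bar>\<integral>\<omega>. gibbs_mean \<pi> (W \<omega> + h \<omega>) (v \<omega>) - gibbs_mean \<pi> (W \<omega>) (v \<omega>) - gibbs_cov \<pi> (W \<omega>) (h \<omega>) (v \<omega>) \<partial>N\<bar>"
    using i1 i2 z0 by simp
  also have "\<dots> \<le> (\<integral>\<omega>. \<bar>gibbs_mean \<pi> (W \<omega> + h \<omega>) (v \<omega>) - gibbs_mean \<pi> (W \<omega>) (v \<omega>) - gibbs_cov \<pi> (W \<omega>) (h \<omega>) (v \<omega>)\<bar> \<partial>N)"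
    by (rule integral_abs_bound)
  also have "\<dots> \<le> (\<integral>\<omega>. (norm (h \<omega>))\<^sup>2 * norm (v \<omega>) \<partial>N)"
    using i1 i2 int(4) by (intro integral_mono integrable_abs Bochner_Integration.integrable_diff gibbs_mean_taylor) auto
  finally have b1: "\<bar>(\<integral>\<omega>. gibbs_mean \<pi> (W \<omega> + h \<omega>) (v \<omega>) \<partial>N) - (\<integral>\<omega>. avg_gibbs_cov N h v (W \<omega>) \<partial>N)\<bar>
    \<le> (\<integral>\<omega>. (norm (h \<omega>))\<^sup>2 * norm (v \<omega>) \<partial>N)" by (simp add: z1)
  have "\<bar>(\<integral>\<omega>. avg_gibbs_cov N h v (W \<omega> + h \<omega>) \<partial>N) - (\<integral>\<omega>. avg_gibbs_cov N h v (W \<omega>) \<partial>N)\<bar>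
      = \<bar>\<integral>\<omega>. avg_gibbs_cov N h v (W \<omega> + h \<omega>) - avg_gibbs_cov N h v (W \<omega>) \<partial>N\<bar>"
    using i3 by simp
  also have "\<dots> \<le> (\<integral>\<omega>. \<bar>avg_gibbs_cov N h v (W \<omega> + h \<omega>) - avg_gibbs_cov N h v (W \<omega>)\<bar> \<partial>N)"
    by (rule integral_abs_bound)
  also have "\<dots> \<le> (\<integral>\<omega>. 2 * norm (h \<omega>) * ?C \<partial>N)"
    using i3 int(1) avg_gibbs_cov_lipschitz[OF h v int(3)]
    by (intro integral_mono integrable_abs Bochner_Integration.integrable_diff) auto
  also have "\<dots> = 2 * (\<integral>\<omega>. norm (h \<omega>) \<partial>N) * ?C" by simp
  finally show ?thesis using b1 by linarith
qed

text \<open>The Gibbs covariance is bilinear, so it averages to zero over independent factors one of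
  which is centered.\<close>

lemma avg_gibbs_cov_indep:
  fixes h v :: "'w \<Rightarrow> 't \<Rightarrow>\<^sub>C real"
  assumes N: "prob_space N" and ind: "indep_pair N borel h borel v"
    and int: "integrable N h" "integrable N v" and v0: "(\<integral>\<omega>. v \<omega> \<partial>N) = 0"
  shows "integrable N (\<lambda>\<omega>. norm (h \<omega>) * norm (v \<omega>))" "avg_gibbs_cov N h v z = 0"
proof -
  interpret N: prob_space N by fact
  have h [measurable]: "h \<in> borel_measurable N" and v [measurable]: "v \<in> borel_measurable N"
    using int by auto
  have hv [measurable]: "(\<lambda>\<omega>. norm (h \<omega>)) \<in> borel_measurable N" "(\<lambda>\<omega>. norm (v \<omega>)) \<in> borel_measurable N"
    by auto
  have "indep_pair N borel (\<lambda>\<omega>. norm (h \<omega>)) borel (\<lambda>\<omega>. norm (v \<omega>))"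
    by (rule N.indep_pair_compose[OF ind]) auto
  then have "N.indep_var borel (\<lambda>\<omega>. norm (h \<omega>)) borel (\<lambda>\<omega>. norm (v \<omega>))"
    by (simp add: indep_pair_def N.indep_var_distribution_eq)
  then show i: "integrable N (\<lambda>\<omega>. norm (h \<omega>) * norm (v \<omega>))"
    using N.indep_var_integrable[of "\<lambda>\<omega>. norm (h \<omega>)" "\<lambda>\<omega>. norm (v \<omega>)"]
      integrable_norm[OF int(1)] integrable_norm[OF int(2)] by simp
  have *: "avg_gibbs_cov N h v z = (\<integral>\<omega>. (\<integral>\<omega>'. gibbs_cov \<pi> z (h \<omega>) (v \<omega>') \<partial>N) \<partial>N)"
    using N.indep_pair_integral(2)[OF ind, of "\<lambda>(h, v). gibbs_cov \<pi> z (apply_bcontfun h) (apply_bcontfun v)"]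
      integrable_gibbs_cov[OF _ h v i]
    by (simp add: avg_gibbs_cov_def case_prod_beta')
  have "(\<integral>\<omega>'. gibbs_cov \<pi> z k (v \<omega>') \<partial>N) = 0" for k :: "'t \<Rightarrow>\<^sub>C real"
  proof -
    have lin: "bounded_linear (\<lambda>v :: 't \<Rightarrow>\<^sub>C real. gibbs_cov \<pi> z k v)"
      by (rule bounded_bilinear.bounded_linear_right[OF bounded_bilinear_gibbs_cov])
    show ?thesis
      using integral_bounded_linear[OF lin int(2)] v0 linear_0[OF bounded_linear.linear[OF lin]] by simp
  qed
  then show "avg_gibbs_cov N h v z = 0" by (simp add: *)
qed

lemma indep_vars_pair_split:
  fixes X V :: "'i \<Rightarrow> 'w \<Rightarrow> 't \<Rightarrow>\<^sub>C real"
  assumes N: "prob_space N" and I: "finite I" "i \<in> I"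
    and ind: "prob_space.indep_vars N (\<lambda>_. borel) (\<lambda>i \<omega>. (X i \<omega>, V i \<omega>)) I"
  shows "indep_pair N borel (\<lambda>\<omega>. c + (\<Sum>j\<in>I - {i}. X j \<omega>)) borel (\<lambda>\<omega>. (X i \<omega>, V i \<omega>))"
    and "j \<in> I \<Longrightarrow> j \<noteq> i \<Longrightarrow> indep_pair N borel (X j) borel (V i)"
    and "indep_pair N borel (\<lambda>\<omega>. \<Sum>j\<in>I - {i}. V j \<omega>) borel (V i)"
proof -
  interpret N: prob_space N by fact
  show "indep_pair N borel (\<lambda>\<omega>. c + (\<Sum>j\<in>I - {i}. X j \<omega>)) borel (\<lambda>\<omega>. (X i \<omega>, V i \<omega>))"
    using N.indep_pair_of_indep_vars[OF ind, of "I - {i}" "{i}"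
        "\<lambda>x. c + (\<Sum>j\<in>I - {i}. fst (x j))" borel "\<lambda>x. x i" borel] I
    by (simp add: borel_prod[symmetric] cong: sum.cong_simp)
  show "indep_pair N borel (\<lambda>\<omega>. \<Sum>j\<in>I - {i}. V j \<omega>) borel (V i)"
    using N.indep_pair_of_indep_vars[OF ind, of "I - {i}" "{i}"
        "\<lambda>x. \<Sum>j\<in>I - {i}. snd (x j)" borel "\<lambda>x. snd (x i)" borel] I
    by (simp add: borel_prod[symmetric] cong: sum.cong_simp)
  assume j: "j \<in> I" "j \<noteq> i"
  show "indep_pair N borel (X j) borel (V i)"
    using N.indep_pair_of_indep_vars[OF ind, of "{j}" "{i}" "\<lambda>x. fst (x j)" borel "\<lambda>x. snd (x i)" borel] I j
    by (simp add: borel_prod[symmetric])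
qed

text \<open>Each summand in turn is left out: \<open>X i\<close> plays the role of \<open>h\<close>, and \<open>c\<close> plus the other
  summands that of \<open>W\<close>. The averaged covariances of the summands add up to that of the sums, since
  the cross terms vanish by independence.\<close>

lemma approx_integration_by_parts:
  fixes X V :: "'i \<Rightarrow> 'w \<Rightarrow> 't \<Rightarrow>\<^sub>C real"
  assumes N: "prob_space N" and I: "finite I"
    and ind: "prob_space.indep_vars N (\<lambda>_. borel) (\<lambda>i \<omega>. (X i \<omega>, V i \<omega>)) I"
    and int: "\<And>i. i \<in> I \<Longrightarrow> integrable N (X i)" "\<And>i. i \<in> I \<Longrightarrow> integrable N (V i)"
      "\<And>i. i \<in> I \<Longrightarrow> integrable N (\<lambda>\<omega>. norm (X i \<omega>) * norm (V i \<omega>))"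
      "\<And>i. i \<in> I \<Longrightarrow> integrable N (\<lambda>\<omega>. (norm (X i \<omega>))\<^sup>2 * norm (V i \<omega>))"
    and V0: "\<And>i. i \<in> I \<Longrightarrow> (\<integral>\<omega>. V i \<omega> \<partial>N) = 0"
  shows "integrable N (\<lambda>\<omega>. norm (\<Sum>i\<in>I. X i \<omega>) * norm (\<Sum>i\<in>I. V i \<omega>))" (is ?int)
    and "\<bar>(\<integral>\<omega>. gibbs_mean \<pi> (c + (\<Sum>i\<in>I. X i \<omega>)) (\<Sum>i\<in>I. V i \<omega>) \<partial>N)
      - (\<integral>\<omega>. avg_gibbs_cov N (\<lambda>\<omega>. \<Sum>i\<in>I. X i \<omega>) (\<lambda>\<omega>. \<Sum>i\<in>I. V i \<omega>) (c + (\<Sum>i\<in>I. X i \<omega>)) \<partial>N)\<bar>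
    \<le> (\<Sum>i\<in>I. (\<integral>\<omega>. (norm (X i \<omega>))\<^sup>2 * norm (V i \<omega>) \<partial>N)
      + 2 * (\<integral>\<omega>. norm (X i \<omega>) \<partial>N) * (\<integral>\<omega>. norm (X i \<omega>) * norm (V i \<omega>) \<partial>N))" (is ?bound)
proof -
  interpret N: prob_space N by fact
  have sf: "sigma_finite_measure N" ..
  have X: "X i \<in> borel_measurable N" and V: "V i \<in> borel_measurable N" if "i \<in> I" for i
    using int(1,2)[OF that] by auto
  let ?S = "\<lambda>\<omega>. \<Sum>i\<in>I. X i \<omega>" and ?U = "\<lambda>\<omega>. \<Sum>i\<in>I. V i \<omega>"
  have S [measurable]: "?S \<in> borel_measurable N" and U [measurable]: "?U \<in> borel_measurable N"
    using X V by auto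
  have ij: "integrable N (\<lambda>\<omega>. norm (X j \<omega>) * norm (V i \<omega>))" if "i \<in> I" "j \<in> I" for i j
  proof (cases "i = j")
    case True
    then show ?thesis using int(3) that by simp
  next
    case False
    then show ?thesis
      using that avg_gibbs_cov_indep(1)[OF N indep_vars_pair_split(2)[OF N I that(1) ind that(2)]] int V0 by simp
  qed
  show ?int
  proof (rule Bochner_Integration.integrable_bound)
    show "integrable N (\<lambda>\<omega>. \<Sum>j\<in>I. \<Sum>i\<in>I. norm (X j \<omega>) * norm (V i \<omega>))"
      by (intro Bochner_Integration.integrable_sum ij)
    have "norm (?S \<omega>) * norm (?U \<omega>) \<le> (\<Sum>j\<in>I. norm (X j \<omega>)) * (\<Sum>i\<in>I. norm (V i \<omega>))" for \<omega>
      by (intro mult_mono norm_sum sum_nonneg) auto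
    then have "norm (?S \<omega>) * norm (?U \<omega>) \<le> (\<Sum>j\<in>I. \<Sum>i\<in>I. norm (X j \<omega>) * norm (V i \<omega>))" for \<omega>
      by (simp add: sum_product)
    then show "AE \<omega> in N. norm (norm (?S \<omega>) * norm (?U \<omega>)) \<le> norm (\<Sum>j\<in>I. \<Sum>i\<in>I. norm (X j \<omega>) * norm (V i \<omega>))"
      by (auto simp: sum_nonneg)
  qed measurable
  have avg: "avg_gibbs_cov N ?S ?U z = (\<Sum>i\<in>I. avg_gibbs_cov N (X i) (V i) z)" for z
  proof -
    have "gibbs_cov \<pi> z (?S \<omega>) (?U \<omega>) = (\<Sum>j\<in>I. \<Sum>i\<in>I. gibbs_cov \<pi> z (X j \<omega>) (V i \<omega>))" for \<omega>
      unfolding bounded_bilinear.sum_left[OF bounded_bilinear_gibbs_cov]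
        bounded_bilinear.sum_right[OF bounded_bilinear_gibbs_cov] by (rule sum.swap)
    then have "avg_gibbs_cov N ?S ?U z = (\<Sum>j\<in>I. \<Sum>i\<in>I. avg_gibbs_cov N (X j) (V i) z)"
      unfolding avg_gibbs_cov_def
      by (simp add: Bochner_Integration.integral_sum integrable_gibbs_cov ij X V)
    also have "\<dots> = (\<Sum>j\<in>I. \<Sum>i\<in>I. if i = j then avg_gibbs_cov N (X i) (V i) z else 0)"
      using avg_gibbs_cov_indep(2)[OF N indep_vars_pair_split(2)[OF N I _ ind]] int V0
      by (intro sum.cong) auto
    also have "\<dots> = (\<Sum>i\<in>I. avg_gibbs_cov N (X i) (V i) z)"
      using I by simp
    finally show ?thesis .
  qed
  have split: "c + ?S \<omega> = (c + (\<Sum>j\<in>I - {i}. X j \<omega>)) + X i \<omega>" if "i \<in> I" for i \<omega>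
    using I that by (simp add: sum.remove[of I i])
  have i1: "integrable N (\<lambda>\<omega>. gibbs_mean \<pi> (c + ?S \<omega>) (V i \<omega>))" if "i \<in> I" for i
    using int(2)[OF that] V[OF that] by (intro integrable_gibbs_mean) auto
  have i2: "integrable N (\<lambda>\<omega>. avg_gibbs_cov N (X i) (V i) (c + ?S \<omega>))" if "i \<in> I" for i
    by (rule N.integrable_const_bound[where B="2 * (\<integral>\<omega>. norm (X i \<omega>) * norm (V i \<omega>) \<partial>N)"])
      (use abs_avg_gibbs_cov_le[OF X V int(3)] X V sf that in auto)
  have gm: "gibbs_mean \<pi> z (?U \<omega>) = (\<Sum>i\<in>I. gibbs_mean \<pi> z (V i \<omega>))" for z \<omega>
    using linear_sum[OF bounded_linear.linear[OF bounded_linear_gibbs_mean]] by simp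
  have "\<bar>(\<integral>\<omega>. gibbs_mean \<pi> (c + ?S \<omega>) (?U \<omega>) \<partial>N) - (\<integral>\<omega>. avg_gibbs_cov N ?S ?U (c + ?S \<omega>) \<partial>N)\<bar>
    = \<bar>\<Sum>i\<in>I. (\<integral>\<omega>. gibbs_mean \<pi> (c + ?S \<omega>) (V i \<omega>) \<partial>N) - (\<integral>\<omega>. avg_gibbs_cov N (X i) (V i) (c + ?S \<omega>) \<partial>N)\<bar>"
    unfolding gm avg using i1 i2 by (simp add: Bochner_Integration.integral_sum sum_subtractf)
  also have "\<dots> \<le> (\<Sum>i\<in>I. \<bar>(\<integral>\<omega>. gibbs_mean \<pi> (c + ?S \<omega>) (V i \<omega>) \<partial>N) - (\<integral>\<omega>. avg_gibbs_cov N (X i) (V i) (c + ?S \<omega>) \<partial>N)\<bar>)"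
    by (rule sum_abs)
  also have "\<dots> \<le> (\<Sum>i\<in>I. (\<integral>\<omega>. (norm (X i \<omega>))\<^sup>2 * norm (V i \<omega>) \<partial>N)
      + 2 * (\<integral>\<omega>. norm (X i \<omega>) \<partial>N) * (\<integral>\<omega>. norm (X i \<omega>) * norm (V i \<omega>) \<partial>N))"
  proof (rule sum_mono)
    fix i assume i: "i \<in> I"
    show "\<bar>(\<integral>\<omega>. gibbs_mean \<pi> (c + ?S \<omega>) (V i \<omega>) \<partial>N) - (\<integral>\<omega>. avg_gibbs_cov N (X i) (V i) (c + ?S \<omega>) \<partial>N)\<bar>
      \<le> (\<integral>\<omega>. (norm (X i \<omega>))\<^sup>2 * norm (V i \<omega>) \<partial>N)
      + 2 * (\<integral>\<omega>. norm (X i \<omega>) \<partial>N) * (\<integral>\<omega>. norm (X i \<omega>) * norm (V i \<omega>) \<partial>N)"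
      unfolding split[OF i] using i int V0
      by (intro approx_integration_by_parts_single[OF N indep_vars_pair_split(1)[OF N I i ind]]) auto
  qed
  finally show ?bound .
qed

end

section \<open>Third moments\<close>

lemma amgm3:
  fixes a b c :: real
  assumes "a \<ge> 0" "b \<ge> 0" "c \<ge> 0"
  shows "a * b * c \<le> (a ^ 3 + b ^ 3 + c ^ 3) / 3"
proof -
  have "a ^ 3 + b ^ 3 + c ^ 3 - 3 * (a * b * c) = (a + b + c) * ((a - b)\<^sup>2 + (b - c)\<^sup>2 + (c - a)\<^sup>2) / 2"
    by (simp add: power2_eq_square power3_eq_cube algebra_simps)
  also have "\<dots> \<ge> 0" using assms by simp
  finally show ?thesis by simp
qed

text \<open>If the three third moments are scaled to one, this is the inequality of arithmetic and
  geometric means under the integral sign.\<close>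

lemma (in prob_space) holder3:
  assumes [measurable]: "f \<in> borel_measurable M" "g \<in> borel_measurable M" "h \<in> borel_measurable M"
    and pos: "\<And>x. f x \<ge> 0" "\<And>x. g x \<ge> 0" "\<And>x. h x \<ge> (0 :: real)"
    and int: "integrable M (\<lambda>x. f x ^ 3)" "integrable M (\<lambda>x. g x ^ 3)" "integrable M (\<lambda>x. h x ^ 3)"
  shows "integrable M (\<lambda>x. f x * g x * h x)"
    and "expectation (\<lambda>x. f x * g x * h x)
      \<le> root 3 (expectation (\<lambda>x. f x ^ 3)) * root 3 (expectation (\<lambda>x. g x ^ 3)) * root 3 (expectation (\<lambda>x. h x ^ 3))"
proof -
  show int': "integrable M (\<lambda>x. f x * g x * h x)"
  proof (rule Bochner_Integration.integrable_bound)
    show "integrable M (\<lambda>x. (f x ^ 3 + g x ^ 3 + h x ^ 3) / 3)" using int by simp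
    show "AE x in M. norm (f x * g x * h x) \<le> norm ((f x ^ 3 + g x ^ 3 + h x ^ 3) / 3)"
      using amgm3 pos by (auto simp: abs_mult)
  qed measurable
  define A B C where "A = root 3 (expectation (\<lambda>x. f x ^ 3))" and "B = root 3 (expectation (\<lambda>x. g x ^ 3))"
    and "C = root 3 (expectation (\<lambda>x. h x ^ 3))"
  have cube: "A ^ 3 = expectation (\<lambda>x. f x ^ 3)" "B ^ 3 = expectation (\<lambda>x. g x ^ 3)" "C ^ 3 = expectation (\<lambda>x. h x ^ 3)"
    by (simp_all add: A_def B_def C_def odd_real_root_pow)
  have nn: "A \<ge> 0" "B \<ge> 0" "C \<ge> 0"
    using pos by (auto simp: A_def B_def C_def intro!: integral_nonneg_AE)
  show "expectation (\<lambda>x. f x * g x * h x) \<le> A * B * C"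
  proof (cases "A > 0 \<and> B > 0 \<and> C > 0")
    case True
    then have pos': "A > 0" "B > 0" "C > 0" by auto
    have "f x * g x * h x \<le> A * B * C * ((f x ^ 3 / A ^ 3 + g x ^ 3 / B ^ 3 + h x ^ 3 / C ^ 3) / 3)" for x
    proof -
      have "(f x / A) * (g x / B) * (h x / C) \<le> ((f x / A) ^ 3 + (g x / B) ^ 3 + (h x / C) ^ 3) / 3"
        using pos pos' by (intro amgm3) auto
      from mult_left_mono[OF this, of "A * B * C"] pos' show ?thesis by (simp add: power_divide)
    qed
    then have "expectation (\<lambda>x. f x * g x * h x) \<le> expectation (\<lambda>x. A * B * C * ((f x ^ 3 / A ^ 3 + g x ^ 3 / B ^ 3 + h x ^ 3 / C ^ 3) / 3))"
      using int by (intro integral_mono int') auto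
    also have "\<dots> = A * B * C" using int pos' by (simp flip: cube)
    finally show ?thesis .
  next
    case False
    then have "expectation (\<lambda>x. f x ^ 3) = 0 \<or> expectation (\<lambda>x. g x ^ 3) = 0 \<or> expectation (\<lambda>x. h x ^ 3) = 0"
      using nn by (auto simp flip: cube)
    then have "AE x in M. f x * g x * h x = 0"
      using pos integral_nonneg_eq_0_iff_AE[OF int(1)] integral_nonneg_eq_0_iff_AE[OF int(2)]
        integral_nonneg_eq_0_iff_AE[OF int(3)] by auto
    then have "expectation (\<lambda>x. f x * g x * h x) = expectation (\<lambda>x. 0)"
      by (intro integral_cong_AE) auto
    then show ?thesis using nn by simp
  qed
qed

lemma root3_power2_eq_powr: "x \<ge> 0 \<Longrightarrow> (root 3 x)\<^sup>2 = x powr (2 / 3)"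
  and root3_eq_powr: "x \<ge> 0 \<Longrightarrow> root 3 x = x powr (1 / 3)"
proof -
  show *: "root 3 x = x powr (1 / 3)" if "x \<ge> 0" for x using that
    by (cases "x = 0") (auto simp: root_powr_inverse)
  show "(root 3 x)\<^sup>2 = x powr (2 / 3)" if "x \<ge> 0" for x using that
    by (cases "x = 0") (auto simp: * powr_powr simp flip: powr_realpow)
qed

text \<open>The two error terms of the leave-one-out argument have the same bound: Hoelder's inequality
  for three factors is applied with constant factors where one is missing. Together they give the
  factor \<open>1 + 2 = 3\<close>.\<close>

lemma (in prob_space) moment_error_le:
  assumes [measurable]: "x \<in> borel_measurable M" "y \<in> borel_measurable M"
    and pos: "\<And>\<omega>. x \<omega> \<ge> 0" "\<And>\<omega>. y \<omega> \<ge> (0 :: real)"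
    and int: "integrable M (\<lambda>\<omega>. x \<omega> ^ 3)" "integrable M (\<lambda>\<omega>. y \<omega> ^ 3)"
  shows "integrable M x" "integrable M (\<lambda>\<omega>. x \<omega> * y \<omega>)" "integrable M (\<lambda>\<omega>. (x \<omega>)\<^sup>2 * y \<omega>)"
    and "expectation (\<lambda>\<omega>. (x \<omega>)\<^sup>2 * y \<omega>) + 2 * expectation x * expectation (\<lambda>\<omega>. x \<omega> * y \<omega>)
      \<le> 3 * (expectation (\<lambda>\<omega>. x \<omega> ^ 3) powr (2 / 3) * expectation (\<lambda>\<omega>. y \<omega> ^ 3) powr (1 / 3))"
proof -
  define A B where "A = root 3 (expectation (\<lambda>x'. x x' ^ 3))" and "B = root 3 (expectation (\<lambda>x. y x ^ 3))"
  have nn: "A \<ge> 0" "B \<ge> 0" "expectation (\<lambda>x'. x x' ^ 3) \<ge> 0" "expectation (\<lambda>x. y x ^ 3) \<ge> 0"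
    using pos by (auto simp: A_def B_def intro!: integral_nonneg_AE)
  show i1: "integrable M x"
    using holder3(1)[of x "\<lambda>_. 1" "\<lambda>_. 1"] pos int by simp
  show i2: "integrable M (\<lambda>\<omega>. x \<omega> * y \<omega>)"
    using holder3(1)[of x y "\<lambda>_. 1"] pos int by simp
  show i3: "integrable M (\<lambda>\<omega>. (x \<omega>)\<^sup>2 * y \<omega>)"
    using holder3(1)[of x x y] pos int by (simp add: power2_eq_square)
  have "expectation (\<lambda>\<omega>. (x \<omega>)\<^sup>2 * y \<omega>) \<le> A\<^sup>2 * B"
    using holder3(2)[of x x y] pos int by (simp add: power2_eq_square A_def B_def)
  moreover have "expectation x \<le> A"
    using holder3(2)[of x "\<lambda>_. 1" "\<lambda>_. 1"] pos int by (simp add: A_def prob_space)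
  moreover have "expectation (\<lambda>\<omega>. x \<omega> * y \<omega>) \<le> A * B"
    using holder3(2)[of x y "\<lambda>_. 1"] pos int by (simp add: A_def B_def prob_space)
  moreover have "expectation (\<lambda>\<omega>. x \<omega> * y \<omega>) \<ge> 0"
    using pos by (auto intro!: integral_nonneg_AE)
  ultimately have "expectation x * expectation (\<lambda>\<omega>. x \<omega> * y \<omega>) \<le> A * (A * B)"
    using nn by (intro mult_mono) auto
  with \<open>expectation (\<lambda>\<omega>. (x \<omega>)\<^sup>2 * y \<omega>) \<le> A\<^sup>2 * B\<close>
  have "expectation (\<lambda>\<omega>. (x \<omega>)\<^sup>2 * y \<omega>) + 2 * expectation x * expectation (\<lambda>\<omega>. x \<omega> * y \<omega>) \<le> 3 * (A\<^sup>2 * B)"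
    by (simp add: power2_eq_square)
  then show "expectation (\<lambda>\<omega>. (x \<omega>)\<^sup>2 * y \<omega>) + 2 * expectation x * expectation (\<lambda>\<omega>. x \<omega> * y \<omega>)
      \<le> 3 * (expectation (\<lambda>\<omega>. x \<omega> ^ 3) powr (2 / 3) * expectation (\<lambda>\<omega>. y \<omega> ^ 3) powr (1 / 3))"
    unfolding A_def B_def root3_power2_eq_powr[OF nn(3)] root3_eq_powr[OF nn(4)] .
qed

lemma sup_norm_bcontfun:
  fixes z :: "'t::topological_space \<Rightarrow>\<^sub>C real"
  shows "sup_norm (apply_bcontfun z) = ennreal (norm z)"
proof (rule antisym)
  show "sup_norm (apply_bcontfun z) \<le> ennreal (norm z)"
    unfolding sup_norm_def by (intro SUP_least ennreal_leI abs_eval_le)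
  then have fin: "sup_norm (apply_bcontfun z) < \<infinity>" by (rule le_less_trans) simp
  have "norm z \<le> enn2real (sup_norm (apply_bcontfun z))"
  proof (rule norm_bound)
    fix t
    have "ennreal \<bar>z t\<bar> \<le> sup_norm (apply_bcontfun z)"
      unfolding sup_norm_def by (rule SUP_upper) simp
    from enn2real_mono[OF this] fin
    show "norm (z t) \<le> enn2real (sup_norm (apply_bcontfun z))" by (simp add: less_top)
  qed
  then have "ennreal (norm z) \<le> ennreal (enn2real (sup_norm (apply_bcontfun z)))" by (rule ennreal_leI)
  also have "\<dots> = sup_norm (apply_bcontfun z)" using fin by (intro ennreal_enn2real) simp
  finally show "ennreal (norm z) \<le> sup_norm (apply_bcontfun z)" .
qed

lemma abs_le_enn2real_sup_norm:
  assumes "sup_norm f < \<infinity>"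
  shows "\<bar>f t\<bar> \<le> enn2real (sup_norm f)"
proof -
  have "ennreal \<bar>f t\<bar> \<le> sup_norm f" unfolding sup_norm_def by (rule SUP_upper) simp
  from enn2real_mono[OF this] assms show ?thesis by (simp add: less_top)
qed

lemma abs_le_enn2real_sup_norm2:
  assumes "sup_norm2 f < \<infinity>"
  shows "\<bar>f s t\<bar> \<le> enn2real (sup_norm2 f)"
proof -
  have "ennreal \<bar>f s t\<bar> \<le> sup_norm2 f"
    unfolding sup_norm2_def by (rule SUP_upper2[of "(s, t)"]) auto
  from enn2real_mono[OF this] assms show ?thesis by (simp add: less_top)
qed

lemma mean_fun_eq:
  fixes Z :: "'w \<Rightarrow> 't::compact_metric_space \<Rightarrow>\<^sub>C real"
  assumes "integrable P Z"
  shows "mean_fun P Z = apply_bcontfun (\<integral>\<omega>. Z \<omega> \<partial>P)"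
  using integral_bounded_linear[OF bounded_linear_eval assms] by (simp add: mean_fun_def fun_eq_iff)

lemma cube_add_le:
  fixes a b :: real
  assumes "a \<ge> 0" "b \<ge> 0"
  shows "(a + b) ^ 3 \<le> 8 * a ^ 3 + 8 * b ^ 3"
proof -
  have "(a + b) ^ 3 \<le> (2 * max a b) ^ 3" using assms by (intro power_mono) auto
  also have "\<dots> \<le> 8 * a ^ 3 + 8 * b ^ 3" using assms by (simp add: power_mult_distrib max_def)
  finally show ?thesis .
qed

text \<open>A mean function is a value of the Bochner integral and would be zero where the integral
  does not exist, so integrability has to be derived from the finite moment itself. Subtracting a
  fixed sample path instead of the mean function removes the latter from the argument. The sup norm
  in the hypothesis is first restricted to a countable dense set, which makes it measurable.\<close>

lemma (in prob_space) third_moment_of_centered_moment3: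
  fixes Z :: "'a \<Rightarrow> 't::compact_metric_space \<Rightarrow>\<^sub>C real"
  assumes [measurable]: "Z \<in> borel_measurable M" and fin: "centered_moment3 M Z < \<infinity>"
  shows "integrable M (\<lambda>\<omega>. norm (Z \<omega>) ^ 3)"
proof -
  define m where "m = mean_fun M Z"
  obtain D :: "'t set" where D: "countable D" "\<And>U. open U \<Longrightarrow> U \<noteq> {} \<Longrightarrow> \<exists>d\<in>D. d \<in> U"
    using countable_dense_setE by blast
  define S where "S \<omega> = (SUP t\<in>D. ennreal \<bar>Z \<omega> t - m t\<bar>)" for \<omega>
  have [measurable]: "(\<lambda>\<omega>. Z \<omega> t) \<in> borel_measurable M" for t by measurable
  have Sm [measurable]: "S \<in> borel_measurable M"
    unfolding S_def using D(1) by measurable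
  have "(\<integral>\<^sup>+\<omega>. S \<omega> ^ 3 \<partial>M) \<le> centered_moment3 M Z"
    unfolding centered_moment3_def S_def sup_norm_def m_def
    by (intro nn_integral_mono power_mono SUP_subset_mono) auto
  then have fin3: "(\<integral>\<^sup>+\<omega>. S \<omega> ^ 3 \<partial>M) < \<infinity>" using fin by (rule le_less_trans)
  then have "AE \<omega> in M. S \<omega> ^ 3 \<noteq> \<infinity>" by (intro nn_integral_noteq_infinite) auto
  then have AE: "AE \<omega> in M. S \<omega> < \<infinity>" by eventually_elim (auto simp: less_top power_eq_top_ennreal)
  have "\<exists>\<omega>\<in>space M. S \<omega> < \<infinity>"
  proof (rule ccontr)
    assume "\<not> ?thesis"
    then have "AE \<omega> in M. False" using AE by (auto elim!: AE_mp)
    then show False by simp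
  qed
  then obtain \<omega>0 where \<omega>0: "S \<omega>0 < \<infinity>" by blast
  define f where "f \<omega> = enn2real (S \<omega>)" for \<omega>
  define b where "b = f \<omega>0 + norm (Z \<omega>0)"
  have b: "b \<ge> 0" by (simp add: b_def f_def)
  have bound: "norm (Z \<omega>) \<le> f \<omega> + b" if "S \<omega> < \<infinity>" for \<omega>
  proof -
    have pt: "\<bar>Z \<omega> t - m t\<bar> \<le> f \<omega>" if "S \<omega> < \<infinity>" "t \<in> D" for \<omega> t
    proof -
      have "ennreal \<bar>Z \<omega> t - m t\<bar> \<le> S \<omega>" unfolding S_def by (rule SUP_upper[OF that(2)])
      from enn2real_mono[OF this] that(1) show ?thesis by (simp add: f_def less_top)
    qed
    have "\<forall>t\<in>D. \<bar>(Z \<omega> - Z \<omega>0) t\<bar> \<le> f \<omega> + f \<omega>0"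
    proof (intro ballI)
      fix t assume "t \<in> D"
      then show "\<bar>(Z \<omega> - Z \<omega>0) t\<bar> \<le> f \<omega> + f \<omega>0"
        using pt[OF that, of t] pt[OF \<omega>0, of t] by simp
    qed
    then have "norm (Z \<omega> - Z \<omega>0) \<le> f \<omega> + f \<omega>0"
      using norm_le_iff_dense[OF D(2)] by blast
    then show ?thesis using norm_triangle_sub[of "Z \<omega>" "Z \<omega>0"] by (simp add: b_def)
  qed
  have f3: "integrable M (\<lambda>\<omega>. f \<omega> ^ 3)"
  proof (rule integrableI_bounded)
    have "(\<integral>\<^sup>+\<omega>. ennreal (norm (f \<omega> ^ 3)) \<partial>M) = (\<integral>\<^sup>+\<omega>. S \<omega> ^ 3 \<partial>M)"
      using AE by (intro nn_integral_cong_AE) (auto simp: f_def less_top ennreal_power[symmetric])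
    then show "(\<integral>\<^sup>+\<omega>. ennreal (norm (f \<omega> ^ 3)) \<partial>M) < \<infinity>" using fin3 by simp
  qed (simp add: f_def)
  show ?thesis
  proof (rule Bochner_Integration.integrable_bound)
    show "integrable M (\<lambda>\<omega>. 8 * f \<omega> ^ 3 + 8 * b ^ 3)" using f3 by simp
    show "AE \<omega> in M. norm (norm (Z \<omega>) ^ 3) \<le> norm (8 * f \<omega> ^ 3 + 8 * b ^ 3)"
      using AE
    proof eventually_elim
      fix \<omega> assume "S \<omega> < \<infinity>"
      then have "norm (Z \<omega>) ^ 3 \<le> (f \<omega> + b) ^ 3" by (intro power_mono bound) auto
      also have "\<dots> \<le> 8 * f \<omega> ^ 3 + 8 * b ^ 3" using b by (intro cube_add_le) (auto simp: f_def)
      finally show "norm (norm (Z \<omega>) ^ 3) \<le> norm (8 * f \<omega> ^ 3 + 8 * b ^ 3)" by simp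
    qed
  qed measurable
qed

lemma (in prob_space) third_moment_centered:
  fixes Z :: "'a \<Rightarrow> 't::compact_metric_space \<Rightarrow>\<^sub>C real"
  assumes [measurable]: "Z \<in> borel_measurable M" and Z3: "integrable M (\<lambda>\<omega>. norm (Z \<omega>) ^ 3)"
  shows "integrable M Z" "integrable M (\<lambda>\<omega>. norm (Z \<omega> - c) ^ 3)"
    and "centered_moment3 M Z = ennreal (\<integral>\<omega>. norm (Z \<omega> - (\<integral>\<omega>. Z \<omega> \<partial>M)) ^ 3 \<partial>M)"
proof -
  have "integrable M (\<lambda>\<omega>. norm (Z \<omega>))"
    using moment_error_le(1)[of "\<lambda>\<omega>. norm (Z \<omega>)" "\<lambda>\<omega>. norm (Z \<omega>)"] Z3 by auto
  from integrable_norm_cancel[OF this] show iZ: "integrable M Z" by simp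
  show c3: "integrable M (\<lambda>\<omega>. norm (Z \<omega> - c) ^ 3)" for c
  proof (rule Bochner_Integration.integrable_bound)
    show "integrable M (\<lambda>\<omega>. 8 * norm (Z \<omega>) ^ 3 + 8 * norm c ^ 3)" using Z3 by simp
    have "norm (Z \<omega> - c) ^ 3 \<le> 8 * norm (Z \<omega>) ^ 3 + 8 * norm c ^ 3" for \<omega>
      by (rule order_trans[OF power_mono[OF norm_triangle_ineq4] cube_add_le]) auto
    then show "AE \<omega> in M. norm (norm (Z \<omega> - c) ^ 3) \<le> norm (8 * norm (Z \<omega>) ^ 3 + 8 * norm c ^ 3)"
      by (auto intro: order_trans[OF _ abs_ge_self])
  qed measurable
  have "sup_norm (\<lambda>t. Z \<omega> t - mean_fun M Z t) = ennreal (norm (Z \<omega> - (\<integral>\<omega>. Z \<omega> \<partial>M)))" for \<omega>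
    using sup_norm_bcontfun[of "Z \<omega> - (\<integral>\<omega>. Z \<omega> \<partial>M)"] by (simp add: mean_fun_eq[OF iZ])
  then have "centered_moment3 M Z = (\<integral>\<^sup>+\<omega>. ennreal (norm (Z \<omega> - (\<integral>\<omega>. Z \<omega> \<partial>M)) ^ 3) \<partial>M)"
    by (simp add: centered_moment3_def ennreal_power)
  also have "\<dots> = ennreal (\<integral>\<omega>. norm (Z \<omega> - (\<integral>\<omega>. Z \<omega> \<partial>M)) ^ 3 \<partial>M)"
    by (intro nn_integral_eq_integral c3) auto
  finally show "centered_moment3 M Z = ennreal (\<integral>\<omega>. norm (Z \<omega> - (\<integral>\<omega>. Z \<omega> \<partial>M)) ^ 3 \<partial>M)" .
qed

section \<open>The Lindeberg comparison\<close>

text \<open>Domination is required along one sequence of steps only. A bound valid for all steps of an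
  interval would involve an uncountable supremum, which need not be measurable.\<close>

lemma integral_quotient_tendsto:
  fixes f :: "real \<Rightarrow> 'w \<Rightarrow> real"
  assumes x: "x \<longlonglongrightarrow> 0" "\<And>n. x n \<noteq> 0"
    and int: "integrable N (f a)" "\<And>n. integrable N (f (a + x n))" "integrable N g"
    and der: "\<And>\<omega>. \<omega> \<in> space N \<Longrightarrow> ((\<lambda>b. f b \<omega>) has_real_derivative f' \<omega>) (at a)"
    and bound: "AE \<omega> in N. \<forall>n. \<bar>f (a + x n) \<omega> - f a \<omega>\<bar> \<le> g \<omega> * \<bar>x n\<bar>"
    and [measurable]: "f' \<in> borel_measurable N"
  shows "(\<lambda>n. ((\<integral>\<omega>. f (a + x n) \<omega> \<partial>N) - (\<integral>\<omega>. f a \<omega> \<partial>N)) / x n) \<longlonglongrightarrow> (\<integral>\<omega>. f' \<omega> \<partial>N)"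
proof -
  have [measurable]: "f a \<in> borel_measurable N" "\<And>n. f (a + x n) \<in> borel_measurable N" using int by auto
  have "(\<lambda>n. (\<integral>\<omega>. (f (a + x n) \<omega> - f a \<omega>) / x n \<partial>N)) \<longlonglongrightarrow> (\<integral>\<omega>. f' \<omega> \<partial>N)"
  proof (rule integral_dominated_convergence[OF _ _ int(3)])
    show "AE \<omega> in N. (\<lambda>n. (f (a + x n) \<omega> - f a \<omega>) / x n) \<longlonglongrightarrow> f' \<omega>"
    proof (rule AE_I2)
      fix \<omega> assume "\<omega> \<in> space N"
      from der[OF this] have "((\<lambda>h. (f (a + h) \<omega> - f a \<omega>) / h) \<longlongrightarrow> f' \<omega>) (at 0)"
        by (simp add: DERIV_def)
      then show "(\<lambda>n. (f (a + x n) \<omega> - f a \<omega>) / x n) \<longlonglongrightarrow> f' \<omega>"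
        using x by (auto simp flip: LIMSEQ_SEQ_conv)
    qed
    show "AE \<omega> in N. norm ((f (a + x n) \<omega> - f a \<omega>) / x n) \<le> g \<omega>" for n
      using bound x(2)[of n] by (auto simp: divide_le_eq)
  qed measurable
  also have "(\<lambda>n. (\<integral>\<omega>. (f (a + x n) \<omega> - f a \<omega>) / x n \<partial>N)) = (\<lambda>n. ((\<integral>\<omega>. f (a + x n) \<omega> \<partial>N) - (\<integral>\<omega>. f a \<omega> \<partial>N)) / x n)"
    using int by simp
  finally show ?thesis .
qed

lemma has_real_derivative_integral:
  fixes f :: "real \<Rightarrow> 'w \<Rightarrow> real"
  assumes int: "\<And>b. integrable N (f b)" "integrable N g"
    and der: "\<And>\<omega>. \<omega> \<in> space N \<Longrightarrow> ((\<lambda>b. f b \<omega>) has_real_derivative f' \<omega>) (at a)"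
    and bound: "\<And>b \<omega>. \<omega> \<in> space N \<Longrightarrow> \<bar>f b \<omega> - f a \<omega>\<bar> \<le> g \<omega> * \<bar>b - a\<bar>"
    and meas: "f' \<in> borel_measurable N"
  shows "((\<lambda>b. \<integral>\<omega>. f b \<omega> \<partial>N) has_real_derivative (\<integral>\<omega>. f' \<omega> \<partial>N)) (at a)"
  unfolding DERIV_def LIMSEQ_SEQ_conv[symmetric]
proof (intro allI impI)
  fix S :: "nat \<Rightarrow> real" assume S: "(\<forall>n. S n \<noteq> 0) \<and> S \<longlonglongrightarrow> 0"
  have "AE \<omega> in N. \<forall>n. \<bar>f (a + S n) \<omega> - f a \<omega>\<bar> \<le> g \<omega> * \<bar>S n\<bar>"
    using bound[of _ "a + S _"] by (intro AE_I2) auto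
  then show "(\<lambda>n. ((\<integral>\<omega>. f (a + S n) \<omega> \<partial>N) - (\<integral>\<omega>. f a \<omega> \<partial>N)) / S n) \<longlonglongrightarrow> (\<integral>\<omega>. f' \<omega> \<partial>N)"
    using S int by (intro integral_quotient_tendsto[where g=g] der meas) auto
qed

context base_measure
begin

lemma avg_gibbs_cov_eq_pair_integral:
  fixes h v :: "'w \<Rightarrow> 't \<Rightarrow>\<^sub>C real"
  assumes N: "prob_space N" and [measurable]: "h \<in> borel_measurable N" "v \<in> borel_measurable N"
    and int: "integrable N (\<lambda>\<omega>. norm (h \<omega>) * norm (v \<omega>))"
  shows "avg_gibbs_cov N h v z = (\<integral>(s, t). (\<integral>\<omega>. h \<omega> t * v \<omega> t \<partial>N) - (\<integral>\<omega>. h \<omega> s * v \<omega> t \<partial>N)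
      \<partial>(gibbs \<pi> z \<Otimes>\<^sub>M gibbs \<pi> z))"
proof -
  interpret N: prob_space N by fact
  interpret G: prob_space "gibbs \<pi> z" by (rule prob_space_gibbs)
  let ?G = "gibbs \<pi> z \<Otimes>\<^sub>M gibbs \<pi> z"
  interpret GG: pair_prob_space "gibbs \<pi> z" "gibbs \<pi> z" ..
  interpret NG: pair_prob_space N ?G ..
  have pt: "\<bar>h \<omega> s * v \<omega> t\<bar> \<le> norm (h \<omega>) * norm (v \<omega>)" for \<omega> s t
    unfolding abs_mult by (intro mult_mono abs_eval_le) auto
  have i: "integrable N (\<lambda>\<omega>. h \<omega> s * v \<omega> t)" for s t
    by (rule Bochner_Integration.integrable_bound[OF int]) (auto simp: pt)
  have dom: "integrable (N \<Otimes>\<^sub>M ?G) (\<lambda>(\<omega>, p). 2 * (norm (h \<omega>) * norm (v \<omega>)))"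
    by (rule NG.Fubini_integrable) (use int in \<open>auto simp: GG.prob_space\<close>)
  have int2: "integrable (N \<Otimes>\<^sub>M ?G) (\<lambda>(\<omega>, p). h \<omega> (snd p) * v \<omega> (snd p) - h \<omega> (fst p) * v \<omega> (snd p))"
  proof (rule Bochner_Integration.integrable_bound[OF dom])
    show "AE x in N \<Otimes>\<^sub>M ?G. norm (case x of (\<omega>, p) \<Rightarrow> h \<omega> (snd p) * v \<omega> (snd p) - h \<omega> (fst p) * v \<omega> (snd p))
      \<le> norm (case x of (\<omega>, p) \<Rightarrow> 2 * (norm (h \<omega>) * norm (v \<omega>)))"
    proof (rule AE_I2, clarsimp)
      fix \<omega> s t
      show "\<bar>h \<omega> t * v \<omega> t - h \<omega> s * v \<omega> t\<bar> \<le> 2 * (norm (h \<omega>) * norm (v \<omega>))"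
        using pt[of \<omega> t t] pt[of \<omega> s t] by linarith
    qed
  qed measurable
  have "avg_gibbs_cov N h v z = (\<integral>\<omega>. (\<integral>p. h \<omega> (snd p) * v \<omega> (snd p) - h \<omega> (fst p) * v \<omega> (snd p) \<partial>?G) \<partial>N)"
    unfolding avg_gibbs_cov_def by (simp add: gibbs_cov_eq_pair_integral case_prod_beta')
  also have "\<dots> = (\<integral>p. (\<integral>\<omega>. h \<omega> (snd p) * v \<omega> (snd p) - h \<omega> (fst p) * v \<omega> (snd p) \<partial>N) \<partial>?G)"
    by (rule NG.Fubini_integral[OF int2, symmetric])
  also have "\<dots> = (\<integral>(s, t). (\<integral>\<omega>. h \<omega> t * v \<omega> t \<partial>N) - (\<integral>\<omega>. h \<omega> s * v \<omega> t \<partial>N) \<partial>?G)"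
    by (simp add: Bochner_Integration.integral_diff[OF i i] case_prod_beta')
  finally show ?thesis .
qed

lemma avg_gibbs_cov_diff_le:
  fixes S U :: "'w \<Rightarrow> 't \<Rightarrow>\<^sub>C real"
  assumes N: "prob_space N" and S: "S \<in> borel_measurable N" "integrable N (\<lambda>\<omega>. norm (S \<omega>) * norm (S \<omega>))"
    and U: "U \<in> borel_measurable N" "integrable N (\<lambda>\<omega>. norm (U \<omega>) * norm (U \<omega>))"
    and \<kappa>: "\<And>s t. \<bar>(\<integral>\<omega>. S \<omega> s * S \<omega> t \<partial>N) - (\<integral>\<omega>. U \<omega> s * U \<omega> t \<partial>N)\<bar> \<le> \<kappa>"
  shows "avg_gibbs_cov N S S z - avg_gibbs_cov N U U z \<le> 2 * \<kappa>"
proof -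
  interpret N: prob_space N by fact
  interpret G: prob_space "gibbs \<pi> z" by (rule prob_space_gibbs)
  let ?G = "gibbs \<pi> z \<Otimes>\<^sub>M gibbs \<pi> z"
  interpret GG: pair_prob_space "gibbs \<pi> z" "gibbs \<pi> z" ..
  have int: "integrable ?G (\<lambda>(s, t). (\<integral>\<omega>. h \<omega> t * h \<omega> t \<partial>N) - (\<integral>\<omega>. h \<omega> s * h \<omega> t \<partial>N))"
    if [measurable]: "h \<in> borel_measurable N" and h: "integrable N (\<lambda>\<omega>. norm (h \<omega>) * norm (h \<omega>))" for h :: "'w \<Rightarrow> 't \<Rightarrow>\<^sub>C real"
  proof (rule GG.integrable_const_bound[where B="2 * (\<integral>\<omega>. norm (h \<omega>) * norm (h \<omega>) \<partial>N)"])
    have b: "\<bar>\<integral>\<omega>. h \<omega> s * h \<omega> t \<partial>N\<bar> \<le> (\<integral>\<omega>. norm (h \<omega>) * norm (h \<omega>) \<partial>N)" for s t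
    proof -
      have "\<bar>\<integral>\<omega>. h \<omega> s * h \<omega> t \<partial>N\<bar> \<le> (\<integral>\<omega>. \<bar>h \<omega> s * h \<omega> t\<bar> \<partial>N)" by (rule integral_abs_bound)
      also have "\<dots> \<le> (\<integral>\<omega>. norm (h \<omega>) * norm (h \<omega>) \<partial>N)"
      proof (rule integral_mono[OF _ h])
        have pt: "\<bar>h \<omega> s * h \<omega> t\<bar> \<le> norm (h \<omega>) * norm (h \<omega>)" for \<omega>
          unfolding abs_mult by (intro mult_mono abs_eval_le) auto
        then show "\<bar>h \<omega> s * h \<omega> t\<bar> \<le> norm (h \<omega>) * norm (h \<omega>)" for \<omega> .
        show "integrable N (\<lambda>\<omega>. \<bar>h \<omega> s * h \<omega> t\<bar>)"
          by (rule Bochner_Integration.integrable_bound[OF h]) (auto simp: pt)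
      qed
      finally show ?thesis .
    qed
    show "AE x in ?G. norm (case x of (s, t) \<Rightarrow> (\<integral>\<omega>. h \<omega> t * h \<omega> t \<partial>N) - (\<integral>\<omega>. h \<omega> s * h \<omega> t \<partial>N))
      \<le> 2 * (\<integral>\<omega>. norm (h \<omega>) * norm (h \<omega>) \<partial>N)"
    proof (rule AE_I2, clarsimp)
      fix s t
      show "\<bar>(\<integral>\<omega>. h \<omega> t * h \<omega> t \<partial>N) - (\<integral>\<omega>. h \<omega> s * h \<omega> t \<partial>N)\<bar> \<le> 2 * (\<integral>\<omega>. norm (h \<omega>) * norm (h \<omega>) \<partial>N)"
        using b[of t t] b[of s t] by linarith
    qed
  qed measurable
  have "avg_gibbs_cov N S S z - avg_gibbs_cov N U U z
    = (\<integral>p. (case p of (s, t) \<Rightarrow> (\<integral>\<omega>. S \<omega> t * S \<omega> t \<partial>N) - (\<integral>\<omega>. S \<omega> s * S \<omega> t \<partial>N))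
      - (case p of (s, t) \<Rightarrow> (\<integral>\<omega>. U \<omega> t * U \<omega> t \<partial>N) - (\<integral>\<omega>. U \<omega> s * U \<omega> t \<partial>N)) \<partial>?G)"
    unfolding avg_gibbs_cov_eq_pair_integral[OF N S(1) S] avg_gibbs_cov_eq_pair_integral[OF N U(1) U]
    by (rule Bochner_Integration.integral_diff[OF int[OF S] int[OF U], symmetric])
  also have "\<dots> \<le> (\<integral>p. 2 * \<kappa> \<partial>?G)"
  proof (intro integral_mono Bochner_Integration.integrable_diff int S U)
    fix p :: "'t \<times> 't"
    obtain s t where p: "p = (s, t)" by (cases p)
    show "(case p of (s, t) \<Rightarrow> (\<integral>\<omega>. S \<omega> t * S \<omega> t \<partial>N) - (\<integral>\<omega>. S \<omega> s * S \<omega> t \<partial>N))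
      - (case p of (s, t) \<Rightarrow> (\<integral>\<omega>. U \<omega> t * U \<omega> t \<partial>N) - (\<integral>\<omega>. U \<omega> s * U \<omega> t \<partial>N)) \<le> 2 * \<kappa>"
      using \<kappa>[of t t] \<kappa>[of s t] by (simp add: p)
  qed simp
  also have "\<dots> = 2 * \<kappa>" using GG.prob_space by simp
  finally show ?thesis .
qed

text \<open>The smart path method. With \<open>S\<close> and \<open>U\<close> the two sums, the path \<open>c + sin a S + cos a U\<close> joins
  them; unlike a path with square roots it is smooth up to both ends. The derivative of the mean log
  partition function along it is the mean Gibbs average of the velocity \<open>cos a S - sin a U\<close>, and
  approximate integration by parts applies to it. The covariances of \<open>S\<close> and \<open>U\<close> enter with weights
  \<open>sin a cos a\<close> of opposite signs, and their cross terms vanish. A summand of \<open>S\<close> contributes an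
  error of at most \<open>3 sin\<^sup>2 a cos a\<close> times its third moment, whose integral over the path has
  the factor one.\<close>

lemma lindeberg_comparison_le:
  fixes Z :: "'i \<Rightarrow> 'w \<Rightarrow> 't \<Rightarrow>\<^sub>C real"
  assumes N: "prob_space N" and fin: "finite I" "finite J" and disj: "I \<inter> J = {}"
    and ind: "prob_space.indep_vars N (\<lambda>_. borel) Z (I \<union> J)"
    and mean: "\<And>k. k \<in> I \<union> J \<Longrightarrow> (\<integral>\<omega>. Z k \<omega> \<partial>N) = 0"
    and third: "\<And>k. k \<in> I \<union> J \<Longrightarrow> integrable N (\<lambda>\<omega>. norm (Z k \<omega>) ^ 3)"
    and \<kappa>: "\<And>s t. \<bar>(\<integral>\<omega>. (\<Sum>k\<in>I. Z k \<omega>) s * (\<Sum>k\<in>I. Z k \<omega>) t \<partial>N) - (\<integral>\<omega>. (\<Sum>k\<in>J. Z k \<omega>) s * (\<Sum>k\<in>J. Z k \<omega>) t \<partial>N)\<bar> \<le> \<kappa>"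
  shows "(\<integral>\<omega>. log_partition \<pi> (c + (\<Sum>k\<in>I. Z k \<omega>)) \<partial>N) - (\<integral>\<omega>. log_partition \<pi> (c + (\<Sum>k\<in>J. Z k \<omega>)) \<partial>N)
    \<le> \<kappa> + (\<Sum>k\<in>I \<union> J. \<integral>\<omega>. norm (Z k \<omega>) ^ 3 \<partial>N)"
proof -
  interpret N: prob_space N by fact
  have Zm [measurable]: "Z k \<in> borel_measurable N" if "k \<in> I \<union> J" for k
    using ind that by (auto simp: N.indep_vars_def)
  let ?S = "\<lambda>\<omega>. \<Sum>k\<in>I. Z k \<omega>" and ?U = "\<lambda>\<omega>. \<Sum>k\<in>J. Z k \<omega>"
  have S [measurable]: "?S \<in> borel_measurable N" and U [measurable]: "?U \<in> borel_measurable N"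
    using Zm by auto
  have mom: "integrable N (\<lambda>\<omega>. norm (Z k \<omega>))" "integrable N (\<lambda>\<omega>. norm (Z k \<omega>) * norm (Z k \<omega>))"
    "integrable N (\<lambda>\<omega>. (norm (Z k \<omega>))\<^sup>2 * norm (Z k \<omega>))"
    "(\<integral>\<omega>. (norm (Z k \<omega>))\<^sup>2 * norm (Z k \<omega>) \<partial>N) + 2 * (\<integral>\<omega>. norm (Z k \<omega>) \<partial>N) * (\<integral>\<omega>. norm (Z k \<omega>) * norm (Z k \<omega>) \<partial>N)
      \<le> 3 * (\<integral>\<omega>. norm (Z k \<omega>) ^ 3 \<partial>N)" if k: "k \<in> I \<union> J" for k
  proof -
    have "(\<integral>\<omega>. norm (Z k \<omega>) ^ 3 \<partial>N) powr (2 / 3) * (\<integral>\<omega>. norm (Z k \<omega>) ^ 3 \<partial>N) powr (1 / 3) = (\<integral>\<omega>. norm (Z k \<omega>) ^ 3 \<partial>N)"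
      using integral_nonneg_AE[of "\<lambda>\<omega>. norm (Z k \<omega>) ^ 3" N] by (simp flip: powr_add)
    then show "integrable N (\<lambda>\<omega>. norm (Z k \<omega>))" "integrable N (\<lambda>\<omega>. norm (Z k \<omega>) * norm (Z k \<omega>))"
    "integrable N (\<lambda>\<omega>. (norm (Z k \<omega>))\<^sup>2 * norm (Z k \<omega>))"
    "(\<integral>\<omega>. (norm (Z k \<omega>))\<^sup>2 * norm (Z k \<omega>) \<partial>N) + 2 * (\<integral>\<omega>. norm (Z k \<omega>) \<partial>N) * (\<integral>\<omega>. norm (Z k \<omega>) * norm (Z k \<omega>) \<partial>N)
      \<le> 3 * (\<integral>\<omega>. norm (Z k \<omega>) ^ 3 \<partial>N)"
      using N.moment_error_le[of "\<lambda>\<omega>. norm (Z k \<omega>)" "\<lambda>\<omega>. norm (Z k \<omega>)"] third[OF k] Zm[OF k] by auto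
  qed
  have iZ: "integrable N (Z k)" if "k \<in> I \<union> J" for k
    using integrable_norm_cancel[OF mom(1) Zm] that by blast
  have ZZ: "N.indep_vars (\<lambda>_. borel) (\<lambda>k \<omega>. (a k *\<^sub>R Z k \<omega>, b k *\<^sub>R Z k \<omega>)) (I \<union> J)" for a b :: "'i \<Rightarrow> real"
    by (rule N.indep_vars_compose2[OF ind, of "\<lambda>k z. (a k *\<^sub>R z, b k *\<^sub>R z)"]) (auto simp: borel_prod[symmetric])
  have iS: "integrable N ?S" "integrable N ?U" using iZ by auto
  have S0: "(\<integral>\<omega>. ?S \<omega> \<partial>N) = 0" "(\<integral>\<omega>. ?U \<omega> \<partial>N) = 0"
    using iZ mean by (simp_all add: Bochner_Integration.integral_sum)
  have ipSU: "indep_pair N borel ?S borel ?U"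
    using N.indep_pair_of_indep_vars[OF ind, of I J "\<lambda>x. \<Sum>k\<in>I. x k" borel "\<lambda>x. \<Sum>k\<in>J. x k" borel] disj
    by (simp cong: sum.cong_simp)
  have ipUS: "indep_pair N borel ?U borel ?S"
    using N.indep_pair_of_indep_vars[OF ind, of J I "\<lambda>x. \<Sum>k\<in>J. x k" borel "\<lambda>x. \<Sum>k\<in>I. x k" borel] disj
    by (simp add: Int_commute cong: sum.cong_simp)
  have sq: "integrable N (\<lambda>\<omega>. norm (\<Sum>k\<in>K. Z k \<omega>) * norm (\<Sum>k\<in>K. Z k \<omega>))" if K: "K \<subseteq> I \<union> J" for K
  proof (rule approx_integration_by_parts(1)[OF N])
    show "N.indep_vars (\<lambda>_. borel) (\<lambda>k \<omega>. (Z k \<omega>, Z k \<omega>)) K"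
      using N.indep_vars_subset[OF ZZ[of "\<lambda>_. 1" "\<lambda>_. 1"] K] by simp
    show "finite K" using K fin by (simp add: finite_subset)
  qed (use K iZ mom mean in blast)+
  define \<Gamma> where "\<Gamma> a \<omega> = c + sin a *\<^sub>R ?S \<omega> + cos a *\<^sub>R ?U \<omega>" for a :: real and \<omega>
  define \<Gamma>' where "\<Gamma>' a \<omega> = cos a *\<^sub>R ?S \<omega> - sin a *\<^sub>R ?U \<omega>" for a :: real and \<omega>
  have [measurable]: "\<Gamma> a \<in> borel_measurable N" "\<Gamma>' a \<in> borel_measurable N" for a
    unfolding \<Gamma>_def \<Gamma>'_def by measurable
  define H where "H a = (\<integral>\<omega>. log_partition \<pi> (\<Gamma> a \<omega>) \<partial>N)" for a
  have H: "(H has_real_derivative (\<integral>\<omega>. gibbs_mean \<pi> (\<Gamma> a \<omega>) (\<Gamma>' a \<omega>) \<partial>N)) (at a)" for a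
    unfolding H_def
  proof (rule has_real_derivative_integral[where g="\<lambda>\<omega>. norm (?S \<omega>) + norm (?U \<omega>)"])
    show "integrable N (\<lambda>\<omega>. log_partition \<pi> (\<Gamma> b \<omega>))" for b
    proof (rule Bochner_Integration.integrable_bound)
      show "integrable N (\<lambda>\<omega>. norm (\<Gamma> b \<omega>))" using iS by (auto simp: \<Gamma>_def)
    qed (use abs_log_partition_le in auto)
    show "((\<lambda>b. log_partition \<pi> (\<Gamma> b \<omega>)) has_real_derivative gibbs_mean \<pi> (\<Gamma> a \<omega>) (\<Gamma>' a \<omega>)) (at a)" for \<omega>
      unfolding \<Gamma>_def \<Gamma>'_def
      by (rule log_partition_has_real_derivative) (auto intro!: derivative_eq_intros)
    show "\<bar>log_partition \<pi> (\<Gamma> b \<omega>) - log_partition \<pi> (\<Gamma> a \<omega>)\<bar> \<le> (norm (?S \<omega>) + norm (?U \<omega>)) * \<bar>b - a\<bar>" for b \<omega>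
    proof -
      have sc: "\<bar>sin b - sin a\<bar> \<le> \<bar>b - a\<bar>" "\<bar>cos b - cos a\<bar> \<le> \<bar>b - a\<bar>"
        using field_differentiable_bound[of UNIV sin cos 1 b a] field_differentiable_bound[of UNIV cos "\<lambda>x. - sin x" 1 b a]
        by (auto intro!: derivative_eq_intros)
      have "\<bar>log_partition \<pi> (\<Gamma> b \<omega>) - log_partition \<pi> (\<Gamma> a \<omega>)\<bar> \<le> norm (\<Gamma> b \<omega> - \<Gamma> a \<omega>)"
        by (rule log_partition_lipschitz)
      also have "\<Gamma> b \<omega> - \<Gamma> a \<omega> = (sin b - sin a) *\<^sub>R ?S \<omega> + (cos b - cos a) *\<^sub>R ?U \<omega>"
        by (simp add: \<Gamma>_def algebra_simps)
      also have "norm \<dots> \<le> \<bar>sin b - sin a\<bar> * norm (?S \<omega>) + \<bar>cos b - cos a\<bar> * norm (?U \<omega>)"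
        by (metis norm_triangle_ineq norm_scaleR)
      also have "\<dots> \<le> \<bar>b - a\<bar> * norm (?S \<omega>) + \<bar>b - a\<bar> * norm (?U \<omega>)"
        using sc by (intro add_mono mult_right_mono) auto
      finally show ?thesis by (simp add: algebra_simps)
    qed
  qed (use iS in auto)
  define m where "m k = (\<integral>\<omega>. norm (Z k \<omega>) ^ 3 \<partial>N)" for k
  have H'_le: "(\<integral>\<omega>. gibbs_mean \<pi> (\<Gamma> a \<omega>) (\<Gamma>' a \<omega>) \<partial>N)
      \<le> 2 * \<kappa> * (sin a * cos a) + 3 * (sin a)\<^sup>2 * cos a * (\<Sum>k\<in>I. m k) + 3 * (cos a)\<^sup>2 * sin a * (\<Sum>k\<in>J. m k)"
    if sc: "sin a \<ge> 0" "cos a \<ge> 0" for a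
  proof -
    define w v where "w k = (if k \<in> I then sin a else cos a)" and "v k = (if k \<in> I then cos a else - sin a)" for k
    have wI: "(\<Sum>k\<in>I. w k *\<^sub>R Z k \<omega>) = sin a *\<^sub>R ?S \<omega>" and wJ: "(\<Sum>k\<in>J. w k *\<^sub>R Z k \<omega>) = cos a *\<^sub>R ?U \<omega>"
      and vI: "(\<Sum>k\<in>I. v k *\<^sub>R Z k \<omega>) = cos a *\<^sub>R ?S \<omega>" and vJ: "(\<Sum>k\<in>J. v k *\<^sub>R Z k \<omega>) = - sin a *\<^sub>R ?U \<omega>" for \<omega>
      using disj by (auto simp: w_def v_def scaleR_sum_right intro!: sum.cong)
    have \<Gamma>: "\<Gamma> a \<omega> = c + (\<Sum>k\<in>I \<union> J. w k *\<^sub>R Z k \<omega>)" and \<Gamma>': "\<Gamma>' a \<omega> = (\<Sum>k\<in>I \<union> J. v k *\<^sub>R Z k \<omega>)" for \<omega>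
      unfolding sum.union_disjoint[OF fin disj] wI wJ vI vJ by (simp_all add: \<Gamma>_def \<Gamma>'_def)
    let ?X = "\<lambda>\<omega>. \<Sum>k\<in>I \<union> J. w k *\<^sub>R Z k \<omega>" and ?V = "\<lambda>\<omega>. \<Sum>k\<in>I \<union> J. v k *\<^sub>R Z k \<omega>"
    have ibp: "\<bar>(\<integral>\<omega>. gibbs_mean \<pi> (\<Gamma> a \<omega>) (\<Gamma>' a \<omega>) \<partial>N) - (\<integral>\<omega>. avg_gibbs_cov N ?X ?V (\<Gamma> a \<omega>) \<partial>N)\<bar>
      \<le> (\<Sum>k\<in>I \<union> J. (\<integral>\<omega>. (norm (w k *\<^sub>R Z k \<omega>))\<^sup>2 * norm (v k *\<^sub>R Z k \<omega>) \<partial>N)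
        + 2 * (\<integral>\<omega>. norm (w k *\<^sub>R Z k \<omega>) \<partial>N) * (\<integral>\<omega>. norm (w k *\<^sub>R Z k \<omega>) * norm (v k *\<^sub>R Z k \<omega>) \<partial>N))"
      unfolding \<Gamma> \<Gamma>'
    proof (rule approx_integration_by_parts(2)[OF N _ ZZ])
      fix k assume k: "k \<in> I \<union> J"
      show "integrable N (\<lambda>\<omega>. norm (w k *\<^sub>R Z k \<omega>) * norm (v k *\<^sub>R Z k \<omega>))"
        using integrable_mult_right[OF mom(2)[OF k], of "\<bar>w k\<bar> * \<bar>v k\<bar>"] by (simp add: mult_ac)
      show "integrable N (\<lambda>\<omega>. (norm (w k *\<^sub>R Z k \<omega>))\<^sup>2 * norm (v k *\<^sub>R Z k \<omega>))"
        using integrable_mult_right[OF mom(3)[OF k], of "\<bar>w k\<bar>\<^sup>2 * \<bar>v k\<bar>"] by (simp add: mult_ac power_mult_distrib)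
    qed (use fin iZ mean in auto)
    also have "\<dots> \<le> (\<Sum>k\<in>I \<union> J. 3 * \<bar>w k\<bar>\<^sup>2 * \<bar>v k\<bar> * m k)"
    proof (rule sum_mono)
      fix k assume k: "k \<in> I \<union> J"
      have "(\<integral>\<omega>. (norm (w k *\<^sub>R Z k \<omega>))\<^sup>2 * norm (v k *\<^sub>R Z k \<omega>) \<partial>N)
        + 2 * (\<integral>\<omega>. norm (w k *\<^sub>R Z k \<omega>) \<partial>N) * (\<integral>\<omega>. norm (w k *\<^sub>R Z k \<omega>) * norm (v k *\<^sub>R Z k \<omega>) \<partial>N)
        = (\<integral>\<omega>. (\<bar>w k\<bar>\<^sup>2 * \<bar>v k\<bar>) * ((norm (Z k \<omega>))\<^sup>2 * norm (Z k \<omega>)) \<partial>N)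
        + 2 * (\<integral>\<omega>. \<bar>w k\<bar> * norm (Z k \<omega>) \<partial>N) * (\<integral>\<omega>. (\<bar>w k\<bar> * \<bar>v k\<bar>) * (norm (Z k \<omega>) * norm (Z k \<omega>)) \<partial>N)"
        by (simp add: power_mult_distrib mult_ac)
      also have "\<dots> = \<bar>w k\<bar>\<^sup>2 * \<bar>v k\<bar> * ((\<integral>\<omega>. (norm (Z k \<omega>))\<^sup>2 * norm (Z k \<omega>) \<partial>N) + 2 * (\<integral>\<omega>. norm (Z k \<omega>) \<partial>N) * (\<integral>\<omega>. norm (Z k \<omega>) * norm (Z k \<omega>) \<partial>N))"
        unfolding integral_mult_right_zero by (simp add: algebra_simps power2_eq_square)
      also have "\<dots> \<le> \<bar>w k\<bar>\<^sup>2 * \<bar>v k\<bar> * (3 * m k)"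
        using mom(4)[OF k] by (intro mult_left_mono) (auto simp: m_def)
      finally show "(\<integral>\<omega>. (norm (w k *\<^sub>R Z k \<omega>))\<^sup>2 * norm (v k *\<^sub>R Z k \<omega>) \<partial>N)
        + 2 * (\<integral>\<omega>. norm (w k *\<^sub>R Z k \<omega>) \<partial>N) * (\<integral>\<omega>. norm (w k *\<^sub>R Z k \<omega>) * norm (v k *\<^sub>R Z k \<omega>) \<partial>N)
        \<le> 3 * \<bar>w k\<bar>\<^sup>2 * \<bar>v k\<bar> * m k" by (simp add: mult_ac)
    qed
    also have "\<dots> = (\<Sum>k\<in>I. 3 * (sin a)\<^sup>2 * cos a * m k) + (\<Sum>k\<in>J. 3 * (cos a)\<^sup>2 * sin a * m k)"
      unfolding sum.union_disjoint[OF fin disj] using disj sc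
      by (intro arg_cong2[where f="(+)"] sum.cong) (auto simp: w_def v_def)
    finally have err: "(\<integral>\<omega>. gibbs_mean \<pi> (\<Gamma> a \<omega>) (\<Gamma>' a \<omega>) \<partial>N) \<le> (\<integral>\<omega>. avg_gibbs_cov N ?X ?V (\<Gamma> a \<omega>) \<partial>N)
      + (3 * (sin a)\<^sup>2 * cos a * (\<Sum>k\<in>I. m k) + 3 * (cos a)\<^sup>2 * sin a * (\<Sum>k\<in>J. m k))"
      by (simp add: sum_distrib_left)
    have avg: "avg_gibbs_cov N ?X ?V z \<le> 2 * \<kappa> * (sin a * cos a)" for z
    proof -
      have XV: "?X \<omega> = sin a *\<^sub>R ?S \<omega> + cos a *\<^sub>R ?U \<omega>" "?V \<omega> = cos a *\<^sub>R ?S \<omega> - sin a *\<^sub>R ?U \<omega>" for \<omega>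
        using \<Gamma> \<Gamma>' by (simp_all add: \<Gamma>_def \<Gamma>'_def)
      note bb = bounded_bilinear_gibbs_cov[of z]
      have pt: "gibbs_cov \<pi> z (?X \<omega>) (?V \<omega>) = (sin a * cos a) * gibbs_cov \<pi> z (?S \<omega>) (?S \<omega>) + (cos a)\<^sup>2 * gibbs_cov \<pi> z (?U \<omega>) (?S \<omega>)
        - (sin a)\<^sup>2 * gibbs_cov \<pi> z (?S \<omega>) (?U \<omega>) - (sin a * cos a) * gibbs_cov \<pi> z (?U \<omega>) (?U \<omega>)" for \<omega>
        unfolding XV bounded_bilinear.add_left[OF bb] bounded_bilinear.diff_right[OF bb]
          bounded_bilinear.scaleR_left[OF bb] bounded_bilinear.scaleR_right[OF bb]
        by (simp add: algebra_simps power2_eq_square)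
      note i = integrable_gibbs_cov[of "\<lambda>_. z", OF _ S S sq[of I]] integrable_gibbs_cov[of "\<lambda>_. z", OF _ U U sq[of J]]
        integrable_gibbs_cov[of "\<lambda>_. z", OF _ S U avg_gibbs_cov_indep(1)[OF N ipSU iS(1) iS(2) S0(2)]]
        integrable_gibbs_cov[of "\<lambda>_. z", OF _ U S avg_gibbs_cov_indep(1)[OF N ipUS iS(2) iS(1) S0(1)]]
      have "avg_gibbs_cov N ?X ?V z = (sin a * cos a) * avg_gibbs_cov N ?S ?S z + (cos a)\<^sup>2 * avg_gibbs_cov N ?U ?S z
        - (sin a)\<^sup>2 * avg_gibbs_cov N ?S ?U z - (sin a * cos a) * avg_gibbs_cov N ?U ?U z"
        unfolding avg_gibbs_cov_def pt using i by simp
      also have "\<dots> = (sin a * cos a) * (avg_gibbs_cov N ?S ?S z - avg_gibbs_cov N ?U ?U z)"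
        using avg_gibbs_cov_indep(2)[OF N ipSU iS(1) iS(2) S0(2)] avg_gibbs_cov_indep(2)[OF N ipUS iS(2) iS(1) S0(1)]
        by (simp add: algebra_simps)
      also have "\<dots> \<le> (sin a * cos a) * (2 * \<kappa>)"
        using sc by (intro mult_left_mono avg_gibbs_cov_diff_le N S U sq \<kappa>) auto
      finally show ?thesis by (simp add: mult_ac)
    qed
    have mX: "?X \<in> borel_measurable N" "?V \<in> borel_measurable N" using Zm by auto
    have "integrable N (\<lambda>\<omega>. avg_gibbs_cov N ?X ?V (\<Gamma> a \<omega>))"
    proof (rule N.integrable_const_bound)
      have "integrable N (\<lambda>\<omega>. norm (?X \<omega>) * norm (?V \<omega>))"
      proof (rule approx_integration_by_parts(1)[OF N _ ZZ])
        fix k assume k: "k \<in> I \<union> J"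
        show "integrable N (\<lambda>\<omega>. norm (w k *\<^sub>R Z k \<omega>) * norm (v k *\<^sub>R Z k \<omega>))"
          using integrable_mult_right[OF mom(2)[OF k], of "\<bar>w k\<bar> * \<bar>v k\<bar>"] by (simp add: mult_ac)
        show "integrable N (\<lambda>\<omega>. (norm (w k *\<^sub>R Z k \<omega>))\<^sup>2 * norm (v k *\<^sub>R Z k \<omega>))"
          using integrable_mult_right[OF mom(3)[OF k], of "\<bar>w k\<bar>\<^sup>2 * \<bar>v k\<bar>"] by (simp add: mult_ac power_mult_distrib)
      qed (use fin iZ mean in auto)
      from abs_avg_gibbs_cov_le[OF mX this]
      show "AE \<omega> in N. norm (avg_gibbs_cov N ?X ?V (\<Gamma> a \<omega>)) \<le> 2 * (\<integral>\<omega>. norm (?X \<omega>) * norm (?V \<omega>) \<partial>N)" by simp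
      show "(\<lambda>\<omega>. avg_gibbs_cov N ?X ?V (\<Gamma> a \<omega>)) \<in> borel_measurable N"
        using mX by (intro measurable_avg_gibbs_cov) (auto intro: N.sigma_finite_measure_axioms)
    qed
    then have "(\<integral>\<omega>. avg_gibbs_cov N ?X ?V (\<Gamma> a \<omega>) \<partial>N) \<le> (\<integral>\<omega>. 2 * \<kappa> * (sin a * cos a) \<partial>N)"
      by (intro integral_mono avg) auto
    then show ?thesis using err by (simp add: N.prob_space)
  qed
  \<comment> \<open>subtract the antiderivative of the bound for the derivative of \<open>H\<close>\<close>
  define L where "L a = H a - (\<kappa> * (sin a)\<^sup>2 + (sin a) ^ 3 * (\<Sum>k\<in>I. m k) - (cos a) ^ 3 * (\<Sum>k\<in>J. m k))" for a
  have "L (pi / 2) \<le> L 0"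
  proof (rule DERIV_nonpos_imp_nonincreasing[of 0 "pi / 2" L])
    fix a :: real assume a: "0 \<le> a" "a \<le> pi / 2"
    have sc: "sin a \<ge> 0" "cos a \<ge> 0" using a by (auto intro: sin_ge_zero cos_ge_zero)
    have "(L has_real_derivative ((\<integral>\<omega>. gibbs_mean \<pi> (\<Gamma> a \<omega>) (\<Gamma>' a \<omega>) \<partial>N) -
       (2 * \<kappa> * (sin a * cos a) + 3 * (sin a)\<^sup>2 * cos a * (\<Sum>k\<in>I. m k) + 3 * (cos a)\<^sup>2 * sin a * (\<Sum>k\<in>J. m k)))) (at a)"
      unfolding L_def[abs_def]
      by (rule derivative_eq_intros H refl | simp)+
    then show "\<exists>y. (L has_real_derivative y) (at a) \<and> y \<le> 0"
      using H'_le[OF sc] by (intro exI conjI) auto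
  qed simp
  then show ?thesis
    unfolding L_def sum.union_disjoint[OF fin disj] by (simp add: H_def \<Gamma>_def m_def)
qed

lemma lindeberg_comparison:
  fixes Z :: "'i \<Rightarrow> 'w \<Rightarrow> 't \<Rightarrow>\<^sub>C real"
  assumes N: "prob_space N" and fin: "finite I" "finite J" and disj: "I \<inter> J = {}"
    and ind: "prob_space.indep_vars N (\<lambda>_. borel) Z (I \<union> J)"
    and mean: "\<And>k. k \<in> I \<union> J \<Longrightarrow> (\<integral>\<omega>. Z k \<omega> \<partial>N) = 0"
    and third: "\<And>k. k \<in> I \<union> J \<Longrightarrow> integrable N (\<lambda>\<omega>. norm (Z k \<omega>) ^ 3)"
    and \<kappa>: "\<And>s t. \<bar>(\<integral>\<omega>. (\<Sum>k\<in>I. Z k \<omega>) s * (\<Sum>k\<in>I. Z k \<omega>) t \<partial>N) - (\<integral>\<omega>. (\<Sum>k\<in>J. Z k \<omega>) s * (\<Sum>k\<in>J. Z k \<omega>) t \<partial>N)\<bar> \<le> \<kappa>"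
  shows "\<bar>(\<integral>\<omega>. log_partition \<pi> (c + (\<Sum>k\<in>I. Z k \<omega>)) \<partial>N) - (\<integral>\<omega>. log_partition \<pi> (c + (\<Sum>k\<in>J. Z k \<omega>)) \<partial>N)\<bar>
    \<le> \<kappa> + (\<Sum>k\<in>I \<union> J. \<integral>\<omega>. norm (Z k \<omega>) ^ 3 \<partial>N)"
  using lindeberg_comparison_le[OF assms, of c]
    lindeberg_comparison_le[OF N fin(2,1), of Z \<kappa> c] disj ind mean third \<kappa>
  by (simp add: Un_commute Int_commute abs_minus_commute abs_le_iff)

end

section \<open>Characteristic functionals determine laws\<close>

text \<open>Levy's uniqueness theorem, with nonnegative weights in place of probability densities:
  after normalising the total mass, the weighted laws of \<open>f\<close> have equal characteristic functions.\<close>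

lemma weighted_char_uniqueness:
  fixes f p q :: "'a \<Rightarrow> real"
  assumes fin: "finite_measure M" "finite_measure N" and sets: "sets M = sets N"
    and [measurable]: "f \<in> borel_measurable M" "p \<in> borel_measurable M"
    and p: "\<And>x. 0 \<le> p x" "\<And>x. p x \<le> K"
    and cos: "\<And>u. (\<integral>x. p x * cos (u * f x) \<partial>M) = (\<integral>x. p x * cos (u * f x) \<partial>N)"
    and sin: "\<And>u. (\<integral>x. p x * sin (u * f x) \<partial>M) = (\<integral>x. p x * sin (u * f x) \<partial>N)"
    and A: "A \<in> sets borel"
  shows "(\<integral>x. p x * indicator A (f x) \<partial>M) = (\<integral>x. p x * indicator A (f x) \<partial>N)"
proof -
  have fN [measurable]: "f \<in> borel_measurable N" and pN [measurable]: "p \<in> borel_measurable N"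
    using assms(4,5) unfolding measurable_cong_sets[OF sets refl] .
  note A [measurable]
  have int: "integrable L (\<lambda>x. p x * g x)"
    if L: "finite_measure L" and [measurable]: "p \<in> borel_measurable L" "g \<in> borel_measurable L"
      and g: "\<And>x. \<bar>g x\<bar> \<le> (1 :: real)" for L g
  proof (rule finite_measure.integrable_const_bound[OF L, where B=K])
    show "AE x in L. norm (p x * g x) \<le> K"
    proof (rule AE_I2)
      fix x
      have "p x * \<bar>g x\<bar> \<le> K * 1" using p[of x] g[of x] by (intro mult_mono) auto
      then show "norm (p x * g x) \<le> K" using p(1)[of x] by (simp add: abs_mult)
    qed
  qed measurable
  define m where "m = (\<integral>x. p x \<partial>M)"
  have mN: "m = (\<integral>x. p x \<partial>N)" using cos[of 0] by (simp add: m_def)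
  have ip: "integrable M p" "integrable N p" using int[of M "\<lambda>_. 1"] int[of N "\<lambda>_. 1"] fin by auto
  show ?thesis
  proof (cases "m = 0")
    case True
    have "AE x in M. p x = 0" "AE x in N. p x = 0"
      using True mN p(1) integral_nonneg_eq_0_iff_AE[OF ip(1)] integral_nonneg_eq_0_iff_AE[OF ip(2)]
      by (auto simp: m_def)
    then have "AE x in M. p x * indicator A (f x) = 0" "AE x in N. p x * indicator A (f x) = 0" by auto
    then show ?thesis by (simp add: integral_eq_zero_AE)
  next
    case False
    then have m: "m > 0" using p(1) by (simp add: m_def order_less_le integral_nonneg_AE)
    define law where "law L = distr (density L (\<lambda>x. ennreal (p x / m))) borel f" for L
    have props: "real_distribution (law L)"
      "char (law L) u = Complex ((\<integral>x. p x * cos (u * f x) \<partial>L) / m) ((\<integral>x. p x * sin (u * f x) \<partial>L) / m)"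
      "measure (law L) A = (\<integral>x. p x * indicator A (f x) \<partial>L) / m"
      if L: "finite_measure L" and [measurable]: "f \<in> borel_measurable L" "p \<in> borel_measurable L"
        and mL: "m = (\<integral>x. p x \<partial>L)" for L u
    proof -
      have ipL: "integrable L p" using int[OF L, of "\<lambda>_. 1"] by simp
      have "prob_space (density L (\<lambda>x. ennreal (p x / m)))"
      proof
        have "emeasure (density L (\<lambda>x. ennreal (p x / m))) (space L) = (\<integral>\<^sup>+x. ennreal (p x / m) \<partial>L)"
          by (simp add: emeasure_density cong: nn_integral_cong)
        also have "\<dots> = ennreal (\<integral>x. p x / m \<partial>L)"
          using m p(1) ipL by (intro nn_integral_eq_integral) auto
        also have "\<dots> = 1" using m mL by simp
        finally show "emeasure (density L (\<lambda>x. ennreal (p x / m))) (space (density L (\<lambda>x. ennreal (p x / m)))) = 1"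
          by simp
      qed
      then interpret D: prob_space "density L (\<lambda>x. ennreal (p x / m))" .
      show "real_distribution (law L)" unfolding law_def by (rule D.real_distribution_distr) simp
      have "char (law L) u = (CLINT x|L. (p x / m) *\<^sub>R iexp (u * f x))"
        unfolding char_def law_def using m p(1)
        by (subst integral_distr, simp, simp, subst integral_density) auto
      also have "\<dots> = (CLINT x|L. Complex (p x * cos (u * f x) / m) (p x * sin (u * f x) / m))"
        by (intro Bochner_Integration.integral_cong) (auto simp: complex_eq_iff Re_exp Im_exp)
      also have "\<dots> = Complex ((\<integral>x. p x * cos (u * f x) \<partial>L) / m) ((\<integral>x. p x * sin (u * f x) \<partial>L) / m)"
      proof -
        have i: "integrable L (\<lambda>x. Complex (p x * cos (u * f x) / m) (p x * sin (u * f x) / m))"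
          unfolding Complex_eq
          by (intro Bochner_Integration.integrable_add integrable_mult_right integrable_of_real integrable_divide int L) auto
        show ?thesis
          using integral_Re[OF i] integral_Im[OF i] by (simp add: complex_eq_iff)
      qed
      finally show "char (law L) u = Complex ((\<integral>x. p x * cos (u * f x) \<partial>L) / m) ((\<integral>x. p x * sin (u * f x) \<partial>L) / m)" .
      have "measure (law L) A = (\<integral>x. indicator A x \<partial>law L)"
        by (simp add: law_def)
      also have "\<dots> = (\<integral>x. (p x / m) *\<^sub>R indicator A (f x) \<partial>L)"
        unfolding law_def using m p(1) by (subst integral_distr, simp, simp, subst integral_density) auto
      finally show "measure (law L) A = (\<integral>x. p x * indicator A (f x) \<partial>L) / m" by simp
    qed
    have "law M = law N"
      using props(1,2)[OF fin(1) _ _ m_def] props(1,2)[OF fin(2) _ _ mN] cos sin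
      by (intro Levy_uniqueness) (auto simp: fun_eq_iff)
    then show ?thesis
      using props(3)[OF fin(1) _ _ m_def] props(3)[OF fin(2) _ _ mN] m by simp
  qed
qed

text \<open>The weights \<open>w (1 + cos L)\<close> and \<open>w (1 + sin L)\<close> are nonnegative, and product-to-sum formulas
  turn their Fourier integrals against one more functional \<open>l\<close> into Fourier integrals of \<open>w\<close> itself.
  One-dimensional uniqueness then allows \<open>w\<close> to be multiplied by the indicator of an event about \<open>l\<close>.
  By induction, indicators of finitely many functionals are inserted one after the other, and no
  multidimensional Fourier analysis is involved.\<close>

lemma cylinder_fourier_eq:
  fixes \<Lambda> :: "('a \<Rightarrow> real) set" and xs :: "(('a \<Rightarrow> real) \<times> real set) list"
  assumes fin: "finite_measure M" "finite_measure N" and sets: "sets M = sets N"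
    and meas: "\<And>L. L \<in> \<Lambda> \<Longrightarrow> L \<in> borel_measurable M"
    and lin: "\<And>L l u. L \<in> \<Lambda> \<Longrightarrow> l \<in> \<Lambda> \<Longrightarrow> (\<lambda>x. L x + u * l x) \<in> \<Lambda>" and zero: "(\<lambda>x. 0) \<in> \<Lambda>"
    and cos: "\<And>L. L \<in> \<Lambda> \<Longrightarrow> (\<integral>x. cos (L x) \<partial>M) = (\<integral>x. cos (L x) \<partial>N)"
    and sin: "\<And>L. L \<in> \<Lambda> \<Longrightarrow> (\<integral>x. sin (L x) \<partial>M) = (\<integral>x. sin (L x) \<partial>N)"
    and xs: "set xs \<subseteq> \<Lambda> \<times> sets borel" and L: "L \<in> \<Lambda>"
  defines "w \<equiv> \<lambda>ys x. \<Prod>(l, A)\<leftarrow>ys. indicator A (l x) :: real"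
  shows "(\<integral>x. w xs x * cos (L x) \<partial>M) = (\<integral>x. w xs x * cos (L x) \<partial>N)
    \<and> (\<integral>x. w xs x * sin (L x) \<partial>M) = (\<integral>x. w xs x * sin (L x) \<partial>N)"
  using xs L
proof (induction xs arbitrary: L)
  case Nil
  then show ?case using cos sin by (simp add: w_def)
next
  case (Cons a xs)
  obtain l A where a: "a = (l, A)" by (cases a)
  have l: "l \<in> \<Lambda>" and A: "A \<in> sets borel" and xs: "set xs \<subseteq> \<Lambda> \<times> sets borel" using Cons.prems by (auto simp: a)
  note IH = Cons.IH[OF xs]
  have measN: "L \<in> borel_measurable N" if "L \<in> \<Lambda>" for L
    using meas[OF that] unfolding measurable_cong_sets[OF sets refl] .
  have wmeas: "w xs \<in> borel_measurable M" using xs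
  proof (induction xs)
    case (Cons b xs)
    then show ?case using meas by (cases b) (auto simp: w_def)
  qed (simp add: w_def)
  then have wN: "w xs \<in> borel_measurable N" unfolding measurable_cong_sets[OF sets refl] .
  have w01: "0 \<le> w xs x \<and> w xs x \<le> 1" for x
    by (induction xs) (auto simp: w_def indicator_def)
  have int: "integrable P (\<lambda>x. w xs x * g x)"
    if "P = M \<or> P = N" "g \<in> borel_measurable P" "\<And>x. \<bar>g x\<bar> \<le> 2" for P g
  proof (rule finite_measure.integrable_const_bound[where B=2])
    show "AE x in P. norm (w xs x * g x) \<le> 2"
    proof (rule AE_I2)
      fix x
      have "w xs x * \<bar>g x\<bar> \<le> 1 * 2" using w01[of x] that(3)[of x] by (intro mult_mono) auto
      then show "norm (w xs x * g x) \<le> 2" using w01[of x] by (simp add: abs_mult)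
    qed
  qed (use that fin wmeas wN in auto)
  have abs2: "\<bar>cos y\<bar> \<le> 2" "\<bar>sin y\<bar> \<le> 2" for y :: real
    using abs_cos_le_one[of y] abs_sin_le_one[of y] by linarith+
  have int1: "integrable P (\<lambda>x. w xs x * cos (l x))" "integrable P (\<lambda>x. w xs x * sin (l x))"
    if "P = M \<or> P = N" "l \<in> \<Lambda>" for P l
    using that meas measN by (auto intro!: int simp: abs2)
  have shift: "(\<lambda>x. u * l x) \<in> \<Lambda>" "(\<lambda>x. L x + u * l x) \<in> \<Lambda>" "(\<lambda>x. L x - u * l x) \<in> \<Lambda>" if "L \<in> \<Lambda>" for L u
    using lin[OF zero l, of u] lin[OF that l, of u] lin[OF that l, of "- u"] by simp_all
  have step_cos: "(\<integral>x. w xs x * (1 + cos (L x)) * indicator A (l x) \<partial>M) = (\<integral>x. w xs x * (1 + cos (L x)) * indicator A (l x) \<partial>N)"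
    if L: "L \<in> \<Lambda>" for L
  proof (rule weighted_char_uniqueness[OF fin sets _ _ _ _ _ _ A, where K=2])
    fix u
    have pt: "w xs x * (1 + cos (L x)) * cos (u * l x) = w xs x * cos (u * l x)
      + (w xs x * cos (L x + u * l x) + w xs x * cos (L x - u * l x)) / 2"
      "w xs x * (1 + cos (L x)) * sin (u * l x) = w xs x * sin (u * l x)
      + (w xs x * sin (L x + u * l x) - w xs x * sin (L x - u * l x)) / 2" for x
      by (simp_all add: cos_add cos_diff sin_add sin_diff algebra_simps)
    show "(\<integral>x. w xs x * (1 + cos (L x)) * cos (u * l x) \<partial>M) = (\<integral>x. w xs x * (1 + cos (L x)) * cos (u * l x) \<partial>N)"
      unfolding pt using IH shift[OF L, of u] int1 by simp
    show "(\<integral>x. w xs x * (1 + cos (L x)) * sin (u * l x) \<partial>M) = (\<integral>x. w xs x * (1 + cos (L x)) * sin (u * l x) \<partial>N)"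
      unfolding pt using IH shift[OF L, of u] int1 by simp
  next
    fix x
    have c: "0 \<le> 1 + cos (L x)" "1 + cos (L x) \<le> 2" using cos_ge_minus_one[of "L x"] cos_le_one[of "L x"] by linarith+
    then show "0 \<le> w xs x * (1 + cos (L x))" using w01[of x] by simp
    show "w xs x * (1 + cos (L x)) \<le> 2" using mult_mono[of "w xs x" 1 "1 + cos (L x)" 2] c w01[of x] by simp
  qed (use l L meas wmeas in auto)
  have step_sin: "(\<integral>x. w xs x * (1 + sin (L x)) * indicator A (l x) \<partial>M) = (\<integral>x. w xs x * (1 + sin (L x)) * indicator A (l x) \<partial>N)"
    if L: "L \<in> \<Lambda>" for L
  proof (rule weighted_char_uniqueness[OF fin sets _ _ _ _ _ _ A, where K=2])
    fix u
    have pt: "w xs x * (1 + sin (L x)) * cos (u * l x) = w xs x * cos (u * l x)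
      + (w xs x * sin (L x + u * l x) + w xs x * sin (L x - u * l x)) / 2"
      "w xs x * (1 + sin (L x)) * sin (u * l x) = w xs x * sin (u * l x)
      + (w xs x * cos (L x - u * l x) - w xs x * cos (L x + u * l x)) / 2" for x
      by (simp_all add: cos_add cos_diff sin_add sin_diff algebra_simps)
    show "(\<integral>x. w xs x * (1 + sin (L x)) * cos (u * l x) \<partial>M) = (\<integral>x. w xs x * (1 + sin (L x)) * cos (u * l x) \<partial>N)"
      unfolding pt using IH shift[OF L, of u] int1 by simp
    show "(\<integral>x. w xs x * (1 + sin (L x)) * sin (u * l x) \<partial>M) = (\<integral>x. w xs x * (1 + sin (L x)) * sin (u * l x) \<partial>N)"
      unfolding pt using IH shift[OF L, of u] int1 by simp
  next
    fix x
    have c: "0 \<le> 1 + sin (L x)" "1 + sin (L x) \<le> 2" using sin_ge_minus_one[of "L x"] sin_le_one[of "L x"] by linarith+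
    then show "0 \<le> w xs x * (1 + sin (L x))" using w01[of x] by simp
    show "w xs x * (1 + sin (L x)) \<le> 2" using mult_mono[of "w xs x" 1 "1 + sin (L x)" 2] c w01[of x] by simp
  qed (use l L meas wmeas in auto)
  have iA: "(\<lambda>x. indicator A (l x) :: real) \<in> borel_measurable M" "(\<lambda>x. indicator A (l x) :: real) \<in> borel_measurable N"
    using meas[OF l] measN[OF l] A by auto
  have int2: "integrable P (\<lambda>x. w xs x * indicator A (l x))" "integrable P (\<lambda>x. w xs x * (cos (L x) * indicator A (l x)))"
    "integrable P (\<lambda>x. w xs x * (sin (L x) * indicator A (l x)))" if "P = M \<or> P = N" for P
    using that meas[OF Cons.prems(2)] measN[OF Cons.prems(2)] iA
    by (auto intro!: int simp: abs2 indicator_def)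
  have base: "(\<integral>x. w xs x * indicator A (l x) \<partial>M) = (\<integral>x. w xs x * indicator A (l x) \<partial>N)"
    using step_cos[OF zero] by (simp add: mult.commute mult.left_commute)
  have c: "w xs x * (1 + cos (L x)) * indicator A (l x) = w xs x * indicator A (l x) + w xs x * (cos (L x) * indicator A (l x))"
    "w xs x * (1 + sin (L x)) * indicator A (l x) = w xs x * indicator A (l x) + w xs x * (sin (L x) * indicator A (l x))"
    "w (a # xs) x * cos (L x) = w xs x * (cos (L x) * indicator A (l x))"
    "w (a # xs) x * sin (L x) = w xs x * (sin (L x) * indicator A (l x))" for x
    by (simp_all add: algebra_simps w_def a)
  show ?case
    using step_cos[OF Cons.prems(2)] step_sin[OF Cons.prems(2)] base unfolding c by (simp add: int2)
qed

definition cylinder_algebra :: "'e::real_normed_vector measure" where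
  "cylinder_algebra = sigma UNIV {L -` A | (L :: 'e \<Rightarrow> real) A. bounded_linear L \<and> A \<in> sets borel}"

lemma measurable_cylinder_algebra:
  assumes "bounded_linear (L :: 'e::real_normed_vector \<Rightarrow> real)"
  shows "L \<in> borel_measurable cylinder_algebra"
proof (rule measurableI)
  fix A :: "real set" assume "A \<in> sets borel"
  then show "L -` A \<inter> space cylinder_algebra \<in> sets cylinder_algebra"
    using assms by (auto simp: cylinder_algebra_def sets_measure_of space_measure_of_conv intro!: sigma_sets.Basic)
qed simp

text \<open>Events about finitely many functionals are closed under intersection and generate the
  Borel sets, so it is enough to compare their probabilities; this is the case \<open>L = 0\<close> of the previous
  lemma.\<close>

lemma law_eqI_char:
  fixes M N :: "'e::real_normed_vector measure"
  assumes M: "prob_space M" "sets M = sets borel" and N: "prob_space N" "sets N = sets borel"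
    and cyl: "sets (cylinder_algebra :: 'e measure) = sets borel"
    and char: "\<And>L. bounded_linear (L :: 'e \<Rightarrow> real) \<Longrightarrow> (CLINT z|M. iexp (L z)) = (CLINT z|N. iexp (L z))"
  shows "M = N"
proof -
  interpret M: prob_space M by fact
  interpret N: prob_space N by fact
  have space: "space M = UNIV" "space N = UNIV" using M(2) N(2) by (simp_all add: sets_eq_imp_space_eq)
  define \<Lambda> where "\<Lambda> = {L :: 'e \<Rightarrow> real. bounded_linear L}"
  have meas: "L \<in> borel_measurable M" "L \<in> borel_measurable N" if "L \<in> \<Lambda>" for L
    using measurable_cylinder_algebra[of L] that M(2) N(2) cyl
    by (auto simp: \<Lambda>_def cong: measurable_cong_sets)
  have int: "integrable P (\<lambda>z. iexp (L z))" if "L \<in> \<Lambda>" "P = M \<or> P = N" for L P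
    using that meas M.integrable_iexp N.integrable_iexp by auto
  have "(\<integral>x. cos (L x) \<partial>P) = Re (CLINT z|P. iexp (L z))" "(\<integral>x. sin (L x) \<partial>P) = Im (CLINT z|P. iexp (L z))"
    if "L \<in> \<Lambda>" "P = M \<or> P = N" for L P
    using integral_Re[OF int[OF that]] integral_Im[OF int[OF that]] by (simp_all add: Re_exp Im_exp)
  then have cs: "(\<integral>x. cos (L x) \<partial>M) = (\<integral>x. cos (L x) \<partial>N)" "(\<integral>x. sin (L x) \<partial>M) = (\<integral>x. sin (L x) \<partial>N)" if "L \<in> \<Lambda>" for L
    using that char[of L] by (auto simp: \<Lambda>_def)
  define cyls where "cyls = {{x. \<forall>(l, A)\<in>set xs. l x \<in> A} | xs. set xs \<subseteq> \<Lambda> \<times> sets borel}"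
  show ?thesis
  proof (rule measure_eqI_generator_eq[where E=cyls and \<Omega>=UNIV and A="\<lambda>_. UNIV"])
    show "Int_stable cyls"
    proof (rule Int_stableI)
      fix a b assume "a \<in> cyls" "b \<in> cyls"
      then obtain xs ys where "a = {x. \<forall>(l, A)\<in>set xs. l x \<in> A}" "set xs \<subseteq> \<Lambda> \<times> sets borel"
        "b = {x. \<forall>(l, A)\<in>set ys. l x \<in> A}" "set ys \<subseteq> \<Lambda> \<times> sets borel" by (auto simp: cyls_def)
      then show "a \<inter> b \<in> cyls"
        unfolding cyls_def by (intro CollectI exI[of _ "xs @ ys"]) auto
    qed
    have gen: "sets borel = sigma_sets UNIV cyls"
    proof
      have "{L -` A | (L :: 'e \<Rightarrow> real) A. bounded_linear L \<and> A \<in> sets borel} \<subseteq> cyls"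
      proof safe
        fix L :: "'e \<Rightarrow> real" and A :: "real set" assume "bounded_linear L" "A \<in> sets borel"
        then show "L -` A \<in> cyls"
          unfolding cyls_def by (intro CollectI exI[of _ "[(L, A)]"]) (auto simp: \<Lambda>_def)
      qed
      then show "sets borel \<subseteq> sigma_sets UNIV cyls"
        unfolding cyl[symmetric] by (simp add: cylinder_algebra_def sigma_sets_mono' sets_measure_of)
      have cyl_meas: "{x. \<forall>(l, A)\<in>set xs. l x \<in> A} \<in> sets M" if "set xs \<subseteq> \<Lambda> \<times> sets borel" for xs
        using that
      proof (induction xs)
        case Nil
        show ?case using sets.top[of M] by (simp add: space)
      next
        case (Cons a xs)
        obtain l A where a: "a = (l, A)" by (cases a)
        have "{x. \<forall>(l, A)\<in>set (a # xs). l x \<in> A} = (l -` A \<inter> space M) \<inter> {x. \<forall>(l, A)\<in>set xs. l x \<in> A}"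
          by (auto simp: a space)
        also have "\<dots> \<in> sets M"
          using Cons meas(1)[of l] by (intro sets.Int measurable_sets) (auto simp: a)
        finally show ?case .
      qed
      show "sigma_sets UNIV cyls \<subseteq> sets borel"
        using cyl_meas unfolding M(2)[symmetric] space(1)[symmetric]
        by (intro sets.sigma_sets_subset) (auto simp: cyls_def)
    qed
    then show "sets M = sigma_sets UNIV cyls" "sets N = sigma_sets UNIV cyls" using M(2) N(2) by simp_all
    fix a assume "a \<in> cyls"
    then obtain xs where a: "a = {x. \<forall>(l, A)\<in>set xs. l x \<in> A}" and xs: "set xs \<subseteq> \<Lambda> \<times> sets borel"
      by (auto simp: cyls_def)
    have ind: "(\<Prod>(l, A)\<leftarrow>xs. indicator A (l x) :: real) = indicator a x" for x
      unfolding a by (induction xs) (auto simp: indicator_def)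
    have "(\<integral>x. indicator a x * cos (0 :: real) \<partial>M) = (\<integral>x. indicator a x * cos (0 :: real) \<partial>N)"
      using cylinder_fourier_eq[of M N \<Lambda> xs "\<lambda>_. 0"] M(2) N(2) meas cs xs M.finite_measure_axioms N.finite_measure_axioms
      unfolding ind
      by (auto simp: \<Lambda>_def bounded_linear_zero bounded_linear_add bounded_linear_const_mult)
    then have "measure M a = measure N a" using space by simp
    then show "emeasure M a = emeasure N a" by (simp add: M.emeasure_eq_measure N.emeasure_eq_measure)
  next
    show "range (\<lambda>_. UNIV) \<subseteq> cyls" by (auto simp: cyls_def intro!: exI[of _ "[]"])
  qed auto
qed

lemma space_cylinder_algebra [simp]: "space cylinder_algebra = UNIV"
  by (simp add: cylinder_algebra_def space_measure_of_conv)

lemma cylinder_algebra_subset_borel: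
  "sets (cylinder_algebra :: 'e::real_normed_vector measure) \<subseteq> sets borel"
proof -
  have "L -` A \<in> sets borel" if "bounded_linear L" "A \<in> sets borel" for L :: "'e \<Rightarrow> real" and A
    using measurable_sets[OF borel_measurable_continuous_onI that(2), of L] that(1)
    by (simp add: linear_continuous_on)
  then show ?thesis
    unfolding cylinder_algebra_def
    by (subst sets_measure_of) (auto intro!: sets.sigma_sets_subset[of _ "borel", simplified])
qed

text \<open>Evaluations are continuous linear functionals, and a random function is measurable as
  soon as its evaluations are.\<close>

lemma cylinder_algebra_bcontfun_pair:
  "sets (cylinder_algebra :: (('t::compact_metric_space \<Rightarrow>\<^sub>C real) \<times> ('t \<Rightarrow>\<^sub>C real)) measure) = sets borel"
proof (rule antisym[OF cylinder_algebra_subset_borel])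
  let ?C = "cylinder_algebra :: (('t \<Rightarrow>\<^sub>C real) \<times> ('t \<Rightarrow>\<^sub>C real)) measure"
  have "fst \<in> borel_measurable ?C" "snd \<in> borel_measurable ?C"
    by (auto intro!: borel_measurable_bcontfunI measurable_cylinder_algebra
        bounded_linear_compose[OF bounded_linear_eval] bounded_linear_fst bounded_linear_snd)
  then have "(\<lambda>z. (fst z, snd z)) \<in> borel_measurable ?C" by measurable
  then have id: "(\<lambda>z. z) \<in> borel_measurable ?C" by simp
  show "sets borel \<subseteq> sets ?C"
    using measurable_sets[OF id] by auto
qed

section \<open>Normal laws and tail estimates\<close>

text \<open>Point masses are normal laws of variance zero, and the formula for the characteristic
  function in terms of mean and variance does not distinguish the two cases.\<close>

lemma normal_law_properties:
  assumes "normal_law N"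
  shows "integrable N (\<lambda>x. x\<^sup>2)" "integrable N (\<lambda>x. x)" "prob_space N"
    and "(CLINT x|N. iexp x) = iexp (\<integral>x. x \<partial>N) * of_real (exp (- (\<integral>x. (x - (\<integral>x. x \<partial>N))\<^sup>2 \<partial>N) / 2))"
proof -
  have "integrable N (\<lambda>x. x\<^sup>2) \<and> integrable N (\<lambda>x. x) \<and> prob_space N \<and>
    (CLINT x|N. iexp x) = iexp (\<integral>x. x \<partial>N) * of_real (exp (- (\<integral>x. (x - (\<integral>x. x \<partial>N))\<^sup>2 \<partial>N) / 2))"
    using assms unfolding normal_law_def
  proof (elim disjE exE conjE)
    fix \<mu> assume N: "N = return borel \<mu>"
    have "prob_space N" unfolding N by (rule prob_space_return) simp
    then interpret prob_space N .
    have *: "integrable N f" if "f \<in> borel_measurable borel" for f :: "real \<Rightarrow> real"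
    proof (rule integrable_const_bound[where B="\<bar>f \<mu>\<bar>"])
      show "AE x in N. norm (f x) \<le> \<bar>f \<mu>\<bar>" unfolding N using that by (subst AE_return) auto
    qed (use that in \<open>simp add: N\<close>)
    show ?thesis
    proof (intro conjI \<open>prob_space N\<close> *)
      have 1: "(\<integral>x. f x \<partial>N) = f \<mu>" if "f \<in> borel_measurable borel" for f :: "real \<Rightarrow> real"
        unfolding N using that by (simp add: integral_return)
      have "(CLINT x|N. iexp x) = iexp \<mu>"
        unfolding N by (simp add: integral_return)
      then show "(CLINT x|N. iexp x) = iexp (\<integral>x. x \<partial>N) * of_real (exp (- (\<integral>x. (x - (\<integral>x. x \<partial>N))\<^sup>2 \<partial>N) / 2))"
        using 1[of "\<lambda>x. x"] 1[of "\<lambda>x. (x - \<mu>)\<^sup>2"] by simp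
    qed simp_all
  next
    fix \<mu> \<sigma> :: real assume \<sigma>: "\<sigma> > 0" and N: "N = density lborel (normal_density \<mu> \<sigma>)"
    define S where "S = std_normal_distribution"
    interpret S: real_distribution S unfolding S_def by (rule real_dist_normal_dist)
    have "distributed S lborel (\<lambda>x. x) (normal_density 0 1)"
      by (simp add: distributed_def distr_id2 S_def)
    from S.normal_density_affine[OF this, of \<sigma> \<mu>] \<sigma>
    have "distributed S lborel (\<lambda>x. \<mu> + \<sigma> * x) (normal_density \<mu> \<sigma>)" by simp
    then have "distr S lborel (\<lambda>x. \<mu> + \<sigma> * x) = N" by (simp add: distributed_def N)
    then have N': "N = distr S borel (\<lambda>x. \<mu> + \<sigma> * x)"
      by (metis distr_cong sets_lborel)
    have m: "integrable S (\<lambda>x. x)" "integrable S (\<lambda>x. x\<^sup>2)" "(\<integral>x. x \<partial>S) = 0" "(\<integral>x. x\<^sup>2 \<partial>S) = 1"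
      using integrable_std_normal_distribution_moment[of 1] integrable_std_normal_distribution_moment[of 2]
        integral_std_normal_distribution_moment_odd[of 1] std_normal_distribution_even_moments(1)[of 1] by (simp_all add: S_def)
    have sq: "(\<mu> + \<sigma> * x)\<^sup>2 = \<mu>\<^sup>2 + 2 * \<mu> * \<sigma> * x + \<sigma>\<^sup>2 * x\<^sup>2" for x
      by (simp add: power2_eq_square algebra_simps)
    have aff: "(\<lambda>x. \<mu> + \<sigma> * x) \<in> borel_measurable S" by (simp add: S_def)
    have "prob_space N" unfolding N' by (rule S.prob_space_distr) simp
    moreover have "integrable N (\<lambda>x. x\<^sup>2)"
    proof -
      have "integrable S (\<lambda>x. (\<mu> + \<sigma> * x)\<^sup>2)"
        unfolding sq
        by (intro Bochner_Integration.integrable_add integrable_mult_right m S.integrable_const)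
      then show ?thesis unfolding N' by (subst integrable_distr_eq[OF aff]) auto
    qed
    moreover have "integrable N (\<lambda>x. x)"
    proof -
      have "integrable S (\<lambda>x. \<mu> + \<sigma> * x)"
        by (intro Bochner_Integration.integrable_add integrable_mult_right m S.integrable_const)
      then show ?thesis unfolding N' by (subst integrable_distr_eq[OF aff]) auto
    qed
    moreover have mean: "(\<integral>x. x \<partial>N) = \<mu>"
    proof -
      have "(\<integral>x. x \<partial>N) = (\<integral>x. \<mu> + \<sigma> * x \<partial>S)"
        unfolding N' by (rule integral_distr[OF aff]) simp
      also have "\<dots> = (\<integral>x. \<mu> \<partial>S) + (\<integral>x. \<sigma> * x \<partial>S)"
        by (intro Bochner_Integration.integral_add integrable_mult_right m S.integrable_const)
      also have "(\<integral>x. \<sigma> * x \<partial>S) = \<sigma> * 0" unfolding integral_mult_right_zero m(3) ..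
      also have "(\<integral>x. \<mu> \<partial>S) = \<mu>" using S.prob_space by simp
      finally show ?thesis by simp
    qed
    moreover have "(\<integral>x. (x - \<mu>)\<^sup>2 \<partial>N) = \<sigma>\<^sup>2"
    proof -
      have "(\<integral>x. (x - \<mu>)\<^sup>2 \<partial>N) = (\<integral>x. (\<mu> + \<sigma> * x - \<mu>)\<^sup>2 \<partial>S)"
        unfolding N' by (rule integral_distr[OF aff]) simp
      also have "\<dots> = (\<integral>x. \<sigma>\<^sup>2 * x\<^sup>2 \<partial>S)" by (simp add: power_mult_distrib)
      also have "\<dots> = \<sigma>\<^sup>2 * 1" unfolding integral_mult_right_zero m(4) ..
      finally show ?thesis by simp
    qed
    moreover have "(CLINT x|N. iexp x) = iexp \<mu> * of_real (exp (- (\<sigma>\<^sup>2) / 2))"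
    proof -
      have "(CLINT x|N. iexp x) = (CLINT x|S. iexp \<mu> * iexp (\<sigma> * x))"
        unfolding N' by (subst integral_distr) (auto simp: distrib_left exp_add)
      also have "\<dots> = iexp \<mu> * char S \<sigma>" by (simp add: char_def)
      finally show ?thesis by (simp add: char_std_normal_distribution S_def)
    qed
    ultimately show ?thesis by simp
  qed
  then show "integrable N (\<lambda>x. x\<^sup>2)" "integrable N (\<lambda>x. x)" "prob_space N"
    and "(CLINT x|N. iexp x) = iexp (\<integral>x. x \<partial>N) * of_real (exp (- (\<integral>x. (x - (\<integral>x. x \<partial>N))\<^sup>2 \<partial>N) / 2))"
    by auto
qed

lemma gaussian_functional:
  fixes L :: "'e::real_normed_vector \<Rightarrow> real"
  assumes "gaussian M G" and L: "bounded_linear L"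
  shows "(\<lambda>\<omega>. L (G \<omega>)) \<in> borel_measurable M"
    and "integrable M (\<lambda>\<omega>. L (G \<omega>))" "integrable M (\<lambda>\<omega>. (L (G \<omega>))\<^sup>2)"
    and "(CLINT \<omega>|M. iexp (L (G \<omega>))) = iexp (\<integral>\<omega>. L (G \<omega>) \<partial>M)
      * of_real (exp (- (\<integral>\<omega>. (L (G \<omega>) - (\<integral>\<omega>. L (G \<omega>) \<partial>M))\<^sup>2 \<partial>M) / 2))"
proof -
  have *: "normal_law (distr M borel (\<lambda>\<omega>. L (G \<omega>)))" and
    meas [measurable]: "(\<lambda>\<omega>. L (G \<omega>)) \<in> borel_measurable M" using assms unfolding gaussian_def by blast+
  show "(\<lambda>\<omega>. L (G \<omega>)) \<in> borel_measurable M" by (rule meas)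
  show "integrable M (\<lambda>\<omega>. L (G \<omega>))" "integrable M (\<lambda>\<omega>. (L (G \<omega>))\<^sup>2)"
    using integrable_distr[OF meas normal_law_properties(2)[OF *]]
      integrable_distr[OF meas normal_law_properties(1)[OF *]] by simp_all
  show "(CLINT \<omega>|M. iexp (L (G \<omega>))) = iexp (\<integral>\<omega>. L (G \<omega>) \<partial>M)
      * of_real (exp (- (\<integral>\<omega>. (L (G \<omega>) - (\<integral>\<omega>. L (G \<omega>) \<partial>M))\<^sup>2 \<partial>M) / 2))"
    using normal_law_properties(4)[OF *] by (simp add: integral_distr[OF meas])
qed

lemma prod_integral_mult:
  fixes f :: "'a \<Rightarrow> complex" and g :: "'b \<Rightarrow> complex"
  assumes "prob_space M" "prob_space N"
    and [measurable]: "f \<in> borel_measurable M" "g \<in> borel_measurable N"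
    and bnd: "\<And>x. norm (f x) \<le> 1" "\<And>x. norm (g x) \<le> 1"
  shows "(\<integral>(x, y). f x * g y \<partial>(M \<Otimes>\<^sub>M N)) = (\<integral>x. f x \<partial>M) * (\<integral>y. g y \<partial>N)"
proof -
  interpret M: prob_space M by fact
  interpret N: prob_space N by fact
  interpret MN: pair_prob_space M N ..
  have int: "integrable (M \<Otimes>\<^sub>M N) (\<lambda>(x, y). f x * g y)"
  proof (rule MN.integrable_const_bound[where B=1])
    show "AE z in M \<Otimes>\<^sub>M N. norm (case z of (x, y) \<Rightarrow> f x * g y) \<le> 1"
      using mult_mono[OF bnd(1) bnd(2)] by (auto simp: norm_mult)
  qed measurable
  have "(\<integral>(x, y). f x * g y \<partial>(M \<Otimes>\<^sub>M N)) = (\<integral>x. (\<integral>y. f x * g y \<partial>N) \<partial>M)"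
    using MN.integral_fst'[OF int] by simp
  then show ?thesis by simp
qed

text \<open>The tail estimate behind Fernique's theorem. Suppose that rotating two independent copies
  by 45 degrees does not change their joint law. If one rotated coordinate is large while the other
  one is moderate, then both copies are large; hence doubling the level roughly squares the tail.\<close>

lemma rotation_invariant_third_moment:
  fixes \<kappa> :: "'e::{real_normed_vector, second_countable_topology} measure"
  assumes \<kappa>: "prob_space \<kappa>" "sets \<kappa> = sets borel"
    and rot: "distr (\<kappa> \<Otimes>\<^sub>M \<kappa>) borel (\<lambda>(x, y). ((x + y) /\<^sub>R sqrt 2, (x - y) /\<^sub>R sqrt 2)) = \<kappa> \<Otimes>\<^sub>M \<kappa>"
  shows "integrable \<kappa> (\<lambda>x. norm x ^ 3)"
proof -
  interpret prob_space \<kappa> by fact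
  interpret KK: pair_prob_space \<kappa> \<kappa> ..
  note [measurable_cong] = \<kappa>(2)
  have space [simp]: "space \<kappa> = UNIV" using \<kappa>(2) by (simp add: sets_eq_imp_space_eq)
  define p where "p t = prob {x. norm x > t}" for t
  have pset [measurable]: "{x. norm x > t} \<in> sets \<kappa>" "{x. norm x \<le> t} \<in> sets \<kappa>" for t
    by (simp_all add: \<kappa>(2))
  have times: "measure (\<kappa> \<Otimes>\<^sub>M \<kappa>) (A \<times> B) = prob A * prob B" if "A \<in> sets \<kappa>" "B \<in> sets \<kappa>" for A B
    using emeasure_pair_measure_Times[OF that] by (simp add: measure_def enn2real_mult)
  have p_nonneg: "p t \<ge> 0" for t by (simp add: p_def)
  have p_mono: "p t \<le> p s" if "s \<le> t" for s t
    unfolding p_def using that by (intro finite_measure_mono) auto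
  have p_lim: "((\<lambda>n. p (real n)) \<longlongrightarrow> 0) sequentially"
  proof -
    have "(\<lambda>n. prob {x. norm x > real n}) \<longlonglongrightarrow> prob (\<Inter>n. {x. norm x > real n})"
      by (rule finite_Lim_measure_decseq) (auto simp: decseq_def \<kappa>(2))
    moreover have "(\<Inter>n. {x :: 'e. norm x > real n}) = {}"
      by auto (metis less_asym reals_Archimedean2)
    ultimately show ?thesis by (simp add: p_def)
  qed
  have "\<forall>\<^sub>F n in sequentially. p (real n) < 1 / 2" "\<forall>\<^sub>F n in sequentially. p (real n) < 1 / 32"
    by (rule order_tendstoD(2)[OF p_lim], simp)+
  then obtain n0 n1 where n0: "p (real n0) < 1 / 2" and n1: "p (real n1) < 1 / 32"
    using eventually_happens'[OF sequentially_bot] by blast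
  \<comment> \<open>beyond \<open>u0\<close> the tail is below \<open>1 / 32\<close>, so each doubling of the level divides it by \<open>16\<close>, which beats the growth of the cubed level by the factor \<open>8\<close>\<close>
  define s u0 where "s = real n0" and "u0 = max (real n1) (2 * s + 1)"
  have s: "s \<ge> 0" "p s < 1 / 2" and u0: "u0 \<ge> 2 * s" "u0 \<ge> 1" "p u0 < 1 / 32"
    using n0 p_mono[of "real n1" u0] n1 by (auto simp: s_def u0_def)
  have doubling: "p (2 * u) \<le> 2 * (p u * p u)" if u: "u \<ge> 2 * s" for u
  proof -
    have "(1 - p s) * p (2 * u) = measure \<kappa> {x. norm x > 2 * u} * measure \<kappa> {x. norm x \<le> s}"
    proof -
      have "measure \<kappa> {x. norm x \<le> s} = 1 - p s"
        using prob_compl[of "{x. norm x > s}"] by (simp add: p_def not_less Compl_eq_Diff_UNIV[symmetric] Collect_neg_eq[symmetric])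
      then show ?thesis by (simp add: p_def)
    qed
    also have "\<dots> = measure (\<kappa> \<Otimes>\<^sub>M \<kappa>) ({x. norm x > 2 * u} \<times> {x. norm x \<le> s})"
      by (simp add: times)
    also have "\<dots> = measure (distr (\<kappa> \<Otimes>\<^sub>M \<kappa>) borel (\<lambda>(x, y). ((x + y) /\<^sub>R sqrt 2, (x - y) /\<^sub>R sqrt 2)))
        ({x. norm x > 2 * u} \<times> {x. norm x \<le> s})"
      by (simp add: rot)
    also have "\<dots> = measure (\<kappa> \<Otimes>\<^sub>M \<kappa>) ((\<lambda>(x, y). ((x + y) /\<^sub>R sqrt 2, (x - y) /\<^sub>R sqrt 2)) -`
        ({x. norm x > 2 * u} \<times> {x. norm x \<le> s}) \<inter> space (\<kappa> \<Otimes>\<^sub>M \<kappa>))"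
      by (rule measure_distr) (auto simp: borel_prod[symmetric])
    also have "\<dots> \<le> measure (\<kappa> \<Otimes>\<^sub>M \<kappa>) ({x. norm x > u} \<times> {x. norm x > u})"
    proof (rule KK.finite_measure_mono)
      show "(\<lambda>(x, y). ((x + y) /\<^sub>R sqrt 2, (x - y) /\<^sub>R sqrt 2)) -` ({x. norm x > 2 * u} \<times> {x. norm x \<le> s}) \<inter> space (\<kappa> \<Otimes>\<^sub>M \<kappa>)
        \<subseteq> {x. norm x > u} \<times> {x. norm x > u}"
      proof
        fix q :: "'e \<times> 'e"
        assume q: "q \<in> (\<lambda>(x, y). ((x + y) /\<^sub>R sqrt 2, (x - y) /\<^sub>R sqrt 2)) -` ({x. norm x > 2 * u} \<times> {x. norm x \<le> s}) \<inter> space (\<kappa> \<Otimes>\<^sub>M \<kappa>)"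
        obtain x y where xy: "q = (x, y)" by (cases q)
        have a: "2 * u < norm (x + y) / sqrt 2" and b: "norm (x - y) / sqrt 2 \<le> s"
          using q by (simp_all add: xy divide_inverse mult.commute)
        have a': "2 * u * sqrt 2 < norm (x + y)" and b': "norm (x - y) \<le> s * sqrt 2"
          using a b by (simp_all add: less_divide_eq divide_le_eq)
        have "norm (x + y) - norm (x - y) \<le> 2 * norm x"
        proof -
          have "(x + y) = 2 *\<^sub>R x - (x - y)" by (simp add: scaleR_2)
          then have "norm (x + y) \<le> norm (2 *\<^sub>R x) + norm (x - y)" by (metis norm_triangle_ineq4)
          then show ?thesis by simp
        qed
        moreover have "norm (x + y) - norm (x - y) \<le> 2 * norm y"
        proof -
          have "(x + y) = 2 *\<^sub>R y + (x - y)" by (simp add: scaleR_2)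
          then have "norm (x + y) \<le> norm (2 *\<^sub>R y) + norm (x - y)" by (metis norm_triangle_ineq)
          then show ?thesis by simp
        qed
        moreover have "2 * u \<le> 2 * u * sqrt 2 - s * sqrt 2"
        proof -
          have "2 * u * sqrt 2 - s * sqrt 2 - 2 * u \<ge> 2 * u * sqrt 2 - (u / 2) * sqrt 2 - 2 * u"
            using u by (simp add: mult_right_mono)
          also have "2 * u * sqrt 2 - (u / 2) * sqrt 2 - 2 * u = u * (3 / 2 * sqrt 2 - 2)" by (simp add: algebra_simps)
          moreover have "3 / 2 * sqrt 2 \<ge> (2 :: real)"
            using real_le_rsqrt[of "4 / 3" 2] by (simp add: power2_eq_square)
          moreover have "u \<ge> 0" using u s by simp
          ultimately show ?thesis by (smt (verit) mult_nonneg_nonneg)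
        qed
        ultimately have "u < norm x \<and> u < norm y" using a' b' by linarith
        then show "q \<in> {x. norm x > u} \<times> {x. norm x > u}" by (simp add: xy)
      qed
    qed (auto simp: \<kappa>(2))
    also have "\<dots> = p u * p u" by (simp add: times p_def)
    finally have "(1 - p s) * p (2 * u) \<le> p u * p u" .
    moreover have "1 / 2 * p (2 * u) \<le> (1 - p s) * p (2 * u)"
      using s p_nonneg[of "2 * u"] by (intro mult_right_mono) auto
    ultimately show ?thesis by simp
  qed
  have geo: "p (2 ^ n * u0) \<le> (1 / 16) ^ n" for n
  proof (induction n)
    case 0
    show ?case using u0 by simp
  next
    case (Suc n)
    have ge: "u0 \<le> 2 ^ n * u0" using u0 by simp
    then have le: "p (2 ^ n * u0) \<le> 1 / 32" using p_mono[OF ge] u0 by simp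
    have "p (2 ^ Suc n * u0) \<le> 2 * (p (2 ^ n * u0) * p (2 ^ n * u0))"
      using doubling[OF order_trans[OF u0(1) ge]] by (simp add: mult_ac)
    also have "\<dots> \<le> 2 * ((1 / 16) ^ n * (1 / 32))"
      using Suc.IH le p_nonneg by (intro mult_left_mono mult_mono) auto
    finally show ?case by simp
  qed
  let ?f = "\<lambda>n x. ennreal ((2 ^ Suc n * u0) ^ 3) * indicator {x. norm x > 2 ^ n * u0} x"
  have pt: "ennreal (norm x ^ 3) \<le> ennreal (u0 ^ 3) + (\<Sum>n. ?f n x)" for x :: 'e
  proof (cases "norm x \<le> u0")
    case True
    then have "ennreal (norm x ^ 3) \<le> ennreal (u0 ^ 3)" by (intro ennreal_leI power_mono) simp_all
    then show ?thesis by (rule order_trans) simp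
  next
    case False
    obtain k :: nat where k: "norm x / u0 < 2 ^ k" using real_arch_pow[of 2 "norm x / u0"] by auto
    define n where "n = (LEAST n. norm x \<le> 2 ^ n * u0)"
    have ex: "norm x \<le> 2 ^ k * u0" using k u0 by (simp add: divide_less_eq)
    have n: "norm x \<le> 2 ^ n * u0" unfolding n_def using ex by (rule LeastI)
    have "n \<noteq> 0" using n False by (cases n) auto
    then obtain j where j: "n = Suc j" by (cases n) auto
    have "norm x > 2 ^ j * u0" using not_less_Least[of j "\<lambda>n. norm x \<le> 2 ^ n * u0"] j by (simp add: n_def)
    then have "ennreal (norm x ^ 3) \<le> ?f j x"
      using power_mono[OF n, of 3] j by (simp add: ennreal_leI)
    also have "\<dots> \<le> (\<Sum>n. ?f n x)"
    proof -
      have "g j \<le> (\<Sum>n. g n)" for g :: "nat \<Rightarrow> ennreal"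
        using sum_le_suminf[of g "{j}"] by simp
      then show ?thesis .
    qed
    finally show ?thesis by (simp add: add_increasing)
  qed
  have "(\<integral>\<^sup>+x. ennreal (norm x ^ 3) \<partial>\<kappa>) \<le> (\<integral>\<^sup>+x. ennreal (u0 ^ 3) + (\<Sum>n. ?f n x) \<partial>\<kappa>)"
    by (intro nn_integral_mono pt)
  also have "\<dots> = ennreal (u0 ^ 3) + (\<Sum>n. ennreal ((2 ^ Suc n * u0) ^ 3) * emeasure \<kappa> {x. norm x > 2 ^ n * u0})"
    by (simp add: nn_integral_add nn_integral_suminf nn_integral_cmult emeasure_space_1[simplified])
  also have "\<dots> \<le> ennreal (u0 ^ 3) + (\<Sum>n. ennreal (8 * u0 ^ 3 * (1 / 2) ^ n))"
  proof (intro add_left_mono suminf_le)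
    fix n
    have "(2 ^ Suc n * u0) ^ 3 * p (2 ^ n * u0) \<le> (2 ^ Suc n * u0) ^ 3 * (1 / 16) ^ n"
      using geo[of n] u0 by (intro mult_left_mono) auto
    also have "\<dots> = 8 * u0 ^ 3 * ((2 ^ n) ^ 3 * (1 / 16) ^ n)" by (simp add: power_mult_distrib)
    also have "(2 ^ n) ^ 3 * (1 / 16) ^ n = (1 / 2 :: real) ^ n"
    proof -
      have "(2 ^ n) ^ 3 = (8 :: real) ^ n" by (simp add: power_mult[symmetric] mult.commute[of n] power_mult)
      then show ?thesis by (simp add: power_mult_distrib[symmetric])
    qed
    finally show "ennreal ((2 ^ Suc n * u0) ^ 3) * emeasure \<kappa> {x. norm x > 2 ^ n * u0} \<le> ennreal (8 * u0 ^ 3 * (1 / 2) ^ n)"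
      using u0 by (simp add: emeasure_eq_measure p_def ennreal_mult'[symmetric] ennreal_leI)
  qed auto
  also have "\<dots> < \<infinity>"
  proof -
    have "summable (\<lambda>n. 8 * u0 ^ 3 * (1 / 2 :: real) ^ n)"
      by (intro summable_mult summable_geometric) simp
    then have "(\<Sum>n. ennreal (8 * u0 ^ 3 * (1 / 2) ^ n)) = ennreal (\<Sum>n. 8 * u0 ^ 3 * (1 / 2) ^ n)"
      using u0 by (intro suminf_ennreal2) auto
    then show ?thesis by (simp add: ennreal_add_eq_top less_top)
  qed
  finally show ?thesis
    by (intro integrableI_bounded) auto
qed

section \<open>Gaussian laws on C(T)\<close>

text \<open>The characteristic functional of a centered Gaussian law is determined by the variances of
  the continuous linear functionals. This form suits
  stability, where characteristic functionals multiply and variances add up.\<close>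

definition centered_gaussian_law :: "'e::real_normed_vector measure \<Rightarrow> bool" where
  "centered_gaussian_law \<mu> \<longleftrightarrow> prob_space \<mu> \<and> sets \<mu> = sets borel \<and>
     (\<forall>L :: 'e \<Rightarrow> real. bounded_linear L \<longrightarrow>
        (CLINT z|\<mu>. iexp (L z)) = of_real (exp (- (\<integral>z. (L z)\<^sup>2 \<partial>\<mu>) / 2)))"

lemma borel_measurable_bounded_linear:
  fixes L :: "'e::real_normed_vector \<Rightarrow> 'f::real_normed_vector"
  shows "bounded_linear L \<Longrightarrow> L \<in> borel_measurable borel"
  by (intro borel_measurable_continuous_onI linear_continuous_on)

lemma gaussian_centered_law:
  fixes G :: "'w \<Rightarrow> 'e::{banach, second_countable_topology}"
  assumes M: "prob_space M" and G: "gaussian M G" and int: "integrable M G"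
  shows "centered_gaussian_law (distr M borel (\<lambda>\<omega>. G \<omega> - (\<integral>\<omega>. G \<omega> \<partial>M)))"
  unfolding centered_gaussian_law_def
proof (intro conjI allI impI)
  interpret prob_space M by fact
  define m where "m = (\<integral>\<omega>. G \<omega> \<partial>M)"
  have Gm [measurable]: "(\<lambda>\<omega>. G \<omega> - m) \<in> borel_measurable M" using int by auto
  show "prob_space (distr M borel (\<lambda>\<omega>. G \<omega> - (\<integral>\<omega>. G \<omega> \<partial>M)))"
    using Gm unfolding m_def by (rule prob_space_distr)
  fix L :: "'e \<Rightarrow> real" assume L: "bounded_linear L"
  have [measurable]: "L \<in> borel_measurable borel" by (rule borel_measurable_bounded_linear[OF L])
  have mean: "(\<integral>\<omega>. L (G \<omega>) \<partial>M) = L m"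
    unfolding m_def by (rule integral_bounded_linear[OF L int])
  have diff: "L (G \<omega> - m) = L (G \<omega>) - L m" for \<omega>
    by (rule linear_diff[OF bounded_linear.linear[OF L]])
  have "(CLINT \<omega>|M. iexp (L (G \<omega> - m))) = (CLINT \<omega>|M. iexp (L (G \<omega>)) * iexp (- L m))"
    by (simp add: diff algebra_simps flip: exp_add)
  also have "\<dots> = iexp (L m) * of_real (exp (- (\<integral>\<omega>. (L (G \<omega> - m))\<^sup>2 \<partial>M) / 2)) * iexp (- L m)"
    using gaussian_functional(4)[OF G L] by (simp add: mean diff)
  also have "\<dots> = of_real (exp (- (\<integral>\<omega>. (L (G \<omega> - m))\<^sup>2 \<partial>M) / 2))"
    by (simp add: exp_minus)
  finally show "(CLINT z|distr M borel (\<lambda>\<omega>. G \<omega> - (\<integral>\<omega>. G \<omega> \<partial>M)). iexp (L z))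
    = of_real (exp (- (\<integral>z. (L z)\<^sup>2 \<partial>distr M borel (\<lambda>\<omega>. G \<omega> - (\<integral>\<omega>. G \<omega> \<partial>M))) / 2))"
    unfolding m_def[symmetric] by (simp add: integral_distr)
qed simp

lemma gaussian_measurable:
  fixes G :: "'w \<Rightarrow> 't::compact_metric_space \<Rightarrow>\<^sub>C real"
  assumes "gaussian M G"
  shows "G \<in> borel_measurable M"
  using gaussian_functional(1)[OF assms bounded_linear_eval] by (rule borel_measurable_bcontfunI)

text \<open>Fernique's theorem, as far as it is needed. The difference of two independent copies has a
  rotation invariant law, so it has a third moment. By Fubini so does \<open>G\<close> minus one of its values.
  The symmetrisation avoids the mean of \<open>G\<close>, which is not yet known to be a continuous function.\<close>

lemma gaussian_third_moment:
  fixes G :: "'w \<Rightarrow> 't::compact_metric_space \<Rightarrow>\<^sub>C real"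
  assumes M: "prob_space M" and G: "gaussian M G"
  shows "integrable M (\<lambda>\<omega>. norm (G \<omega>) ^ 3)"
proof -
  interpret prob_space M by fact
  interpret MM: pair_prob_space M M ..
  have Gm [measurable]: "G \<in> borel_measurable M" by (rule gaussian_measurable[OF G])
  define c where "c L \<omega> = L (G \<omega>) - (\<integral>\<omega>. L (G \<omega>) \<partial>M)" for L :: "('t \<Rightarrow>\<^sub>C real) \<Rightarrow> real" and \<omega>
  define q where "q L = (\<integral>\<omega>. (c L \<omega>)\<^sup>2 \<partial>M)" for L
  have csq: "integrable M (\<lambda>\<omega>. (c L \<omega>)\<^sup>2)" if "bounded_linear L" for L
    unfolding c_def power2_diff
    using gaussian_functional(2,3)[OF G that] by simp
  define \<kappa> where "\<kappa> = distr (M \<Otimes>\<^sub>M M) borel (\<lambda>(\<omega>, \<omega>'). G \<omega> - G \<omega>')"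
  have prob: "prob_space \<kappa>" unfolding \<kappa>_def by (rule MM.prob_space_distr) measurable
  interpret K: prob_space \<kappa> by fact
  interpret KK: pair_prob_space \<kappa> \<kappa> ..
  have sets: "sets \<kappa> = sets borel" by (simp add: \<kappa>_def)
  note [measurable_cong] = sets
  have char: "(CLINT z|\<kappa>. iexp (L z)) = of_real (exp (- q L))" if L: "bounded_linear L" for L
  proof -
    have [measurable]: "L \<in> borel_measurable borel" by (rule borel_measurable_bounded_linear[OF L])
    have L': "bounded_linear (\<lambda>z. - L z)" using L by (rule bounded_linear_minus)
    have "(CLINT z|\<kappa>. iexp (L z)) = (\<integral>(\<omega>, \<omega>'). iexp (L (G \<omega>)) * iexp (- L (G \<omega>')) \<partial>(M \<Otimes>\<^sub>M M))"
      unfolding \<kappa>_def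
      by (subst integral_distr)
        (auto simp: case_prod_beta' linear_diff[OF bounded_linear.linear[OF L]] algebra_simps simp flip: exp_add)
    also have "\<dots> = (CLINT \<omega>|M. iexp (L (G \<omega>))) * (CLINT \<omega>|M. iexp (- L (G \<omega>)))"
      by (rule prod_integral_mult) (auto intro: M)
    also have "\<dots> = (iexp (\<integral>\<omega>. L (G \<omega>) \<partial>M) * of_real (exp (- q L / 2))) * (iexp (- (\<integral>\<omega>. L (G \<omega>) \<partial>M)) * of_real (exp (- q L / 2)))"
    proof -
      have "(c (\<lambda>z. - L z) \<omega>)\<^sup>2 = (c L \<omega>)\<^sup>2" for \<omega> by (simp add: c_def power2_eq_square algebra_simps)
      then have "q (\<lambda>z. - L z) = q L" by (simp add: q_def)
      then show ?thesis
        using gaussian_functional(4)[OF G L] gaussian_functional(4)[OF G L'] by (simp add: q_def c_def)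
    qed
    also have "\<dots> = of_real (exp (- q L / 2)) * of_real (exp (- q L / 2))"
      by (simp add: exp_minus)
    also have "\<dots> = of_real (exp (- q L))" by (simp flip: of_real_mult exp_add)
    finally show ?thesis .
  qed
  have "distr (\<kappa> \<Otimes>\<^sub>M \<kappa>) borel (\<lambda>(x, y). ((x + y) /\<^sub>R sqrt 2, (x - y) /\<^sub>R sqrt 2)) = \<kappa> \<Otimes>\<^sub>M \<kappa>"
  proof (rule law_eqI_char[OF _ _ _ _ cylinder_algebra_bcontfun_pair])
    have Rm [measurable]: "(\<lambda>(x, y). ((x + y) /\<^sub>R sqrt 2, (x - y) /\<^sub>R sqrt 2)) \<in> borel_measurable (\<kappa> \<Otimes>\<^sub>M \<kappa>)"
      by (simp add: borel_prod[symmetric])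
    then show "prob_space (distr (\<kappa> \<Otimes>\<^sub>M \<kappa>) borel (\<lambda>(x, y). ((x + y) /\<^sub>R sqrt 2, (x - y) /\<^sub>R sqrt 2)))"
      by (rule KK.prob_space_distr)
    show "prob_space (\<kappa> \<Otimes>\<^sub>M \<kappa>)" by (rule KK.prob_space_axioms)
    show "sets (\<kappa> \<Otimes>\<^sub>M \<kappa>) = sets borel"
      using sets_pair_measure_cong[OF sets sets] unfolding borel_prod .
    fix L :: "('t \<Rightarrow>\<^sub>C real) \<times> ('t \<Rightarrow>\<^sub>C real) \<Rightarrow> real" assume L: "bounded_linear L"
    have [measurable]: "L \<in> borel_measurable (borel \<Otimes>\<^sub>M borel)"
      using borel_measurable_bounded_linear[OF L] by (simp add: borel_prod)
    define L1 L2 where "L1 x = L (x, 0)" and "L2 y = L (0, y)" for x y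
    have bl: "bounded_linear L1" "bounded_linear L2"
      unfolding L1_def L2_def
      by (auto intro!: bounded_linear_compose[OF L] bounded_linear_Pair bounded_linear_ident bounded_linear_zero)
    have Lsum: "L (x, y) = L1 x + L2 y" for x y
      unfolding L1_def L2_def by (simp flip: linear_add[OF bounded_linear.linear[OF L]])
    \<comment> \<open>the functional seen from the two copies before the rotation; the parallelogram law preserves the total variance\<close>
    define A B where "A x = (L1 x + L2 x) / sqrt 2" and "B x = (L1 x - L2 x) / sqrt 2" for x
    have blAB: "bounded_linear A" "bounded_linear B"
      unfolding A_def B_def divide_inverse
      by (auto intro!: bounded_linear_mult_left[THEN bounded_linear_compose] bounded_linear_add bounded_linear_sub bl)
    have [measurable]: "A \<in> borel_measurable borel" "B \<in> borel_measurable borel"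
      "L1 \<in> borel_measurable borel" "L2 \<in> borel_measurable borel"
      using blAB bl by (auto intro: borel_measurable_bounded_linear)
    have rot: "L ((x + y) /\<^sub>R sqrt 2, (x - y) /\<^sub>R sqrt 2) = A x + B y" for x y
      unfolding Lsum A_def B_def
      using bl[THEN bounded_linear.linear]
      by (simp add: linear_add linear_diff linear_scale divide_inverse algebra_simps)
    have sq2: "(a / sqrt 2)\<^sup>2 = a\<^sup>2 / 2" for a by (simp add: power_divide)
    have cAB: "(c A \<omega>)\<^sup>2 + (c B \<omega>)\<^sup>2 = (c L1 \<omega>)\<^sup>2 + (c L2 \<omega>)\<^sup>2" for \<omega>
    proof -
      have "c A \<omega> = (c L1 \<omega> + c L2 \<omega>) / sqrt 2" "c B \<omega> = (c L1 \<omega> - c L2 \<omega>) / sqrt 2"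
        unfolding c_def A_def B_def using gaussian_functional(2)[OF G bl(1)] gaussian_functional(2)[OF G bl(2)]
        by (simp_all add: add_divide_distrib diff_divide_distrib)
      then show ?thesis by (simp add: sq2) (simp add: power2_eq_square field_simps)
    qed
    have qAB: "q A + q B = q L1 + q L2"
      unfolding q_def using csq blAB bl cAB by (simp flip: Bochner_Integration.integral_add)
    have "(CLINT z|distr (\<kappa> \<Otimes>\<^sub>M \<kappa>) borel (\<lambda>(x, y). ((x + y) /\<^sub>R sqrt 2, (x - y) /\<^sub>R sqrt 2)). iexp (L z))
      = (\<integral>z. iexp (L (case z of (x, y) \<Rightarrow> ((x + y) /\<^sub>R sqrt 2, (x - y) /\<^sub>R sqrt 2))) \<partial>(\<kappa> \<Otimes>\<^sub>M \<kappa>))"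
      using Rm by (rule integral_distr) (simp add: borel_prod[symmetric])
    also have "\<dots> = (\<integral>(x, y). iexp (A x) * iexp (B y) \<partial>(\<kappa> \<Otimes>\<^sub>M \<kappa>))"
      by (rule Bochner_Integration.integral_cong[OF refl])
        (simp only: case_prod_beta' rot of_real_add distrib_left exp_add)
    also have "\<dots> = of_real (exp (- (q A + q B)))"
      by (subst prod_integral_mult) (auto simp: char[OF blAB(1)] char[OF blAB(2)] prob exp_add[symmetric] simp flip: of_real_mult)
    also have "\<dots> = (\<integral>(x, y). iexp (L1 x) * iexp (L2 y) \<partial>(\<kappa> \<Otimes>\<^sub>M \<kappa>))"
      unfolding qAB
      by (subst prod_integral_mult) (auto simp: char[OF bl(1)] char[OF bl(2)] prob exp_add[symmetric] simp flip: of_real_mult)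
    also have "\<dots> = (CLINT z|\<kappa> \<Otimes>\<^sub>M \<kappa>. iexp (L z))"
      by (intro Bochner_Integration.integral_cong) (auto simp: Lsum algebra_simps simp flip: exp_add)
    finally show "(CLINT z|distr (\<kappa> \<Otimes>\<^sub>M \<kappa>) borel (\<lambda>(x, y). ((x + y) /\<^sub>R sqrt 2, (x - y) /\<^sub>R sqrt 2)). iexp (L z))
      = (CLINT z|\<kappa> \<Otimes>\<^sub>M \<kappa>. iexp (L z))" .
  qed (rule sets_distr)
  from rotation_invariant_third_moment[OF prob sets this]
  have "integrable \<kappa> (\<lambda>x. norm x ^ 3)" .
  then have "integrable (M \<Otimes>\<^sub>M M) (\<lambda>(\<omega>, \<omega>'). norm (G \<omega> - G \<omega>') ^ 3)"
    unfolding \<kappa>_def by (subst (asm) integrable_distr_eq) (auto simp: case_prod_beta')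
  from MM.AE_integrable_fst'[OF this]
  have "AE \<omega> in M. integrable M (\<lambda>\<omega>'. norm (G \<omega> - G \<omega>') ^ 3)" by simp
  then have "\<exists>\<omega>. integrable M (\<lambda>\<omega>'. norm (G \<omega> - G \<omega>') ^ 3)"
    using AE_False eventually_mono by (metis (mono_tags, lifting))
  then obtain \<omega> where *: "integrable M (\<lambda>\<omega>'. norm (G \<omega> - G \<omega>') ^ 3)" by blast
  have "(\<lambda>\<omega>'. G \<omega> - G \<omega>') \<in> borel_measurable M" by measurable
  from third_moment_centered(2)[OF this *, of "G \<omega>"] show ?thesis by simp
qed

lemma (in prob_space) char_indep_sum:
  fixes X :: "'i \<Rightarrow> 'a \<Rightarrow> 'e::{real_normed_vector, second_countable_topology}"
  assumes "indep_vars (\<lambda>_. borel) X I" "finite I" and L: "bounded_linear (L :: 'e \<Rightarrow> real)"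
  shows "(CLINT \<omega>|M. iexp (L (\<Sum>i\<in>I. X i \<omega>))) = (\<Prod>i\<in>I. CLINT \<omega>|M. iexp (L (X i \<omega>)))"
proof -
  have Lm [measurable]: "L \<in> borel_measurable borel" by (rule borel_measurable_bounded_linear[OF L])
  have Xm: "X i \<in> borel_measurable M" if "i \<in> I" for i using assms(1) that by (auto simp: indep_vars_def)
  have ind: "indep_vars (\<lambda>_. borel) (\<lambda>i \<omega>. L (X i \<omega>)) I"
    by (rule indep_vars_compose2[OF assms(1)]) simp
  have "(CLINT \<omega>|M. iexp (L (\<Sum>i\<in>I. X i \<omega>))) = (CLINT \<omega>|M. iexp (\<Sum>i\<in>I. L (X i \<omega>)))"
    by (simp add: linear_sum[OF bounded_linear.linear[OF L]])
  also have "\<dots> = char (distr M borel (\<lambda>\<omega>. \<Sum>i\<in>I. L (X i \<omega>))) 1"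
    using Xm by (simp add: char_def integral_distr)
  also have "\<dots> = (\<Prod>i\<in>I. char (distr M borel (\<lambda>\<omega>. L (X i \<omega>))) 1)"
    by (rule char_distr_sum[OF ind])
  also have "\<dots> = (\<Prod>i\<in>I. CLINT \<omega>|M. iexp (L (X i \<omega>)))"
    using Xm by (intro prod.cong) (simp_all add: char_def integral_distr)
  finally show ?thesis .
qed

lemma indep_vars_PiM_coordinates:
  assumes \<nu>: "\<And>i. i \<in> I \<Longrightarrow> prob_space (\<nu> i)" and I: "I \<noteq> {}"
  shows "prob_space.indep_vars (PiM I \<nu>) \<nu> (\<lambda>i \<omega>. \<omega> i) I"
proof -
  interpret N: prob_space "PiM I \<nu>" by (rule prob_space_PiM) (rule \<nu>)
  have "distr (PiM I \<nu>) (PiM I \<nu>) (\<lambda>\<omega>. \<lambda>i\<in>I. \<omega> i) = distr (PiM I \<nu>) (PiM I \<nu>) (\<lambda>\<omega>. \<omega>)"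
    by (rule distr_cong) (auto simp: space_PiM)
  also have "\<dots> = PiM I \<nu>" by (rule distr_id2) simp
  also have "\<dots> = PiM I (\<lambda>i. distr (PiM I \<nu>) (\<nu> i) (\<lambda>\<omega>. \<omega> i))"
    by (rule PiM_cong) (use distr_PiM_component[of I \<nu>] \<nu> in auto)
  finally show ?thesis
    using I by (subst N.indep_vars_iff_distr_eq_PiM') auto
qed

text \<open>Stability of centered Gaussian laws: the \<open>n\<close> variances of a functional, each divided by
  \<open>n\<close>, add up to the original variance.\<close>

lemma centered_gaussian_sum_law:
  fixes \<mu> :: "'e::{real_normed_vector, second_countable_topology} measure" and n :: nat
  assumes \<mu>: "centered_gaussian_law \<mu>" and cyl: "sets (cylinder_algebra :: 'e measure) = sets borel" and n: "n > 0"
  shows "distr (PiM {..<n} (\<lambda>_. \<mu>)) borel (\<lambda>\<omega>. \<Sum>i<n. \<omega> i /\<^sub>R sqrt n) = \<mu>"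
proof -
  have prob: "prob_space \<mu>" and sets: "sets \<mu> = sets borel" using \<mu> by (auto simp: centered_gaussian_law_def)
  note [measurable_cong] = sets
  interpret N: prob_space "PiM {..<n} (\<lambda>_. \<mu>)" by (rule prob_space_PiM) (rule prob)
  have ind: "N.indep_vars (\<lambda>_. borel) (\<lambda>i \<omega>. \<omega> i /\<^sub>R sqrt n) {..<n}"
    using N.indep_vars_compose2[OF indep_vars_PiM_coordinates[of "{..<n}" "\<lambda>_. \<mu>"], of "\<lambda>_ z. z /\<^sub>R sqrt n" "\<lambda>_. borel"] prob n
    by auto
  have meas: "(\<lambda>\<omega>. \<Sum>i<n. \<omega> i /\<^sub>R sqrt n) \<in> borel_measurable (PiM {..<n} (\<lambda>_. \<mu>))"
    by measurable
  show ?thesis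
  proof (rule law_eqI_char[OF _ _ prob sets cyl])
    show "prob_space (distr (PiM {..<n} (\<lambda>_. \<mu>)) borel (\<lambda>\<omega>. \<Sum>i<n. \<omega> i /\<^sub>R sqrt n))"
      using meas by (rule N.prob_space_distr)
    fix L :: "'e \<Rightarrow> real" assume L: "bounded_linear L"
    have [measurable]: "L \<in> borel_measurable borel" by (rule borel_measurable_bounded_linear[OF L])
    define L' where "L' z = L z / sqrt n" for z
    have L': "bounded_linear L'"
      unfolding L'_def divide_inverse by (rule bounded_linear_compose[OF bounded_linear_mult_left L])
    have [measurable]: "L' \<in> borel_measurable borel" by (rule borel_measurable_bounded_linear[OF L'])
    have "(CLINT z|distr (PiM {..<n} (\<lambda>_. \<mu>)) borel (\<lambda>\<omega>. \<Sum>i<n. \<omega> i /\<^sub>R sqrt n). iexp (L z))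
      = (CLINT \<omega>|PiM {..<n} (\<lambda>_. \<mu>). iexp (L (\<Sum>i<n. \<omega> i /\<^sub>R sqrt n)))"
      using meas by (simp add: integral_distr)
    also have "\<dots> = (\<Prod>i<n. CLINT \<omega>|PiM {..<n} (\<lambda>_. \<mu>). iexp (L (\<omega> i /\<^sub>R sqrt n)))"
      by (rule N.char_indep_sum[OF ind _ L]) simp
    also have "\<dots> = (\<Prod>i<n. CLINT z|\<mu>. iexp (L' z))"
    proof (rule prod.cong[OF refl])
      fix i assume i: "i \<in> {..<n}"
      have "(CLINT z|\<mu>. iexp (L' z)) = (CLINT z|distr (PiM {..<n} (\<lambda>_. \<mu>)) \<mu> (\<lambda>\<omega>. \<omega> i). iexp (L' z))"
        using distr_PiM_component[of "{..<n}" "\<lambda>_. \<mu>" i] prob i by simp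
      also have "\<dots> = (CLINT \<omega>|PiM {..<n} (\<lambda>_. \<mu>). iexp (L' (\<omega> i)))"
        using i by (intro integral_distr) auto
      finally show "(CLINT \<omega>|PiM {..<n} (\<lambda>_. \<mu>). iexp (L (\<omega> i /\<^sub>R sqrt n))) = (CLINT z|\<mu>. iexp (L' z))"
        using bounded_linear.linear[OF L] by (simp add: L'_def linear_scale divide_inverse mult.commute)
    qed
    also have "\<dots> = of_real (exp (- (\<integral>z. (L' z)\<^sup>2 \<partial>\<mu>) / 2)) ^ n"
      using \<mu> L' by (simp add: centered_gaussian_law_def)
    also have "\<dots> = of_real (exp (- (\<integral>z. (L z)\<^sup>2 \<partial>\<mu>) / 2))"
      using n by (simp add: L'_def power_divide exp_of_nat_mult[symmetric] flip: of_real_power)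
    also have "\<dots> = (CLINT z|\<mu>. iexp (L z))"
      using \<mu> L by (simp add: centered_gaussian_law_def)
    finally show "(CLINT z|distr (PiM {..<n} (\<lambda>_. \<mu>)) borel (\<lambda>\<omega>. \<Sum>i<n. \<omega> i /\<^sub>R sqrt n). iexp (L z))
      = (CLINT z|\<mu>. iexp (L z))" .
  qed simp
qed

lemma cylinder_algebra_bcontfun:
  "sets (cylinder_algebra :: ('t::compact_metric_space \<Rightarrow>\<^sub>C real) measure) = sets borel"
proof (rule antisym[OF cylinder_algebra_subset_borel])
  let ?C = "cylinder_algebra :: ('t \<Rightarrow>\<^sub>C real) measure"
  have id: "(\<lambda>z. z) \<in> borel_measurable ?C"
    by (rule borel_measurable_bcontfunI) (rule measurable_cylinder_algebra[OF bounded_linear_eval])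
  show "sets borel \<subseteq> sets ?C"
    using measurable_sets[OF id] by auto
qed

section \<open>Exact integration by parts and comparison with a Gaussian\<close>

text \<open>Characteristic functionals of independent sums factorise, so the law of the sum depends on
  the laws of the summands only. The summands may live on different probability spaces.\<close>

lemma indep_sum_law_eq:
  fixes X :: "'i \<Rightarrow> 'a \<Rightarrow> 'e::{real_normed_vector, second_countable_topology}" and X' :: "'j \<Rightarrow> 'b \<Rightarrow> 'e"
  assumes M: "prob_space M" "prob_space.indep_vars M (\<lambda>_. borel) X I" and N: "prob_space N" "prob_space.indep_vars N (\<lambda>_. borel) X' I'"
    and I: "finite I" "bij_betw h I I'"
    and law: "\<And>i. i \<in> I \<Longrightarrow> distr M borel (X i) = distr N borel (X' (h i))"
    and cyl: "sets (cylinder_algebra :: 'e measure) = sets borel"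
  shows "distr M borel (\<lambda>\<omega>. \<Sum>i\<in>I. X i \<omega>) = distr N borel (\<lambda>\<omega>. \<Sum>i\<in>I'. X' i \<omega>)"
proof -
  interpret M: prob_space M by fact
  interpret N: prob_space N by fact
  have Xm: "X i \<in> borel_measurable M" if "i \<in> I" for i using M(2) that by (auto simp: M.indep_vars_def)
  have Xm': "X' i \<in> borel_measurable N" if "i \<in> I'" for i using N(2) that by (auto simp: N.indep_vars_def)
  have h: "h i \<in> I'" if "i \<in> I" for i using I(2) that by (auto simp: bij_betw_def)
  have fin: "finite I'" using I bij_betw_finite by blast
  have m [measurable]: "(\<lambda>\<omega>. \<Sum>i\<in>I. X i \<omega>) \<in> borel_measurable M" "(\<lambda>\<omega>. \<Sum>i\<in>I'. X' i \<omega>) \<in> borel_measurable N"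
    using Xm Xm' by auto
  show ?thesis
  proof (rule law_eqI_char[OF _ _ _ _ cyl])
    show "prob_space (distr M borel (\<lambda>\<omega>. \<Sum>i\<in>I. X i \<omega>))" "prob_space (distr N borel (\<lambda>\<omega>. \<Sum>i\<in>I'. X' i \<omega>))"
      using m by (auto intro: M.prob_space_distr N.prob_space_distr)
    fix L :: "'e \<Rightarrow> real" assume L: "bounded_linear L"
    have [measurable]: "L \<in> borel_measurable borel" by (rule borel_measurable_bounded_linear[OF L])
    have "(CLINT z|distr M borel (\<lambda>\<omega>. \<Sum>i\<in>I. X i \<omega>). iexp (L z)) = (\<Prod>i\<in>I. CLINT \<omega>|M. iexp (L (X i \<omega>)))"
      using M.char_indep_sum[OF M(2) I(1) L] m by (simp add: integral_distr)
    also have "\<dots> = (\<Prod>i\<in>I. CLINT z|distr M borel (X i). iexp (L z))"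
      using Xm by (intro prod.cong) (simp_all add: integral_distr)
    also have "\<dots> = (\<Prod>i\<in>I. CLINT \<omega>|N. iexp (L (X' (h i) \<omega>)))"
      using Xm' h by (intro prod.cong) (simp_all add: law integral_distr)
    also have "\<dots> = (\<Prod>i\<in>I'. CLINT \<omega>|N. iexp (L (X' i \<omega>)))"
      by (rule prod.reindex_bij_betw[OF I(2)])
    also have "\<dots> = (CLINT z|distr N borel (\<lambda>\<omega>. \<Sum>i\<in>I'. X' i \<omega>). iexp (L z))"
      using N.char_indep_sum[OF N(2) fin L] m by (simp add: integral_distr)
    finally show "(CLINT z|distr M borel (\<lambda>\<omega>. \<Sum>i\<in>I. X i \<omega>). iexp (L z)) = (CLINT z|distr N borel (\<lambda>\<omega>. \<Sum>i\<in>I'. X' i \<omega>). iexp (L z))" .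
  qed (rule sets_distr)+
qed

lemma tendsto_const_div_sqrt: "(\<lambda>n. C / sqrt (real n)) \<longlonglongrightarrow> 0"
  by (intro tendsto_divide_0[OF tendsto_const] filterlim_at_top_imp_at_infinity
      filterlim_compose[OF sqrt_at_top filterlim_real_sequentially])

lemma le_of_le_add_div_sqrt:
  fixes x y C :: real
  assumes "\<And>n. n > 0 \<Longrightarrow> x \<le> y + C / sqrt (real n)"
  shows "x \<le> y"
proof (rule LIMSEQ_le_const)
  show "(\<lambda>n. y + C / sqrt (real n)) \<longlonglongrightarrow> y"
    using tendsto_add[OF tendsto_const tendsto_const_div_sqrt] by simp
  show "\<exists>N. \<forall>n\<ge>N. x \<le> y + C / sqrt (real n)" using assms by (intro exI[of _ 1]) auto
qed

text \<open>The total error of \<open>n\<close> summands that are scaled by the inverse square root of \<open>n\<close>, with an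
  error of third order each.\<close>

lemma sqrt_scaling:
  assumes "n > 0"
  shows "real n * (1 / sqrt (real n) ^ 3) = 1 / sqrt (real n)"
proof -
  have "sqrt (real n) ^ 3 = real n * sqrt (real n)" by (simp add: power3_eq_cube)
  then show ?thesis using assms by simp
qed

lemma measurable_fst_snd_borel [measurable]:
  "fst \<in> borel_measurable (borel :: ('a::second_countable_topology \<times> 'b::second_countable_topology) measure)"
  "snd \<in> borel_measurable (borel :: ('a::second_countable_topology \<times> 'b::second_countable_topology) measure)"
  by (auto intro!: borel_measurable_continuous_onI continuous_on_fst continuous_on_snd continuous_on_id)

context base_measure
begin

text \<open>A Gaussian law is the law of \<open>n\<close> scaled independent copies of itself, for every \<open>n\<close>.
  Approximate integration by parts for these summands has an error of the order of the inverse
  square root of \<open>n\<close>, so in the limit the formula is exact.\<close>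

lemma centered_gaussian_ibp:
  fixes \<mu> :: "(('t \<Rightarrow>\<^sub>C real) \<times> ('t \<Rightarrow>\<^sub>C real)) measure"
  assumes \<mu>: "centered_gaussian_law \<mu>"
    and third: "integrable \<mu> (\<lambda>z. norm (fst z) ^ 3)" "integrable \<mu> (\<lambda>z. norm (snd z) ^ 3)"
    and mean: "(\<integral>z. snd z \<partial>\<mu>) = 0"
  shows "(\<integral>z. gibbs_mean \<pi> (c + fst z) (apply_bcontfun (snd z)) \<partial>\<mu>) = (\<integral>z. avg_gibbs_cov \<mu> fst snd (c + fst z) \<partial>\<mu>)"
proof -
  have prob: "prob_space \<mu>" and sets: "sets \<mu> = sets borel" using \<mu> by (auto simp: centered_gaussian_law_def)
  note [measurable_cong] = sets
  interpret \<mu>: prob_space \<mu> by fact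
  have mfs: "fst \<in> borel_measurable \<mu>" "snd \<in> borel_measurable \<mu>"
    unfolding measurable_cong_sets[OF sets refl] by measurable
  have mom: "integrable \<mu> (\<lambda>z. norm (fst z))" "integrable \<mu> (\<lambda>z. norm (fst z) * norm (snd z))"
    "integrable \<mu> (\<lambda>z. (norm (fst z))\<^sup>2 * norm (snd z))"
    using \<mu>.moment_error_le(1-3)[of "\<lambda>z. norm (fst z)" "\<lambda>z. norm (snd z)"] third by auto
  have mom2: "integrable \<mu> (\<lambda>z. norm (snd z))"
    using \<mu>.moment_error_le(1)[of "\<lambda>z. norm (snd z)" "\<lambda>z. norm (snd z)"] third by auto
  have i1: "integrable \<mu> fst" "integrable \<mu> snd"
    using integrable_norm_cancel[OF mom(1)] integrable_norm_cancel[OF mom2] by auto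
  define C where "C = (\<integral>z. (norm (fst z))\<^sup>2 * norm (snd z) \<partial>\<mu>) + 2 * (\<integral>z. norm (fst z) \<partial>\<mu>) * (\<integral>z. norm (fst z) * norm (snd z) \<partial>\<mu>)"
  have "\<bar>(\<integral>z. gibbs_mean \<pi> (c + fst z) (apply_bcontfun (snd z)) \<partial>\<mu>) - (\<integral>z. avg_gibbs_cov \<mu> fst snd (c + fst z) \<partial>\<mu>)\<bar> \<le> 0 + C / sqrt n"
    if n: "n > 0" for n :: nat
  proof -
    define N where "N = PiM {..<n} (\<lambda>_. \<mu>)"
    interpret N: prob_space N unfolding N_def by (rule prob_space_PiM) (rule prob)
    define \<sigma> where "\<sigma> \<omega> = (\<Sum>i<n. \<omega> i /\<^sub>R sqrt n)" for \<omega> :: "nat \<Rightarrow> ('t \<Rightarrow>\<^sub>C real) \<times> ('t \<Rightarrow>\<^sub>C real)"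
    have \<sigma> [measurable]: "\<sigma> \<in> borel_measurable N" unfolding \<sigma>_def N_def by measurable
    have law: "distr N borel \<sigma> = \<mu>"
      unfolding \<sigma>_def N_def by (rule centered_gaussian_sum_law[OF \<mu> cylinder_algebra_bcontfun_pair n])
    have ev [measurable]: "(\<lambda>\<omega>. \<omega> i) \<in> borel_measurable N" if "i < n" for i
      using measurable_component_singleton[of i "{..<n}" "\<lambda>_. \<mu>"] that sets unfolding N_def by (simp cong: measurable_cong_sets)
    have coord: "distr N borel (\<lambda>\<omega>. \<omega> i) = \<mu>" if "i < n" for i
      using distr_PiM_component[of "{..<n}" "\<lambda>_. \<mu>" i] prob that
      unfolding N_def by (simp add: sets cong: distr_cong)
    have transfer: "(\<integral>\<omega>. f (\<omega> i) \<partial>N) = (\<integral>z. f z \<partial>\<mu>)" "integrable N (\<lambda>\<omega>. f (\<omega> i)) \<longleftrightarrow> integrable \<mu> f"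
      if "i < n" "f \<in> borel_measurable borel" for i and f :: "_ \<Rightarrow> 'f::{banach, second_countable_topology}"
      using integral_distr[OF ev[OF that(1)] that(2)] integrable_distr_eq[OF ev[OF that(1)] that(2)] coord[OF that(1)] by auto
    let ?X = "\<lambda>i \<omega>. fst (\<omega> i) /\<^sub>R sqrt n" and ?V = "\<lambda>i \<omega>. snd (\<omega> i) /\<^sub>R sqrt n"
    have fs: "(\<Sum>i<n. ?X i \<omega>) = fst (\<sigma> \<omega>)" "(\<Sum>i<n. ?V i \<omega>) = snd (\<sigma> \<omega>)" for \<omega>
      by (simp_all add: \<sigma>_def fst_sum snd_sum)
    have ind: "N.indep_vars (\<lambda>_. borel) (\<lambda>i \<omega>. (?X i \<omega>, ?V i \<omega>)) {..<n}"
    proof (rule N.indep_vars_compose2[where M'="\<lambda>_. \<mu>" and X="\<lambda>i \<omega>. \<omega> i"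
          and Y="\<lambda>_ z. (fst z /\<^sub>R sqrt n, snd z /\<^sub>R sqrt n)"])
      show "N.indep_vars (\<lambda>_. \<mu>) (\<lambda>i \<omega>. \<omega> i) {..<n}"
        unfolding N_def using n by (intro indep_vars_PiM_coordinates prob) auto
      show "(\<lambda>z. (fst z /\<^sub>R sqrt n, snd z /\<^sub>R sqrt n)) \<in> borel_measurable \<mu>"
        unfolding measurable_cong_sets[OF sets refl] by measurable
    qed
    have "\<bar>(\<integral>\<omega>. gibbs_mean \<pi> (c + (\<Sum>i<n. ?X i \<omega>)) (apply_bcontfun (\<Sum>i<n. ?V i \<omega>)) \<partial>N)
      - (\<integral>\<omega>. avg_gibbs_cov N (\<lambda>\<omega>. \<Sum>i<n. ?X i \<omega>) (\<lambda>\<omega>. \<Sum>i<n. ?V i \<omega>) (c + (\<Sum>i<n. ?X i \<omega>)) \<partial>N)\<bar>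
      \<le> (\<Sum>i<n. (\<integral>\<omega>. (norm (?X i \<omega>))\<^sup>2 * norm (?V i \<omega>) \<partial>N)
        + 2 * (\<integral>\<omega>. norm (?X i \<omega>) \<partial>N) * (\<integral>\<omega>. norm (?X i \<omega>) * norm (?V i \<omega>) \<partial>N))"
    proof (rule approx_integration_by_parts(2)[OF N.prob_space_axioms _ ind])
      fix i assume "i \<in> {..<n}"
      then have i: "i < n" by simp
      show "integrable N (?X i)" "integrable N (?V i)"
        using transfer(2)[OF i, of fst] transfer(2)[OF i, of snd] i1 by auto
      have "integrable N (\<lambda>\<omega>. norm (fst (\<omega> i)) * norm (snd (\<omega> i)))" "integrable N (\<lambda>\<omega>. (norm (fst (\<omega> i)))\<^sup>2 * norm (snd (\<omega> i)))"
        using transfer(2)[OF i, of "\<lambda>z. norm (fst z) * norm (snd z)"] transfer(2)[OF i, of "\<lambda>z. (norm (fst z))\<^sup>2 * norm (snd z)"] mom by auto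
      from integrable_mult_right[OF this(1), of "inverse (sqrt n) * inverse (sqrt n)"]
        integrable_mult_right[OF this(2), of "(inverse (sqrt n))\<^sup>2 * inverse (sqrt n)"]
      show "integrable N (\<lambda>\<omega>. norm (?X i \<omega>) * norm (?V i \<omega>))" "integrable N (\<lambda>\<omega>. (norm (?X i \<omega>))\<^sup>2 * norm (?V i \<omega>))"
        by (simp_all add: power_mult_distrib mult_ac)
      show "(\<integral>\<omega>. ?V i \<omega> \<partial>N) = 0"
        using transfer(1)[OF i, of snd] mean by simp
    qed simp
    also have "(\<Sum>i<n. (\<integral>\<omega>. (norm (?X i \<omega>))\<^sup>2 * norm (?V i \<omega>) \<partial>N)
        + 2 * (\<integral>\<omega>. norm (?X i \<omega>) \<partial>N) * (\<integral>\<omega>. norm (?X i \<omega>) * norm (?V i \<omega>) \<partial>N)) = (\<Sum>i<n. 1 / sqrt n ^ 3 * C)"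
    proof (rule sum.cong[OF refl])
      fix i assume "i \<in> {..<n}"
      then have i: "i < n" by simp
      have "(\<integral>\<omega>. (norm (?X i \<omega>))\<^sup>2 * norm (?V i \<omega>) \<partial>N) = (\<integral>z. (norm (fst z /\<^sub>R sqrt n))\<^sup>2 * norm (snd z /\<^sub>R sqrt n) \<partial>\<mu>)"
        by (rule transfer(1)[OF i]) measurable
      also have "\<dots> = (\<integral>z. 1 / sqrt n ^ 3 * ((norm (fst z))\<^sup>2 * norm (snd z)) \<partial>\<mu>)"
        by (simp add: power_mult_distrib power3_eq_cube power2_eq_square field_simps)
      finally have 1: "(\<integral>\<omega>. (norm (?X i \<omega>))\<^sup>2 * norm (?V i \<omega>) \<partial>N) = 1 / sqrt n ^ 3 * (\<integral>z. (norm (fst z))\<^sup>2 * norm (snd z) \<partial>\<mu>)"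
        by (simp only: integral_mult_right_zero)
      have "(\<integral>\<omega>. norm (?X i \<omega>) \<partial>N) = (\<integral>z. norm (fst z /\<^sub>R sqrt n) \<partial>\<mu>)"
        by (rule transfer(1)[OF i]) measurable
      then have 2: "(\<integral>\<omega>. norm (?X i \<omega>) \<partial>N) = 1 / sqrt n * (\<integral>z. norm (fst z) \<partial>\<mu>)"
        by (simp add: divide_inverse)
      have "(\<integral>\<omega>. norm (?X i \<omega>) * norm (?V i \<omega>) \<partial>N) = (\<integral>z. norm (fst z /\<^sub>R sqrt n) * norm (snd z /\<^sub>R sqrt n) \<partial>\<mu>)"
        by (rule transfer(1)[OF i]) measurable
      also have "\<dots> = (\<integral>z. 1 / sqrt n ^ 2 * (norm (fst z) * norm (snd z)) \<partial>\<mu>)"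
        by (simp add: power2_eq_square field_simps)
      finally have 3: "(\<integral>\<omega>. norm (?X i \<omega>) * norm (?V i \<omega>) \<partial>N) = 1 / sqrt n ^ 2 * (\<integral>z. norm (fst z) * norm (snd z) \<partial>\<mu>)"
        by (simp only: integral_mult_right_zero)
      show "(\<integral>\<omega>. (norm (?X i \<omega>))\<^sup>2 * norm (?V i \<omega>) \<partial>N)
        + 2 * (\<integral>\<omega>. norm (?X i \<omega>) \<partial>N) * (\<integral>\<omega>. norm (?X i \<omega>) * norm (?V i \<omega>) \<partial>N) = 1 / sqrt n ^ 3 * C"
        unfolding 1 2 3 C_def by (simp add: power2_eq_square power3_eq_cube add_divide_distrib)
    qed
    also have "\<dots> = (real n * (1 / sqrt n ^ 3)) * C" by simp
    also have "\<dots> = C / sqrt n" unfolding sqrt_scaling[OF n] by simp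
    finally have b: "\<bar>(\<integral>\<omega>. gibbs_mean \<pi> (c + fst (\<sigma> \<omega>)) (apply_bcontfun (snd (\<sigma> \<omega>))) \<partial>N)
      - (\<integral>\<omega>. avg_gibbs_cov N (\<lambda>\<omega>. fst (\<sigma> \<omega>)) (\<lambda>\<omega>. snd (\<sigma> \<omega>)) (c + fst (\<sigma> \<omega>)) \<partial>N)\<bar> \<le> C / sqrt n"
      unfolding fs .
    have t: "(\<integral>\<omega>. f (\<sigma> \<omega>) \<partial>N) = (\<integral>z. f z \<partial>\<mu>)" if "f \<in> borel_measurable borel" for f :: "_ \<Rightarrow> real"
      using integral_distr[OF \<sigma> that] by (simp add: law)
    have "avg_gibbs_cov N (\<lambda>\<omega>. fst (\<sigma> \<omega>)) (\<lambda>\<omega>. snd (\<sigma> \<omega>)) z = avg_gibbs_cov \<mu> fst snd z" for z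
      unfolding avg_gibbs_cov_def by (rule t) measurable
    moreover have "(\<integral>\<omega>. gibbs_mean \<pi> (c + fst (\<sigma> \<omega>)) (apply_bcontfun (snd (\<sigma> \<omega>))) \<partial>N) = (\<integral>z. gibbs_mean \<pi> (c + fst z) (apply_bcontfun (snd z)) \<partial>\<mu>)"
      by (rule t) measurable
    moreover have "(\<integral>\<omega>. avg_gibbs_cov \<mu> fst snd (c + fst (\<sigma> \<omega>)) \<partial>N) = (\<integral>z. avg_gibbs_cov \<mu> fst snd (c + fst z) \<partial>\<mu>)"
      by (rule t, rule measurable_avg_gibbs_cov) (auto intro: \<mu>.sigma_finite_measure_axioms mfs)
    ultimately show ?thesis using b by simp
  qed
  from le_of_le_add_div_sqrt[OF this] show ?thesis by simp
qed

text \<open>The mean of \<open>Y\<close> becomes the shift \<open>c\<close> of the centered formula, and the mean of \<open>V\<close>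
  contributes the first summand on the right.\<close>

lemma gaussian_integration_by_parts:
  fixes Y V :: "'w \<Rightarrow> 't \<Rightarrow>\<^sub>C real"
  assumes Q: "prob_space Q" and G: "gaussian Q (\<lambda>\<omega>. (Y \<omega>, V \<omega>))"
  defines "EY \<equiv> \<integral>\<omega>. Y \<omega> \<partial>Q" and "EV \<equiv> \<integral>\<omega>. V \<omega> \<partial>Q"
  shows "integrable Q (\<lambda>\<omega>. norm (Y \<omega>) ^ 3)" "integrable Q (\<lambda>\<omega>. norm (V \<omega>) ^ 3)"
    and "Y \<in> borel_measurable Q" "V \<in> borel_measurable Q"
    and "(\<integral>\<omega>. gibbs_mean \<pi> (Y \<omega>) (V \<omega>) \<partial>Q)
      = (\<integral>\<omega>. gibbs_mean \<pi> (Y \<omega>) EV + avg_gibbs_cov Q (\<lambda>\<omega>. Y \<omega> - EY) (\<lambda>\<omega>. V \<omega> - EV) (Y \<omega>) \<partial>Q)"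
proof -
  interpret Q: prob_space Q by fact
  have GY: "gaussian Q Y" unfolding gaussian_def
  proof (intro allI impI)
    fix L :: "('t \<Rightarrow>\<^sub>C real) \<Rightarrow> real" assume "bounded_linear L"
    then have "bounded_linear (\<lambda>z. L (fst z))" for z :: "('t \<Rightarrow>\<^sub>C real) \<times> ('t \<Rightarrow>\<^sub>C real)"
      by (rule bounded_linear_compose) (rule bounded_linear_fst)
    from G[unfolded gaussian_def, rule_format, OF this]
    show "(\<lambda>\<omega>. L (Y \<omega>)) \<in> borel_measurable Q \<and> normal_law (distr Q borel (\<lambda>\<omega>. L (Y \<omega>)))" by simp
  qed
  have GV: "gaussian Q V" unfolding gaussian_def
  proof (intro allI impI)
    fix L :: "('t \<Rightarrow>\<^sub>C real) \<Rightarrow> real" assume "bounded_linear L"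
    then have "bounded_linear (\<lambda>z. L (snd z))" for z :: "('t \<Rightarrow>\<^sub>C real) \<times> ('t \<Rightarrow>\<^sub>C real)"
      by (rule bounded_linear_compose) (rule bounded_linear_snd)
    from G[unfolded gaussian_def, rule_format, OF this]
    show "(\<lambda>\<omega>. L (V \<omega>)) \<in> borel_measurable Q \<and> normal_law (distr Q borel (\<lambda>\<omega>. L (V \<omega>)))" by simp
  qed
  show Ym [measurable]: "Y \<in> borel_measurable Q" and Vm [measurable]: "V \<in> borel_measurable Q"
    using gaussian_measurable GY GV by auto
  show Y3: "integrable Q (\<lambda>\<omega>. norm (Y \<omega>) ^ 3)" and V3: "integrable Q (\<lambda>\<omega>. norm (V \<omega>) ^ 3)"
    using gaussian_third_moment[OF Q GY] gaussian_third_moment[OF Q GV] by auto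
  have iY: "integrable Q Y" and iV: "integrable Q V"
    using Q.third_moment_centered(1) Y3 V3 Ym Vm by blast+
  have n1: "integrable Q (\<lambda>\<omega>. norm (Y \<omega>))" "integrable Q (\<lambda>\<omega>. norm (V \<omega>))"
    using integrable_norm[OF iY] integrable_norm[OF iV] .
  have iYV: "integrable Q (\<lambda>\<omega>. (Y \<omega>, V \<omega>))"
  proof (rule Bochner_Integration.integrable_bound)
    show "integrable Q (\<lambda>\<omega>. norm (Y \<omega>) + norm (V \<omega>))" using n1 by simp
    show "AE \<omega> in Q. norm (Y \<omega>, V \<omega>) \<le> norm (norm (Y \<omega>) + norm (V \<omega>))"
      using norm_Pair_le by (auto intro: order_trans)
  qed measurable
  have EYV: "(\<integral>\<omega>. (Y \<omega>, V \<omega>) \<partial>Q) = (EY, EV)"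
    using integral_bounded_linear[OF bounded_linear_fst iYV] integral_bounded_linear[OF bounded_linear_snd iYV]
    by (simp add: EY_def EV_def prod_eq_iff)
  define \<mu> where "\<mu> = distr Q borel (\<lambda>\<omega>. (Y \<omega> - EY, V \<omega> - EV))"
  have cg: "centered_gaussian_law \<mu>"
    using gaussian_centered_law[OF Q G iYV] unfolding EYV \<mu>_def by simp
  have gm [measurable]: "(\<lambda>\<omega>. (Y \<omega> - EY, V \<omega> - EV)) \<in> borel_measurable Q"
    by (simp add: borel_prod[symmetric])
  note c3 = Q.third_moment_centered(2)
  have t: "(\<integral>z. f z \<partial>\<mu>) = (\<integral>\<omega>. f (Y \<omega> - EY, V \<omega> - EV) \<partial>Q)" if "f \<in> borel_measurable borel" for f :: "_ \<Rightarrow> 'f::{banach, second_countable_topology}"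
    unfolding \<mu>_def by (rule integral_distr[OF gm that])
  have "(\<integral>z. gibbs_mean \<pi> (EY + fst z) (apply_bcontfun (snd z)) \<partial>\<mu>) = (\<integral>z. avg_gibbs_cov \<mu> fst snd (EY + fst z) \<partial>\<mu>)"
  proof (rule centered_gaussian_ibp[OF cg])
    show "integrable \<mu> (\<lambda>z. norm (fst z) ^ 3)" "integrable \<mu> (\<lambda>z. norm (snd z) ^ 3)"
      unfolding \<mu>_def using c3[OF Ym Y3] c3[OF Vm V3] by (simp_all add: integrable_distr_eq)
    show "(\<integral>z. snd z \<partial>\<mu>) = 0"
      using t[of snd] iV by (simp add: EV_def Q.prob_space)
  qed
  moreover have "(\<integral>z. gibbs_mean \<pi> (EY + fst z) (apply_bcontfun (snd z)) \<partial>\<mu>) = (\<integral>\<omega>. gibbs_mean \<pi> (Y \<omega>) (apply_bcontfun (V \<omega> - EV)) \<partial>Q)"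
  proof -
    have "(\<lambda>z. gibbs_mean \<pi> (EY + fst z) (apply_bcontfun (snd z))) \<in> borel_measurable borel" by measurable
    from t[OF this] show ?thesis by simp
  qed
  moreover have avg: "avg_gibbs_cov \<mu> fst snd z = avg_gibbs_cov Q (\<lambda>\<omega>. Y \<omega> - EY) (\<lambda>\<omega>. V \<omega> - EV) z" for z
  proof -
    have "(\<lambda>y. gibbs_cov \<pi> z (apply_bcontfun (fst y)) (apply_bcontfun (snd y))) \<in> borel_measurable borel" by measurable
    from t[OF this] show ?thesis unfolding avg_gibbs_cov_def by simp
  qed
  moreover have "(\<integral>z. avg_gibbs_cov \<mu> fst snd (EY + fst z) \<partial>\<mu>) = (\<integral>\<omega>. avg_gibbs_cov Q (\<lambda>\<omega>. Y \<omega> - EY) (\<lambda>\<omega>. V \<omega> - EV) (Y \<omega>) \<partial>Q)"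
    unfolding avg by (subst t, rule measurable_avg_gibbs_cov) (auto intro: Q.sigma_finite_measure_axioms)
  ultimately have eq: "(\<integral>\<omega>. gibbs_mean \<pi> (Y \<omega>) (apply_bcontfun (V \<omega> - EV)) \<partial>Q)
    = (\<integral>\<omega>. avg_gibbs_cov Q (\<lambda>\<omega>. Y \<omega> - EY) (\<lambda>\<omega>. V \<omega> - EV) (Y \<omega>) \<partial>Q)" by simp
  have gd: "gibbs_mean \<pi> z (apply_bcontfun (V \<omega> - EV)) = gibbs_mean \<pi> z (V \<omega>) - gibbs_mean \<pi> z EV" for z \<omega>
    by (rule linear_diff[OF bounded_linear.linear[OF bounded_linear_gibbs_mean]])
  have i1: "integrable Q (\<lambda>\<omega>. gibbs_mean \<pi> (Y \<omega>) (V \<omega>))" "integrable Q (\<lambda>\<omega>. gibbs_mean \<pi> (Y \<omega>) EV)"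
    by (rule integrable_gibbs_mean[OF Ym Vm n1(2)]) (rule integrable_gibbs_mean, auto)
  have i2: "integrable Q (\<lambda>\<omega>. avg_gibbs_cov Q (\<lambda>\<omega>. Y \<omega> - EY) (\<lambda>\<omega>. V \<omega> - EV) (Y \<omega>))"
  proof (rule Q.integrable_const_bound)
    have "integrable Q (\<lambda>\<omega>. norm (Y \<omega> - EY) * norm (V \<omega> - EV))"
      using Q.moment_error_le(2)[of "\<lambda>\<omega>. norm (Y \<omega> - EY)" "\<lambda>\<omega>. norm (V \<omega> - EV)"] c3[OF Ym Y3] c3[OF Vm V3] by auto
    from abs_avg_gibbs_cov_le[OF _ _ this]
    show "AE \<omega> in Q. norm (avg_gibbs_cov Q (\<lambda>\<omega>. Y \<omega> - EY) (\<lambda>\<omega>. V \<omega> - EV) (Y \<omega>))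
      \<le> 2 * (\<integral>\<omega>. norm (Y \<omega> - EY) * norm (V \<omega> - EV) \<partial>Q)" by simp
    show "(\<lambda>\<omega>. avg_gibbs_cov Q (\<lambda>\<omega>. Y \<omega> - EY) (\<lambda>\<omega>. V \<omega> - EV) (Y \<omega>)) \<in> borel_measurable Q"
      by (rule measurable_avg_gibbs_cov) (auto intro: Q.sigma_finite_measure_axioms)
  qed
  show "(\<integral>\<omega>. gibbs_mean \<pi> (Y \<omega>) (V \<omega>) \<partial>Q)
      = (\<integral>\<omega>. gibbs_mean \<pi> (Y \<omega>) EV + avg_gibbs_cov Q (\<lambda>\<omega>. Y \<omega> - EY) (\<lambda>\<omega>. V \<omega> - EV) (Y \<omega>) \<partial>Q)"
    using eq[unfolded gd] i1 i2 by simp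
qed

text \<open>The Gaussian is represented by \<open>n\<close> independent scaled copies of itself on a product space
  that also carries independent copies of the \<open>X i\<close>, so that the Lindeberg comparison applies. The
  third moments of the \<open>n\<close> copies sum up to \<open>E |Y|\<^sup>3\<close> divided by the square root of \<open>n\<close>, which
  disappears in the limit.\<close>

lemma gaussian_comparison:
  fixes X :: "'i \<Rightarrow> 'w \<Rightarrow> 't \<Rightarrow>\<^sub>C real" and Y :: "'v \<Rightarrow> 't \<Rightarrow>\<^sub>C real"
  assumes P: "prob_space P" and I: "finite I" and ind: "prob_space.indep_vars P (\<lambda>_. borel) X I"
    and mean: "\<And>i. i \<in> I \<Longrightarrow> (\<integral>\<omega>. X i \<omega> \<partial>P) = 0"
    and third: "\<And>i. i \<in> I \<Longrightarrow> integrable P (\<lambda>\<omega>. norm (X i \<omega>) ^ 3)"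
    and Q: "prob_space Q" and Y [measurable]: "Y \<in> borel_measurable Q" and G: "centered_gaussian_law (distr Q borel Y)"
    and Y3: "integrable Q (\<lambda>\<omega>. norm (Y \<omega>) ^ 3)" and Y0: "(\<integral>\<omega>. Y \<omega> \<partial>Q) = 0"
    and \<kappa>: "\<And>s t. \<bar>(\<integral>\<omega>. (\<Sum>i\<in>I. X i \<omega>) s * (\<Sum>i\<in>I. X i \<omega>) t \<partial>P) - (\<integral>\<omega>. Y \<omega> s * Y \<omega> t \<partial>Q)\<bar> \<le> \<kappa>"
  shows "\<bar>(\<integral>\<omega>. log_partition \<pi> (c + (\<Sum>i\<in>I. X i \<omega>)) \<partial>P) - (\<integral>\<omega>. log_partition \<pi> (c + Y \<omega>) \<partial>Q)\<bar>
    \<le> \<kappa> + (\<Sum>i\<in>I. \<integral>\<omega>. norm (X i \<omega>) ^ 3 \<partial>P)"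
proof (rule le_of_le_add_div_sqrt)
  fix n :: nat assume n: "n > 0"
  interpret P: prob_space P by fact
  interpret Q: prob_space Q by fact
  define \<mu> where "\<mu> = distr Q borel Y"
  have \<mu>: "prob_space \<mu>" unfolding \<mu>_def by (rule Q.prob_space_distr) simp
  have Xm: "X i \<in> borel_measurable P" if "i \<in> I" for i using ind that by (auto simp: P.indep_vars_def)
  define \<nu> where "\<nu> k = (case k of Inl i \<Rightarrow> distr P borel (X i) | Inr j \<Rightarrow> distr \<mu> borel (\<lambda>z. z /\<^sub>R sqrt n))" for k :: "'i + nat"
  \<comment> \<open>the left indices carry the \<open>X i\<close>, the right ones the scaled copies of the Gaussian\<close>
  define K where "K = Inl ` I \<union> Inr ` {..<n}"
  have sets\<nu>: "sets (\<nu> k) = sets borel" for k by (simp add: \<nu>_def split: sum.split)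
  have sets\<mu>: "sets \<mu> = sets borel" by (simp add: \<mu>_def)
  have scale: "(\<lambda>z :: 't \<Rightarrow>\<^sub>C real. z /\<^sub>R sqrt n) \<in> borel_measurable \<mu>"
    by (simp cong: measurable_cong_sets[OF sets\<mu> refl])
  have prob\<nu>: "prob_space (\<nu> k)" if "k \<in> K" for k
    using that Xm scale by (auto simp: \<nu>_def K_def intro!: P.prob_space_distr prob_space.prob_space_distr[OF \<mu>])
  define N where "N = PiM K \<nu>"
  interpret N: prob_space N unfolding N_def by (rule prob_space_PiM) (rule prob\<nu>)
  have ev [measurable]: "(\<lambda>\<omega>. \<omega> k) \<in> borel_measurable N" if "k \<in> K" for k
    using measurable_component_singleton[of k K \<nu>] that sets\<nu>[of k] unfolding N_def by (simp cong: measurable_cong_sets)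
  have coord: "distr N borel (\<lambda>\<omega>. \<omega> k) = \<nu> k" if "k \<in> K" for k
    using distr_PiM_component[of K \<nu> k] prob\<nu> that
    unfolding N_def by (simp add: sets\<nu> cong: distr_cong)
  have transfer: "(\<integral>\<omega>. f (\<omega> k) \<partial>N) = (\<integral>z. f z \<partial>\<nu> k)" "integrable N (\<lambda>\<omega>. f (\<omega> k)) \<longleftrightarrow> integrable (\<nu> k) f"
    if "k \<in> K" "f \<in> borel_measurable borel" for k and f :: "_ \<Rightarrow> 'f::{banach, second_countable_topology}"
    using integral_distr[OF ev[OF that(1)] that(2)] integrable_distr_eq[OF ev[OF that(1)] that(2)] coord[OF that(1)] by auto
  have t\<mu>: "(\<integral>z. f z \<partial>\<mu>) = (\<integral>\<omega>. f (Y \<omega>) \<partial>Q)" "integrable \<mu> f \<longleftrightarrow> integrable Q (\<lambda>\<omega>. f (Y \<omega>))"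
    if "f \<in> borel_measurable borel" for f :: "_ \<Rightarrow> 'f::{banach, second_countable_topology}"
    unfolding \<mu>_def by (rule integral_distr[OF Y that], rule integrable_distr_eq[OF Y that])
  have tI: "(\<integral>\<omega>. f (\<omega> (Inl i)) \<partial>N) = (\<integral>\<omega>. f (X i \<omega>) \<partial>P)" "integrable N (\<lambda>\<omega>. f (\<omega> (Inl i))) \<longleftrightarrow> integrable P (\<lambda>\<omega>. f (X i \<omega>))"
    if i: "i \<in> I" and f: "f \<in> borel_measurable borel" for i and f :: "_ \<Rightarrow> 'f::{banach, second_countable_topology}"
    using transfer[of "Inl i" f] integral_distr[OF Xm[OF i] f] integrable_distr_eq[OF Xm[OF i] f] i f
    by (auto simp: K_def \<nu>_def)
  have tJ: "(\<integral>\<omega>. f (\<omega> (Inr j)) \<partial>N) = (\<integral>\<omega>. f (Y \<omega> /\<^sub>R sqrt n) \<partial>Q)" "integrable N (\<lambda>\<omega>. f (\<omega> (Inr j))) \<longleftrightarrow> integrable Q (\<lambda>\<omega>. f (Y \<omega> /\<^sub>R sqrt n))"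
    if j: "j < n" and f [measurable]: "f \<in> borel_measurable borel" for j and f :: "_ \<Rightarrow> 'f::{banach, second_countable_topology}"
  proof -
    have fm: "(\<lambda>z. f (z /\<^sub>R sqrt n)) \<in> borel_measurable borel" by measurable
    show "(\<integral>\<omega>. f (\<omega> (Inr j)) \<partial>N) = (\<integral>\<omega>. f (Y \<omega> /\<^sub>R sqrt n) \<partial>Q)" "integrable N (\<lambda>\<omega>. f (\<omega> (Inr j))) \<longleftrightarrow> integrable Q (\<lambda>\<omega>. f (Y \<omega> /\<^sub>R sqrt n))"
      using transfer[of "Inr j" f] integral_distr[OF scale f] integrable_distr_eq[OF scale f] t\<mu>[OF fm] j f
      by (auto simp: K_def \<nu>_def)
  qed
  have indN: "N.indep_vars (\<lambda>_. borel) (\<lambda>k \<omega>. \<omega> k) K"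
    using N.indep_vars_compose2[OF indep_vars_PiM_coordinates[of K \<nu>, folded N_def], of "\<lambda>_ z. z" "\<lambda>_. borel"] prob\<nu> n
      measurable_ident_sets[OF sets\<nu>]
    by (auto simp: K_def)
  have lawI: "distr P borel (\<lambda>\<omega>. \<Sum>i\<in>I. X i \<omega>) = distr N borel (\<lambda>\<omega>. \<Sum>k\<in>Inl ` I. \<omega> k)"
  proof (rule indep_sum_law_eq[OF P ind N.prob_space_axioms _ I _ _ cylinder_algebra_bcontfun])
    show "N.indep_vars (\<lambda>_. borel) (\<lambda>k \<omega>. \<omega> k) (Inl ` I)"
      by (rule N.indep_vars_subset[OF indN]) (auto simp: K_def)
    show "bij_betw Inl I (Inl ` I)" by (simp add: bij_betw_def)
    show "distr P borel (X i) = distr N borel (\<lambda>\<omega>. \<omega> (Inl i))" if "i \<in> I" for i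
      using coord[of "Inl i"] that by (simp add: K_def \<nu>_def)
  qed
  interpret N2: prob_space "PiM {..<n} (\<lambda>_. \<mu>)" by (rule prob_space_PiM) (rule \<mu>)
  have lawJ: "\<mu> = distr N borel (\<lambda>\<omega>. \<Sum>k\<in>Inr ` {..<n}. \<omega> k)"
  proof -
    have "\<mu> = distr (PiM {..<n} (\<lambda>_. \<mu>)) borel (\<lambda>\<omega>. \<Sum>i<n. \<omega> i /\<^sub>R sqrt n)"
      by (rule centered_gaussian_sum_law[OF G[folded \<mu>_def] cylinder_algebra_bcontfun n, symmetric])
    also have "\<dots> = distr N borel (\<lambda>\<omega>. \<Sum>k\<in>Inr ` {..<n}. \<omega> k)"
    proof (rule indep_sum_law_eq[OF N2.prob_space_axioms _ N.prob_space_axioms _ _ _ _ cylinder_algebra_bcontfun])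
      show "N2.indep_vars (\<lambda>_. borel) (\<lambda>i \<omega>. \<omega> i /\<^sub>R sqrt n) {..<n}"
        using N2.indep_vars_compose2[OF indep_vars_PiM_coordinates[of "{..<n}" "\<lambda>_. \<mu>"], of "\<lambda>_ z. z /\<^sub>R sqrt n" "\<lambda>_. borel"] \<mu> n scale
        by auto
      show "N.indep_vars (\<lambda>_. borel) (\<lambda>k \<omega>. \<omega> k) (Inr ` {..<n})"
        by (rule N.indep_vars_subset[OF indN]) (auto simp: K_def)
      show "bij_betw Inr {..<n} (Inr ` {..<n})" by (simp add: bij_betw_def)
      fix i assume i: "i \<in> {..<n}"
      have "distr (PiM {..<n} (\<lambda>_. \<mu>)) borel (\<lambda>\<omega>. \<omega> i /\<^sub>R sqrt n)
        = distr (distr (PiM {..<n} (\<lambda>_. \<mu>)) \<mu> (\<lambda>\<omega>. \<omega> i)) borel (\<lambda>z. z /\<^sub>R sqrt n)"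
        using i scale by (subst distr_distr) (auto simp: comp_def)
      also have "\<dots> = distr \<mu> borel (\<lambda>z. z /\<^sub>R sqrt n)"
        using distr_PiM_component[of "{..<n}" "\<lambda>_. \<mu>" i] \<mu> i by simp
      also have "\<dots> = distr N borel (\<lambda>\<omega>. \<omega> (Inr i))"
        using coord[of "Inr i"] i by (simp add: K_def \<nu>_def)
      finally show "distr (PiM {..<n} (\<lambda>_. \<mu>)) borel (\<lambda>\<omega>. \<omega> i /\<^sub>R sqrt n) = distr N borel (\<lambda>\<omega>. \<omega> (Inr i))" .
    qed simp
    finally show ?thesis .
  qed
  have mI: "(\<lambda>\<omega>. \<Sum>k\<in>Inl ` I. \<omega> k) \<in> borel_measurable N" and mJ: "(\<lambda>\<omega>. \<Sum>k\<in>Inr ` {..<n}. \<omega> k) \<in> borel_measurable N"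
    by (auto intro!: borel_measurable_sum ev simp: K_def)
  have mS: "(\<lambda>\<omega>. \<Sum>i\<in>I. X i \<omega>) \<in> borel_measurable P" using Xm by auto
  have sumI: "(\<integral>\<omega>. f (\<Sum>k\<in>Inl ` I. \<omega> k) \<partial>N) = (\<integral>\<omega>. f (\<Sum>i\<in>I. X i \<omega>) \<partial>P)" if "f \<in> borel_measurable borel" for f :: "_ \<Rightarrow> real"
    using integral_distr[OF mI that] integral_distr[OF mS that] by (simp add: lawI)
  have sumJ: "(\<integral>\<omega>. f (\<Sum>k\<in>Inr ` {..<n}. \<omega> k) \<partial>N) = (\<integral>\<omega>. f (Y \<omega>) \<partial>Q)" if "f \<in> borel_measurable borel" for f :: "_ \<Rightarrow> real"
    using integral_distr[OF mJ that] t\<mu>(1)[OF that] by (simp flip: lawJ)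
  have disj: "Inl ` I \<inter> Inr ` {..<n} = {}" by auto
  have "\<bar>(\<integral>\<omega>. log_partition \<pi> (c + (\<Sum>k\<in>Inl ` I. \<omega> k)) \<partial>N) - (\<integral>\<omega>. log_partition \<pi> (c + (\<Sum>k\<in>Inr ` {..<n}. \<omega> k)) \<partial>N)\<bar>
    \<le> \<kappa> + (\<Sum>k\<in>Inl ` I \<union> Inr ` {..<n}. \<integral>\<omega>. norm (\<omega> k) ^ 3 \<partial>N)"
  proof (rule lindeberg_comparison[OF N.prob_space_axioms _ _ disj])
    show "N.indep_vars (\<lambda>_. borel) (\<lambda>k \<omega>. \<omega> k) (Inl ` I \<union> Inr ` {..<n})" using indN by (simp add: K_def)
    fix k assume "k \<in> Inl ` I \<union> Inr ` {..<n}"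
    then consider i where "k = Inl i" "i \<in> I" | j where "k = Inr j" "j < n" by auto
    then show "(\<integral>\<omega>. \<omega> k \<partial>N) = 0" "integrable N (\<lambda>\<omega>. norm (\<omega> k) ^ 3)"
    proof (atomize (full), cases)
      case 1
      then show "(\<integral>\<omega>. \<omega> k \<partial>N) = 0 \<and> integrable N (\<lambda>\<omega>. norm (\<omega> k) ^ 3)"
        using tI(1)[of i "\<lambda>z. z"] tI(2)[of i "\<lambda>z. norm z ^ 3"] mean third by auto
    next
      case 2
      have "integrable Q (\<lambda>\<omega>. norm (Y \<omega> /\<^sub>R sqrt n) ^ 3)"
        using integrable_mult_right[OF Y3, of "inverse (sqrt n) ^ 3"] by (simp add: power_mult_distrib)
      then show "(\<integral>\<omega>. \<omega> k \<partial>N) = 0 \<and> integrable N (\<lambda>\<omega>. norm (\<omega> k) ^ 3)"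
        using 2 tJ(1)[of j "\<lambda>z. z"] tJ(2)[of j "\<lambda>z. norm z ^ 3"] Y0 by simp
    qed
  next
    fix s t
    have "(\<lambda>z :: 't \<Rightarrow>\<^sub>C real. apply_bcontfun z s * apply_bcontfun z t) \<in> borel_measurable borel"
      by (intro borel_measurable_times borel_measurable_bounded_linear bounded_linear_eval)
    from sumI[OF this] sumJ[OF this] \<kappa>[of s t]
    show "\<bar>(\<integral>\<omega>. apply_bcontfun (\<Sum>k\<in>Inl ` I. \<omega> k) s * apply_bcontfun (\<Sum>k\<in>Inl ` I. \<omega> k) t \<partial>N)
      - (\<integral>\<omega>. apply_bcontfun (\<Sum>k\<in>Inr ` {..<n}. \<omega> k) s * apply_bcontfun (\<Sum>k\<in>Inr ` {..<n}. \<omega> k) t \<partial>N)\<bar> \<le> \<kappa>" by simp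
  qed (use I in auto)
  also have "(\<Sum>k\<in>Inl ` I \<union> Inr ` {..<n}. \<integral>\<omega>. norm (\<omega> k) ^ 3 \<partial>N)
    = (\<Sum>i\<in>I. \<integral>\<omega>. norm (\<omega> (Inl i)) ^ 3 \<partial>N) + (\<Sum>j<n. \<integral>\<omega>. norm (\<omega> (Inr j)) ^ 3 \<partial>N)"
    using I by (subst sum.union_disjoint[OF _ _ disj]) (auto simp: sum.reindex)
  also have "(\<Sum>i\<in>I. \<integral>\<omega>. norm (\<omega> (Inl i)) ^ 3 \<partial>N) = (\<Sum>i\<in>I. \<integral>\<omega>. norm (X i \<omega>) ^ 3 \<partial>P)"
    by (intro sum.cong tI(1)[of _ "\<lambda>z. norm z ^ 3"]) auto
  also have "(\<Sum>j<n. \<integral>\<omega>. norm (\<omega> (Inr j)) ^ 3 \<partial>N) = (\<Sum>j<n. 1 / sqrt n ^ 3 * (\<integral>\<omega>. norm (Y \<omega>) ^ 3 \<partial>Q))"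
  proof (rule sum.cong[OF refl])
    fix j assume "j \<in> {..<n}"
    then have "(\<integral>\<omega>. norm (\<omega> (Inr j)) ^ 3 \<partial>N) = (\<integral>\<omega>. norm (Y \<omega> /\<^sub>R sqrt n) ^ 3 \<partial>Q)"
      by (intro tJ(1)[of _ "\<lambda>z. norm z ^ 3"]) auto
    also have "\<dots> = (\<integral>\<omega>. 1 / sqrt n ^ 3 * norm (Y \<omega>) ^ 3 \<partial>Q)"
      by (simp add: power_mult_distrib divide_inverse power_inverse)
    finally show "(\<integral>\<omega>. norm (\<omega> (Inr j)) ^ 3 \<partial>N) = 1 / sqrt n ^ 3 * (\<integral>\<omega>. norm (Y \<omega>) ^ 3 \<partial>Q)"
      by (simp only: integral_mult_right_zero)
  qed
  also have "\<dots> = (real n * (1 / sqrt n ^ 3)) * (\<integral>\<omega>. norm (Y \<omega>) ^ 3 \<partial>Q)" by simp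
  also have "\<dots> = (\<integral>\<omega>. norm (Y \<omega>) ^ 3 \<partial>Q) / sqrt n" unfolding sqrt_scaling[OF n] by simp
  also have "(\<integral>\<omega>. log_partition \<pi> (c + (\<Sum>k\<in>Inl ` I. \<omega> k)) \<partial>N) = (\<integral>\<omega>. log_partition \<pi> (c + (\<Sum>i\<in>I. X i \<omega>)) \<partial>P)"
    by (rule sumI) measurable
  also have "(\<integral>\<omega>. log_partition \<pi> (c + (\<Sum>k\<in>Inr ` {..<n}. \<omega> k)) \<partial>N) = (\<integral>\<omega>. log_partition \<pi> (c + Y \<omega>) \<partial>Q)"
    by (rule sumJ) measurable
  finally show "\<bar>(\<integral>\<omega>. log_partition \<pi> (c + (\<Sum>i\<in>I. X i \<omega>)) \<partial>P) - (\<integral>\<omega>. log_partition \<pi> (c + Y \<omega>) \<partial>Q)\<bar>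
    \<le> \<kappa> + (\<Sum>i\<in>I. \<integral>\<omega>. norm (X i \<omega>) ^ 3 \<partial>P) + (\<integral>\<omega>. norm (Y \<omega>) ^ 3 \<partial>Q) / sqrt n" by simp
qed

end

section \<open>The kernel averaged over the expected pair of Gibbs measures\<close>

lemma covariance_eq:
  fixes Z V :: "'w \<Rightarrow> 't::compact_metric_space \<Rightarrow>\<^sub>C real"
  assumes "integrable P Z" "integrable P V"
  shows "covariance P (\<lambda>\<omega>. Z \<omega> s) (\<lambda>\<omega>. V \<omega> t)
    = (\<integral>\<omega>. (Z \<omega> - (\<integral>\<omega>. Z \<omega> \<partial>P)) s * (V \<omega> - (\<integral>\<omega>. V \<omega> \<partial>P)) t \<partial>P)"
  using mean_fun_eq[OF assms(1)] mean_fun_eq[OF assms(2)]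
  by (simp add: covariance_def mean_fun_def fun_eq_iff)

text \<open>By Fubini \<open>U\<close> can be frozen at a suitable value. This gives the integrability of the
  derivative of a component even if its third moment is infinite.\<close>

lemma (in prob_space) integrable_summand_of_indep_sum:
  fixes U V :: "'a \<Rightarrow> 'e::{banach, second_countable_topology}"
  assumes ind: "indep_pair M borel U borel V" and int: "integrable M (\<lambda>\<omega>. norm (U \<omega> + V \<omega>))"
  shows "integrable M V"
proof -
  interpret MM: pair_prob_space M M ..
  have [measurable]: "U \<in> borel_measurable M" "V \<in> borel_measurable M" using ind by (auto simp: indep_pair_def)
  have "integrable (M \<Otimes>\<^sub>M M) (\<lambda>(\<omega>, \<omega>'). norm (U \<omega> + V \<omega>'))"
    using indep_pair_integral(1)[OF ind, of "\<lambda>(u, v). norm (u + v)"] int by simp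
  from MM.AE_integrable_fst'[OF this]
  have "AE \<omega> in M. integrable M (\<lambda>\<omega>'. norm (U \<omega> + V \<omega>'))" by simp
  then have "\<exists>\<omega>. integrable M (\<lambda>\<omega>'. norm (U \<omega> + V \<omega>'))"
    using AE_False eventually_mono by (metis (mono_tags, lifting))
  then obtain \<omega> where "integrable M (\<lambda>\<omega>'. norm (U \<omega> + V \<omega>'))" by blast
  then have "integrable M (\<lambda>\<omega>'. U \<omega> + V \<omega>')" by (rule integrable_norm_cancel) measurable
  from Bochner_Integration.integrable_diff[OF this integrable_const[of "U \<omega>"]] show ?thesis by simp
qed

context base_measure
begin

lemma measurable_gibbs_kernel [measurable]: "gibbs \<pi> \<in> measurable borel (subprob_algebra borel)"
proof (rule measurable_subprob_algebra)
  fix z :: "'t \<Rightarrow>\<^sub>C real"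
  show "subprob_space (gibbs \<pi> z)" by (rule prob_space_imp_subprob_space[OF prob_space_gibbs])
  show "sets (gibbs \<pi> z) = sets borel" by (rule sets_gibbs)
next
  fix A :: "'t set" assume A [measurable]: "A \<in> sets borel"
  have "emeasure (gibbs \<pi> z) A = (\<integral>\<^sup>+t. ennreal (exp (z t) / (\<integral>s. exp (z s) \<partial>\<pi>)) * indicator A t \<partial>\<pi>)" for z
    unfolding gibbs_def by (rule emeasure_density) auto
  then show "(\<lambda>z. emeasure (gibbs \<pi> z) A) \<in> borel_measurable borel" by simp
qed

lemma expected_gibbs2_props:
  assumes P: "prob_space P" and Z [measurable]: "Z \<in> borel_measurable P"
  shows "prob_space (expected_gibbs2 \<pi> P Z)" "sets (expected_gibbs2 \<pi> P Z) = sets borel"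
    and "\<And>(f :: 't \<times> 't \<Rightarrow> real) K. f \<in> borel_measurable borel \<Longrightarrow> (\<And>p. \<bar>f p\<bar> \<le> K) \<Longrightarrow>
      (\<integral>p. f p \<partial>expected_gibbs2 \<pi> P Z) = (\<integral>\<omega>. (\<integral>p. f p \<partial>(gibbs \<pi> (Z \<omega>) \<Otimes>\<^sub>M gibbs \<pi> (Z \<omega>))) \<partial>P)"
proof -
  interpret P: prob_space P by fact
  have k: "(\<lambda>\<omega>. gibbs \<pi> (Z \<omega>) \<Otimes>\<^sub>M gibbs \<pi> (Z \<omega>)) \<in> measurable P (subprob_algebra (borel \<Otimes>\<^sub>M borel))"
    by (rule measurable_pair_measure) measurable
  have pp: "prob_space (gibbs \<pi> z \<Otimes>\<^sub>M gibbs \<pi> z)" for z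
  proof -
    interpret G: prob_space "gibbs \<pi> z" by (rule prob_space_gibbs)
    interpret GG: pair_prob_space "gibbs \<pi> z" "gibbs \<pi> z" ..
    show ?thesis by (rule GG.prob_space_axioms)
  qed
  show "prob_space (expected_gibbs2 \<pi> P Z)"
    unfolding expected_gibbs2_def by (rule P.prob_space_bind[OF _ k]) (simp add: pp)
  show "sets (expected_gibbs2 \<pi> P Z) = sets borel"
    unfolding expected_gibbs2_def
    unfolding borel_prod[symmetric] by (rule sets_bind[OF sets_kernel[OF k] P.not_empty])
  fix f :: "'t \<times> 't \<Rightarrow> real" and K assume f: "f \<in> borel_measurable borel" "\<And>p. \<bar>f p\<bar> \<le> K"
  show "(\<integral>p. f p \<partial>expected_gibbs2 \<pi> P Z) = (\<integral>\<omega>. (\<integral>p. f p \<partial>(gibbs \<pi> (Z \<omega>) \<Otimes>\<^sub>M gibbs \<pi> (Z \<omega>))) \<partial>P)"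
    unfolding expected_gibbs2_def
  proof (rule integral_bind[OF _ _ k, where B=K and B'=1])
    show "f \<in> borel_measurable (borel \<Otimes>\<^sub>M borel)" using f(1) unfolding borel_prod .
    show "finite_measure P" by (rule P.finite_measure_axioms)
    show "AE \<omega> in P. emeasure (gibbs \<pi> (Z \<omega>) \<Otimes>\<^sub>M gibbs \<pi> (Z \<omega>)) (space (gibbs \<pi> (Z \<omega>) \<Otimes>\<^sub>M gibbs \<pi> (Z \<omega>))) \<le> ennreal 1"
      using prob_space.emeasure_space_1[OF pp] by simp
  qed (rule f(2))
qed

text \<open>The kernel \<open>psi\<close> consists of the mean of \<open>V\<close> and of the two covariance terms of an averaged
  Gibbs covariance, so its average over the expected pair of Gibbs measures is the main term of
  integration by parts for the mean Gibbs average of \<open>V\<close>.\<close>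

lemma Phi_psi_kernel:
  fixes Z V :: "'w \<Rightarrow> 't \<Rightarrow>\<^sub>C real"
  assumes P: "prob_space P" and int: "integrable P Z" "integrable P V"
    and int2: "integrable P (\<lambda>\<omega>. norm (Z \<omega> - (\<integral>\<omega>. Z \<omega> \<partial>P)) * norm (V \<omega> - (\<integral>\<omega>. V \<omega> \<partial>P)))"
  shows "integrable (expected_gibbs2 \<pi> P Z) (\<lambda>(s, t). psi_kernel P Z V s t)"
    and "Phi \<pi> P Z (psi_kernel P Z V) = (\<integral>\<omega>. gibbs_mean \<pi> (Z \<omega>) (\<integral>\<omega>. V \<omega> \<partial>P)
      + avg_gibbs_cov P (\<lambda>\<omega>. Z \<omega> - (\<integral>\<omega>. Z \<omega> \<partial>P)) (\<lambda>\<omega>. V \<omega> - (\<integral>\<omega>. V \<omega> \<partial>P)) (Z \<omega>) \<partial>P)"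
proof -
  interpret P: prob_space P by fact
  have Zm [measurable]: "Z \<in> borel_measurable P" and Vm [measurable]: "V \<in> borel_measurable P" using int by auto
  define EZ EV where "EZ = (\<integral>\<omega>. Z \<omega> \<partial>P)" and "EV = (\<integral>\<omega>. V \<omega> \<partial>P)"
  define Zc Vc where "Zc \<omega> = Z \<omega> - EZ" and "Vc \<omega> = V \<omega> - EV" for \<omega>
  have cm [measurable]: "Zc \<in> borel_measurable P" "Vc \<in> borel_measurable P" unfolding Zc_def Vc_def by measurable
  have int2': "integrable P (\<lambda>\<omega>. norm (Zc \<omega>) * norm (Vc \<omega>))" using int2 by (simp add: Zc_def Vc_def EZ_def EV_def)
  define C where "C s t = (\<integral>\<omega>. Zc \<omega> s * Vc \<omega> t \<partial>P)" for s t
  define c where "c = (\<integral>\<omega>. norm (Zc \<omega>) * norm (Vc \<omega>) \<partial>P)"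
  have psi: "psi_kernel P Z V s t = EV t + (C t t - C s t)" for s t
    using covariance_eq[OF int] by (simp add: psi_kernel_def mean_fun_eq[OF int(2)] C_def Zc_def Vc_def EZ_def EV_def)
  have C: "\<bar>C s t\<bar> \<le> c" for s t
  proof -
    have pt: "\<bar>Zc \<omega> s * Vc \<omega> t\<bar> \<le> norm (Zc \<omega>) * norm (Vc \<omega>)" for \<omega>
      unfolding abs_mult by (intro mult_mono abs_eval_le) auto
    have "\<bar>C s t\<bar> \<le> (\<integral>\<omega>. \<bar>Zc \<omega> s * Vc \<omega> t\<bar> \<partial>P)" unfolding C_def by (rule integral_abs_bound)
    also have "\<dots> \<le> c" unfolding c_def
      by (intro integral_mono int2' pt Bochner_Integration.integrable_bound[OF int2']) (auto simp: pt)
    finally show ?thesis .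
  qed
  have Cm [measurable]: "(\<lambda>p. C (fst p) (snd p)) \<in> borel_measurable (borel \<Otimes>\<^sub>M borel)"
    "(\<lambda>p. C (snd p) (snd p)) \<in> borel_measurable (borel \<Otimes>\<^sub>M borel)"
    unfolding C_def by measurable
  let ?f = "\<lambda>(s, t). psi_kernel P Z V s t"
  have fm: "?f \<in> borel_measurable borel"
    unfolding borel_prod[symmetric] psi case_prod_beta' by measurable
  have fb: "\<bar>?f p\<bar> \<le> norm EV + 2 * c" for p
    using abs_eval_le[of EV "snd p"] C[of "snd p" "snd p"] C[of "fst p" "snd p"]
    by (simp add: psi case_prod_beta' abs_le_iff)
  interpret E: prob_space "expected_gibbs2 \<pi> P Z" by (rule expected_gibbs2_props[OF P Zm])
  show "integrable (expected_gibbs2 \<pi> P Z) ?f"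
    by (rule E.integrable_const_bound[where B="norm EV + 2 * c"])
      (use fb fm in \<open>auto simp: measurable_cong_sets[OF expected_gibbs2_props(2)[OF P Zm] refl]\<close>)
  have 1: "Phi \<pi> P Z (psi_kernel P Z V) = (\<integral>\<omega>. (\<integral>p. ?f p \<partial>(gibbs \<pi> (Z \<omega>) \<Otimes>\<^sub>M gibbs \<pi> (Z \<omega>))) \<partial>P)"
    unfolding Phi_def by (rule expected_gibbs2_props(3)[OF P Zm fm fb])
  have 2: "(\<integral>p. ?f p \<partial>(gibbs \<pi> z \<Otimes>\<^sub>M gibbs \<pi> z)) = gibbs_mean \<pi> z EV + avg_gibbs_cov P Zc Vc z" for z
  proof -
    interpret G: prob_space "gibbs \<pi> z" by (rule prob_space_gibbs)
    interpret GG: pair_prob_space "gibbs \<pi> z" "gibbs \<pi> z" ..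
    have i1: "integrable (gibbs \<pi> z \<Otimes>\<^sub>M gibbs \<pi> z) (\<lambda>(s, t). EV t)"
      by (rule GG.integrable_const_bound[where B="norm EV"]) (auto simp: abs_eval_le)
    have i2: "integrable (gibbs \<pi> z \<Otimes>\<^sub>M gibbs \<pi> z) (\<lambda>(s, t). C t t - C s t)"
    proof (rule GG.integrable_const_bound[where B="2 * c"])
      show "AE p in gibbs \<pi> z \<Otimes>\<^sub>M gibbs \<pi> z. norm (case p of (s, t) \<Rightarrow> C t t - C s t) \<le> 2 * c"
      proof (rule AE_I2, clarsimp)
        fix s t show "\<bar>C t t - C s t\<bar> \<le> 2 * c" using C[of t t] C[of s t] by linarith
      qed
      show "(\<lambda>(s, t). C t t - C s t) \<in> borel_measurable (gibbs \<pi> z \<Otimes>\<^sub>M gibbs \<pi> z)"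
        unfolding case_prod_beta' by measurable
    qed
    have "(\<integral>p. ?f p \<partial>(gibbs \<pi> z \<Otimes>\<^sub>M gibbs \<pi> z)) = (\<integral>(s, t). EV t \<partial>(gibbs \<pi> z \<Otimes>\<^sub>M gibbs \<pi> z)) + (\<integral>(s, t). C t t - C s t \<partial>(gibbs \<pi> z \<Otimes>\<^sub>M gibbs \<pi> z))"
      using Bochner_Integration.integral_add[OF i1 i2] by (simp add: psi case_prod_beta')
    also have "(\<integral>(s, t). EV t \<partial>(gibbs \<pi> z \<Otimes>\<^sub>M gibbs \<pi> z)) = gibbs_mean \<pi> z EV"
      using GG.integral_fst'[OF i1] by (simp add: gibbs_mean_def)
    also have "(\<integral>(s, t). C t t - C s t \<partial>(gibbs \<pi> z \<Otimes>\<^sub>M gibbs \<pi> z)) = avg_gibbs_cov P Zc Vc z"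
      unfolding C_def by (rule avg_gibbs_cov_eq_pair_integral[OF P cm int2', symmetric])
    finally show ?thesis .
  qed
  show "Phi \<pi> P Z (psi_kernel P Z V) = (\<integral>\<omega>. gibbs_mean \<pi> (Z \<omega>) (\<integral>\<omega>. V \<omega> \<partial>P)
      + avg_gibbs_cov P (\<lambda>\<omega>. Z \<omega> - (\<integral>\<omega>. Z \<omega> \<partial>P)) (\<lambda>\<omega>. V \<omega> - (\<integral>\<omega>. V \<omega> \<partial>P)) (Z \<omega>) \<partial>P)"
    unfolding 1 2 by (simp add: Zc_def[abs_def] Vc_def[abs_def] EZ_def EV_def)
qed

lemma Phi_diff_le:
  assumes P: "prob_space P" "Z \<in> borel_measurable P"
    and int: "integrable (expected_gibbs2 \<pi> P Z) (\<lambda>(s, t). f s t)" "integrable (expected_gibbs2 \<pi> P Z) (\<lambda>(s, t). g s t)"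
    and fin: "sup_norm2 (\<lambda>s t. f s t - g s t) < \<infinity>"
  shows "\<bar>Phi \<pi> P Z f - Phi \<pi> P Z g\<bar> \<le> enn2real (sup_norm2 (\<lambda>s t. f s t - g s t))"
proof -
  interpret E: prob_space "expected_gibbs2 \<pi> P Z" by (rule expected_gibbs2_props[OF P])
  let ?d = "enn2real (sup_norm2 (\<lambda>s t. f s t - g s t))"
  have pt: "\<bar>(case p of (s, t) \<Rightarrow> f s t) - (case p of (s, t) \<Rightarrow> g s t)\<bar> \<le> ?d" for p
    using abs_le_enn2real_sup_norm2[OF fin] by (simp add: case_prod_beta')
  have "\<bar>Phi \<pi> P Z f - Phi \<pi> P Z g\<bar> = \<bar>\<integral>p. (case p of (s, t) \<Rightarrow> f s t) - (case p of (s, t) \<Rightarrow> g s t) \<partial>expected_gibbs2 \<pi> P Z\<bar>"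
    unfolding Phi_def Bochner_Integration.integral_diff[OF int] ..
  also have "\<dots> \<le> (\<integral>p. \<bar>(case p of (s, t) \<Rightarrow> f s t) - (case p of (s, t) \<Rightarrow> g s t)\<bar> \<partial>expected_gibbs2 \<pi> P Z)"
    by (rule integral_abs_bound)
  also have "\<dots> \<le> (\<integral>p. ?d \<partial>expected_gibbs2 \<pi> P Z)"
    using pt int by (intro integral_mono integrable_abs Bochner_Integration.integrable_diff) auto
  finally show ?thesis by (simp add: E.prob_space)
qed

end

section \<open>Differentiating the free energy\<close>

text \<open>The slopes of a convex function increase, so the limit of right difference quotients
  along a single sequence of steps is already the slope of a line that touches the graph from below.\<close>

lemma convex_on_support_line:
  fixes F :: "real \<Rightarrow> real"
  assumes F: "convex_on B F" and \<beta>: "\<beta> \<in> B" "\<gamma> \<in> B"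
    and h: "\<And>n. h n > 0" "\<And>n. \<beta> + h n \<in> B" "h \<longlonglongrightarrow> 0"
    and D: "(\<lambda>n. (F (\<beta> + h n) - F \<beta>) / h n) \<longlonglongrightarrow> D"
  shows "F \<beta> + D * (\<gamma> - \<beta>) \<le> F \<gamma>"
proof -
  consider "\<gamma> = \<beta>" | "\<gamma> > \<beta>" | "\<gamma> < \<beta>" by linarith
  then show ?thesis
  proof cases
    case 2
    have "\<forall>\<^sub>F n in sequentially. h n < \<gamma> - \<beta>" using h(3) 2 by (intro order_tendstoD) auto
    then have "\<forall>\<^sub>F n in sequentially. (F (\<beta> + h n) - F \<beta>) / h n \<le> (F \<gamma> - F \<beta>) / (\<gamma> - \<beta>)"
    proof eventually_elim
      fix n assume "h n < \<gamma> - \<beta>"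
      then have "(F \<beta> - F (\<beta> + h n)) / (\<beta> - (\<beta> + h n)) \<le> (F \<beta> - F \<gamma>) / (\<beta> - \<gamma>)"
        using h(1)[of n] by (intro convex_on_slope_le(1)[OF F \<beta>]) auto
      then show "(F (\<beta> + h n) - F \<beta>) / h n \<le> (F \<gamma> - F \<beta>) / (\<gamma> - \<beta>)"
        using minus_divide_divide[of "F \<gamma> - F \<beta>" "\<gamma> - \<beta>"] minus_divide_divide[of "F (\<beta> + h n) - F \<beta>" "h n"] by simp
    qed
    then have "D \<le> (F \<gamma> - F \<beta>) / (\<gamma> - \<beta>)" by (rule tendsto_upperbound[OF D]) simp
    then show ?thesis using 2 by (simp add: le_divide_eq mult.commute)
  next
    case 3
    have "(F \<beta> - F \<gamma>) / (\<beta> - \<gamma>) \<le> (F (\<beta> + h n) - F \<beta>) / h n" for n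
    proof -
      have "(F \<gamma> - F \<beta>) / (\<gamma> - \<beta>) \<le> (F \<gamma> - F (\<beta> + h n)) / (\<gamma> - (\<beta> + h n))"
        using 3 h(1)[of n] by (intro convex_on_slope_le(1)[OF F \<beta>(2) h(2)]) auto
      also have "\<dots> \<le> (F \<beta> - F (\<beta> + h n)) / (\<beta> - (\<beta> + h n))"
        using 3 h(1)[of n] by (intro convex_on_slope_le(2)[OF F \<beta>(2) h(2)]) auto
      finally show ?thesis
        using minus_divide_divide[of "F \<beta> - F \<gamma>" "\<beta> - \<gamma>"] minus_divide_divide[of "F (\<beta> + h n) - F \<beta>" "h n"] by simp
    qed
    then have "(F \<beta> - F \<gamma>) / (\<beta> - \<gamma>) \<le> D" by (intro tendsto_lowerbound[OF D]) auto
    then show ?thesis using 3 by (simp add: divide_le_eq algebra_simps)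
  qed simp
qed

lemma ennreal_divide_le_of_le_mult:
  assumes "ennreal a \<le> S * ennreal d" "d > 0" "a \<ge> 0"
  shows "ennreal (a / d) \<le> S"
proof -
  have "ennreal (a / d) = ennreal a * ennreal (1 / d)"
    using assms by (simp add: ennreal_mult'[symmetric])
  also have "\<dots> \<le> S * ennreal d * ennreal (1 / d)" using assms(1) by (rule mult_right_mono) simp
  also have "\<dots> = S" using assms(2) by (simp add: mult.assoc ennreal_mult'[symmetric])
  finally show ?thesis .
qed

text \<open>The bound is stated in the extended reals because the supremum is finite only for almost
  every sample.\<close>

lemma perturbation_lipschitz:
  fixes Xb :: "real \<Rightarrow> 'w \<Rightarrow> 'v::real_normed_vector"
  assumes pert: "perturbation \<Omega> B X Xb" and B: "is_interval B" and \<omega>: "\<omega> \<in> space \<Omega>" and bc: "\<beta> \<in> B" "\<gamma> \<in> B"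
  shows "ennreal (norm (Xb \<gamma> \<omega> - Xb \<beta> \<omega>)) \<le> (SUP b\<in>B. ennreal (norm (ddot Xb b \<omega>))) * ennreal \<bar>\<gamma> - \<beta>\<bar>"
proof (cases "\<gamma> = \<beta>")
  case False
  let ?S = "SUP b\<in>B. ennreal (norm (ddot Xb b \<omega>))"
  show ?thesis
  proof (cases "?S = \<top>")
    case True
    show ?thesis unfolding True using False by (simp add: ennreal_top_mult)
  next
    case fin: False
    define K where "K = enn2real ?S"
    have K: "ennreal K = ?S" unfolding K_def using fin by (intro ennreal_enn2real) (simp only: less_top)
    have K0: "K \<ge> 0" by (simp add: K_def)
    have le: "norm (ddot Xb b \<omega>) \<le> K" if "b \<in> B" for b
    proof -
      have "ennreal (norm (ddot Xb b \<omega>)) \<le> ennreal K" unfolding K by (rule SUP_upper[OF that])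
      then show ?thesis using K0 by simp
    qed
    have "norm (Xb \<gamma> \<omega> - Xb \<beta> \<omega>) \<le> K * norm (\<gamma> - \<beta>)"
    proof (rule differentiable_bound[where f="\<lambda>b. Xb b \<omega>" and f'="\<lambda>b x. x *\<^sub>R ddot Xb b \<omega>"])
      show "convex B" using B by (simp add: is_interval_convex)
      fix b assume b: "b \<in> B"
      have "(\<lambda>b. Xb b \<omega>) differentiable (at b)" using pert \<omega> b by (auto simp: perturbation_def)
      then have "((\<lambda>b. Xb b \<omega>) has_vector_derivative ddot Xb b \<omega>) (at b)"
        by (simp add: ddot_def vector_derivative_works)
      then show "((\<lambda>b. Xb b \<omega>) has_derivative (\<lambda>x. x *\<^sub>R ddot Xb b \<omega>)) (at b within B)"
        by (auto simp: has_vector_derivative_def intro: has_derivative_at_withinI)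
      show "onorm (\<lambda>x. x *\<^sub>R ddot Xb b \<omega>) \<le> K"
        by (rule onorm_le) (use le[OF b] in \<open>simp add: mult.commute[of K] mult_left_mono\<close>)
    qed (use bc in auto)
    then have "ennreal (norm (Xb \<gamma> \<omega> - Xb \<beta> \<omega>)) \<le> ennreal (K * \<bar>\<gamma> - \<beta>\<bar>)" by (intro ennreal_leI) simp
    then show ?thesis unfolding K[symmetric] using K0 by (simp add: ennreal_mult)
  qed
qed simp

lemma free_energy_eq: "free_energy \<pi> M Z = (\<integral>\<omega>. log_partition \<pi> (Z \<omega>) \<partial>M)"
  by (simp add: free_energy_def log_partition_def)

context base_measure
begin

text \<open>Differentiation under the expectation. The log partition function is Lipschitz with
  constant one, so its difference quotients are dominated by those of the random function, and these
  by the supremum of the norms of its derivatives. Integrability at one parameter \<open>\<gamma>0\<close> then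
  carries over to all others.\<close>

lemma perturbation_right_derivative:
  fixes Xb :: "real \<Rightarrow> 'w \<Rightarrow> 't \<Rightarrow>\<^sub>C real"
  assumes P: "prob_space P" and sets: "sets P = sets \<Omega>" and pert: "perturbation \<Omega> B X Xb"
    and B: "open B" "is_interval B" and \<beta>: "\<beta> \<in> B" and \<gamma>0: "\<gamma>0 \<in> B" "integrable P (\<lambda>\<omega>. norm (Xb \<gamma>0 \<omega>))"
    and dom: "(\<integral>\<^sup>+\<omega>. (SUP b\<in>B. ennreal (norm (ddot Xb b \<omega>))) \<partial>P) < \<infinity>"
  shows "integrable P (ddot Xb \<beta>)"
    and "\<exists>h. (\<forall>n. h n > 0 \<and> \<beta> + h n \<in> B) \<and> h \<longlonglongrightarrow> 0 \<and>
      (\<lambda>n. (free_energy \<pi> P (Xb (\<beta> + h n)) - free_energy \<pi> P (Xb \<beta>)) / h n)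
        \<longlonglongrightarrow> (\<integral>\<omega>. gibbs_mean \<pi> (Xb \<beta> \<omega>) (ddot Xb \<beta> \<omega>) \<partial>P)"
proof -
  interpret P: prob_space P by fact
  have space: "space P = space \<Omega>" using sets by (rule sets_eq_imp_space_eq)
  let ?S = "\<lambda>\<omega>. SUP b\<in>B. ennreal (norm (ddot Xb b \<omega>))"
  have meas: "Xb b \<in> borel_measurable P" if "b \<in> B" for b
    using pert that unfolding perturbation_def measurable_cong_sets[OF sets refl] by blast
  have vd: "((\<lambda>b. Xb b \<omega>) has_vector_derivative ddot Xb b \<omega>) (at b)" if "b \<in> B" "\<omega> \<in> space P" for b \<omega>
    using pert that by (auto simp: perturbation_def ddot_def vector_derivative_works space)
  obtain e where e: "e > 0" "ball \<beta> e \<subseteq> B" using B(1) \<beta> by (auto simp: open_contains_ball)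
  define h where "h n = e / 2 * inverse (real (Suc n))" for n :: nat
  have h: "h n > 0" "h n < e" for n
  proof -
    show "h n > 0" using e(1) by (simp add: h_def)
    have "h n \<le> e / 2 * 1" unfolding h_def using e(1) by (intro mult_left_mono) (auto simp: inverse_eq_divide)
    then show "h n < e" using e(1) by simp
  qed
  have hB: "\<beta> + h n \<in> B" for n
    using e(2) h[of n] by (intro subsetD[OF e(2)]) (simp add: dist_real_def)
  have hlim: "h \<longlonglongrightarrow> 0"
    unfolding h_def using tendsto_mult[OF tendsto_const[of "e / 2"] LIMSEQ_inverse_real_of_nat] by simp
  have lip: "ennreal (norm (Xb c \<omega> - Xb b \<omega>)) \<le> ?S \<omega> * ennreal \<bar>c - b\<bar>" if "b \<in> B" "c \<in> B" "\<omega> \<in> space P" for b c \<omega>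
    using perturbation_lipschitz[OF pert B(2)] that by (simp add: space)
  have int: "integrable P (\<lambda>\<omega>. norm (Xb b \<omega>))" if b: "b \<in> B" for b
  proof -
    note [measurable] = meas[OF b] meas[OF \<gamma>0(1)]
    have "integrable P (\<lambda>\<omega>. Xb b \<omega> - Xb \<gamma>0 \<omega>)"
    proof (rule integrableI_bounded)
      have "(\<integral>\<^sup>+\<omega>. ennreal (norm (Xb b \<omega> - Xb \<gamma>0 \<omega>)) \<partial>P) \<le> (\<integral>\<^sup>+\<omega>. ?S \<omega> \<partial>P) * ennreal \<bar>b - \<gamma>0\<bar>"
      proof (cases "b = \<gamma>0")
        case False
        define g where "g \<omega> = ennreal (norm (Xb b \<omega> - Xb \<gamma>0 \<omega>) / \<bar>b - \<gamma>0\<bar>)" for \<omega>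
        have [measurable]: "g \<in> borel_measurable P" unfolding g_def by measurable
        have g: "g \<omega> \<le> ?S \<omega>" if "\<omega> \<in> space P" for \<omega>
          unfolding g_def using False by (intro ennreal_divide_le_of_le_mult lip \<gamma>0(1) b that) auto
        have "(\<integral>\<^sup>+\<omega>. ennreal (norm (Xb b \<omega> - Xb \<gamma>0 \<omega>)) \<partial>P) = (\<integral>\<^sup>+\<omega>. g \<omega> * ennreal \<bar>b - \<gamma>0\<bar> \<partial>P)"
          using False by (simp add: g_def ennreal_mult'[symmetric])
        also have "\<dots> = (\<integral>\<^sup>+\<omega>. g \<omega> \<partial>P) * ennreal \<bar>b - \<gamma>0\<bar>" by (rule nn_integral_multc) measurable
        also have "\<dots> \<le> (\<integral>\<^sup>+\<omega>. ?S \<omega> \<partial>P) * ennreal \<bar>b - \<gamma>0\<bar>"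
          by (intro mult_right_mono nn_integral_mono g) auto
        finally show ?thesis .
      qed simp
      also have "\<dots> < \<infinity>" using dom by (simp add: ennreal_mult_less_top)
      finally show "(\<integral>\<^sup>+\<omega>. ennreal (norm (Xb b \<omega> - Xb \<gamma>0 \<omega>)) \<partial>P) < \<infinity>" .
    qed measurable
    moreover have "integrable P (Xb \<gamma>0)" by (rule integrable_norm_cancel[OF \<gamma>0(2)]) measurable
    ultimately have "integrable P (\<lambda>\<omega>. (Xb b \<omega> - Xb \<gamma>0 \<omega>) + Xb \<gamma>0 \<omega>)" by (rule Bochner_Integration.integrable_add)
    then show ?thesis by simp
  qed
  note [measurable] = meas[OF \<beta>] meas[OF hB]
  have quot: "(\<lambda>n. (Xb (\<beta> + h n) \<omega> - Xb \<beta> \<omega>) /\<^sub>R h n) \<longlonglongrightarrow> ddot Xb \<beta> \<omega>" if "\<omega> \<in> space P" for \<omega>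
  proof -
    have "((\<lambda>k. norm (Xb (\<beta> + k) \<omega> - Xb \<beta> \<omega> - k *\<^sub>R ddot Xb \<beta> \<omega>) / norm k) \<longlongrightarrow> 0) (at 0)"
      using vd[OF \<beta> that] unfolding has_vector_derivative_def has_derivative_at by blast
    moreover have "\<forall>n. h n \<noteq> 0" using h(1) by (metis less_irrefl)
    ultimately have "(\<lambda>n. norm (Xb (\<beta> + h n) \<omega> - Xb \<beta> \<omega> - h n *\<^sub>R ddot Xb \<beta> \<omega>) / norm (h n)) \<longlonglongrightarrow> 0"
      using hlim by (simp flip: LIMSEQ_SEQ_conv)
    also have "(\<lambda>n. norm (Xb (\<beta> + h n) \<omega> - Xb \<beta> \<omega> - h n *\<^sub>R ddot Xb \<beta> \<omega>) / norm (h n))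
      = (\<lambda>n. norm ((Xb (\<beta> + h n) \<omega> - Xb \<beta> \<omega>) /\<^sub>R h n - ddot Xb \<beta> \<omega>))"
    proof
      fix n
      have "(Xb (\<beta> + h n) \<omega> - Xb \<beta> \<omega>) /\<^sub>R h n - ddot Xb \<beta> \<omega> = (Xb (\<beta> + h n) \<omega> - Xb \<beta> \<omega> - h n *\<^sub>R ddot Xb \<beta> \<omega>) /\<^sub>R h n"
        using h(1)[of n] by (simp add: scaleR_diff_right)
      then show "norm (Xb (\<beta> + h n) \<omega> - Xb \<beta> \<omega> - h n *\<^sub>R ddot Xb \<beta> \<omega>) / norm (h n)
        = norm ((Xb (\<beta> + h n) \<omega> - Xb \<beta> \<omega>) /\<^sub>R h n - ddot Xb \<beta> \<omega>)"
        using h(1)[of n] by (simp only: norm_scaleR) (simp add: divide_inverse mult.commute)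
    qed
    finally show ?thesis by (rule LIM_zero_cancel[OF tendsto_norm_zero_cancel])
  qed
  have dm [measurable]: "ddot Xb \<beta> \<in> borel_measurable P"
    by (rule borel_measurable_LIMSEQ_metric[OF _ quot]) measurable
  show di: "integrable P (ddot Xb \<beta>)"
  proof (rule integrableI_bounded)
    have "(\<integral>\<^sup>+\<omega>. ennreal (norm (ddot Xb \<beta> \<omega>)) \<partial>P) \<le> (\<integral>\<^sup>+\<omega>. ?S \<omega> \<partial>P)"
      by (intro nn_integral_mono SUP_upper \<beta>)
    then show "(\<integral>\<^sup>+\<omega>. ennreal (norm (ddot Xb \<beta> \<omega>)) \<partial>P) < \<infinity>" using dom by (rule le_less_trans)
  qed measurable
  \<comment> \<open>the supremum over all of \<open>B\<close> need not be measurable; the supremum over the step sequence is\<close>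
  define g where "g \<omega> = (SUP n. ennreal (norm (Xb (\<beta> + h n) \<omega> - Xb \<beta> \<omega>) / h n))" for \<omega>
  have gm [measurable]: "g \<in> borel_measurable P" unfolding g_def by measurable
  have g_le: "g \<omega> \<le> ?S \<omega>" if "\<omega> \<in> space P" for \<omega>
    unfolding g_def
  proof (rule SUP_least)
    fix n
    show "ennreal (norm (Xb (\<beta> + h n) \<omega> - Xb \<beta> \<omega>) / h n) \<le> ?S \<omega>"
      using lip[OF \<beta> hB that, of n] h(1)[of n] by (intro ennreal_divide_le_of_le_mult) auto
  qed
  have gfin: "(\<integral>\<^sup>+\<omega>. g \<omega> \<partial>P) < \<infinity>"
    using nn_integral_mono[of P g ?S] g_le dom by (meson le_less_trans)
  then have gAE: "AE \<omega> in P. g \<omega> \<noteq> \<infinity>" by (intro nn_integral_noteq_infinite) auto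
  have gi: "integrable P (\<lambda>\<omega>. enn2real (g \<omega>))"
  proof (rule integrableI_bounded)
    have "(\<integral>\<^sup>+\<omega>. ennreal (norm (enn2real (g \<omega>))) \<partial>P) = (\<integral>\<^sup>+\<omega>. g \<omega> \<partial>P)"
      using gAE by (intro nn_integral_cong_AE) (auto simp: less_top)
    then show "(\<integral>\<^sup>+\<omega>. ennreal (norm (enn2real (g \<omega>))) \<partial>P) < \<infinity>" using gfin by simp
  qed measurable
  have li: "integrable P (\<lambda>\<omega>. log_partition \<pi> (Xb b \<omega>))" if "b \<in> B" for b
  proof (rule Bochner_Integration.integrable_bound[OF int[OF that]])
    show "(\<lambda>\<omega>. log_partition \<pi> (Xb b \<omega>)) \<in> borel_measurable P" using meas[OF that] by measurable
  qed (simp add: abs_log_partition_le)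
  have "(\<lambda>n. ((\<integral>\<omega>. log_partition \<pi> (Xb (\<beta> + h n) \<omega>) \<partial>P) - (\<integral>\<omega>. log_partition \<pi> (Xb \<beta> \<omega>) \<partial>P)) / h n)
        \<longlonglongrightarrow> (\<integral>\<omega>. gibbs_mean \<pi> (Xb \<beta> \<omega>) (ddot Xb \<beta> \<omega>) \<partial>P)"
  proof (rule integral_quotient_tendsto[OF hlim _ li[OF \<beta>] li[OF hB] gi])
    show "h n \<noteq> 0" for n using h(1)[of n] by simp
    show "((\<lambda>b. log_partition \<pi> (Xb b \<omega>)) has_real_derivative gibbs_mean \<pi> (Xb \<beta> \<omega>) (ddot Xb \<beta> \<omega>)) (at \<beta>)"
      if "\<omega> \<in> space P" for \<omega>
      by (rule log_partition_has_real_derivative[OF vd[OF \<beta> that]])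
    show "AE \<omega> in P. \<forall>n. \<bar>log_partition \<pi> (Xb (\<beta> + h n) \<omega>) - log_partition \<pi> (Xb \<beta> \<omega>)\<bar> \<le> enn2real (g \<omega>) * \<bar>h n\<bar>"
      using gAE
    proof eventually_elim
      fix \<omega> assume fin: "g \<omega> \<noteq> \<infinity>"
      show "\<forall>n. \<bar>log_partition \<pi> (Xb (\<beta> + h n) \<omega>) - log_partition \<pi> (Xb \<beta> \<omega>)\<bar> \<le> enn2real (g \<omega>) * \<bar>h n\<bar>"
      proof
        fix n
        have "ennreal (norm (Xb (\<beta> + h n) \<omega> - Xb \<beta> \<omega>) / h n) \<le> g \<omega>" unfolding g_def by (rule SUP_upper) simp
        from enn2real_mono[OF this] fin h(1)[of n]
        have "norm (Xb (\<beta> + h n) \<omega> - Xb \<beta> \<omega>) / h n \<le> enn2real (g \<omega>)" by (simp add: less_top)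
        then have "norm (Xb (\<beta> + h n) \<omega> - Xb \<beta> \<omega>) \<le> enn2real (g \<omega>) * \<bar>h n\<bar>" using h(1)[of n] by (simp add: divide_le_eq)
        then show "\<bar>log_partition \<pi> (Xb (\<beta> + h n) \<omega>) - log_partition \<pi> (Xb \<beta> \<omega>)\<bar> \<le> enn2real (g \<omega>) * \<bar>h n\<bar>"
          using log_partition_lipschitz order_trans by blast
      qed
    qed
  qed measurable
  then show "\<exists>h. (\<forall>n. h n > 0 \<and> \<beta> + h n \<in> B) \<and> h \<longlonglongrightarrow> 0 \<and>
      (\<lambda>n. (free_energy \<pi> P (Xb (\<beta> + h n)) - free_energy \<pi> P (Xb \<beta>)) / h n)
        \<longlonglongrightarrow> (\<integral>\<omega>. gibbs_mean \<pi> (Xb \<beta> \<omega>) (ddot Xb \<beta> \<omega>) \<partial>P)"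
    using h(1) hB hlim by (intro exI[of _ h]) (simp add: free_energy_eq)
qed

text \<open>Replacing the mean of the sum by that of the Gaussian costs at most the distance of the two
  means, as the log partition function is Lipschitz with constant one. After this shift only
  centered random functions are compared.\<close>

lemma free_energy_comparison:
  fixes X :: "'i \<Rightarrow> 'w \<Rightarrow> 't \<Rightarrow>\<^sub>C real" and Y :: "'v \<Rightarrow> 't \<Rightarrow>\<^sub>C real"
  assumes P: "prob_space P" and I: "finite I" and ind: "prob_space.indep_vars P (\<lambda>_. borel) X I"
    and third: "\<And>i. i \<in> I \<Longrightarrow> integrable P (\<lambda>\<omega>. norm (X i \<omega>) ^ 3)"
    and XX: "\<And>\<omega>. \<omega> \<in> space P \<Longrightarrow> XX \<omega> = (\<Sum>i\<in>I. X i \<omega>)"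
    and Q: "prob_space Q" and G: "gaussian Q Y"
    and fin: "sup_norm (\<lambda>t. mean_fun P XX t - mean_fun Q Y t) < \<infinity>"
      "sup_norm2 (\<lambda>s t. cov_kernel P XX s t - cov_kernel Q Y s t) < \<infinity>"
  shows "\<bar>free_energy \<pi> P XX - free_energy \<pi> Q Y\<bar>
    \<le> enn2real (sup_norm (\<lambda>t. mean_fun P XX t - mean_fun Q Y t))
      + enn2real (sup_norm2 (\<lambda>s t. cov_kernel P XX s t - cov_kernel Q Y s t))
      + (\<Sum>i\<in>I. \<integral>\<omega>. norm (X i \<omega> - (\<integral>\<omega>. X i \<omega> \<partial>P)) ^ 3 \<partial>P)"
proof -
  interpret P: prob_space P by fact
  interpret Q: prob_space Q by fact
  have Xm: "X i \<in> borel_measurable P" if "i \<in> I" for i using ind that by (auto simp: P.indep_vars_def)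
  have iX: "integrable P (X i)" if "i \<in> I" for i by (rule P.third_moment_centered(1)[OF Xm third]) (rule that)+
  have Ym [measurable]: "Y \<in> borel_measurable Q" by (rule gaussian_measurable[OF G])
  have Y3: "integrable Q (\<lambda>\<omega>. norm (Y \<omega>) ^ 3)" by (rule gaussian_third_moment[OF Q G])
  have iY: "integrable Q Y" by (rule Q.third_moment_centered(1)[OF Ym Y3])
  define mX where "mX i = (\<integral>\<omega>. X i \<omega> \<partial>P)" for i
  define mY where "mY = (\<integral>\<omega>. Y \<omega> \<partial>Q)"
  define mXX where "mXX = (\<integral>\<omega>. XX \<omega> \<partial>P)"
  have iSum: "integrable P (\<lambda>\<omega>. \<Sum>i\<in>I. X i \<omega>)" using iX by auto
  have iXX: "integrable P XX"
    using Bochner_Integration.integrable_cong[of P P XX "\<lambda>\<omega>. \<Sum>i\<in>I. X i \<omega>"] XX iSum by blast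
  have mXX: "mXX = (\<Sum>i\<in>I. mX i)"
    unfolding mXX_def mX_def using iX Bochner_Integration.integral_cong[OF refl XX, of P "\<lambda>x. x"]
    by (simp add: Bochner_Integration.integral_sum XX cong: Bochner_Integration.integral_cong)
  have cent: "XX \<omega> - mXX = (\<Sum>i\<in>I. X i \<omega> - mX i)" if "\<omega> \<in> space P" for \<omega>
    by (simp add: XX[OF that] mXX sum_subtractf)
  let ?d = "enn2real (sup_norm (\<lambda>t. mean_fun P XX t - mean_fun Q Y t))"
  let ?\<kappa> = "enn2real (sup_norm2 (\<lambda>s t. cov_kernel P XX s t - cov_kernel Q Y s t))"
  have d: "norm (mXX - mY) \<le> ?d"
    using abs_le_enn2real_sup_norm[OF fin(1)]
    by (intro norm_bound) (simp add: mean_fun_eq[OF iXX] mean_fun_eq[OF iY] mXX_def mY_def)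
  have sm: "(\<lambda>\<omega>. \<Sum>i\<in>I. X i \<omega> - mX i) \<in> borel_measurable P" using Xm by auto
  have iS: "integrable P (\<lambda>\<omega>. c + (\<Sum>i\<in>I. X i \<omega> - mX i))" for c using iX by auto
  have ilp: "integrable P (\<lambda>\<omega>. log_partition \<pi> (c + (\<Sum>i\<in>I. X i \<omega> - mX i)))" for c
    by (rule Bochner_Integration.integrable_bound[OF integrable_norm[OF iS[of c]]])
      (use sm abs_log_partition_le in auto)
  have "\<bar>(\<integral>\<omega>. log_partition \<pi> (mXX + (\<Sum>i\<in>I. X i \<omega> - mX i)) \<partial>P) - (\<integral>\<omega>. log_partition \<pi> (mY + (\<Sum>i\<in>I. X i \<omega> - mX i)) \<partial>P)\<bar>
    = \<bar>\<integral>\<omega>. log_partition \<pi> (mXX + (\<Sum>i\<in>I. X i \<omega> - mX i)) - log_partition \<pi> (mY + (\<Sum>i\<in>I. X i \<omega> - mX i)) \<partial>P\<bar>"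
    unfolding Bochner_Integration.integral_diff[OF ilp ilp] ..
  also have "\<dots> \<le> (\<integral>\<omega>. \<bar>log_partition \<pi> (mXX + (\<Sum>i\<in>I. X i \<omega> - mX i)) - log_partition \<pi> (mY + (\<Sum>i\<in>I. X i \<omega> - mX i))\<bar> \<partial>P)"
    by (rule integral_abs_bound)
  also have "\<dots> \<le> (\<integral>\<omega>. ?d \<partial>P)"
  proof (intro integral_mono integrable_abs Bochner_Integration.integrable_diff ilp)
    fix \<omega>
    have "\<bar>log_partition \<pi> (mXX + (\<Sum>i\<in>I. X i \<omega> - mX i)) - log_partition \<pi> (mY + (\<Sum>i\<in>I. X i \<omega> - mX i))\<bar>
      \<le> norm ((mXX + (\<Sum>i\<in>I. X i \<omega> - mX i)) - (mY + (\<Sum>i\<in>I. X i \<omega> - mX i)))"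
      by (rule log_partition_lipschitz)
    also have "(mXX + (\<Sum>i\<in>I. X i \<omega> - mX i)) - (mY + (\<Sum>i\<in>I. X i \<omega> - mX i)) = mXX - mY"
      by (simp only: add_diff_cancel_right)
    finally show "\<bar>log_partition \<pi> (mXX + (\<Sum>i\<in>I. X i \<omega> - mX i)) - log_partition \<pi> (mY + (\<Sum>i\<in>I. X i \<omega> - mX i))\<bar> \<le> ?d"
      using d by simp
  qed simp
  finally have step1: "\<bar>(\<integral>\<omega>. log_partition \<pi> (mXX + (\<Sum>i\<in>I. X i \<omega> - mX i)) \<partial>P) - (\<integral>\<omega>. log_partition \<pi> (mY + (\<Sum>i\<in>I. X i \<omega> - mX i)) \<partial>P)\<bar> \<le> ?d"
    by (simp add: P.prob_space)
  have step2: "\<bar>(\<integral>\<omega>. log_partition \<pi> (mY + (\<Sum>i\<in>I. X i \<omega> - mX i)) \<partial>P) - (\<integral>\<omega>. log_partition \<pi> (mY + (Y \<omega> - mY)) \<partial>Q)\<bar>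
    \<le> ?\<kappa> + (\<Sum>i\<in>I. \<integral>\<omega>. norm (X i \<omega> - mX i) ^ 3 \<partial>P)"
  proof (rule gaussian_comparison[OF P I _ _ _ Q])
    show "P.indep_vars (\<lambda>_. borel) (\<lambda>i \<omega>. X i \<omega> - mX i) I"
      by (rule P.indep_vars_compose2[OF ind]) auto
    show "(\<integral>\<omega>. X i \<omega> - mX i \<partial>P) = 0" if "i \<in> I" for i
      using iX[OF that] by (simp add: mX_def P.prob_space)
    show "integrable P (\<lambda>\<omega>. norm (X i \<omega> - mX i) ^ 3)" if "i \<in> I" for i
      by (rule P.third_moment_centered(2)[OF Xm third]) (rule that)+
    show "centered_gaussian_law (distr Q borel (\<lambda>\<omega>. Y \<omega> - mY))"
      unfolding mY_def by (rule gaussian_centered_law[OF Q G iY])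
    show "integrable Q (\<lambda>\<omega>. norm (Y \<omega> - mY) ^ 3)" by (rule Q.third_moment_centered(2)[OF Ym Y3])
    show "(\<integral>\<omega>. Y \<omega> - mY \<partial>Q) = 0" using iY by (simp add: mY_def Q.prob_space)
    fix s t
    have "(\<integral>\<omega>. (\<Sum>i\<in>I. X i \<omega> - mX i) s * (\<Sum>i\<in>I. X i \<omega> - mX i) t \<partial>P) = (\<integral>\<omega>. (XX \<omega> - mXX) s * (XX \<omega> - mXX) t \<partial>P)"
      by (rule Bochner_Integration.integral_cong[OF refl]) (simp only: cent)
    then show "\<bar>(\<integral>\<omega>. (\<Sum>i\<in>I. X i \<omega> - mX i) s * (\<Sum>i\<in>I. X i \<omega> - mX i) t \<partial>P) - (\<integral>\<omega>. (Y \<omega> - mY) s * (Y \<omega> - mY) t \<partial>Q)\<bar> \<le> ?\<kappa>"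
      using abs_le_enn2real_sup_norm2[OF fin(2), of s t]
      unfolding cov_kernel_def covariance_eq[OF iXX iXX] covariance_eq[OF iY iY] by (simp add: mXX_def mY_def)
  qed measurable
  have "(\<integral>\<omega>. log_partition \<pi> (XX \<omega>) \<partial>P) = (\<integral>\<omega>. log_partition \<pi> (mXX + (\<Sum>i\<in>I. X i \<omega> - mX i)) \<partial>P)"
    by (rule Bochner_Integration.integral_cong[OF refl]) (simp add: cent[symmetric])
  then show ?thesis using step1 step2 by (simp add: free_energy_eq mX_def)
qed

end

section \<open>Error terms\<close>

lemma ennreal_powr_eq_0_D: "ennreal_powr x a = 0 \<Longrightarrow> x = 0"
  by (auto simp: ennreal_powr_def enn2real_eq_0_iff split: if_splits)

lemma ennreal_powr_ennreal: "x \<ge> 0 \<Longrightarrow> ennreal_powr (ennreal x) a = ennreal (x powr a)"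
  by (simp add: ennreal_powr_def)

lemma enn2real_sum:
  assumes "\<And>i. i \<in> I \<Longrightarrow> f i < \<infinity>"
  shows "enn2real (\<Sum>i\<in>I. f i) = (\<Sum>i\<in>I. enn2real (f i))"
  using assms
proof (induction I rule: infinite_finite_induct)
  case (insert x F)
  then show ?case by (simp add: enn2real_plus)
qed simp_all

text \<open>The error of one summand in terms of extended moments. The product on the right can be
  finite although the third moment of \<open>V\<close> is infinite.\<close>

lemma (in prob_space) leave_one_out_error_le:
  fixes X V :: "'a \<Rightarrow> 't::compact_metric_space \<Rightarrow>\<^sub>C real"
  assumes [measurable]: "X \<in> borel_measurable M" "V \<in> borel_measurable M"
    and X3: "integrable M (\<lambda>\<omega>. norm (X \<omega>) ^ 3)" and V1: "integrable M V"
    and fin: "ennreal_powr (centered_moment3 M X) (2 / 3) * ennreal_powr (centered_moment3 M V) (1 / 3) < \<infinity>"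
  defines "Xc \<equiv> \<lambda>\<omega>. X \<omega> - (\<integral>\<omega>. X \<omega> \<partial>M)" and "Vc \<equiv> \<lambda>\<omega>. V \<omega> - (\<integral>\<omega>. V \<omega> \<partial>M)"
  shows "integrable M (\<lambda>\<omega>. norm (Xc \<omega>) * norm (Vc \<omega>))" "integrable M (\<lambda>\<omega>. (norm (Xc \<omega>))\<^sup>2 * norm (Vc \<omega>))"
    and "(\<integral>\<omega>. (norm (Xc \<omega>))\<^sup>2 * norm (Vc \<omega>) \<partial>M) + 2 * (\<integral>\<omega>. norm (Xc \<omega>) \<partial>M) * (\<integral>\<omega>. norm (Xc \<omega>) * norm (Vc \<omega>) \<partial>M)
      \<le> 3 * enn2real (ennreal_powr (centered_moment3 M X) (2 / 3) * ennreal_powr (centered_moment3 M V) (1 / 3))"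
proof -
  have Xm: "Xc \<in> borel_measurable M" and Vm: "Vc \<in> borel_measurable M" unfolding Xc_def Vc_def by measurable
  note [measurable] = Xm Vm
  have Xc3: "integrable M (\<lambda>\<omega>. norm (Xc \<omega>) ^ 3)" unfolding Xc_def by (rule third_moment_centered(2)) (use X3 in auto)
  have cX: "centered_moment3 M X = ennreal (\<integral>\<omega>. norm (Xc \<omega>) ^ 3 \<partial>M)"
    unfolding Xc_def by (rule third_moment_centered(3)) (use X3 in auto)
  have "integrable M (\<lambda>\<omega>. norm (Xc \<omega>) * norm (Vc \<omega>)) \<and> integrable M (\<lambda>\<omega>. (norm (Xc \<omega>))\<^sup>2 * norm (Vc \<omega>)) \<and>
    (\<integral>\<omega>. (norm (Xc \<omega>))\<^sup>2 * norm (Vc \<omega>) \<partial>M) + 2 * (\<integral>\<omega>. norm (Xc \<omega>) \<partial>M) * (\<integral>\<omega>. norm (Xc \<omega>) * norm (Vc \<omega>) \<partial>M)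
      \<le> 3 * enn2real (ennreal_powr (centered_moment3 M X) (2 / 3) * ennreal_powr (centered_moment3 M V) (1 / 3))"
  proof (cases "centered_moment3 M V < \<infinity>")
    case True
    have V3: "integrable M (\<lambda>\<omega>. norm (V \<omega>) ^ 3)" by (rule third_moment_of_centered_moment3[OF _ True]) simp
    have Vc3: "integrable M (\<lambda>\<omega>. norm (Vc \<omega>) ^ 3)" unfolding Vc_def by (rule third_moment_centered(2)) (use V3 in auto)
    have cV: "centered_moment3 M V = ennreal (\<integral>\<omega>. norm (Vc \<omega>) ^ 3 \<partial>M)"
      unfolding Vc_def by (rule third_moment_centered(3)) (use V3 in auto)
    have nn: "(\<integral>\<omega>. norm (Xc \<omega>) ^ 3 \<partial>M) \<ge> 0" "(\<integral>\<omega>. norm (Vc \<omega>) ^ 3 \<partial>M) \<ge> 0"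
      by (auto intro!: integral_nonneg_AE)
    have "enn2real (ennreal_powr (centered_moment3 M X) (2 / 3) * ennreal_powr (centered_moment3 M V) (1 / 3))
      = (\<integral>\<omega>. norm (Xc \<omega>) ^ 3 \<partial>M) powr (2 / 3) * (\<integral>\<omega>. norm (Vc \<omega>) ^ 3 \<partial>M) powr (1 / 3)"
      using nn by (simp add: cX cV ennreal_powr_ennreal enn2real_mult)
    then show ?thesis
      using moment_error_le[of "\<lambda>\<omega>. norm (Xc \<omega>)" "\<lambda>\<omega>. norm (Vc \<omega>)"] Xc3 Vc3 by auto
  next
    case False
    \<comment> \<open>the convention \<open>0 * \<infinity> = 0\<close>: where an infinite moment of \<open>V\<close> gives a finite product, \<open>X\<close> is deterministic\<close>
    then have "ennreal_powr (centered_moment3 M V) (1 / 3) = \<infinity>" by (simp add: ennreal_powr_def less_top)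
    then have "ennreal_powr (centered_moment3 M X) (2 / 3) = 0"
      using fin by (simp add: ennreal_mult_less_top)
    then have "centered_moment3 M X = 0" by (rule ennreal_powr_eq_0_D)
    then have "(\<integral>\<omega>. norm (Xc \<omega>) ^ 3 \<partial>M) \<le> 0" by (simp add: cX ennreal_eq_0_iff)
    moreover have "(\<integral>\<omega>. norm (Xc \<omega>) ^ 3 \<partial>M) \<ge> 0" by (auto intro!: integral_nonneg_AE)
    ultimately have "(\<integral>\<omega>. norm (Xc \<omega>) ^ 3 \<partial>M) = 0" by simp
    then have "AE \<omega> in M. norm (Xc \<omega>) ^ 3 = 0"
      using integral_nonneg_eq_0_iff_AE[OF Xc3] by simp
    then have AE: "AE \<omega> in M. norm (Xc \<omega>) * norm (Vc \<omega>) = 0" "AE \<omega> in M. (norm (Xc \<omega>))\<^sup>2 * norm (Vc \<omega>) = 0"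
      by auto
    have "integrable M (\<lambda>\<omega>. norm (Xc \<omega>) * norm (Vc \<omega>))" "integrable M (\<lambda>\<omega>. (norm (Xc \<omega>))\<^sup>2 * norm (Vc \<omega>))"
      using integrable_cong_AE[of "\<lambda>\<omega>. norm (Xc \<omega>) * norm (Vc \<omega>)" M "\<lambda>_. 0"]
        integrable_cong_AE[of "\<lambda>\<omega>. (norm (Xc \<omega>))\<^sup>2 * norm (Vc \<omega>)" M "\<lambda>_. 0"] AE by auto
    then show ?thesis using AE by (simp add: integral_eq_zero_AE)
  qed
  then show "integrable M (\<lambda>\<omega>. norm (Xc \<omega>) * norm (Vc \<omega>))" "integrable M (\<lambda>\<omega>. (norm (Xc \<omega>))\<^sup>2 * norm (Vc \<omega>))"
    "(\<integral>\<omega>. (norm (Xc \<omega>))\<^sup>2 * norm (Vc \<omega>) \<partial>M) + 2 * (\<integral>\<omega>. norm (Xc \<omega>) \<partial>M) * (\<integral>\<omega>. norm (Xc \<omega>) * norm (Vc \<omega>) \<partial>M)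
      \<le> 3 * enn2real (ennreal_powr (centered_moment3 M X) (2 / 3) * ennreal_powr (centered_moment3 M V) (1 / 3))"
    by auto
qed

context base_measure
begin

text \<open>Approximate integration by parts for the derivative of the free energy of \<open>XX\<close> in the
  direction \<open>VV\<close>, after centering all summands.\<close>

lemma derivative_approx_Phi_psi:
  fixes X V :: "'i \<Rightarrow> 'w \<Rightarrow> 't \<Rightarrow>\<^sub>C real"
  assumes P: "prob_space P" and I: "finite I"
    and ind: "prob_space.indep_vars P (\<lambda>_. borel) (\<lambda>i \<omega>. (X i \<omega>, V i \<omega>)) I"
    and XX: "\<And>\<omega>. \<omega> \<in> space P \<Longrightarrow> XX \<omega> = (\<Sum>i\<in>I. X i \<omega>)"
    and VV: "\<And>\<omega>. \<omega> \<in> space P \<Longrightarrow> VV \<omega> = (\<Sum>i\<in>I. V i \<omega>)" "integrable P VV"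
    and third: "\<And>i. i \<in> I \<Longrightarrow> integrable P (\<lambda>\<omega>. norm (X i \<omega>) ^ 3)"
    and fin: "\<And>i. i \<in> I \<Longrightarrow> ennreal_powr (centered_moment3 P (X i)) (2 / 3) * ennreal_powr (centered_moment3 P (V i)) (1 / 3) < \<infinity>"
  shows "integrable (expected_gibbs2 \<pi> P XX) (\<lambda>(s, t). psi_kernel P XX VV s t)"
    and "\<bar>(\<integral>\<omega>. gibbs_mean \<pi> (XX \<omega>) (VV \<omega>) \<partial>P) - Phi \<pi> P XX (psi_kernel P XX VV)\<bar>
      \<le> 3 * (\<Sum>i\<in>I. enn2real (ennreal_powr (centered_moment3 P (X i)) (2 / 3) * ennreal_powr (centered_moment3 P (V i)) (1 / 3)))"
proof -
  interpret P: prob_space P by fact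
  have XVm: "(\<lambda>\<omega>. (X i \<omega>, V i \<omega>)) \<in> borel_measurable P" if "i \<in> I" for i
    using ind that by (auto simp: P.indep_vars_def)
  have Xm: "X i \<in> borel_measurable P" and Vm: "V i \<in> borel_measurable P" if "i \<in> I" for i
    using measurable_compose[OF XVm[OF that] measurable_fst_snd_borel(1)]
      measurable_compose[OF XVm[OF that] measurable_fst_snd_borel(2)] by simp_all
  have iX: "integrable P (X i)" if "i \<in> I" for i by (rule P.third_moment_centered(1)[OF Xm third]) (rule that)+
  have iV: "integrable P (V i)" if i: "i \<in> I" for i
  proof (rule P.integrable_summand_of_indep_sum[OF indep_vars_pair_split(3)[OF P I i ind]])
    have "integrable P (\<lambda>\<omega>. norm (VV \<omega>))" using VV(2) by simp
    moreover have "norm (VV \<omega>) = norm ((\<Sum>j\<in>I - {i}. V j \<omega>) + V i \<omega>)" if "\<omega> \<in> space P" for \<omega>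
      using VV(1)[OF that] I i by (simp add: sum.remove[of I i] add.commute)
    ultimately show "integrable P (\<lambda>\<omega>. norm ((\<Sum>j\<in>I - {i}. V j \<omega>) + V i \<omega>))"
      by (rule iffD1[OF Bochner_Integration.integrable_cong[OF refl], rotated])
  qed
  define mX where "mX i = (\<integral>\<omega>. X i \<omega> \<partial>P)" for i
  define mV where "mV i = (\<integral>\<omega>. V i \<omega> \<partial>P)" for i
  define mXX where "mXX = (\<integral>\<omega>. XX \<omega> \<partial>P)"
  define mVV where "mVV = (\<integral>\<omega>. VV \<omega> \<partial>P)"
  have iXX: "integrable P XX"
    using Bochner_Integration.integrable_cong[of P P XX "\<lambda>\<omega>. \<Sum>i\<in>I. X i \<omega>"] XX iX by auto
  have mXX: "mXX = (\<Sum>i\<in>I. mX i)"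
    unfolding mXX_def mX_def using iX
    by (simp add: Bochner_Integration.integral_sum XX cong: Bochner_Integration.integral_cong)
  have mVV: "mVV = (\<Sum>i\<in>I. mV i)"
    unfolding mVV_def mV_def using iV
    by (simp add: Bochner_Integration.integral_sum VV(1) cong: Bochner_Integration.integral_cong)
  let ?S = "\<lambda>\<omega>. \<Sum>i\<in>I. X i \<omega> - mX i" and ?U = "\<lambda>\<omega>. \<Sum>i\<in>I. V i \<omega> - mV i"
  have cX: "XX \<omega> - mXX = ?S \<omega>" and cV: "VV \<omega> - mVV = ?U \<omega>" if "\<omega> \<in> space P" for \<omega>
    by (simp_all add: XX[OF that] VV(1)[OF that] mXX mVV sum_subtractf)
  have indc: "P.indep_vars (\<lambda>_. borel) (\<lambda>i \<omega>. (X i \<omega> - mX i, V i \<omega> - mV i)) I"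
  proof -
    have "(\<lambda>z :: ('t \<Rightarrow>\<^sub>C real) \<times> ('t \<Rightarrow>\<^sub>C real). (fst z - mX i, snd z - mV i)) \<in> borel_measurable borel" for i
      by measurable
    then show ?thesis
      using P.indep_vars_compose2[OF ind, of "\<lambda>i z. (fst z - mX i, snd z - mV i)" "\<lambda>_. borel"] by simp
  qed
  note err = P.leave_one_out_error_le[OF Xm Vm third iV fin, folded mX_def mV_def]
  have props: "integrable P (\<lambda>\<omega>. X i \<omega> - mX i)" "integrable P (\<lambda>\<omega>. V i \<omega> - mV i)"
    "integrable P (\<lambda>\<omega>. norm (X i \<omega> - mX i) * norm (V i \<omega> - mV i))"
    "integrable P (\<lambda>\<omega>. (norm (X i \<omega> - mX i))\<^sup>2 * norm (V i \<omega> - mV i))"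
    "(\<integral>\<omega>. V i \<omega> - mV i \<partial>P) = 0" if "i \<in> I" for i
    using iX[OF that] iV[OF that] err[OF that that that that that] by (auto simp: mV_def P.prob_space)
  have iSU: "integrable P (\<lambda>\<omega>. norm (?S \<omega>) * norm (?U \<omega>))"
    using approx_integration_by_parts(1)[OF P I indc] props by simp
  have iXV: "integrable P (\<lambda>\<omega>. norm (XX \<omega> - mXX) * norm (VV \<omega> - mVV))"
    using Bochner_Integration.integrable_cong[of P P "\<lambda>\<omega>. norm (XX \<omega> - mXX) * norm (VV \<omega> - mVV)" "\<lambda>\<omega>. norm (?S \<omega>) * norm (?U \<omega>)"]
      iSU cX cV by simp
  note Phi = Phi_psi_kernel[OF P iXX VV(2), folded mXX_def mVV_def, OF iXV]
  show "integrable (expected_gibbs2 \<pi> P XX) (\<lambda>(s, t). psi_kernel P XX VV s t)" by (rule Phi(1))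
  have XXm [measurable]: "XX \<in> borel_measurable P" and VVm [measurable]: "VV \<in> borel_measurable P"
    using iXX VV(2) by auto
  have i1: "integrable P (\<lambda>\<omega>. gibbs_mean \<pi> (XX \<omega>) mVV)" by (rule integrable_gibbs_mean) auto
  have i2: "integrable P (\<lambda>\<omega>. gibbs_mean \<pi> (XX \<omega>) (apply_bcontfun (VV \<omega> - mVV)))"
    using VV(2) by (intro integrable_gibbs_mean) auto
  have i3: "integrable P (\<lambda>\<omega>. avg_gibbs_cov P (\<lambda>\<omega>. XX \<omega> - mXX) (\<lambda>\<omega>. VV \<omega> - mVV) (XX \<omega>))"
  proof (rule P.integrable_const_bound)
    show "AE \<omega> in P. norm (avg_gibbs_cov P (\<lambda>\<omega>. XX \<omega> - mXX) (\<lambda>\<omega>. VV \<omega> - mVV) (XX \<omega>))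
      \<le> 2 * (\<integral>\<omega>. norm (XX \<omega> - mXX) * norm (VV \<omega> - mVV) \<partial>P)"
      using abs_avg_gibbs_cov_le[OF _ _ iXV] by simp
    show "(\<lambda>\<omega>. avg_gibbs_cov P (\<lambda>\<omega>. XX \<omega> - mXX) (\<lambda>\<omega>. VV \<omega> - mVV) (XX \<omega>)) \<in> borel_measurable P"
      by (rule measurable_avg_gibbs_cov) (auto intro: P.sigma_finite_measure_axioms)
  qed
  have "gibbs_mean \<pi> z (VV \<omega>) = gibbs_mean \<pi> z mVV + gibbs_mean \<pi> z (apply_bcontfun (VV \<omega> - mVV))" for z \<omega>
    using linear_add[OF bounded_linear.linear[OF bounded_linear_gibbs_mean], of z mVV "VV \<omega> - mVV"] by simp
  then have "(\<integral>\<omega>. gibbs_mean \<pi> (XX \<omega>) (VV \<omega>) \<partial>P) - Phi \<pi> P XX (psi_kernel P XX VV)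
    = (\<integral>\<omega>. gibbs_mean \<pi> (XX \<omega>) (apply_bcontfun (VV \<omega> - mVV)) \<partial>P) - (\<integral>\<omega>. avg_gibbs_cov P (\<lambda>\<omega>. XX \<omega> - mXX) (\<lambda>\<omega>. VV \<omega> - mVV) (XX \<omega>) \<partial>P)"
    unfolding Phi(2) using Bochner_Integration.integral_add[OF i1 i2] Bochner_Integration.integral_add[OF i1 i3] by simp
  also have "(\<integral>\<omega>. gibbs_mean \<pi> (XX \<omega>) (apply_bcontfun (VV \<omega> - mVV)) \<partial>P) = (\<integral>\<omega>. gibbs_mean \<pi> (mXX + ?S \<omega>) (apply_bcontfun (?U \<omega>)) \<partial>P)"
    by (rule Bochner_Integration.integral_cong[OF refl]) (simp only: cV cX[symmetric] add.commute[of mXX] diff_add_cancel)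
  also have avg: "avg_gibbs_cov P (\<lambda>\<omega>. XX \<omega> - mXX) (\<lambda>\<omega>. VV \<omega> - mVV) = avg_gibbs_cov P ?S ?U"
  proof
    fix z
    show "avg_gibbs_cov P (\<lambda>\<omega>. XX \<omega> - mXX) (\<lambda>\<omega>. VV \<omega> - mVV) z = avg_gibbs_cov P ?S ?U z"
      unfolding avg_gibbs_cov_def by (rule Bochner_Integration.integral_cong[OF refl]) (simp only: cX cV)
  qed
  also have "(\<integral>\<omega>. avg_gibbs_cov P ?S ?U (XX \<omega>) \<partial>P) = (\<integral>\<omega>. avg_gibbs_cov P ?S ?U (mXX + ?S \<omega>) \<partial>P)"
    by (rule Bochner_Integration.integral_cong[OF refl]) (simp only: cX[symmetric] add.commute[of mXX] diff_add_cancel)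
  finally have "\<bar>(\<integral>\<omega>. gibbs_mean \<pi> (XX \<omega>) (VV \<omega>) \<partial>P) - Phi \<pi> P XX (psi_kernel P XX VV)\<bar>
    = \<bar>(\<integral>\<omega>. gibbs_mean \<pi> (mXX + ?S \<omega>) (apply_bcontfun (?U \<omega>)) \<partial>P) - (\<integral>\<omega>. avg_gibbs_cov P ?S ?U (mXX + ?S \<omega>) \<partial>P)\<bar>" by simp
  also have "\<dots> \<le> (\<Sum>i\<in>I. (\<integral>\<omega>. (norm (X i \<omega> - mX i))\<^sup>2 * norm (V i \<omega> - mV i) \<partial>P)
      + 2 * (\<integral>\<omega>. norm (X i \<omega> - mX i) \<partial>P) * (\<integral>\<omega>. norm (X i \<omega> - mX i) * norm (V i \<omega> - mV i) \<partial>P))"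
    by (rule approx_integration_by_parts(2)[OF P I indc props])
  also have "\<dots> \<le> (\<Sum>i\<in>I. 3 * enn2real (ennreal_powr (centered_moment3 P (X i)) (2 / 3) * ennreal_powr (centered_moment3 P (V i)) (1 / 3)))"
    using err(3) by (intro sum_mono) auto
  finally show "\<bar>(\<integral>\<omega>. gibbs_mean \<pi> (XX \<omega>) (VV \<omega>) \<partial>P) - Phi \<pi> P XX (psi_kernel P XX VV)\<bar>
      \<le> 3 * (\<Sum>i\<in>I. enn2real (ennreal_powr (centered_moment3 P (X i)) (2 / 3) * ennreal_powr (centered_moment3 P (V i)) (1 / 3)))"
    by (simp add: sum_distrib_left)
qed

lemma gaussian_derivative_eq_Phi_psi:
  fixes Y V :: "'w \<Rightarrow> 't \<Rightarrow>\<^sub>C real"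
  assumes Q: "prob_space Q" and G: "gaussian Q (\<lambda>\<omega>. (Y \<omega>, V \<omega>))"
  shows "integrable (expected_gibbs2 \<pi> Q Y) (\<lambda>(s, t). psi_kernel Q Y V s t)"
    and "(\<integral>\<omega>. gibbs_mean \<pi> (Y \<omega>) (V \<omega>) \<partial>Q) = Phi \<pi> Q Y (psi_kernel Q Y V)"
proof -
  interpret Q: prob_space Q by fact
  note ibp = gaussian_integration_by_parts[OF Q G]
  have iY: "integrable Q Y" and iV: "integrable Q V"
    using Q.third_moment_centered(1) ibp(1-4) by auto
  have "integrable Q (\<lambda>\<omega>. norm (Y \<omega> - (\<integral>\<omega>. Y \<omega> \<partial>Q)) ^ 3)" "integrable Q (\<lambda>\<omega>. norm (V \<omega> - (\<integral>\<omega>. V \<omega> \<partial>Q)) ^ 3)"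
    using Q.third_moment_centered(2) ibp(1-4) by auto
  then have "integrable Q (\<lambda>\<omega>. norm (Y \<omega> - (\<integral>\<omega>. Y \<omega> \<partial>Q)) * norm (V \<omega> - (\<integral>\<omega>. V \<omega> \<partial>Q)))"
    using Q.moment_error_le(2)[of "\<lambda>\<omega>. norm (Y \<omega> - (\<integral>\<omega>. Y \<omega> \<partial>Q))" "\<lambda>\<omega>. norm (V \<omega> - (\<integral>\<omega>. V \<omega> \<partial>Q))"] ibp(3,4) by auto
  note Phi = Phi_psi_kernel[OF Q iY iV this]
  show "integrable (expected_gibbs2 \<pi> Q Y) (\<lambda>(s, t). psi_kernel Q Y V s t)" by (rule Phi(1))
  show "(\<integral>\<omega>. gibbs_mean \<pi> (Y \<omega>) (V \<omega>) \<partial>Q) = Phi \<pi> Q Y (psi_kernel Q Y V)"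
    unfolding Phi(2) by (rule ibp(5))
qed

end

text \<open>If one of the errors is infinite, both bounds hold trivially.\<close>

lemma ereal_bounds_of_finite:
  fixes D1 D2 :: ennreal and a b \<epsilon> :: real
  assumes \<epsilon>: "\<epsilon> > 0"
  shows "(D1 < \<infinity> \<Longrightarrow> D2 < \<infinity> \<Longrightarrow> a - enn2real D1 - enn2real D2 / \<epsilon> \<le> b) \<Longrightarrow>
      ereal a - enn2ereal D1 - enn2ereal D2 / ereal \<epsilon> \<le> ereal b"
    and "(D1 < \<infinity> \<Longrightarrow> D2 < \<infinity> \<Longrightarrow> b \<le> a + enn2real D1 + enn2real D2 / \<epsilon>) \<Longrightarrow>
      ereal b \<le> ereal a + enn2ereal D1 + enn2ereal D2 / ereal \<epsilon>"
proof -
  have real: "enn2ereal D = ereal (enn2real D)" if "D < \<infinity>" for D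
    using that by (cases D) auto
  have top: "enn2ereal D = \<infinity>" if "\<not> D < \<infinity>" for D
    using that by (cases D) auto
  have pos: "enn2ereal D2 / ereal \<epsilon> \<noteq> - \<infinity>" "enn2ereal D2 / ereal \<epsilon> \<ge> 0"
    using \<epsilon> by (auto simp: ereal_divide_eq)
  show "ereal a - enn2ereal D1 - enn2ereal D2 / ereal \<epsilon> \<le> ereal b"
    if *: "D1 < \<infinity> \<Longrightarrow> D2 < \<infinity> \<Longrightarrow> a - enn2real D1 - enn2real D2 / \<epsilon> \<le> b"
    using \<epsilon> * pos by (cases "D1 < \<infinity>"; cases "D2 < \<infinity>") (auto simp: real top)
  show "ereal b \<le> ereal a + enn2ereal D1 + enn2ereal D2 / ereal \<epsilon>"
    if *: "D1 < \<infinity> \<Longrightarrow> D2 < \<infinity> \<Longrightarrow> b \<le> a + enn2real D1 + enn2real D2 / \<epsilon>"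
    using \<epsilon> * pos by (cases "D1 < \<infinity>"; cases "D2 < \<infinity>") (auto simp: real top)
qed

section \<open>The comparison theorem\<close>

theorem theorem5:
  fixes \<Theta> :: "'p::topological_space set"
    and incl :: "'t::compact_metric_space \<Rightarrow> 'p"
    and \<pi> :: "'t measure"
    and \<Omega> :: "'w measure"
    and P Q :: "'p \<Rightarrow> 'w measure"
    and B :: "real set"
    and X Y :: "'w \<Rightarrow> 't \<Rightarrow>\<^sub>C real"
    and Xb Yb :: "real \<Rightarrow> 'w \<Rightarrow> 't \<Rightarrow>\<^sub>C real"
    and M :: nat
    and Xc :: "nat \<Rightarrow> real \<Rightarrow> 'w \<Rightarrow> 't \<Rightarrow>\<^sub>C real"
    and \<phi> :: "'p \<Rightarrow> 't \<Rightarrow> 't \<Rightarrow> real"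
  assumes Theta: "compact \<Theta>"
    and T: "inj incl" "range incl \<subseteq> \<Theta>"
    and pi: "prob_space \<pi>" "sets \<pi> = sets borel"
    and P: "\<And>\<theta>. \<theta> \<in> \<Theta> \<Longrightarrow> prob_space (P \<theta>)" "\<And>\<theta>. \<theta> \<in> \<Theta> \<Longrightarrow> sets (P \<theta>) = sets \<Omega>"
    and Q: "\<And>\<theta>. \<theta> \<in> \<Theta> \<Longrightarrow> prob_space (Q \<theta>)" "\<And>\<theta>. \<theta> \<in> \<Theta> \<Longrightarrow> sets (Q \<theta>) = sets \<Omega>"
    and X: "X \<in> borel_measurable \<Omega>"
    and Y: "Y \<in> borel_measurable \<Omega>" "\<And>\<theta>. \<theta> \<in> \<Theta> \<Longrightarrow> gaussian (Q \<theta>) Y"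
    and phi_measurable:
      "\<And>\<theta>. \<theta> \<in> \<Theta> \<Longrightarrow> (\<lambda>(s, t). \<phi> \<theta> s t) \<in> borel_measurable borel"
    and phi_integrable:
      "\<And>\<theta>. \<theta> \<in> \<Theta> \<Longrightarrow> integrable (expected_gibbs2 \<pi> (P \<theta>) X) (\<lambda>(s, t). \<phi> \<theta> s t)"
      "\<And>\<theta> \<beta>. \<theta> \<in> \<Theta> \<Longrightarrow> \<beta> \<in> B \<Longrightarrow>
         integrable (expected_gibbs2 \<pi> (Q \<theta>) (Yb \<beta>)) (\<lambda>(s, t). \<phi> \<theta> s t)"
    and B: "open B" "is_interval B" "0 \<in> B"
    and Xb: "perturbation \<Omega> B X Xb"
    and Yb: "\<And>\<theta>. \<theta> \<in> \<Theta> \<Longrightarrow> gaussian_perturbation \<Omega> (Q \<theta>) B Y Yb"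
    and Xc: "\<And>m. m \<in> {1..M} \<Longrightarrow> perturbation \<Omega> B (Xc m 0) (Xc m)"
    and a_sum:
      "\<And>\<beta> \<omega>. \<beta> \<in> B \<Longrightarrow> \<omega> \<in> space \<Omega> \<Longrightarrow> Xb \<beta> \<omega> = (\<Sum>m=1..M. Xc m \<beta> \<omega>)"
    and a_indep:
      "\<And>\<theta> \<beta>. \<theta> \<in> \<Theta> \<Longrightarrow> \<beta> \<in> B \<Longrightarrow>
         prob_space.indep_vars (P \<theta>) (\<lambda>_. borel \<Otimes>\<^sub>M borel)
           (\<lambda>m \<omega>. (Xc m \<beta> \<omega>, ddot (Xc m) \<beta> \<omega>)) {1..M}"
    and b_X: "\<And>\<theta>. \<theta> \<in> \<Theta> \<Longrightarrow> (\<integral>\<^sup>+\<omega>. (SUP \<beta>\<in>B. ennreal (norm (ddot Xb \<beta> \<omega>))) \<partial>P \<theta>) < \<infinity>"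
    and b_Y: "\<And>\<theta>. \<theta> \<in> \<Theta> \<Longrightarrow> (\<integral>\<^sup>+\<omega>. (SUP \<beta>\<in>B. ennreal (norm (ddot Yb \<beta> \<omega>))) \<partial>Q \<theta>) < \<infinity>"
    and c_X: "\<And>\<theta>. \<theta> \<in> \<Theta> \<Longrightarrow> convex_on B (\<lambda>\<beta>. free_energy \<pi> (P \<theta>) (Xb \<beta>))"
    and c_Y: "\<And>\<theta>. \<theta> \<in> \<Theta> \<Longrightarrow> convex_on B (\<lambda>\<beta>. free_energy \<pi> (Q \<theta>) (Yb \<beta>))"
  shows "\<forall>\<theta>\<in>\<Theta>. \<forall>\<epsilon>>0. \<epsilon> \<in> B \<and> -\<epsilon> \<in> B \<longrightarrow>
    ereal (Phi \<pi> (Q \<theta>) (Yb (-\<epsilon>)) (\<phi> \<theta>))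
        - enn2ereal (Delta1 (P \<theta>) (Q \<theta>) M Xb Xc Yb (\<phi> \<theta>) (-\<epsilon>))
        - enn2ereal (Delta2 (P \<theta>) (Q \<theta>) M X Xb Xc Y Yb (-\<epsilon>)) / ereal \<epsilon>
      \<le> ereal (Phi \<pi> (P \<theta>) X (\<phi> \<theta>))
    \<and> ereal (Phi \<pi> (P \<theta>) X (\<phi> \<theta>))
      \<le> ereal (Phi \<pi> (Q \<theta>) (Yb \<epsilon>) (\<phi> \<theta>))
        + enn2ereal (Delta1 (P \<theta>) (Q \<theta>) M Xb Xc Yb (\<phi> \<theta>) \<epsilon>)
        + enn2ereal (Delta2 (P \<theta>) (Q \<theta>) M X Xb Xc Y Yb \<epsilon>) / ereal \<epsilon>"
proof (intro ballI allI impI)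
  fix \<theta> and \<epsilon> :: real
  assume \<theta>: "\<theta> \<in> \<Theta>" and \<epsilon>: "\<epsilon> > 0" "\<epsilon> \<in> B \<and> - \<epsilon> \<in> B"
  interpret base_measure \<pi> using pi by (simp add: base_measure_def base_measure_axioms_def)
  define R S where "R = P \<theta>" and "S = Q \<theta>"
  have probR: "prob_space R" and setsR: "sets R = sets \<Omega>" and probS: "prob_space S" and setsS: "sets S = sets \<Omega>"
    using P Q \<theta> by (auto simp: R_def S_def)
  interpret R: prob_space R by fact
  interpret S: prob_space S by fact
  have spaceR: "space R = space \<Omega>" and spaceS: "space S = space \<Omega>"
    by (rule sets_eq_imp_space_eq[OF setsR], rule sets_eq_imp_space_eq[OF setsS])
  have YbS: "gaussian_perturbation \<Omega> S B Y Yb" using Yb[OF \<theta>] by (simp add: S_def)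
  have pertY: "perturbation \<Omega> B Y Yb" using YbS by (simp add: gaussian_perturbation_def)
  have GY: "gaussian S (Yb \<beta>)" "gaussian S (\<lambda>\<omega>. (Yb \<beta> \<omega>, ddot Yb \<beta> \<omega>))" if "\<beta> \<in> B" for \<beta>
    using YbS that by (auto simp: gaussian_perturbation_def)
  have X0: "Xb 0 \<omega> = X \<omega>" if "\<omega> \<in> space R" for \<omega> using Xb that by (simp add: perturbation_def spaceR)
  have Y0: "Yb 0 \<omega> = Y \<omega>" if "\<omega> \<in> space S" for \<omega> using pertY that by (simp add: perturbation_def spaceS)
  have XbR: "Xb \<beta> \<in> borel_measurable R" if "\<beta> \<in> B" for \<beta>
    using Xb that unfolding perturbation_def measurable_cong_sets[OF setsR refl] by blast
  have YbM: "Yb \<beta> \<in> borel_measurable S" if "\<beta> \<in> B" for \<beta> by (rule gaussian_measurable[OF GY(1)[OF that]])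
  have XcR: "Xc m \<beta> \<in> borel_measurable R" if "m \<in> {1..M}" "\<beta> \<in> B" for m \<beta>
    using Xc[OF that(1)] that(2) unfolding perturbation_def measurable_cong_sets[OF setsR refl] by blast
  have indR: "R.indep_vars (\<lambda>_. borel) (\<lambda>m \<omega>. (Xc m \<beta> \<omega>, ddot (Xc m) \<beta> \<omega>)) {1..M}" if "\<beta> \<in> B" for \<beta>
    using a_indep[OF \<theta> that] unfolding borel_prod R_def .
  have indX: "R.indep_vars (\<lambda>_. borel) (\<lambda>m. Xc m \<beta>) {1..M}" if "\<beta> \<in> B" for \<beta>
    using R.indep_vars_compose2[OF indR[OF that], of "\<lambda>_. fst" "\<lambda>_. borel"] by simp
  have ddot_sum: "ddot Xb 0 \<omega> = (\<Sum>m=1..M. ddot (Xc m) 0 \<omega>)" if \<omega>: "\<omega> \<in> space R" for \<omega>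
  proof -
    have "((\<lambda>b. Xc m b \<omega>) has_vector_derivative ddot (Xc m) 0 \<omega>) (at 0)" if "m \<in> {1..M}" for m
      using Xc[OF that] B(3) \<omega> by (auto simp: perturbation_def ddot_def vector_derivative_works spaceR)
    then have "((\<lambda>b. \<Sum>m=1..M. Xc m b \<omega>) has_vector_derivative (\<Sum>m=1..M. ddot (Xc m) 0 \<omega>)) (at 0)"
      by (rule has_vector_derivative_sum)
    then have "((\<lambda>b. Xb b \<omega>) has_vector_derivative (\<Sum>m=1..M. ddot (Xc m) 0 \<omega>)) (at 0)"
      by (rule has_vector_derivative_transform_within_open[OF _ B(1,3)]) (use a_sum \<omega> in \<open>auto simp: spaceR\<close>)
    then show ?thesis unfolding ddot_def by (rule vector_derivative_at)
  qed
  define FX FY where "FX \<beta> = free_energy \<pi> R (Xb \<beta>)" and "FY \<beta> = free_energy \<pi> S (Yb \<beta>)" for \<beta>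
  define A AY where "A = (\<integral>\<omega>. gibbs_mean \<pi> (Xb 0 \<omega>) (ddot Xb 0 \<omega>) \<partial>R)"
    and "AY \<beta> = (\<integral>\<omega>. gibbs_mean \<pi> (Yb \<beta> \<omega>) (ddot Yb \<beta> \<omega>) \<partial>S)" for \<beta>
  have FX0: "FX 0 = free_energy \<pi> R X" and FY0: "FY 0 = free_energy \<pi> S Y"
    unfolding FX_def FY_def free_energy_eq by (auto intro!: Bochner_Integration.integral_cong simp: X0 Y0)
  have eg0: "expected_gibbs2 \<pi> R X = expected_gibbs2 \<pi> R (Xb 0)"
    unfolding expected_gibbs2_def by (rule bind_cong) (auto simp: X0)
  then have Phi0: "Phi \<pi> R X f = Phi \<pi> R (Xb 0) f" for f by (simp add: Phi_def)
  have convX: "convex_on B FX" and convY: "convex_on B FY"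
    using c_X[OF \<theta>] c_Y[OF \<theta>] by (simp_all add: FX_def[abs_def] FY_def[abs_def] R_def S_def)
  let ?D1 = "\<lambda>\<beta>. Delta1 R S M Xb Xc Yb (\<phi> \<theta>) \<beta>" and ?D2 = "\<lambda>\<beta>. Delta2 R S M X Xb Xc Y Yb \<beta>"
  \<comment> \<open>one estimate for both signs of \<open>\<beta>\<close>; multiplying the slopes by \<open>\<beta>\<close> orients the inequality\<close>
  have key: "\<bar>Phi \<pi> R X (\<phi> \<theta>) - A\<bar> + \<bar>Phi \<pi> S (Yb \<beta>) (\<phi> \<theta>) - AY \<beta>\<bar> \<le> enn2real (?D1 \<beta>)
    \<and> A * \<beta> \<le> AY \<beta> * \<beta> + enn2real (?D2 \<beta>)"
    if \<beta>: "\<beta> \<in> B" and fin1: "?D1 \<beta> < \<infinity>" and fin2: "?D2 \<beta> < \<infinity>" for \<beta>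
  proof -
    let ?e = "\<lambda>m. ennreal_powr (centered_moment3 R (Xc m 0)) (2 / 3) * ennreal_powr (centered_moment3 R (ddot (Xc m) 0)) (1 / 3)"
    let ?f1 = "sup_norm2 (\<lambda>s t. \<phi> \<theta> s t - psi_kernel R (Xb 0) (ddot Xb 0) s t)"
    let ?f2 = "sup_norm2 (\<lambda>s t. \<phi> \<theta> s t - psi_kernel S (Yb \<beta>) (ddot Yb \<beta>) s t)"
    have fin1': "?f1 < \<infinity>" "?f2 < \<infinity>" "\<And>m. m \<in> {1..M} \<Longrightarrow> ?e m < \<infinity>"
      using fin1 by (auto simp: Delta1_def ennreal_mult_less_top)
    have D1: "enn2real (?D1 \<beta>) = enn2real ?f1 + enn2real ?f2 + 3 * (\<Sum>m=1..M. enn2real (?e m))"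
    proof -
      define E where "E = (\<Sum>m=1..M. ?e m)"
      have "E < \<infinity>" unfolding E_def using fin1'(3) by simp
      moreover have "enn2real E = (\<Sum>m=1..M. enn2real (?e m))" unfolding E_def by (rule enn2real_sum[OF fin1'(3)])
      ultimately show ?thesis
        using fin1'(1,2) unfolding Delta1_def E_def[symmetric]
        by (simp add: enn2real_plus enn2real_mult ennreal_mult_less_top)
    qed
    have fin2': "sup_norm (\<lambda>t. mean_fun R X t - mean_fun S Y t) < \<infinity>"
      "sup_norm (\<lambda>t. mean_fun R (Xb \<beta>) t - mean_fun S (Yb \<beta>) t) < \<infinity>"
      "sup_norm2 (\<lambda>s t. cov_kernel R X s t - cov_kernel S Y s t) < \<infinity>"
      "sup_norm2 (\<lambda>s t. cov_kernel R (Xb \<beta>) s t - cov_kernel S (Yb \<beta>) s t) < \<infinity>"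
      "\<And>m. m \<in> {1..M} \<Longrightarrow> centered_moment3 R (Xc m 0) < \<infinity>"
      "\<And>m. m \<in> {1..M} \<Longrightarrow> centered_moment3 R (Xc m \<beta>) < \<infinity>"
      using fin2 by (auto simp: Delta2_def)
    have D2: "enn2real (?D2 \<beta>) = enn2real (sup_norm (\<lambda>t. mean_fun R X t - mean_fun S Y t))
      + enn2real (sup_norm (\<lambda>t. mean_fun R (Xb \<beta>) t - mean_fun S (Yb \<beta>) t))
      + enn2real (sup_norm2 (\<lambda>s t. cov_kernel R X s t - cov_kernel S Y s t))
      + enn2real (sup_norm2 (\<lambda>s t. cov_kernel R (Xb \<beta>) s t - cov_kernel S (Yb \<beta>) s t))
      + (\<Sum>m=1..M. enn2real (centered_moment3 R (Xc m 0))) + (\<Sum>m=1..M. enn2real (centered_moment3 R (Xc m \<beta>)))"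
    proof -
      define E0 E1 where "E0 = (\<Sum>m=1..M. centered_moment3 R (Xc m 0))" and "E1 = (\<Sum>m=1..M. centered_moment3 R (Xc m \<beta>))"
      have "E0 < \<infinity>" "E1 < \<infinity>" unfolding E0_def E1_def using fin2'(5,6) by simp_all
      moreover have "enn2real E0 = (\<Sum>m=1..M. enn2real (centered_moment3 R (Xc m 0)))"
        "enn2real E1 = (\<Sum>m=1..M. enn2real (centered_moment3 R (Xc m \<beta>)))"
        unfolding E0_def E1_def by (rule enn2real_sum[OF fin2'(5)], assumption, rule enn2real_sum[OF fin2'(6)], assumption)
      ultimately show ?thesis
        using fin2'(1-4) unfolding Delta2_def E0_def[symmetric] E1_def[symmetric] by (simp add: enn2real_plus)
    qed
    have third: "integrable R (\<lambda>\<omega>. norm (Xc m b \<omega>) ^ 3)"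
      and cm: "enn2real (centered_moment3 R (Xc m b)) = (\<integral>\<omega>. norm (Xc m b \<omega> - (\<integral>\<omega>. Xc m b \<omega> \<partial>R)) ^ 3 \<partial>R)"
      if m: "m \<in> {1..M}" and b: "b = 0 \<or> b = \<beta>" for m b
    proof -
      have bB: "b \<in> B" using b \<beta> B(3) by auto
      have "centered_moment3 R (Xc m b) < \<infinity>" using b fin2'(5,6)[OF m] by auto
      from R.third_moment_of_centered_moment3[OF XcR[OF m bB] this]
      show 3: "integrable R (\<lambda>\<omega>. norm (Xc m b \<omega>) ^ 3)" .
      show "enn2real (centered_moment3 R (Xc m b)) = (\<integral>\<omega>. norm (Xc m b \<omega> - (\<integral>\<omega>. Xc m b \<omega> \<partial>R)) ^ 3 \<partial>R)"
        unfolding R.third_moment_centered(3)[OF XcR[OF m bB] 3] by (simp add: integral_nonneg_AE)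
    qed
    have iXb0: "integrable R (\<lambda>\<omega>. norm (Xb 0 \<omega>))"
    proof -
      have "integrable R (Xc m 0)" if "m \<in> {1..M}" for m
        by (rule R.third_moment_centered(1)[OF XcR[OF that B(3)] third]) (use that in auto)
      then have "integrable R (\<lambda>\<omega>. \<Sum>m=1..M. Xc m 0 \<omega>)" by auto
      then have "integrable R (\<lambda>\<omega>. norm (\<Sum>m=1..M. Xc m 0 \<omega>))" by (rule integrable_norm)
      then show ?thesis
        by (rule iffD1[OF Bochner_Integration.integrable_cong[OF refl], rotated]) (use a_sum B(3) in \<open>auto simp: spaceR\<close>)
    qed
    have iYb: "integrable S (\<lambda>\<omega>. norm (Yb b \<omega>))" if "b \<in> B" for b
      using S.third_moment_centered(1)[OF YbM[OF that] gaussian_third_moment[OF probS GY(1)[OF that]]] by (rule integrable_norm)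
    note derX = perturbation_right_derivative[OF probR setsR Xb B(1,2,3) B(3) iXb0 b_X[OF \<theta>, folded R_def]]
    note derY = perturbation_right_derivative[OF probS setsS pertY B(1,2) \<beta> \<beta> iYb[OF \<beta>] b_Y[OF \<theta>, folded S_def]]
    \<comment> \<open>tangents of the two free energies, at opposite ends of the interval between \<open>0\<close> and \<open>\<beta>\<close>\<close>
    have lineX: "FX 0 + A * (\<beta> - 0) \<le> FX \<beta>"
      using derX(2) convex_on_support_line[OF convX B(3) \<beta>] unfolding FX_def A_def by blast
    have lineY: "FY \<beta> + AY \<beta> * (0 - \<beta>) \<le> FY 0"
      using derY(2) convex_on_support_line[OF convY \<beta> B(3)] unfolding FY_def AY_def by blast
    have cmp0: "\<bar>FX 0 - FY 0\<bar> \<le> enn2real (sup_norm (\<lambda>t. mean_fun R X t - mean_fun S Y t))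
      + enn2real (sup_norm2 (\<lambda>s t. cov_kernel R X s t - cov_kernel S Y s t)) + (\<Sum>m=1..M. enn2real (centered_moment3 R (Xc m 0)))"
    proof -
      have "\<bar>free_energy \<pi> R X - free_energy \<pi> S Y\<bar> \<le> enn2real (sup_norm (\<lambda>t. mean_fun R X t - mean_fun S Y t))
        + enn2real (sup_norm2 (\<lambda>s t. cov_kernel R X s t - cov_kernel S Y s t))
        + (\<Sum>m=1..M. \<integral>\<omega>. norm (Xc m 0 \<omega> - (\<integral>\<omega>. Xc m 0 \<omega> \<partial>R)) ^ 3 \<partial>R)"
      proof (rule free_energy_comparison[OF probR _ indX[OF B(3)] _ _ probS])
        show "integrable R (\<lambda>\<omega>. norm (Xc m 0 \<omega>) ^ 3)" if "m \<in> {1..M}" for m using third[OF that] by simp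
        show "X \<omega> = (\<Sum>m=1..M. Xc m 0 \<omega>)" if "\<omega> \<in> space R" for \<omega>
          using a_sum[OF B(3)] that X0[OF that] by (simp add: spaceR)
        show "gaussian S Y" using Y(2)[OF \<theta>] by (simp add: S_def)
      qed (use fin2' in auto)
      then show ?thesis unfolding FX0 FY0 using cm by simp
    qed
    have cmp\<beta>: "\<bar>FX \<beta> - FY \<beta>\<bar> \<le> enn2real (sup_norm (\<lambda>t. mean_fun R (Xb \<beta>) t - mean_fun S (Yb \<beta>) t))
      + enn2real (sup_norm2 (\<lambda>s t. cov_kernel R (Xb \<beta>) s t - cov_kernel S (Yb \<beta>) s t)) + (\<Sum>m=1..M. enn2real (centered_moment3 R (Xc m \<beta>)))"
    proof -
      have "\<bar>free_energy \<pi> R (Xb \<beta>) - free_energy \<pi> S (Yb \<beta>)\<bar> \<le> enn2real (sup_norm (\<lambda>t. mean_fun R (Xb \<beta>) t - mean_fun S (Yb \<beta>) t))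
        + enn2real (sup_norm2 (\<lambda>s t. cov_kernel R (Xb \<beta>) s t - cov_kernel S (Yb \<beta>) s t))
        + (\<Sum>m=1..M. \<integral>\<omega>. norm (Xc m \<beta> \<omega> - (\<integral>\<omega>. Xc m \<beta> \<omega> \<partial>R)) ^ 3 \<partial>R)"
      proof (rule free_energy_comparison[OF probR _ indX[OF \<beta>] _ _ probS])
        show "integrable R (\<lambda>\<omega>. norm (Xc m \<beta> \<omega>) ^ 3)" if "m \<in> {1..M}" for m using third[OF that] by simp
        show "Xb \<beta> \<omega> = (\<Sum>m=1..M. Xc m \<beta> \<omega>)" if "\<omega> \<in> space R" for \<omega>
          using a_sum[OF \<beta>] that by (simp add: spaceR)
        show "gaussian S (Yb \<beta>)" by (rule GY(1)[OF \<beta>])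
      qed (use fin2' in auto)
      then show ?thesis unfolding FX_def FY_def using cm by simp
    qed
    have XbSum: "Xb 0 \<omega> = (\<Sum>m=1..M. Xc m 0 \<omega>)" if "\<omega> \<in> space R" for \<omega>
      using a_sum[OF B(3)] that by (simp add: spaceR)
    note dp = derivative_approx_Phi_psi[OF probR _ indR[OF B(3)] XbSum ddot_sum derX(1) _ fin1'(3)]
    have dp1: "integrable (expected_gibbs2 \<pi> R (Xb 0)) (\<lambda>(s, t). psi_kernel R (Xb 0) (ddot Xb 0) s t)"
      and dp2: "\<bar>A - Phi \<pi> R (Xb 0) (psi_kernel R (Xb 0) (ddot Xb 0))\<bar> \<le> 3 * (\<Sum>m=1..M. enn2real (?e m))"
      unfolding A_def by (rule dp, simp, assumption, assumption, rule third, assumption, simp, assumption)+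
    have "\<bar>Phi \<pi> R (Xb 0) (\<phi> \<theta>) - Phi \<pi> R (Xb 0) (psi_kernel R (Xb 0) (ddot Xb 0))\<bar> \<le> enn2real ?f1"
      using phi_integrable(1)[OF \<theta>] eg0 fin1'(1) dp1
      by (intro Phi_diff_le[OF probR XbR[OF B(3)]]) (auto simp: R_def)
    then have b1: "\<bar>Phi \<pi> R X (\<phi> \<theta>) - A\<bar> \<le> enn2real ?f1 + 3 * (\<Sum>m=1..M. enn2real (?e m))"
      using dp2 unfolding Phi0 by linarith
    note gp = gaussian_derivative_eq_Phi_psi[OF probS GY(2)[OF \<beta>]]
    have b2: "\<bar>Phi \<pi> S (Yb \<beta>) (\<phi> \<theta>) - AY \<beta>\<bar> \<le> enn2real ?f2"
      unfolding AY_def gp(2)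
      using phi_integrable(2)[OF \<theta> \<beta>] fin1'(2) gp(1)
      by (intro Phi_diff_le[OF probS YbM[OF \<beta>]]) (auto simp: S_def)
    have "\<bar>Phi \<pi> R X (\<phi> \<theta>) - A\<bar> + \<bar>Phi \<pi> S (Yb \<beta>) (\<phi> \<theta>) - AY \<beta>\<bar> \<le> enn2real (?D1 \<beta>)"
      using b1 b2 unfolding D1 by linarith
    moreover have "A * \<beta> \<le> AY \<beta> * \<beta> + enn2real (?D2 \<beta>)"
    proof -
      have "A * \<beta> \<le> FX \<beta> - FX 0" "FY \<beta> - FY 0 \<le> AY \<beta> * \<beta>" using lineX lineY by simp_all
      then show ?thesis using cmp0 cmp\<beta> unfolding D2 by linarith
    qed
    ultimately show ?thesis by blast
  qed
  have "ereal (Phi \<pi> S (Yb (- \<epsilon>)) (\<phi> \<theta>)) - enn2ereal (?D1 (- \<epsilon>)) - enn2ereal (?D2 (- \<epsilon>)) / ereal \<epsilon> \<le> ereal (Phi \<pi> R X (\<phi> \<theta>))"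
  proof (rule ereal_bounds_of_finite(1)[OF \<epsilon>(1)])
    assume "?D1 (- \<epsilon>) < \<infinity>" "?D2 (- \<epsilon>) < \<infinity>"
    from key[OF conjunct2[OF \<epsilon>(2)] this]
    have k: "\<bar>Phi \<pi> R X (\<phi> \<theta>) - A\<bar> + \<bar>Phi \<pi> S (Yb (- \<epsilon>)) (\<phi> \<theta>) - AY (- \<epsilon>)\<bar> \<le> enn2real (?D1 (- \<epsilon>))"
      and "(AY (- \<epsilon>) - A) * \<epsilon> \<le> enn2real (?D2 (- \<epsilon>))" by (auto simp: algebra_simps)
    then have "AY (- \<epsilon>) - A \<le> enn2real (?D2 (- \<epsilon>)) / \<epsilon>" using \<epsilon>(1) by (simp add: le_divide_eq)
    then show "Phi \<pi> S (Yb (- \<epsilon>)) (\<phi> \<theta>) - enn2real (?D1 (- \<epsilon>)) - enn2real (?D2 (- \<epsilon>)) / \<epsilon> \<le> Phi \<pi> R X (\<phi> \<theta>)"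
      using k by linarith
  qed
  moreover have "ereal (Phi \<pi> R X (\<phi> \<theta>)) \<le> ereal (Phi \<pi> S (Yb \<epsilon>) (\<phi> \<theta>)) + enn2ereal (?D1 \<epsilon>) + enn2ereal (?D2 \<epsilon>) / ereal \<epsilon>"
  proof (rule ereal_bounds_of_finite(2)[OF \<epsilon>(1)])
    assume "?D1 \<epsilon> < \<infinity>" "?D2 \<epsilon> < \<infinity>"
    from key[OF conjunct1[OF \<epsilon>(2)] this]
    have k: "\<bar>Phi \<pi> R X (\<phi> \<theta>) - A\<bar> + \<bar>Phi \<pi> S (Yb \<epsilon>) (\<phi> \<theta>) - AY \<epsilon>\<bar> \<le> enn2real (?D1 \<epsilon>)"
      and "(A - AY \<epsilon>) * \<epsilon> \<le> enn2real (?D2 \<epsilon>)" by (auto simp: algebra_simps)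
    then have "A - AY \<epsilon> \<le> enn2real (?D2 \<epsilon>) / \<epsilon>" using \<epsilon>(1) by (simp add: le_divide_eq)
    then show "Phi \<pi> R X (\<phi> \<theta>) \<le> Phi \<pi> S (Yb \<epsilon>) (\<phi> \<theta>) + enn2real (?D1 \<epsilon>) + enn2real (?D2 \<epsilon>) / \<epsilon>"
      using k by linarith
  qed
  ultimately show "ereal (Phi \<pi> (Q \<theta>) (Yb (-\<epsilon>)) (\<phi> \<theta>))
        - enn2ereal (Delta1 (P \<theta>) (Q \<theta>) M Xb Xc Yb (\<phi> \<theta>) (-\<epsilon>))
        - enn2ereal (Delta2 (P \<theta>) (Q \<theta>) M X Xb Xc Y Yb (-\<epsilon>)) / ereal \<epsilon>
      \<le> ereal (Phi \<pi> (P \<theta>) X (\<phi> \<theta>))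
    \<and> ereal (Phi \<pi> (P \<theta>) X (\<phi> \<theta>))
      \<le> ereal (Phi \<pi> (Q \<theta>) (Yb \<epsilon>) (\<phi> \<theta>))
        + enn2ereal (Delta1 (P \<theta>) (Q \<theta>) M Xb Xc Yb (\<phi> \<theta>) \<epsilon>)
        + enn2ereal (Delta2 (P \<theta>) (Q \<theta>) M X Xb Xc Y Yb \<epsilon>) / ereal \<epsilon>"
    by (simp add: R_def S_def)
qed

end
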